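(* Let $\mathbf y_{i1},\dots,\mathbf y_{in_i}$ ($i=1,2$) be two independent samples of i.i.d. $p$-dimensional random vectors with mean $\boldsymbol\mu_i$ and covariance matrix $\boldsymbol\Sigma_i$, let $n=n_1+n_2$, and let $F_{n,p}$, $d_1,d_2$, $\hat d_1,\hat d_2$, $\rho_{n,p,r}$ be as defined in the context. Let $\alpha\in(0,1)$ be a nominal significance level. Consider the following conditions. (C1) $\mathbf y_{ij}=\boldsymbol\mu_i+\boldsymbol\Gamma_i\mathbf z_{ij}$, $j=1,\dots,n_i$, $i=1,2$, where each $\boldsymbol\Gamma_i$ is a $p\times m$ matrix for some $m\ge p$ with $\boldsymbol\Gamma_i\boldsymbol\Gamma_i^\top=\boldsymbol\Sigma_i$, and the $\mathbf z_{ij}$ are i.i.d. $m$-vectors with $\operatorname{E}(\mathbf z_{ij})=\mathbf 0$ and $\operatorname{Cov}(\mathbf z_{ij})=\mathbf I_m$. (C2) $\operatorname{E}(z_{ijk}^4)=3+\Delta<\infty$, where $z_{ijk}$ is the $k$-th component of $\mathbf z_{ij}$ and $\Delta$ is some constant, and $\operatorname{E}[z_{ijl_1}^{\alpha_1}\cdots z_{ijl_q}^{\alpha_q}]=\operatorname{E}[z_{ijl_1}^{\alpha_1}]\cdots\operatorname{E}[z_{ijl_q}^{\alpha_q}]$ for every positive integer $q$, all positive integers $\alpha_1,\dots,\alpha_q$ with $\sum_{l=1}^q\alpha_l\le 8$, and all pairwise distinct indices $l_1,\dots,l_q$. (C3) As $n\to\infty$, $n_1/n\to\tau\in(0,1)$.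 (C4) $\lim_{n,p\to\infty}\rho_{n,p,r}=\rho_r$ for $r=1,2,\dots$, uniformly in $r$, and $\lim_{n,p\to\infty}\sum_{r=1}^p\rho_{n,p,r}=\sum_{r=1}^\infty\rho_r<\infty$. (C5) As $p\to\infty$, $\operatorname{tr}(\boldsymbol\Sigma_i\boldsymbol\Sigma_j\boldsymbol\Sigma_l\boldsymbol\Sigma_h)=o\{\operatorname{tr}^2[(\boldsymbol\Sigma_1+\boldsymbol\Sigma_2)^2]\}$ for all $i,j,l,h\in\{1,2\}$. (LA) (local alternative) As $n,p\to\infty$, $(\boldsymbol\mu_1-\boldsymbol\mu_2)^\top\boldsymbol\Sigma_i(\boldsymbol\mu_1-\boldsymbol\mu_2)=o\{n^{-1}\operatorname{tr}[(\boldsymbol\Sigma_1+\boldsymbol\Sigma_2)^2]\}$ for $i=1,2$. Assume that, as $n,p\to\infty$, $\hat d_1$ and $\hat d_2$ are ratio-consistent for $d_1$ and $d_2$, i.e. $\hat d_1/d_1\to1$ and $\hat d_2/d_2\to1$ in probability. Put $\boldsymbol\Omega=(1-\tau)\boldsymbol\Sigma_1+\tau\boldsymbol\Sigma_2$. Then: (a) Under (C1), (C2), (C3), (C4) and (LA), as $n,p\to\infty$, $$\Pr\left[F_{n,p}\ge F_{\hat d_1,\hat d_2}(\alpha)\right]=\Pr\left\{\zeta\ge\frac{F_{d_1,d_2}(\alpha)-1}{\sqrt{2/d_1}}-\frac{n\tau(1-\tau)\|\boldsymbol\mu_1-\boldsymbol\mu_2\|^2}{\left[2\operatorname{tr}(\boldsymbol\Omega^2)\right]^{1/2}}\right\}[1+o(1)],$$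 where $\zeta\stackrel{d}{=}\sum_{r=1}^\infty\rho_r(A_r-1)/\sqrt2$ with $A_1,A_2,\dots$ i.i.d. $\chi^2_1$. (b) Under (C1), (C2), (C3), (C5) and (LA), as $n,p\to\infty$, $$\Pr\left[F_{n,p}\ge F_{\hat d_1,\hat d_2}(\alpha)\right]=\Phi\left\{-z_\alpha+\frac{n\tau(1-\tau)\|\boldsymbol\mu_1-\boldsymbol\mu_2\|^2}{\left[2\operatorname{tr}(\boldsymbol\Omega^2)\right]^{1/2}}\right\}[1+o(1)],$$ where $z_\alpha$ is the upper $100\alpha$-percentile of $\mathcal N(0,1)$ and $\Phi$ is the cumulative distribution function of $\mathcal N(0,1)$.
   Context: The dimension $p$, the number $m$, the means $\boldsymbol\mu_i$, the matrices $\boldsymbol\Gamma_i$ and the covariance matrices $\boldsymbol\Sigma_i$ (not assumed equal) may vary along the asymptotic regime $n,p\to\infty$. $\stackrel{d}{=}$ denotes equality in distribution, $\chi^2_v$ the central chi-square distribution with $v$ degrees of freedom, $\|\cdot\|$ the Euclidean norm, and $\operatorname{tr}^k(\cdot)=(\operatorname{tr}(\cdot))^k$. $F_{v_1,v_2}(\alpha)$ denotes the upper $100\alpha$ percentile of the usual $F$ distribution with $v_1$ and $v_2$ (not necessarily integer) degrees of freedom. Set $\boldsymbol\Omega_n=\frac{n_2}{n}\boldsymbol\Sigma_1+\frac{n_1}{n}\boldsymbol\Sigma_2$. Let $\lambda_{n,p,1}\ge\dots\ge\lambda_{n,p,p}$ be the eigenvalues of $\boldsymbol\Omega_n$ and $\rho_{n,p,r}=\lambda_{n,p,r}/\sqrt{\operatorname{tr}(\boldsymbol\Omega_n^2)}$,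 $r=1,\dots,p$. Let $\bar{\mathbf y}_i=n_i^{-1}\sum_{j=1}^{n_i}\mathbf y_{ij}$, $\hat{\boldsymbol\Sigma}_i=(n_i-1)^{-1}\sum_{j=1}^{n_i}(\mathbf y_{ij}-\bar{\mathbf y}_i)(\mathbf y_{ij}-\bar{\mathbf y}_i)^\top$ and $\hat{\boldsymbol\Omega}_n=\frac{n_2}{n}\hat{\boldsymbol\Sigma}_1+\frac{n_1}{n}\hat{\boldsymbol\Sigma}_2$. The test statistic is $$F_{n,p}=\frac{n_1n_2n^{-1}\|\bar{\mathbf y}_1-\bar{\mathbf y}_2\|^2}{\operatorname{tr}(\hat{\boldsymbol\Omega}_n)}.$$ The approximation degrees of freedom are $$d_1=\frac{\operatorname{tr}^2(\boldsymbol\Omega_n)}{\operatorname{tr}(\boldsymbol\Omega_n^2)},\qquad d_2=\frac{\operatorname{tr}^2(\boldsymbol\Omega_n)}{\frac{n_2^2}{n^2(n_1-1)}\operatorname{tr}(\boldsymbol\Sigma_1^2)+\frac{n_1^2}{n^2(n_2-1)}\operatorname{tr}(\boldsymbol\Sigma_2^2)}.$$ Their estimators are $$\hat d_1=\frac{\widehat{\operatorname{tr}^2(\boldsymbol\Omega_n)}}{\widehat{\operatorname{tr}(\boldsymbol\Omega_n^2)}},\qquad \hat d_2=\frac{\widehat{\operatorname{tr}^2(\boldsymbol\Omega_n)}}{\frac{n_2^2}{n^2(n_1-1)}\widehat{\operatorname{tr}(\boldsymbol\Sigma_1^2)}+\frac{n_1^2}{n^2(n_2-1)}\widehat{\operatorname{tr}(\boldsymbol\Sigma_2^2)}},$$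 where, for $i=1,2$, $$\widehat{\operatorname{tr}^2(\boldsymbol\Sigma_i)}=\frac{(n_i-1)n_i}{(n_i-2)(n_i+1)}\left[\operatorname{tr}^2(\hat{\boldsymbol\Sigma}_i)-\frac{2}{n_i}\operatorname{tr}(\hat{\boldsymbol\Sigma}_i^2)\right],\quad \widehat{\operatorname{tr}(\boldsymbol\Sigma_i^2)}=\frac{(n_i-1)^2}{(n_i-2)(n_i+1)}\left[\operatorname{tr}(\hat{\boldsymbol\Sigma}_i^2)-\frac{1}{n_i-1}\operatorname{tr}^2(\hat{\boldsymbol\Sigma}_i)\right],$$ and $$\widehat{\operatorname{tr}^2(\boldsymbol\Omega_n)}=\frac{n_2^2}{n^2}\widehat{\operatorname{tr}^2(\boldsymbol\Sigma_1)}+\frac{2n_1n_2}{n^2}\operatorname{tr}(\hat{\boldsymbol\Sigma}_1)\operatorname{tr}(\hat{\boldsymbol\Sigma}_2)+\frac{n_1^2}{n^2}\widehat{\operatorname{tr}^2(\boldsymbol\Sigma_2)},$$ $$\widehat{\operatorname{tr}(\boldsymbol\Omega_n^2)}=\frac{n_2^2}{n^2}\widehat{\operatorname{tr}(\boldsymbol\Sigma_1^2)}+\frac{2n_1n_2}{n^2}\operatorname{tr}(\hat{\boldsymbol\Sigma}_1\hat{\boldsymbol\Sigma}_2)+\frac{n_1^2}{n^2}\widehat{\operatorname{tr}(\boldsymbol\Sigma_2^2)}.$$ *)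

theory Defs
  imports
    "HOL-Probability.Probability"
    "HOL-Library.Landau_Symbols"
    "Jordan_Normal_Form.Char_Poly"
begin

unbundle no vec_syntax
hide_const (open) Finite_Cartesian_Product.vec Finite_Cartesian_Product.mat
hide_const (open) Determinants.trace

definition trace :: "real mat \<Rightarrow> real" where
  "trace A = (\<Sum>i<dim_row A. A $$ (i, i))"

text \<open>
  Real eigenvalues with algebraic multiplicity, largest first (entry \<open>0\<close> is the largest one).
  For a symmetric matrix of size \<open>p\<close> the list has length \<open>p\<close>.
\<close>
definition eigenvalues_desc :: "real mat \<Rightarrow> real list" where
  "eigenvalues_desc A = rev (sorted_list_of_multiset (proots (char_poly A)))"

definition rel_eigenvalue :: "real mat \<Rightarrow> nat \<Rightarrow> real" where
  "rel_eigenvalue A r = eigenvalues_desc A ! r / sqrt (trace (A * A))"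

text \<open>The Borel sets of \<open>d\<close>-dimensional space, transported to \<open>carrier_vec d\<close> along the coordinates.\<close>
definition vec_borel :: "nat \<Rightarrow> real vec measure" where
  "vec_borel d = vimage_algebra (carrier_vec d) (\<lambda>v. \<lambda>a\<in>{..<d}. v $ a) (Pi\<^sub>M {..<d} (\<lambda>_. borel))"

definition has_mean_cov ::
    "'w measure \<Rightarrow> nat \<Rightarrow> ('w \<Rightarrow> real vec) \<Rightarrow> real vec \<Rightarrow> real mat \<Rightarrow> bool" where
  "has_mean_cov M d X m C \<longleftrightarrow>
     X \<in> M \<rightarrow>\<^sub>M vec_borel d \<and> m \<in> carrier_vec d \<and> C \<in> carrier_mat d d \<and>
     (\<forall>a<d. integrable M (\<lambda>w. X w $ a) \<and> (\<integral>w. X w $ a \<partial>M) = m $ a) \<and>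
     (\<forall>a<d. \<forall>b<d. integrable M (\<lambda>w. (X w $ a - m $ a) * (X w $ b - m $ b)) \<and>
        (\<integral>w. (X w $ a - m $ a) * (X w $ b - m $ b) \<partial>M) = C $$ (a, b))"

text \<open>
  Two samples are indexed by pairs \<open>(i, j)\<close>, where \<open>i\<close> is \<open>1\<close> or \<open>2\<close> and \<open>j\<close> runs from \<open>1\<close> to
  the size \<open>N i\<close> of sample \<open>i\<close>.
\<close>
definition sample_index :: "(nat \<Rightarrow> nat) \<Rightarrow> (nat \<times> nat) set" where
  "sample_index N = (SIGMA i:{1, 2}. {1..N i})"

definition two_samples ::
    "'w measure \<Rightarrow> nat \<Rightarrow> (nat \<Rightarrow> nat) \<Rightarrow> (nat \<Rightarrow> real vec) \<Rightarrow> (nat \<Rightarrow> real mat) \<Rightarrow>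
     (nat \<Rightarrow> nat \<Rightarrow> 'w \<Rightarrow> real vec) \<Rightarrow> bool" where
  "two_samples M p N mu Sg y \<longleftrightarrow>
     prob_space.indep_vars M (\<lambda>_. vec_borel p) (\<lambda>(i, j). y i j) (sample_index N) \<and>
     (\<forall>i\<in>{1, 2}. \<forall>j\<in>{1..N i}. \<forall>j'\<in>{1..N i}.
        distr M (vec_borel p) (y i j) = distr M (vec_borel p) (y i j')) \<and>
     (\<forall>i\<in>{1, 2}. mu i \<in> carrier_vec p \<and> Sg i \<in> carrier_mat p p) \<and>
     (\<forall>(i, j)\<in>sample_index N. has_mean_cov M p (y i j) (mu i) (Sg i))"

definition factor_model ::
    "'w measure \<Rightarrow> nat \<Rightarrow> nat \<Rightarrow> (nat \<Rightarrow> nat) \<Rightarrow> (nat \<Rightarrow> real vec) \<Rightarrow> (nat \<Rightarrow> real mat) \<Rightarrow>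
     (nat \<Rightarrow> nat \<Rightarrow> 'w \<Rightarrow> real vec) \<Rightarrow> (nat \<Rightarrow> real mat) \<Rightarrow> (nat \<Rightarrow> nat \<Rightarrow> 'w \<Rightarrow> real vec) \<Rightarrow> bool" where
  "factor_model M p m N mu Sg y G z \<longleftrightarrow>
     p \<le> m \<and>
     (\<forall>i\<in>{1, 2}. G i \<in> carrier_mat p m \<and> G i * transpose_mat (G i) = Sg i) \<and>
     prob_space.indep_vars M (\<lambda>_. vec_borel m) (\<lambda>(i, j). z i j) (sample_index N) \<and>
     (\<forall>(i, j)\<in>sample_index N. \<forall>(i', j')\<in>sample_index N.
        distr M (vec_borel m) (z i j) = distr M (vec_borel m) (z i' j')) \<and>
     (\<forall>(i, j)\<in>sample_index N. has_mean_cov M m (z i j) (0\<^sub>v m) (1\<^sub>m m)) \<and>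
     (\<forall>(i, j)\<in>sample_index N. \<forall>w\<in>space M. y i j w = mu i + G i *\<^sub>v z i j w)"

text \<open>
  Only the fourth moments are required to be finite explicitly; this makes all mixed moments of
  total order at most four finite.  In the factorization identities of higher order, a moment
  that does not exist counts as \<open>0\<close> (the convention of the Bochner integral).
\<close>
definition moment_condition :: "'w measure \<Rightarrow> nat \<Rightarrow> real \<Rightarrow> ('w \<Rightarrow> real vec) \<Rightarrow> bool" where
  "moment_condition M m D Z \<longleftrightarrow>
     (\<forall>a<m. integrable M (\<lambda>w. (Z w $ a) ^ 4) \<and> (\<integral>w. (Z w $ a) ^ 4 \<partial>M) = 3 + D) \<and>
     (\<forall>q::nat. \<forall>e::nat \<Rightarrow> nat. \<forall>l::nat \<Rightarrow> nat.
        q \<ge> 1 \<and> (\<forall>s\<in>{1..q}. e s \<ge> 1 \<and> l s < m) \<and> inj_on l {1..q} \<and> (\<Sum>s=1..q. e s) \<le> 8 \<longrightarrow>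
        (\<integral>w. (\<Prod>s=1..q. (Z w $ l s) ^ e s) \<partial>M) = (\<Prod>s=1..q. (\<integral>w. (Z w $ l s) ^ e s \<partial>M)))"

text \<open>Convergence in probability, where the underlying space may change along the sequence.\<close>
definition tendsto_in_prob :: "(nat \<Rightarrow> 'w measure) \<Rightarrow> (nat \<Rightarrow> 'w \<Rightarrow> real) \<Rightarrow> real \<Rightarrow> bool" where
  "tendsto_in_prob M X c \<longleftrightarrow>
     (\<forall>e>0. (\<lambda>k. \<P>(w in M k. \<bar>X k w - c\<bar> > e)) \<longlonglongrightarrow> 0)"

text \<open>
  For \<open>v \<le> 0\<close> this is the null measure, so that \<open>F_upper v1 v2 \<alpha>\<close> below takes one fixed
  irrelevant value when \<open>v1 \<le> 0\<close> or \<open>v2 \<le> 0\<close>.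
\<close>
definition chi_square :: "real \<Rightarrow> real measure" where
  "chi_square v = density lborel (\<lambda>x. ennreal
     (if 0 < v \<and> 0 < x then x powr (v / 2 - 1) * exp (- x / 2) / (2 powr (v / 2) * Gamma (v / 2))
      else 0))"

definition F_distribution :: "real \<Rightarrow> real \<Rightarrow> real measure" where
  "F_distribution v1 v2 =
     distr (chi_square v1 \<Otimes>\<^sub>M chi_square v2) borel (\<lambda>(a, b). (a / v1) / (b / v2))"

definition upper_percentile :: "real measure \<Rightarrow> real \<Rightarrow> real" where
  "upper_percentile D \<alpha> = Inf {x. measure D {x<..} \<le> \<alpha>}"

definition F_upper :: "real \<Rightarrow> real \<Rightarrow> real \<Rightarrow> real" where
  "F_upper v1 v2 \<alpha> = upper_percentile (F_distribution v1 v2) \<alpha>"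

definition z_upper :: "real \<Rightarrow> real" where
  "z_upper \<alpha> = upper_percentile std_normal_distribution \<alpha>"

definition std_normal_cdf :: "real \<Rightarrow> real" where
  "std_normal_cdf = cdf std_normal_distribution"

text \<open>
  The law of \<open>\<Sum>r. \<rho> r * (A r - 1) / sqrt 2\<close> for independent chi-square variables \<open>A r\<close> with one
  degree of freedom; the series converges almost surely when \<open>\<rho>\<close> is nonnegative and summable.
\<close>
definition chi_square_mixture :: "(nat \<Rightarrow> real) \<Rightarrow> real measure" where
  "chi_square_mixture \<rho> =
     distr (Pi\<^sub>M UNIV (\<lambda>_::nat. chi_square 1)) borel (\<lambda>A. \<Sum>r. \<rho> r * (A r - 1) / sqrt 2)"

definition pooled :: "(nat \<Rightarrow> nat) \<Rightarrow> (nat \<Rightarrow> real mat) \<Rightarrow> real mat" where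
  "pooled N S = (real (N 2) / real (N 1 + N 2)) \<cdot>\<^sub>m S 1 + (real (N 1) / real (N 1 + N 2)) \<cdot>\<^sub>m S 2"

definition sample_mean :: "nat \<Rightarrow> nat \<Rightarrow> (nat \<Rightarrow> real vec) \<Rightarrow> real vec" where
  "sample_mean p n x = vec p (\<lambda>a. (\<Sum>j=1..n. x j $ a) / real n)"

definition sample_cov :: "nat \<Rightarrow> nat \<Rightarrow> (nat \<Rightarrow> real vec) \<Rightarrow> real mat" where
  "sample_cov p n x = mat p p (\<lambda>(a, b).
     (\<Sum>j=1..n. (x j $ a - sample_mean p n x $ a) * (x j $ b - sample_mean p n x $ b)) / (real n - 1))"

definition sq_norm_vec :: "real vec \<Rightarrow> real" where
  "sq_norm_vec v = v \<bullet> v"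

definition F_stat :: "nat \<Rightarrow> (nat \<Rightarrow> nat) \<Rightarrow> (nat \<Rightarrow> nat \<Rightarrow> real vec) \<Rightarrow> real" where
  "F_stat p N x =
     real (N 1) * real (N 2) / real (N 1 + N 2)
       * sq_norm_vec (sample_mean p (N 1) (x 1) - sample_mean p (N 2) (x 2))
     / trace (pooled N (\<lambda>i. sample_cov p (N i) (x i)))"

definition dof1 :: "(nat \<Rightarrow> nat) \<Rightarrow> (nat \<Rightarrow> real mat) \<Rightarrow> real" where
  "dof1 N S = (trace (pooled N S))\<^sup>2 / trace (pooled N S * pooled N S)"

text \<open>
  \<open>t1\<close> and \<open>t2\<close> are the traces of the squared covariance matrices (in \<open>dof2\<close>) or their
  estimates (in \<open>dof2_hat\<close>).
\<close>
definition dof2_denom :: "(nat \<Rightarrow> nat) \<Rightarrow> real \<Rightarrow> real \<Rightarrow> real" where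
  "dof2_denom N t1 t2 =
     (real (N 2))\<^sup>2 / ((real (N 1 + N 2))\<^sup>2 * (real (N 1) - 1)) * t1
     + (real (N 1))\<^sup>2 / ((real (N 1 + N 2))\<^sup>2 * (real (N 2) - 1)) * t2"

definition dof2 :: "(nat \<Rightarrow> nat) \<Rightarrow> (nat \<Rightarrow> real mat) \<Rightarrow> real" where
  "dof2 N S = (trace (pooled N S))\<^sup>2 / dof2_denom N (trace (S 1 * S 1)) (trace (S 2 * S 2))"

text \<open>
  In the next four definitions \<open>S\<close> stands for the sample covariance matrix (matrices); the
  suffix \<open>_sq_trace\<close> refers to the square of a trace, \<open>_trace_sq\<close> to the trace of a square.
\<close>
definition est_sq_trace :: "nat \<Rightarrow> real mat \<Rightarrow> real" where
  "est_sq_trace n S =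
     (real n - 1) * real n / ((real n - 2) * (real n + 1))
     * ((trace S)\<^sup>2 - 2 / real n * trace (S * S))"

definition est_trace_sq :: "nat \<Rightarrow> real mat \<Rightarrow> real" where
  "est_trace_sq n S =
     (real n - 1)\<^sup>2 / ((real n - 2) * (real n + 1))
     * (trace (S * S) - 1 / (real n - 1) * (trace S)\<^sup>2)"

definition est_pooled_sq_trace :: "(nat \<Rightarrow> nat) \<Rightarrow> (nat \<Rightarrow> real mat) \<Rightarrow> real" where
  "est_pooled_sq_trace N S =
     (real (N 2))\<^sup>2 / (real (N 1 + N 2))\<^sup>2 * est_sq_trace (N 1) (S 1)
     + 2 * real (N 1) * real (N 2) / (real (N 1 + N 2))\<^sup>2 * trace (S 1) * trace (S 2)
     + (real (N 1))\<^sup>2 / (real (N 1 + N 2))\<^sup>2 * est_sq_trace (N 2) (S 2)"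

definition est_pooled_trace_sq :: "(nat \<Rightarrow> nat) \<Rightarrow> (nat \<Rightarrow> real mat) \<Rightarrow> real" where
  "est_pooled_trace_sq N S =
     (real (N 2))\<^sup>2 / (real (N 1 + N 2))\<^sup>2 * est_trace_sq (N 1) (S 1)
     + 2 * real (N 1) * real (N 2) / (real (N 1 + N 2))\<^sup>2 * trace (S 1 * S 2)
     + (real (N 1))\<^sup>2 / (real (N 1 + N 2))\<^sup>2 * est_trace_sq (N 2) (S 2)"

definition dof1_hat :: "nat \<Rightarrow> (nat \<Rightarrow> nat) \<Rightarrow> (nat \<Rightarrow> nat \<Rightarrow> real vec) \<Rightarrow> real" where
  "dof1_hat p N x = (let S = (\<lambda>i. sample_cov p (N i) (x i)) in
     est_pooled_sq_trace N S / est_pooled_trace_sq N S)"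

definition dof2_hat :: "nat \<Rightarrow> (nat \<Rightarrow> nat) \<Rightarrow> (nat \<Rightarrow> nat \<Rightarrow> real vec) \<Rightarrow> real" where
  "dof2_hat p N x = (let S = (\<lambda>i. sample_cov p (N i) (x i)) in
     est_pooled_sq_trace N S
     / dof2_denom N (est_trace_sq (N 1) (S 1)) (est_trace_sq (N 2) (S 2)))"

text \<open>
  The regime in which both the sample size and the dimension diverge is an arbitrary sequence
  indexed by \<open>k\<close>, along which every ingredient may vary.
\<close>

text \<open>
  Entry \<open>r\<close> of \<open>\<rho>\<close> belongs to the eigenvalue of rank \<open>r + 1\<close>.  Uniformity in \<open>r\<close> refers to the indices for which
  an eigenvalue exists; as \<open>\<rho>\<close> is summable and \<open>p\<close> diverges, this agrees with padding by zeros.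
\<close>
definition spectral_limit ::
    "(nat \<Rightarrow> nat) \<Rightarrow> (nat \<Rightarrow> nat \<Rightarrow> nat) \<Rightarrow> (nat \<Rightarrow> nat \<Rightarrow> real mat) \<Rightarrow> (nat \<Rightarrow> real) \<Rightarrow> bool" where
  "spectral_limit p N Sg \<rho> \<longleftrightarrow>
     (\<forall>e>0. \<forall>\<^sub>F k in sequentially. \<forall>r<p k. \<bar>rel_eigenvalue (pooled (N k) (Sg k)) r - \<rho> r\<bar> < e) \<and>
     summable \<rho> \<and>
     (\<lambda>k. \<Sum>r<p k. rel_eigenvalue (pooled (N k) (Sg k)) r) \<longlonglongrightarrow> (\<Sum>r. \<rho> r)"

definition trace_condition :: "(nat \<Rightarrow> nat \<Rightarrow> real mat) \<Rightarrow> bool" where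
  "trace_condition Sg \<longleftrightarrow>
     (\<forall>i\<in>{1, 2}. \<forall>j\<in>{1, 2}. \<forall>l\<in>{1, 2}. \<forall>h\<in>{1, 2}.
        (\<lambda>k. trace (Sg k i * Sg k j * Sg k l * Sg k h))
          \<in> o(\<lambda>k. (trace ((Sg k 1 + Sg k 2) * (Sg k 1 + Sg k 2)))\<^sup>2))"

definition local_alternative ::
    "(nat \<Rightarrow> nat \<Rightarrow> nat) \<Rightarrow> (nat \<Rightarrow> nat \<Rightarrow> real vec) \<Rightarrow> (nat \<Rightarrow> nat \<Rightarrow> real mat) \<Rightarrow> bool" where
  "local_alternative N mu Sg \<longleftrightarrow>
     (\<forall>i\<in>{1, 2}.
        (\<lambda>k. (mu k 1 - mu k 2) \<bullet> (Sg k i *\<^sub>v (mu k 1 - mu k 2)))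
          \<in> o(\<lambda>k. trace ((Sg k 1 + Sg k 2) * (Sg k 1 + Sg k 2)) / real (N k 1 + N k 2)))"

text \<open>The standardized mean shift; its covariance matrix uses the limiting proportion \<open>\<tau>\<close>.\<close>
definition mean_shift ::
    "real \<Rightarrow> (nat \<Rightarrow> nat) \<Rightarrow> (nat \<Rightarrow> real vec) \<Rightarrow> (nat \<Rightarrow> real mat) \<Rightarrow> real" where
  "mean_shift \<tau> N mu S = (let Om = (1 - \<tau>) \<cdot>\<^sub>m S 1 + \<tau> \<cdot>\<^sub>m S 2 in
     real (N 1 + N 2) * \<tau> * (1 - \<tau>) * sq_norm_vec (mu 1 - mu 2) / sqrt (2 * trace (Om * Om)))"

end

theory Submission
 imports Defs "Jordan_Normal_Form.Schur_Decomposition" "Jordan_Normal_Form.Spectral_Radius"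
begin

text \<open>
Write \<open>T\<close> for the numerator of the statistic, \<open>\<Omega>\<close> for the pooled covariance matrix, \<open>\<lambda>\<close> for its eigenvalues
and \<open>\<sigma> = sqrt (2 * tr (\<Omega>\<^sup>2))\<close>. After centring, \<open>T\<close> minus the trace estimate is a quadratic form in
the independent vectors \<open>z i j\<close> in which no vector is multiplied by itself
(\<open>offdiag_quad_eq\<close>); let \<open>U\<close> be this form divided by \<open>\<sigma>\<close>. The mean difference adds a
deterministic shift and a linear cross term, which the local alternative makes negligible
(\<open>cross_term\<close>, \<open>cross_bound_lim\<close>). So rejection means that \<open>U\<close> plus the standardized shift exceeds
\<open>(F - 1) * sqrt (d1/2)\<close> up to a factor tending to one, where \<open>F\<close> is the estimated critical value.

The law of \<open>U\<close> is asymptotically insensitive to the law of the \<open>z i j\<close>. As \<open>U\<close> is affine in each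
vector, replacing the vectors by Gaussian ones one at a time (\<open>lindeberg_offdiag_quad\<close>) costs only
third-order terms, controlled by fourth moments; the influence of one vector is at most the
inverse of its sample size (\<open>ell_le\<close>), so the total cost vanishes. For Gaussian vectors the trace
estimate is close to its mean (\<open>tro_variance\<close>), and \<open>T\<close> is the squared norm of a Gaussian vector
with covariance \<open>\<Omega>\<close>, hence a sum of independent chi-square variables weighted by \<open>\<lambda>\<close>
(\<open>gaussian_vec_sq_norm_char\<close>). Therefore \<open>char_limit_bound\<close> compares the characteristic function of
\<open>U\<close> with a product of chi-square factors in the relative eigenvalues.

Under the spectral limit these products converge to the characteristic function of the mixture,
because the relative eigenvalues converge in \<open>l\<^sup>1\<close> (\<open>chi_factor_prod_tendsto_mixture\<close>). Under the trace
condition every relative eigenvalue vanishes and the limit is normal (\<open>chi_square_sum_clt\<close>).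
In both cases \<open>d2/d1\<close> diverges, so the scaled critical value behaves like a percentile of the
standardized chi-square law with \<open>d1\<close> degrees of freedom (\<open>F_upper_tendsto\<close>); this law converges in its
turn, because \<open>d1\<close> is the squared sum of the relative eigenvalues. Ratio consistency transfers
the convergence to estimated degrees of freedom. A version of Slutsky's theorem for tails that
allows unbounded shifts (\<open>slutsky_tail\<close>) shows that the difference of the two powers vanishes. As
shifts are nonnegative, the limiting power is bounded away from zero, so the ratio tends to one.
\<close>

section \<open>Spectral decomposition of real symmetric matrices\<close>

text \<open>
A complex eigenvalue exists by the fundamental theorem of algebra. Its eigenvector has a real and an
imaginary part, and symmetry shows that one of them is a real eigenvector.
\<close>
lemma real_symmetric_eigenvector:
 fixes A :: "real mat"
 assumes A: "A \<in> carrier_mat n n" and sym: "transpose_mat A = A" and n: "0 < n"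
 shows "\<exists>v e. v \<in> carrier_vec n \<and> v \<noteq> 0\<^sub>v n \<and> A *\<^sub>v v = e \<cdot>\<^sub>v v"
proof -
 let ?C = "map_mat complex_of_real A"
 have C: "?C \<in> carrier_mat n n" using A by simp
 obtain k where "k \<in> spectrum ?C" using spectrum_non_empty[OF C] n by auto
 then obtain u where u: "eigenvector ?C u k"
  unfolding spectrum_def eigenvalue_def by auto
 have uc: "u \<in> carrier_vec n" and u0: "u \<noteq> 0\<^sub>v n" and eu: "?C *\<^sub>v u = k \<cdot>\<^sub>v u"
  using u A unfolding eigenvector_def by auto
 have sA: "A $$ (i, j) = A $$ (j, i)" if "i < n" "j < n" for i j
  using sym A that by (metis carrier_matD index_transpose_mat(1))
 define a where "a j = Re (u $ j)" for j
 define b where "b j = Im (u $ j)" for j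
 have row: "(\<Sum>j<n. complex_of_real (A $$ (i, j))*u $ j) = k*u $ i" if i: "i < n" for i
 proof -
  have "(?C *\<^sub>v u) $ i = (k \<cdot>\<^sub>v u) $ i" using eu by simp
  then show ?thesis using i A uc
   by (simp add: scalar_prod_def lessThan_atLeast0)
 qed
 have Aa: "(\<Sum>j<n. A $$ (i, j)*a j) = Re k*a i - Im k*b i" if i: "i < n" for i
  using arg_cong[OF row[OF i], of Re] by (simp add: a_def b_def)
 have Ab: "(\<Sum>j<n. A $$ (i, j)*b j) = Re k*b i + Im k*a i" if i: "i < n" for i
  using arg_cong[OF row[OF i], of Im] by (simp add: a_def b_def)
 \<comment> \<open>Symmetry of \<open>A\<close> makes \<open>b \<bullet> A a\<close> and \<open>a \<bullet> A b\<close> equal, which kills the imaginary part of \<open>k\<close>.\<close>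
 have "(\<Sum>i<n. b i*(\<Sum>j<n. A $$ (i, j)*a j)) = (\<Sum>i<n. a i*(\<Sum>j<n. A $$ (i, j)*b j))"
  unfolding sum_distrib_left
  by (subst sum.swap, intro sum.cong refl) (auto simp: sA mult_ac)
 then have "(\<Sum>i<n. b i*(Re k*a i - Im k*b i)) = (\<Sum>i<n. a i*(Re k*b i + Im k*a i))"
  using Aa Ab by simp
 then have "Im k*(\<Sum>i<n. a i ^ 2 + b i ^ 2) = 0"
  by (simp add: algebra_simps sum.distrib sum_subtractf sum_distrib_left power2_eq_square)
 moreover obtain i0 where i0: "i0 < n" "u $ i0 \<noteq> 0" using u0 uc by (metis carrier_vecD dim_vec eq_vecI index_zero_vec(1) zero_carrier_vec)
 have "(\<Sum>i<n. a i ^ 2 + b i ^ 2) > 0"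
  using i0 by (intro sum_pos2[of _ i0]) (auto simp: a_def b_def complex_eq_iff sum_power2_gt_zero_iff)
 ultimately have Im0: "Im k = 0" by simp
 have real_ev: "A *\<^sub>v vec n f = Re k \<cdot>\<^sub>v vec n f" if "\<And>i. i < n \<Longrightarrow> (\<Sum>j<n. A $$ (i, j)*f j) = Re k*f i" for f
  using A that by (intro eq_vecI) (auto simp: scalar_prod_def lessThan_atLeast0)
 have ea: "A *\<^sub>v vec n a = Re k \<cdot>\<^sub>v vec n a" and eb: "A *\<^sub>v vec n b = Re k \<cdot>\<^sub>v vec n b"
  using Aa Ab Im0 by (auto intro!: real_ev)
 have "vec n a \<noteq> 0\<^sub>v n \<or> vec n b \<noteq> 0\<^sub>v n"
 proof (rule ccontr)
  assume "\<not> ?thesis"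
  then have "a i0 = 0" "b i0 = 0" using i0(1) by (metis index_vec index_zero_vec(1))+
  then show False using i0(2) by (simp add: a_def b_def complex_eq_iff)
 qed
 then show ?thesis using ea eb by (metis vec_carrier)
qed

text \<open>
The Gram-Schmidt process extends the given vector to an orthogonal basis, which is then normalized.
\<close>
lemma orthogonal_matrix_with_first_column:
 fixes v :: "real vec"
 assumes v: "v \<in> carrier_vec n" "v \<noteq> 0\<^sub>v n"
 shows "\<exists>W c. W \<in> carrier_mat n n \<and> transpose_mat W*W = 1\<^sub>m n \<and> col W 0 = c \<cdot>\<^sub>v v"
proof -
 interpret cof_vec_space n "TYPE(real)" .
 define b where "b = basis_completion v"
 define ws where "ws = gram_schmidt n b"
 from basis_completion[OF v, folded b_def]
 have dist_b: "distinct b" and indep: "\<not> lin_dep (set b)" and b: "set b \<subseteq> carrier_vec n"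
  and hdb: "hd b = v" and len_b: "length b = n" by auto
 have n: "0 < n" using v by (cases n) auto
 from hdb len_b n obtain vs where bv: "b = v # vs" by (cases b) auto
 from gram_schmidt_result[OF b dist_b indep refl, folded ws_def]
 have ws: "set ws \<subseteq> carrier_vec n" "corthogonal ws" "length ws = n" by (auto simp: len_b)
 have hdws: "hd ws = v" using gram_schmidt_hd[OF v(1), of vs, folded bv] unfolding ws_def .
 have orth: "(ws ! i \<bullet> ws ! j = 0) = (i \<noteq> j)" if "i < n" "j < n" for i j
  using corthogonalD[OF ws(2), of i j] that ws(3) by simp
 have pos: "ws ! i \<bullet> ws ! i > 0" if i: "i < n" for i
 proof -
  have "ws ! i \<bullet> ws ! i \<ge> 0" unfolding scalar_prod_def by (intro sum_nonneg) simp
  then show ?thesis using orth[OF i i] by linarith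
 qed
 define us where "us = map (\<lambda>w. (1/sqrt (w \<bullet> w)) \<cdot>\<^sub>v w) ws"
 define W where "W = mat_of_cols n us"
 have W: "W \<in> carrier_mat n n" unfolding W_def us_def using ws(3) by (metis length_map mat_of_cols_carrier(1))
 have wsc: "ws ! i \<in> carrier_vec n" if "i < n" for i using ws that by (metis nth_mem subsetD)
 have colW: "col W i = (1/sqrt (ws ! i \<bullet> ws ! i)) \<cdot>\<^sub>v (ws ! i)" if i: "i < n" for i
  unfolding W_def using i ws(3) wsc[OF i] by (subst col_mat_of_cols) (auto simp: us_def)
 have "transpose_mat W*W = 1\<^sub>m n"
 proof (rule eq_matI)
  fix i j assume ij: "i < dim_row (1\<^sub>m n :: real mat)" "j < dim_col (1\<^sub>m n :: real mat)"
  then have ij: "i < n" "j < n" by auto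
  have "(transpose_mat W*W) $$ (i, j) = col W i \<bullet> col W j" using W ij by auto
  also have "\<dots> = (ws ! i \<bullet> ws ! j)/(sqrt (ws ! i \<bullet> ws ! i) * sqrt (ws ! j \<bullet> ws ! j))"
   unfolding colW[OF ij(1)] colW[OF ij(2)] using wsc[OF ij(1)] wsc[OF ij(2)] by simp
  also have "\<dots> = (if i = j then 1 else 0)"
   using orth[OF ij] pos[OF ij(1)] by auto
  finally show "(transpose_mat W*W) $$ (i, j) = 1\<^sub>m n $$ (i, j)" using ij by simp
 qed (use W in auto)
 moreover have "col W 0 = (1/sqrt (v \<bullet> v)) \<cdot>\<^sub>v v"
  using colW[OF n] hdws ws(3) n by (cases ws) auto
 ultimately show ?thesis using W by blast
qed

text \<open>
Induction on the size: in an orthonormal basis that starts with an eigenvector the matrix becomes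
block diagonal, with a smaller symmetric block.
\<close>
lemma real_symmetric_diagonalization:
 fixes A :: "real mat"
 assumes "A \<in> carrier_mat n n" "transpose_mat A = A"
 shows "\<exists>Q d. Q \<in> carrier_mat n n \<and> transpose_mat Q*Q = 1\<^sub>m n \<and> transpose_mat Q*A*Q = mat_diag n d"
 using assms
proof (induction n arbitrary: A)
 case 0
 have "transpose_mat (1\<^sub>m 0)*A*1\<^sub>m 0 = mat_diag 0 (\<lambda>_. 0)"
 proof (rule eq_matI)
  have D: "mat_diag 0 (\<lambda>_. 0::real) \<in> carrier_mat 0 0" by (rule mat_diag_dim)
  have L: "transpose_mat (1\<^sub>m 0)*A*1\<^sub>m 0 \<in> carrier_mat 0 0" using 0(1) by fastforce
  show "dim_row (transpose_mat (1\<^sub>m 0)*A*1\<^sub>m 0) = dim_row (mat_diag 0 (\<lambda>_. 0::real))"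
   "dim_col (transpose_mat (1\<^sub>m 0)*A*1\<^sub>m 0) = dim_col (mat_diag 0 (\<lambda>_. 0::real))"
   using carrier_matD[OF D] carrier_matD[OF L] by metis+
  show "(transpose_mat (1\<^sub>m 0)*A*1\<^sub>m 0) $$ (i, j) = mat_diag 0 (\<lambda>_. 0) $$ (i, j)"
   if "i < dim_row (mat_diag 0 (\<lambda>_. 0::real))" for i j
   using that carrier_matD[OF D] by (metis not_less_zero)
 qed
 then show ?case by (intro exI[of _ "1\<^sub>m 0"] exI[of _ "\<lambda>_. 0"]) simp
next
 case (Suc n A)
 note A = Suc.prems(1) and sym = Suc.prems(2)
 obtain v e where v: "v \<in> carrier_vec (Suc n)" "v \<noteq> 0\<^sub>v (Suc n)" and ev: "A *\<^sub>v v = e \<cdot>\<^sub>v v"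
  using real_symmetric_eigenvector[OF A sym] by auto
 obtain W c where W: "W \<in> carrier_mat (Suc n) (Suc n)" and WW: "transpose_mat W*W = 1\<^sub>m (Suc n)"
  and W0: "col W 0 = c \<cdot>\<^sub>v v"
  using orthogonal_matrix_with_first_column[OF v] by auto
 have Wt: "transpose_mat W \<in> carrier_mat (Suc n) (Suc n)" using W by simp
 define A' where "A' = transpose_mat W*A*W"
 have A'c: "A' \<in> carrier_mat (Suc n) (Suc n)" using A W unfolding A'_def by auto
 have A'sym: "transpose_mat A' = A'"
 proof -
  have "transpose_mat A' = transpose_mat W*transpose_mat (transpose_mat W*A)"
   unfolding A'_def using A W by (subst transpose_mult) auto
  also have "transpose_mat (transpose_mat W*A) = A*W"
   using transpose_mult[OF Wt A] sym by simp
  finally show ?thesis unfolding A'_def using A W Wt by (simp add: assoc_mult_mat[OF Wt A W])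
 qed
 have eW0: "A *\<^sub>v col W 0 = e \<cdot>\<^sub>v col W 0"
  unfolding W0 using ev A v by (simp add: mult_mat_vec[OF A v(1)] smult_smult_assoc mult.commute)
 have A'0: "A' $$ (i, 0) = (if i = 0 then e else 0)" if i: "i < Suc n" for i
 proof -
  have "A' $$ (i, 0) = (transpose_mat W*(A*W)) $$ (i, 0)"
   unfolding A'_def using assoc_mult_mat[OF Wt A W] by simp
  also have "\<dots> = col W i \<bullet> col (A*W) 0" using i W A by simp
  also have "col (A*W) 0 = A *\<^sub>v col W 0" using A W by (subst col_mult2[OF A W]) auto
  also have "col W i \<bullet> (A *\<^sub>v col W 0) = e*(col W i \<bullet> col W 0)"
   unfolding eW0 using W i by simp
  also have "col W i \<bullet> col W 0 = (transpose_mat W*W) $$ (i, 0)" using W i by simp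
  finally show ?thesis unfolding WW using i by simp
 qed
 have A'r: "A' $$ (0, i) = (if i = 0 then e else 0)" if i: "i < Suc n" for i
  using A'0[OF i] A'sym A'c i by (metis carrier_matD index_transpose_mat(1) zero_less_Suc)
 define A3 where "A3 = mat n n (\<lambda>(i, j). A' $$ (Suc i, Suc j))"
 have A3: "A3 \<in> carrier_mat n n" unfolding A3_def by simp
 have "transpose_mat A3 = A3"
 proof (rule eq_matI)
  fix i j assume "i < dim_row A3" "j < dim_col A3"
  then have ij: "i < n" "j < n" using A3 by auto
  have "A' $$ (Suc j, Suc i) = A' $$ (Suc i, Suc j)"
   using A'sym A'c ij by (metis Suc_less_eq carrier_matD index_transpose_mat(1))
  then show "transpose_mat A3 $$ (i, j) = A3 $$ (i, j)" using ij by (simp add: A3_def)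
 qed (use A3 in auto)
 from Suc.IH[OF A3 this] obtain Q3 d3 where Q3: "Q3 \<in> carrier_mat n n"
  "transpose_mat Q3*Q3 = 1\<^sub>m n" "transpose_mat Q3*A3*Q3 = mat_diag n d3" by auto
 define P where "P = four_block_mat (1\<^sub>m 1) (0\<^sub>m 1 n) (0\<^sub>m n 1) Q3"
 have P: "P \<in> carrier_mat (Suc n) (Suc n)" unfolding P_def using Q3(1) four_block_carrier_mat[of "1\<^sub>m 1" 1 1 Q3 n n] by auto
 have Pt: "transpose_mat P = four_block_mat (1\<^sub>m 1) (0\<^sub>m 1 n) (0\<^sub>m n 1) (transpose_mat Q3)"
  unfolding P_def using Q3(1)
  by (subst transpose_four_block_mat[of _ 1 1 _ n _ n]) auto
 have A'b: "A' = four_block_mat (mat 1 1 (\<lambda>_. e)) (0\<^sub>m 1 n) (0\<^sub>m n 1) A3"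
 proof (rule eq_matI)
  fix i j assume "i < dim_row (four_block_mat (mat 1 1 (\<lambda>_. e)) (0\<^sub>m 1 n) (0\<^sub>m n 1) A3)"
   "j < dim_col (four_block_mat (mat 1 1 (\<lambda>_. e)) (0\<^sub>m 1 n) (0\<^sub>m n 1) A3)"
  then have ij: "i < Suc n" "j < Suc n" using A3 by auto
  then show "A' $$ (i, j) = four_block_mat (mat 1 1 (\<lambda>_. e)) (0\<^sub>m 1 n) (0\<^sub>m n 1) A3 $$ (i, j)"
   using A3 A'0[OF ij(1)] A'r[OF ij(2)]
   by (cases i; cases j) (auto simp: A3_def)
 qed (use A'c A3 in auto)
 have PtP: "transpose_mat P*P = 1\<^sub>m (Suc n)"
 proof -
  have "transpose_mat P*P = four_block_mat (1\<^sub>m 1) (0\<^sub>m 1 n) (0\<^sub>m n 1) (1\<^sub>m n)"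
   unfolding Pt unfolding P_def using Q3
   by (subst mult_four_block_mat[of _ 1 1 _ n _ n _ _ 1 _ n]) auto
  also have "\<dots> = 1\<^sub>m (Suc n)" by (rule eq_matI) (auto split: if_splits)
  finally show ?thesis .
 qed
 define d where "d = (\<lambda>i. case i of 0 \<Rightarrow> e | Suc j \<Rightarrow> d3 j)"
 have PAP: "transpose_mat P*A'*P = mat_diag (Suc n) d"
 proof -
  have "transpose_mat P*A'*P = four_block_mat (mat 1 1 (\<lambda>_. e)) (0\<^sub>m 1 n) (0\<^sub>m n 1) (transpose_mat Q3*A3*Q3)"
   unfolding Pt A'b unfolding P_def using Q3(1) A3
   by (simp add: mult_four_block_mat[of _ 1 1 _ n _ n _ _ 1 _ n])
  also have "\<dots> = mat_diag (Suc n) d" unfolding Q3(3)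
   by (rule eq_matI) (auto simp: d_def mat_diag_def split: nat.splits if_splits)
  finally show ?thesis .
 qed
 have Ptc: "transpose_mat P \<in> carrier_mat (Suc n) (Suc n)" using P by simp
 have "transpose_mat (W*P)*(W*P) = transpose_mat P*(transpose_mat W*W)*P"
  using W P Wt Ptc by (simp add: transpose_mult[OF W P] assoc_mult_mat[of _ "Suc n" "Suc n" _ "Suc n" _ "Suc n"])
 then have 1: "transpose_mat (W*P)*(W*P) = 1\<^sub>m (Suc n)" using WW PtP P by simp
 have "transpose_mat (W*P)*A*(W*P) = transpose_mat P*A'*P"
  unfolding A'_def using W P Wt Ptc A by (simp add: transpose_mult[OF W P] assoc_mult_mat[of _ "Suc n" "Suc n" _ "Suc n" _ "Suc n"])
 then have 2: "transpose_mat (W*P)*A*(W*P) = mat_diag (Suc n) d" using PAP by simp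
 show ?case using 1 2 W P by (intro exI[of _ "W*P"] exI[of _ d]) auto
qed

lemma proots_prod_linear:
 fixes f :: "nat \<Rightarrow> real"
 shows "proots (\<Prod>r<n. [:- f r, 1:]) = image_mset f (mset [0..<n])"
proof (induction n)
 case (Suc n)
 have "(\<Prod>r<n. [:- f r, 1:]) \<noteq> 0" by (simp add: prod_zero_iff)
 then have "proots ((\<Prod>r<n. [:- f r, 1:])*[:- f n, 1:]) = proots (\<Prod>r<n. [:- f r, 1:]) + proots [:- f n, 1:]"
  by (rule proots_mult) simp
 also have "proots [:- f n, 1:] = {#f n#}"
  by simp
 finally show ?case unfolding Suc by simp
qed simp

lemma prod_list_map_upt: "(\<Prod>a\<leftarrow>map d [0..<n]. f a) = (\<Prod>r<n. f (d r) :: 'a::comm_monoid_mult)"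
 by (induction n) simp_all

text \<open>
Permuting an orthonormal eigenbasis makes its order agree with the sorted list of eigenvalues, which
the characteristic polynomial determines as a multiset.
\<close>
lemma spectral_decomposition:
 fixes A :: "real mat"
 assumes A: "A \<in> carrier_mat n n" and sym: "transpose_mat A = A"
 shows "\<exists>Q. (\<forall>r<n. \<forall>s<n. (\<Sum>c<n. Q c r*Q c s) = (if r = s then 1 else 0)) \<and>
  (\<forall>a<n. \<forall>b<n. A $$ (a, b) = (\<Sum>r<n. eigenvalues_desc A ! r*Q a r*Q b r)) \<and>
  length (eigenvalues_desc A) = n"
proof -
 obtain Q d where Q: "Q \<in> carrier_mat n n" "transpose_mat Q*Q = 1\<^sub>m n"
  "transpose_mat Q*A*Q = mat_diag n d"
  using real_symmetric_diagonalization[OF assms] by auto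
 have Qt: "transpose_mat Q \<in> carrier_mat n n" using Q by simp
 have QQt: "Q*transpose_mat Q = 1\<^sub>m n" using mat_mult_left_right_inverse[OF Qt Q(1) Q(2)] .
 have D: "mat_diag n d \<in> carrier_mat n n" by (simp add: mat_diag_def)
 have AQ: "A = Q*mat_diag n d*transpose_mat Q"
 proof -
  have "Q*mat_diag n d*transpose_mat Q = (Q*transpose_mat Q)*A*(Q*transpose_mat Q)"
   unfolding Q(3)[symmetric] using Q(1) Qt A
   by (simp add: assoc_mult_mat[of _ n n _ n _ n])
  then show ?thesis using QQt A by simp
 qed
 have "similar_mat A (mat_diag n d)"
  unfolding similar_mat_def using similar_mat_witI[OF QQt Q(2) AQ A D Q(1) Qt] by blast
 then have "char_poly A = char_poly (mat_diag n d)" by (rule char_poly_similar)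
 also have "\<dots> = (\<Prod>a\<leftarrow>diag_mat (mat_diag n d). [:- a, 1:])"
  by (rule char_poly_upper_triangular[OF D]) (auto simp: mat_diag_def)
 also have "diag_mat (mat_diag n d) = map d [0..<n]"
  by (auto simp: diag_mat_def mat_diag_def intro!: map_cong)
 also have "(\<Prod>a\<leftarrow>map d [0..<n]. [:- a, 1:]) = (\<Prod>r<n. [:- d r, 1:])"
  by (rule prod_list_map_upt)
 finally have "proots (char_poly A) = mset (map d [0..<n])"
  by (simp add: proots_prod_linear)
 then have ms: "mset (eigenvalues_desc A) = mset (map d [0..<n])"
  unfolding eigenvalues_desc_def by simp
 then have len: "length (eigenvalues_desc A) = n" by (metis length_map length_upt minus_nat.diff_0 size_mset)
 obtain \<pi> where \<pi>: "\<pi> permutes {..<n}" "permute_list \<pi> (map d [0..<n]) = eigenvalues_desc A"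
  using mset_eq_permutation[OF ms] by auto
 have dev: "eigenvalues_desc A ! r = d (\<pi> r)" if r: "r < n" for r
 proof -
  have "\<pi> r < n" using permutes_in_image[OF \<pi>(1), of r] r by simp
  then show ?thesis using r \<pi> unfolding \<pi>(2)[symmetric] by (subst permute_list_nth) auto
 qed
 have bij: "bij_betw \<pi> {..<n} {..<n}" using \<pi>(1) by (rule permutes_imp_bij)
 have \<pi>n: "\<pi> r < n" if "r < n" for r using permutes_in_image[OF \<pi>(1), of r] that by simp
 have inj: "\<pi> r = \<pi> s \<longleftrightarrow> r = s" for r s using permutes_inj[OF \<pi>(1)] by (auto dest: injD)
 have orth: "(\<Sum>c<n. Q $$ (c, r)*Q $$ (c, s)) = (if r = s then 1 else 0)" if "r < n" "s < n" for r s
 proof -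
  have "(transpose_mat Q*Q) $$ (r, s) = (\<Sum>c<n. Q $$ (c, r)*Q $$ (c, s))"
   using Q(1) that by (simp add: scalar_prod_def lessThan_atLeast0)
  then show ?thesis unfolding Q(2) using that by simp
 qed
 have entry: "A $$ (a, b) = (\<Sum>r<n. d r*Q $$ (a, r)*Q $$ (b, r))" if ab: "a < n" "b < n" for a b
 proof -
  have "A $$ (a, b) = (\<Sum>r<n. (\<Sum>s<n. Q $$ (a, s)*mat_diag n d $$ (s, r))*Q $$ (b, r))"
   by (subst AQ) (use carrier_matD[OF Q(1)] carrier_matD[OF D] ab in \<open>auto simp: scalar_prod_def lessThan_atLeast0 intro!: sum.cong\<close>)
  also have "\<dots> = (\<Sum>r<n. (\<Sum>s<n. if s = r then Q $$ (a, r)*d r else 0)*Q $$ (b, r))"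
   by (intro sum.cong refl arg_cong2[where f="(*)"]) (auto simp: mat_diag_def)
  also have "\<dots> = (\<Sum>r<n. d r*Q $$ (a, r)*Q $$ (b, r))"
   by (intro sum.cong refl) (simp add: mult_ac)
  finally show ?thesis .
 qed
 have "A $$ (a, b) = (\<Sum>r<n. eigenvalues_desc A ! r*Q $$ (a, \<pi> r)*Q $$ (b, \<pi> r))" if ab: "a < n" "b < n" for a b
  unfolding entry[OF ab] using dev
  by (subst sum.reindex_bij_betw[OF bij, symmetric]) (auto intro!: sum.cong)
 then show ?thesis
  by (intro exI[of _ "\<lambda>c r. Q $$ (c, \<pi> r)"]) (auto simp: orth \<pi>n inj len)
qed

lemma eigenvalues_desc_antimono:
 assumes "r \<le> s" "s < length (eigenvalues_desc A)"
 shows "eigenvalues_desc A ! s \<le> eigenvalues_desc A ! r"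
 using assms unfolding eigenvalues_desc_def
 by (auto simp: rev_nth intro!: sorted_nth_mono)

section \<open>Convergence in probability and tails\<close>

text \<open>
The usual subsequence argument, for functions that vary with the index: if \<open>g k\<close> failed
to be uniformly close to \<open>c\<close> near \<open>x\<close>, points witnessing this would form a
sequence that violates the hypothesis on \<open>g\<close>.
\<close>
lemma in_prob_mapping:
 fixes X :: "nat \<Rightarrow> 'w \<Rightarrow> 'a::metric_space" and g :: "nat \<Rightarrow> 'a \<Rightarrow> real"
 assumes prob: "\<And>k. prob_space (M k)"
  and meas: "\<And>k e. {w \<in> space (M k). dist (X k w) x > e} \<in> sets (M k)"
  and conv: "\<And>e. e > 0 \<Longrightarrow> (\<lambda>k. measure (M k) {w \<in> space (M k). dist (X k w) x > e}) \<longlonglongrightarrow> 0"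
  and g: "\<And>a. a \<longlonglongrightarrow> x \<Longrightarrow> (\<lambda>k. g k (a k)) \<longlonglongrightarrow> c"
 shows "tendsto_in_prob M (\<lambda>k w. g k (X k w)) c"
 unfolding tendsto_in_prob_def
proof (intro allI impI)
 fix e :: real assume e: "e > 0"
 have "\<exists>d>0. eventually (\<lambda>k. \<forall>a. dist a x \<le> d \<longrightarrow> \<bar>g k a - c\<bar> \<le> e) sequentially"
 proof (rule ccontr)
  assume "\<not> ?thesis"
  then have bad: "\<exists>k\<ge>K. \<exists>a. dist a x \<le> d \<and> \<bar>g k a - c\<bar> > e" if "d > 0" for d K
   using that unfolding eventually_sequentially by (meson not_le)
  have "\<exists>f. \<forall>j. (\<exists>a. dist a x \<le> 1/Suc j \<and> \<bar>g (f j) a - c\<bar> > e) \<and> f j < f (Suc j)"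
  proof (rule dependent_nat_choice)
   show "\<exists>k. \<exists>a. dist a x \<le> 1/Suc 0 \<and> \<bar>g k a - c\<bar> > e" using bad[of "1/Suc 0" 0] by auto
   fix k j
   show "\<exists>k'. (\<exists>a. dist a x \<le> 1/Suc (Suc j) \<and> \<bar>g k' a - c\<bar> > e) \<and> k < k'"
    using bad[of "1/Suc (Suc j)" "Suc k"] by (auto simp: Suc_le_eq)
  qed
  then obtain f where f: "\<And>j. \<exists>a. dist a x \<le> 1/Suc j \<and> \<bar>g (f j) a - c\<bar> > e" "\<And>j. f j < f (Suc j)"
   by blast
  obtain b where b: "\<And>j. dist (b j) x \<le> 1/Suc j" "\<And>j. \<bar>g (f j) (b j) - c\<bar> > e" using f(1) by metis
  have sm: "strict_mono f" using f(2) by (simp add: strict_mono_Suc_iff)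
  define a where "a k = (if k \<in> range f then b (inv_into UNIV f k) else x)" for k
  have af: "a (f j) = b j" for j by (simp add: a_def inv_into_f_f[OF strict_mono_imp_inj_on[OF sm] UNIV_I])
  have "a \<longlonglongrightarrow> x"
  proof (rule metric_LIMSEQ_I)
   fix r :: real assume "r > 0"
   then obtain J where J: "1/real (Suc J) < r" using nat_approx_posE by blast
   have "dist (a k) x < r" if k: "k \<ge> f J" for k
   proof (cases "k \<in> range f")
    case True
    then obtain j where j: "k = f j" by auto
    then have "J \<le> j" using k sm by (simp add: strict_mono_less_eq)
    then have "1/real (Suc j) \<le> 1/real (Suc J)" by (simp add: frac_le)
    then show ?thesis using b(1)[of j] J j af by simp
   qed (simp add: a_def \<open>r > 0\<close>)
   then show "\<exists>no. \<forall>n\<ge>no. dist (a n) x < r" by blast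
  qed
  from LIMSEQ_subseq_LIMSEQ[OF g[OF this] sm] have "(\<lambda>j. g (f j) (b j)) \<longlonglongrightarrow> c" by (simp add: o_def af)
  then have "eventually (\<lambda>j. \<bar>g (f j) (b j) - c\<bar> < e) sequentially"
   using e by (auto simp: tendsto_iff dist_real_def)
  then obtain j where "\<bar>g (f j) (b j) - c\<bar> < e" unfolding eventually_sequentially by blast
  then show False using b(2)[of j] by simp
 qed
 then obtain d where d: "d > 0" "eventually (\<lambda>k. \<forall>a. dist a x \<le> d \<longrightarrow> \<bar>g k a - c\<bar> \<le> e) sequentially" by blast
 show "(\<lambda>k. \<P>(w in M k. \<bar>g k (X k w) - c\<bar> > e)) \<longlonglongrightarrow> 0"
 proof (rule tendsto_sandwich[OF _ _ tendsto_const conv[OF d(1)]])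
  show "\<forall>\<^sub>F k in sequentially. \<P>(w in M k. \<bar>g k (X k w) - c\<bar> > e) \<le> measure (M k) {w \<in> space (M k). dist (X k w) x > d}"
   using d(2)
  proof eventually_elim
   case (elim k)
   interpret prob_space "M k" by (rule prob)
   show ?case using elim by (intro finite_measure_mono meas) (auto simp: not_le[symmetric])
  qed
 qed simp
qed

lemma in_prob_dist_pair:
 fixes X :: "nat \<Rightarrow> 'w \<Rightarrow> 'a::metric_space" and Y :: "nat \<Rightarrow> 'w \<Rightarrow> 'b::metric_space"
 assumes prob: "\<And>k. prob_space (M k)"
  and X: "\<And>k e. {w \<in> space (M k). dist (X k w) x > e} \<in> sets (M k)"
  and Y: "\<And>k e. {w \<in> space (M k). dist (Y k w) y > e} \<in> sets (M k)"
  and cX: "\<And>e. e > 0 \<Longrightarrow> (\<lambda>k. measure (M k) {w \<in> space (M k). dist (X k w) x > e}) \<longlonglongrightarrow> 0"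
  and cY: "\<And>e. e > 0 \<Longrightarrow> (\<lambda>k. measure (M k) {w \<in> space (M k). dist (Y k w) y > e}) \<longlonglongrightarrow> 0"
  and e: "e > 0"
 shows "(\<lambda>k. measure (M k) {w \<in> space (M k). dist (X k w, Y k w) (x, y) > e}) \<longlonglongrightarrow> 0"
proof (rule tendsto_sandwich[OF _ _ tendsto_const])
 have "(\<lambda>k. measure (M k) {w \<in> space (M k). dist (X k w) x > e/2} + measure (M k) {w \<in> space (M k). dist (Y k w) y > e/2}) \<longlonglongrightarrow> 0 + 0"
  using e by (intro tendsto_add cX cY) auto
 then show "(\<lambda>k. measure (M k) {w \<in> space (M k). dist (X k w) x > e/2} + measure (M k) {w \<in> space (M k). dist (Y k w) y > e/2}) \<longlonglongrightarrow> 0"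
  by simp
 show "\<forall>\<^sub>F k in sequentially. measure (M k) {w \<in> space (M k). dist (X k w, Y k w) (x, y) > e} \<le>
  measure (M k) {w \<in> space (M k). dist (X k w) x > e/2} + measure (M k) {w \<in> space (M k). dist (Y k w) y > e/2}"
 proof (intro always_eventually allI)
  fix k
  interpret prob_space "M k" by (rule prob)
  have "measure (M k) {w \<in> space (M k). dist (X k w, Y k w) (x, y) > e} \<le>
   measure (M k) ({w \<in> space (M k). dist (X k w) x > e/2} \<union> {w \<in> space (M k). dist (Y k w) y > e/2})"
  proof (intro finite_measure_mono sets.Un X Y subsetI)
   fix w assume w: "w \<in> {w \<in> space (M k). e < dist (X k w, Y k w) (x, y)}"
   have "dist (X k w, Y k w) (x, y) \<le> dist (X k w) x + dist (Y k w) y"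
    by (simp add: dist_Pair_Pair sqrt_sum_squares_le_sum)
   with w show "w \<in> {w \<in> space (M k). dist (X k w) x > e/2} \<union> {w \<in> space (M k). dist (Y k w) y > e/2}" by auto
  qed
  also have "\<dots> \<le> measure (M k) {w \<in> space (M k). dist (X k w) x > e/2} + measure (M k) {w \<in> space (M k). dist (Y k w) y > e/2}"
   by (intro measure_Un_le X Y)
  finally show "measure (M k) {w \<in> space (M k). dist (X k w, Y k w) (x, y) > e} \<le>
   measure (M k) {w \<in> space (M k). dist (X k w) x > e/2} + measure (M k) {w \<in> space (M k). dist (Y k w) y > e/2}" .
 qed
qed simp

lemma in_prob_of_L1:
 assumes prob: "\<And>k. prob_space (M k)" and int: "\<And>k. integrable (M k) (X k)"
  and L1: "(\<lambda>k. \<integral>w. \<bar>X k w - c\<bar> \<partial>M k) \<longlonglongrightarrow> 0"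
 shows "tendsto_in_prob M X c"
 unfolding tendsto_in_prob_def
proof (intro allI impI)
 fix e :: real assume e: "e > 0"
 show "(\<lambda>k. \<P>(w in M k. \<bar>X k w - c\<bar> > e)) \<longlonglongrightarrow> 0"
 proof (rule tendsto_sandwich[OF _ _ tendsto_const])
  show "(\<lambda>k. (\<integral>w. \<bar>X k w - c\<bar> \<partial>M k)/e) \<longlonglongrightarrow> 0" using tendsto_divide[OF L1 tendsto_const[of e]] e by simp
  show "\<forall>\<^sub>F k in sequentially. \<P>(w in M k. \<bar>X k w - c\<bar> > e) \<le> (\<integral>w. \<bar>X k w - c\<bar> \<partial>M k)/e"
  proof (intro always_eventually allI)
   fix k
   interpret prob_space "M k" by (rule prob)
   have [measurable]: "X k \<in> borel_measurable (M k)" using int by auto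
   have "\<P>(w in M k. \<bar>X k w - c\<bar> > e) \<le> \<P>(w in M k. \<bar>X k w - c\<bar> \<ge> e)"
    by (intro finite_measure_mono) auto
   also have "\<dots> \<le> (\<integral>w. \<bar>X k w - c\<bar> \<partial>M k)/e"
    using e int by (intro integral_Markov_inequality_measure[where A="{}"]) auto
   finally show "\<P>(w in M k. \<bar>X k w - c\<bar> > e) \<le> (\<integral>w. \<bar>X k w - c\<bar> \<partial>M k)/e" .
  qed
 qed simp
qed

text \<open>
Any event between the strict and the weak inequality is allowed, so that ties between \<open>U
k\<close> and \<open>V k\<close> need no separate treatment.
\<close>
lemma slutsky_tail_fixed:
 assumes prob: "\<And>k. prob_space (M k)"
  and U[measurable]: "\<And>k. U k \<in> borel_measurable (M k)"
  and V[measurable]: "\<And>k. V k \<in> borel_measurable (M k)"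
  and weak: "weak_conv_m (\<lambda>k. distr (M k) borel (U k)) \<mu>"
  and cont: "\<And>x. isCont (cdf \<mu>) x"
  and Vc: "tendsto_in_prob M V c"
  and E: "\<And>k. E k \<in> sets (M k)" "\<And>k w. w \<in> space (M k) \<Longrightarrow> U k w > V k w \<Longrightarrow> w \<in> E k"
   "\<And>k w. w \<in> E k \<Longrightarrow> U k w \<ge> V k w"
 shows "(\<lambda>k. measure (M k) (E k)) \<longlonglongrightarrow> 1 - cdf \<mu> c"
proof -
 have tail: "measure (M k) {w \<in> space (M k). U k w > x} = 1 - cdf (distr (M k) borel (U k)) x" for k x
 proof -
  interpret prob_space "M k" by (rule prob)
  have "cdf (distr (M k) borel (U k)) x = measure (M k) {w \<in> space (M k). U k w \<le> x}"
   unfolding cdf_def by (subst measure_distr) (auto intro!: arg_cong[where f="measure (M k)"])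
  moreover have "measure (M k) {w \<in> space (M k). \<not> U k w \<le> x} = 1 - measure (M k) {w \<in> space (M k). U k w \<le> x}"
   by (intro prob_neg) auto
  ultimately show ?thesis by (simp add: not_le)
 qed
 have conv: "(\<lambda>k. cdf (distr (M k) borel (U k)) x) \<longlonglongrightarrow> cdf \<mu> x" for x
  using weak cont unfolding weak_conv_m_def weak_conv_def by auto
 show ?thesis
 proof (rule LIMSEQ_I, unfold real_norm_def)
  fix r :: real assume r: "r > 0"
  obtain d where d: "d > 0" "\<And>x. \<bar>x - c\<bar> < d \<Longrightarrow> \<bar>cdf \<mu> x - cdf \<mu> c\<bar> < r/3"
   using cont[of c] r unfolding continuous_at_eps_delta dist_real_def by (metis divide_pos_pos zero_less_numeral)
  define h where "h = d/3"
  have h: "h > 0" "2*h < d" using d(1) by (auto simp: h_def)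
  have A: "eventually (\<lambda>k. \<bar>cdf (distr (M k) borel (U k)) x - cdf \<mu> x\<bar> < r/3) sequentially" for x
   using conv[of x] r unfolding tendsto_iff dist_real_def by (meson divide_pos_pos zero_less_numeral)
  have B: "eventually (\<lambda>k. \<P>(w in M k. \<bar>V k w - c\<bar> > h) < r/3) sequentially"
   using order_tendstoD(2)[OF Vc[unfolded tendsto_in_prob_def, rule_format, OF h(1)], of "r/3"] r by simp
  have "eventually (\<lambda>k. \<bar>measure (M k) (E k) - (1 - cdf \<mu> c)\<bar> < r) sequentially"
   using A[of "c - 2*h"] A[of "c + h"] B
  proof eventually_elim
   case (elim k)
   interpret prob_space "M k" by (rule prob)
   have "measure (M k) (E k) \<le> measure (M k) ({w \<in> space (M k). U k w > c - 2*h} \<union> {w \<in> space (M k). \<bar>V k w - c\<bar> > h})"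
   proof (intro finite_measure_mono subsetI)
    fix w assume w: "w \<in> E k"
    then have "w \<in> space (M k)" using E(1)[of k] sets.sets_into_space by blast
    then show "w \<in> {w \<in> space (M k). U k w > c - 2*h} \<union> {w \<in> space (M k). \<bar>V k w - c\<bar> > h}"
     using E(3)[OF w] h by auto
   qed auto
   also have "\<dots> \<le> measure (M k) {w \<in> space (M k). U k w > c - 2*h} + \<P>(w in M k. \<bar>V k w - c\<bar> > h)"
    by (intro measure_Un_le) auto
   finally have up: "measure (M k) (E k) \<le> 1 - cdf (distr (M k) borel (U k)) (c - 2*h) + \<P>(w in M k. \<bar>V k w - c\<bar> > h)"
    by (simp add: tail)
   have "measure (M k) {w \<in> space (M k). U k w > c + h} \<le> measure (M k) (E k \<union> {w \<in> space (M k). \<bar>V k w - c\<bar> > h})"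
   proof (intro finite_measure_mono subsetI)
    fix w assume "w \<in> {w \<in> space (M k). U k w > c + h}"
    then show "w \<in> E k \<union> {w \<in> space (M k). \<bar>V k w - c\<bar> > h}"
     using E(2)[of w k] h by auto
   qed (use E in auto)
   also have "\<dots> \<le> measure (M k) (E k) + \<P>(w in M k. \<bar>V k w - c\<bar> > h)"
    using E by (intro measure_Un_le) auto
   finally have lo: "1 - cdf (distr (M k) borel (U k)) (c + h) \<le> measure (M k) (E k) + \<P>(w in M k. \<bar>V k w - c\<bar> > h)"
    by (simp add: tail)
   show ?case using up lo elim d(2)[of "c - 2*h"] d(2)[of "c + h"] h by (simp add: abs_if split: if_splits)
  qed
  then show "\<exists>no. \<forall>n\<ge>no. \<bar>measure (M n) (E n) - (1 - cdf \<mu> c)\<bar> < r" by (simp add: eventually_sequentially)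
 qed
qed

lemma in_prob_subseq:
 assumes "tendsto_in_prob M V c" "strict_mono f"
 shows "tendsto_in_prob (M \<circ> f) (V \<circ> f) c"
 unfolding tendsto_in_prob_def
proof (intro allI impI)
 fix e :: real assume "e > 0"
 then have "(\<lambda>k. \<P>(w in M k. \<bar>V k w - c\<bar> > e)) \<longlonglongrightarrow> 0" using assms(1) unfolding tendsto_in_prob_def by blast
 from LIMSEQ_subseq_LIMSEQ[OF this assms(2)]
 show "(\<lambda>k. \<P>(w in (M \<circ> f) k. \<bar>(V \<circ> f) k w - c\<bar> > e)) \<longlonglongrightarrow> 0" by (simp add: o_def)
qed

lemma in_prob_shift:
 assumes prob: "\<And>k. prob_space (M k)" and [measurable]: "\<And>k. V k \<in> borel_measurable (M k)"
  and V: "tendsto_in_prob M V c" and t: "t \<longlonglongrightarrow> t0"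
 shows "tendsto_in_prob M (\<lambda>k w. V k w - t k) (c - t0)"
proof (rule in_prob_mapping[OF prob, where g="\<lambda>k v. v - t k" and X=V and x=c])
 show "{w \<in> space (M k). dist (V k w) c > e} \<in> sets (M k)" for k e by measurable
 show "(\<lambda>k. measure (M k) {w \<in> space (M k). dist (V k w) c > e}) \<longlonglongrightarrow> 0" if "e > 0" for e
  using V that unfolding tendsto_in_prob_def by (simp add: dist_real_def)
qed (intro tendsto_diff t)

text \<open>
The shift \<open>s k\<close> may be unbounded. Along a subsequence it either converges, and the
version for fixed shifts applies, or diverges, and then both probabilities tend to one.
\<close>
lemma slutsky_tail:
 assumes prob: "\<And>k. prob_space (M k)"
  and U[measurable]: "\<And>k. U k \<in> borel_measurable (M k)"
  and V[measurable]: "\<And>k. V k \<in> borel_measurable (M k)"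
  and weak: "weak_conv_m (\<lambda>k. distr (M k) borel (U k)) \<mu>"
  and \<mu>: "real_distribution \<mu>"
  and cont: "\<And>x. isCont (cdf \<mu>) x"
  and Vc: "tendsto_in_prob M V c"
  and s: "\<And>k. s k \<ge> 0" and r: "r \<longlonglongrightarrow> 1" and b: "b \<longlonglongrightarrow> c"
 shows "(\<lambda>k. \<P>(w in M k. U k w \<ge> V k w - r k * s k) - measure \<mu> {b k - s k..}) \<longlonglongrightarrow> 0"
proof (rule ccontr)
 interpret \<mu>: real_distribution \<mu> by fact
 have H: "measure \<mu> {x..} = 1 - cdf \<mu> x" for x
 proof -
  have "measure \<mu> {x} = 0" using cont \<mu>.isCont_cdf by blast
  then have "measure \<mu> {x..} = measure \<mu> {x<..}"
   using \<mu>.finite_measure_Union[of "{x}" "{x<..}"] ivl_disj_un_singleton(1)[of x] by simp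
  also have "\<dots> = 1 - cdf \<mu> x" unfolding cdf_def
   using \<mu>.prob_compl[of "{..x}"] by (simp add: Compl_eq_Diff_UNIV[symmetric] Compl_atMost)
  finally show ?thesis .
 qed
 let ?f = "\<lambda>k. \<P>(w in M k. U k w \<ge> V k w - r k * s k) - measure \<mu> {b k - s k..}"
 assume "\<not> ?f \<longlonglongrightarrow> 0"
 then obtain e where e: "e > 0" "\<And>K. \<exists>k\<ge>K. \<bar>?f k\<bar> \<ge> e"
  unfolding LIMSEQ_iff real_norm_def diff_zero by (meson not_less)
 then have "infinite {k. \<bar>?f k\<bar> \<ge> e}" unfolding infinite_nat_iff_unbounded_le by auto
 then obtain p :: "nat \<Rightarrow> nat" where p: "strict_mono p" "\<And>j. \<bar>?f (p j)\<bar> \<ge> e" using infinite_enumerate by blast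
 obtain q :: "nat \<Rightarrow> nat" where q: "strict_mono q" "monoseq (\<lambda>j. s (p (q j)))" using seq_monosub[of "s \<circ> p"] by auto
 define f where "f = p \<circ> q"
 have f: "strict_mono f" unfolding f_def using p q by (simp add: strict_mono_o)
 have fe: "\<bar>?f (f j)\<bar> \<ge> e" for j using p(2) by (simp add: f_def)
 have weakf: "weak_conv_m (\<lambda>k. distr (M (f k)) borel (U (f k))) \<mu>"
  unfolding weak_conv_m_def weak_conv_def
 proof (intro allI impI)
  fix x
  have "(\<lambda>k. cdf (distr (M k) borel (U k)) x) \<longlonglongrightarrow> cdf \<mu> x"
   using weak cont unfolding weak_conv_m_def weak_conv_def by blast
  from LIMSEQ_subseq_LIMSEQ[OF this f] show "(\<lambda>k. cdf (distr (M (f k)) borel (U (f k))) x) \<longlonglongrightarrow> cdf \<mu> x"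
   by (simp add: o_def)
 qed
 have Vf: "tendsto_in_prob (\<lambda>k. M (f k)) (\<lambda>k. V (f k)) c" using in_prob_subseq[OF Vc f] by (simp add: o_def)
 have rf: "(\<lambda>k. r (f k)) \<longlonglongrightarrow> 1" and bf: "(\<lambda>k. b (f k)) \<longlonglongrightarrow> c"
  using r b LIMSEQ_subseq_LIMSEQ[unfolded o_def, OF _ f] by auto
 have mono: "monoseq (\<lambda>j. s (f j))" using q(2) by (simp add: f_def)
 have "(\<lambda>j. ?f (f j)) \<longlonglongrightarrow> 0"
 proof (cases "Bseq (\<lambda>j. s (f j))")
  case True
  then obtain s0 where s0: "(\<lambda>j. s (f j)) \<longlonglongrightarrow> s0" using Bseq_monoseq_convergent[OF _ mono] unfolding convergent_def by blast
  have t: "(\<lambda>j. r (f j) * s (f j)) \<longlonglongrightarrow> s0" using tendsto_mult[OF rf s0] by simp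
  have 1: "(\<lambda>j. measure (M (f j)) {w \<in> space (M (f j)). U (f j) w \<ge> V (f j) w - r (f j) * s (f j)}) \<longlonglongrightarrow> 1 - cdf \<mu> (c - s0)"
   by (rule slutsky_tail_fixed[OF prob _ _ weakf cont in_prob_shift[OF prob _ Vf t]]) auto
  have 2: "(\<lambda>j. 1 - cdf \<mu> (b (f j) - s (f j))) \<longlonglongrightarrow> 1 - cdf \<mu> (c - s0)"
   by (intro tendsto_diff tendsto_const isCont_tendsto_compose[OF cont] bf s0)
  show ?thesis using tendsto_diff[OF 1 2] by (simp add: H)
 next
  case False
  have inc: "incseq (\<lambda>j. s (f j))"
  proof (rule ccontr)
   assume "\<not> ?thesis"
   then have "decseq (\<lambda>j. s (f j))" using mono by (simp add: monoseq_iff)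
   then have "Bseq (\<lambda>j. s (f j))" using s
    by (intro BseqI'[of _ "s (f 0)"]) (auto simp: decseq_def)
   with False show False by simp
  qed
  have sinf: "filterlim (\<lambda>j. s (f j)) at_top sequentially"
  proof (rule filterlim_at_top_mono[OF _ always_eventually])
   have "\<exists>N. \<forall>n\<ge>N. Z \<le> s (f n)" for Z
   proof (rule ccontr)
    assume "\<not> ?thesis"
    then have "s (f n) \<le> Z" for n using inc unfolding incseq_def by (meson le_cases order_trans)
    then have "Bseq (\<lambda>j. s (f j))" using s by (intro BseqI'[of _ Z]) auto
    with False show False by simp
   qed
   then show "filterlim (\<lambda>j. s (f j)) at_top sequentially" unfolding filterlim_at_top eventually_sequentially by blast
  qed simp
  have tinf: "filterlim (\<lambda>j. r (f j) * s (f j)) at_top sequentially"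
   by (rule filterlim_tendsto_pos_mult_at_top[OF rf _ sinf]) simp
  have lim1: "(\<lambda>j. 1 - cdf \<mu> (b (f j) - s (f j))) \<longlonglongrightarrow> 1 - 0"
  proof (intro tendsto_diff tendsto_const filterlim_compose[OF \<mu>.cdf_lim_at_bot])
   show "filterlim (\<lambda>j. b (f j) - s (f j)) at_bot sequentially"
    using filterlim_tendsto_add_at_top[OF tendsto_minus[OF bf] sinf] by (simp add: filterlim_uminus_at_bot)
  qed
  have lim2: "(\<lambda>j. measure (M (f j)) {w \<in> space (M (f j)). U (f j) w \<ge> V (f j) w - r (f j) * s (f j)}) \<longlonglongrightarrow> 1"
  proof (rule LIMSEQ_I, unfold real_norm_def)
   fix \<epsilon> :: real assume \<epsilon>: "\<epsilon> > 0"
   obtain L where L: "cdf \<mu> L < \<epsilon>"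
    using \<mu>.cdf_lim_at_bot \<epsilon> unfolding tendsto_iff eventually_at_bot_linorder dist_real_def
    by (metis abs_of_nonneg diff_zero order_refl \<mu>.cdf_nonneg)
   have "(\<lambda>j. measure (M (f j)) {w \<in> space (M (f j)). U (f j) w \<ge> V (f j) w + (L - c)}) \<longlonglongrightarrow> 1 - cdf \<mu> L"
   proof (rule slutsky_tail_fixed[OF prob _ _ weakf cont, where V="\<lambda>j w. V (f j) w + (L - c)"])
    show "tendsto_in_prob (\<lambda>k. M (f k)) (\<lambda>j w. V (f j) w + (L - c)) L"
     using in_prob_shift[OF prob _ Vf tendsto_const[of "c - L"]] by (simp add: algebra_simps)
   qed auto
   then have "eventually (\<lambda>j. measure (M (f j)) {w \<in> space (M (f j)). U (f j) w \<ge> V (f j) w + (L - c)} > 1 - \<epsilon>) sequentially"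
    using L by (intro order_tendstoD(1)) auto
   moreover have "eventually (\<lambda>j. r (f j) * s (f j) \<ge> c - L) sequentially"
    using tinf by (simp add: filterlim_at_top)
   ultimately have "eventually (\<lambda>j. \<bar>measure (M (f j)) {w \<in> space (M (f j)). U (f j) w \<ge> V (f j) w - r (f j) * s (f j)} - 1\<bar> < \<epsilon>) sequentially"
   proof eventually_elim
    case (elim j)
    interpret prob_space "M (f j)" by (rule prob)
    have "measure (M (f j)) {w \<in> space (M (f j)). U (f j) w \<ge> V (f j) w + (L - c)} \<le> measure (M (f j)) {w \<in> space (M (f j)). U (f j) w \<ge> V (f j) w - r (f j) * s (f j)}"
     using elim(2) by (intro finite_measure_mono) auto
    moreover have "measure (M (f j)) {w \<in> space (M (f j)). U (f j) w \<ge> V (f j) w - r (f j) * s (f j)} \<le> 1" by simp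
    ultimately show ?case using elim(1) by linarith
   qed
   then show "\<exists>no. \<forall>n\<ge>no. \<bar>measure (M (f n)) {w \<in> space (M (f n)). U (f n) w \<ge> V (f n) w - r (f n) * s (f n)} - 1\<bar> < \<epsilon>"
    by (simp add: eventually_sequentially)
  qed
  show ?thesis using tendsto_diff[OF lim2 lim1] by (simp add: H)
 qed
 then have "eventually (\<lambda>j. \<bar>?f (f j)\<bar> < e) sequentially" using e(1) unfolding tendsto_iff dist_real_def by simp
 then obtain j where "\<bar>?f (f j)\<bar> < e" unfolding eventually_sequentially by blast
 then show False using fe[of j] by simp
qed

text \<open>
Convergence of tails at every point forces convergence of percentiles wherever the limiting
distribution function increases strictly. The affine normalisation \<open>1 + \<sigma> k * y\<close>
fits ratios that concentrate at one.
\<close>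
lemma upper_percentile_tendsto:
 fixes D :: "nat \<Rightarrow> real measure"
 assumes \<mu>: "real_distribution \<mu>"
  and strict: "\<And>x y. x < y \<Longrightarrow> 0 < cdf \<mu> x \<Longrightarrow> cdf \<mu> x < cdf \<mu> y"
  and D: "\<And>k. prob_space (D k)" "\<And>k. sets (D k) = sets borel"
  and \<alpha>: "0 < \<alpha>" "\<alpha> < 1"
  and \<sigma>: "\<And>k. \<sigma> k > 0"
  and tail: "\<And>y. (\<lambda>k. measure (D k) {1 + \<sigma> k*y<..}) \<longlonglongrightarrow> 1 - cdf \<mu> y"
 shows "(\<lambda>k. (upper_percentile (D k) \<alpha> - 1)/\<sigma> k) \<longlonglongrightarrow> upper_percentile \<mu> \<alpha>"
proof -
 interpret \<mu>: real_distribution \<mu> by fact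
 define c where "c = upper_percentile \<mu> \<alpha>"
 let ?A = "{x. measure \<mu> {x<..} \<le> \<alpha>}"
 have tl: "measure \<mu> {x<..} = 1 - cdf \<mu> x" for x unfolding cdf_def
  using \<mu>.prob_compl[of "{..x}"] by (simp add: Compl_eq_Diff_UNIV[symmetric] Compl_atMost)
 have A: "?A = {x. 1 - \<alpha> \<le> cdf \<mu> x}" by (auto simp: tl)
 have ne: "?A \<noteq> {}"
 proof -
  have "eventually (\<lambda>x. cdf \<mu> x > 1 - \<alpha>) at_top" using \<mu>.cdf_lim_at_top_prob \<alpha> by (intro order_tendstoD) auto
  then obtain x where "cdf \<mu> x > 1 - \<alpha>" by (auto simp: eventually_at_top_linorder)
  then show ?thesis unfolding A by (auto intro: less_imp_le)
 qed
 have bdd: "bdd_below ?A"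
 proof -
  have "eventually (\<lambda>x. cdf \<mu> x < 1 - \<alpha>) at_bot" using \<mu>.cdf_lim_at_bot \<alpha> by (intro order_tendstoD) auto
  then obtain L where L: "\<And>x. x \<le> L \<Longrightarrow> cdf \<mu> x < 1 - \<alpha>" by (auto simp: eventually_at_bot_linorder)
  show ?thesis unfolding A by (rule bdd_belowI[of _ L]) (use L in \<open>simp, meson linear not_le\<close>)
 qed
 have below: "cdf \<mu> x < 1 - \<alpha>" if "x < c" for x
  using cInf_lower[OF _ bdd, of x] that unfolding c_def upper_percentile_def A by force
 have above: "cdf \<mu> x > 1 - \<alpha>" if x: "c < x" for x
 proof -
  obtain y where y: "y \<in> ?A" "y < x" using cInf_lessD[OF ne, of x] x unfolding c_def upper_percentile_def by blast
  have "cdf \<mu> y \<ge> 1 - \<alpha>" using y A by simp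
  moreover from this have "cdf \<mu> y < cdf \<mu> x" using strict[OF y(2)] \<alpha> by linarith
  ultimately show ?thesis by linarith
 qed
 have anti: "measure (D k) {y<..} \<le> measure (D k) {x<..}" if "x \<le> y" for k x y
 proof -
  interpret prob_space "D k" by (rule D)
  show ?thesis using that D(2) by (intro finite_measure_mono) auto
 qed
 show ?thesis unfolding c_def[symmetric]
 proof (rule LIMSEQ_I, unfold real_norm_def)
  fix r :: real assume r: "r > 0"
  have 1: "eventually (\<lambda>k. measure (D k) {1 + \<sigma> k*(c - r/2)<..} > \<alpha>) sequentially"
   using below[of "c - r/2"] r by (intro order_tendstoD(1)[OF tail]) auto
  have 2: "eventually (\<lambda>k. measure (D k) {1 + \<sigma> k*(c + r/2)<..} < \<alpha>) sequentially"
   using above[of "c + r/2"] r by (intro order_tendstoD(2)[OF tail]) auto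
  have "eventually (\<lambda>k. \<bar>(upper_percentile (D k) \<alpha> - 1)/\<sigma> k - c\<bar> < r) sequentially"
   using 1 2
  proof eventually_elim
   case (elim k)
   let ?B = "{x. measure (D k) {x<..} \<le> \<alpha>}"
   have mem: "1 + \<sigma> k*(c + r/2) \<in> ?B" using elim(2) by simp
   have lb: "1 + \<sigma> k*(c - r/2) \<le> x" if "x \<in> ?B" for x
    using that elim(1) anti[of x "1 + \<sigma> k*(c - r/2)" k] by (cases "x \<le> 1 + \<sigma> k*(c - r/2)") auto
   have "upper_percentile (D k) \<alpha> \<le> 1 + \<sigma> k*(c + r/2)"
    unfolding upper_percentile_def using mem lb by (intro cInf_lower bdd_belowI) auto
   moreover have "1 + \<sigma> k*(c - r/2) \<le> upper_percentile (D k) \<alpha>"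
    unfolding upper_percentile_def using mem lb by (intro cInf_greatest) auto
   ultimately have "(upper_percentile (D k) \<alpha> - 1)/\<sigma> k \<le> c + r/2" "c - r/2 \<le> (upper_percentile (D k) \<alpha> - 1)/\<sigma> k"
    using \<sigma>[of k] by (auto simp: divide_le_eq le_divide_eq mult.commute)
   then show ?case using r unfolding abs_less_iff by linarith
  qed
  then show "\<exists>no. \<forall>n\<ge>no. \<bar>(upper_percentile (D n) \<alpha> - 1)/\<sigma> n - c\<bar> < r" by (simp add: eventually_sequentially)
 qed
qed

section \<open>Laplace transforms and chi-square laws\<close>

text \<open>A Taylor polynomial of \<open>iexp (t * x)\<close>.\<close>
definition exp_poly :: "real \<Rightarrow> nat \<Rightarrow> real \<Rightarrow> complex" where
 "exp_poly t n v = (\<Sum>k\<le>n. (\<i>*complex_of_real (t * v)) ^ k/fact k)"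

lemma exp_poly_approx:
 fixes N :: "'c measure" and W :: "'c \<Rightarrow> real"
 assumes N: "prob_space N" and [measurable]: "W \<in> borel_measurable N" and W: "\<And>w. \<bar>W w\<bar> \<le> 1"
 shows "cmod ((\<integral>w. iexp (t*W w) \<partial>N) - (\<integral>w. exp_poly t n (W w) \<partial>N)) \<le> \<bar>t\<bar> ^ Suc n/fact (Suc n) \<and>
  (\<integral>w. exp_poly t n (W w) \<partial>N) = (\<Sum>k\<le>n. (\<i> * of_real t) ^ k/fact k * of_real (\<integral>w. W w ^ k \<partial>N))"
proof -
 interpret prob_space N by fact
 have pw: "integrable N (\<lambda>w. W w ^ k)" for k
  by (rule integrable_const_bound[of _ 1]) (auto simp: power_abs W power_le_one)
 have Pe: "exp_poly t n (W w) = (\<Sum>k\<le>n. (\<i> * of_real t) ^ k/fact k*complex_of_real (W w ^ k))" for w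
  unfolding exp_poly_def by (intro sum.cong refl) (simp add: power_mult_distrib mult_ac)
 have iP: "integrable N (\<lambda>w. exp_poly t n (W w))" unfolding Pe
  by (intro Bochner_Integration.integrable_sum integrable_mult_right) (use pw in \<open>auto simp del: of_real_power\<close>)
 have ie: "integrable N (\<lambda>w. iexp (t*W w))" by (rule integrable_iexp) auto
 have "cmod ((\<integral>w. iexp (t*W w) \<partial>N) - (\<integral>w. exp_poly t n (W w) \<partial>N)) = cmod (\<integral>w. iexp (t*W w) - exp_poly t n (W w) \<partial>N)"
  using ie iP by simp
 also have "\<dots> \<le> (\<integral>w. cmod (iexp (t*W w) - exp_poly t n (W w)) \<partial>N)" by (rule integral_norm_bound)
 also have "\<dots> \<le> (\<integral>w. \<bar>t\<bar> ^ Suc n/fact (Suc n) \<partial>N)"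
 proof (intro integral_mono)
  fix w
  have "cmod (iexp (t*W w) - exp_poly t n (W w)) \<le> \<bar>t*W w\<bar> ^ Suc n/fact (Suc n)"
   unfolding exp_poly_def by (rule iexp_approx1)
  also have "\<dots> \<le> \<bar>t\<bar> ^ Suc n/fact (Suc n)"
   using W[of w] by (intro divide_right_mono power_mono) (auto simp: abs_mult mult_left_le)
  finally show "cmod (iexp (t*W w) - exp_poly t n (W w)) \<le> \<bar>t\<bar> ^ Suc n/fact (Suc n)" .
 qed (use ie iP in auto)
 also have "\<dots> = \<bar>t\<bar> ^ Suc n/fact (Suc n)" by (simp add: prob_space)
 finally have 1: "cmod ((\<integral>w. iexp (t*W w) \<partial>N) - (\<integral>w. exp_poly t n (W w) \<partial>N)) \<le> \<bar>t\<bar> ^ Suc n/fact (Suc n)" .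
 have "(\<integral>w. exp_poly t n (W w) \<partial>N) = (\<Sum>k\<le>n. (\<i> * of_real t) ^ k/fact k * of_real (\<integral>w. W w ^ k \<partial>N))"
  unfolding Pe using pw
  by (subst Bochner_Integration.integral_sum) (auto intro!: integrable_mult_right simp del: of_real_power)
 with 1 show ?thesis by blast
qed

text \<open>
For a bounded variable the Taylor series of the characteristic function may be integrated termwise,
so the moments determine the law.
\<close>
lemma char_eq_of_bounded_moments_eq:
 assumes M: "prob_space M" and M': "prob_space M'"
  and [measurable]: "V \<in> borel_measurable M" "V' \<in> borel_measurable M'"
  and V: "\<And>w. \<bar>V w\<bar> \<le> (1::real)" and V': "\<And>w. \<bar>V' w\<bar> \<le> (1::real)"
  and mom: "\<And>k. (\<integral>w. V w ^ k \<partial>M) = (\<integral>w. V' w ^ k \<partial>M')"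
 shows "distr M borel V = distr M' borel V'"
proof (rule Levy_uniqueness)
 interpret M: prob_space M by fact
 interpret M': prob_space M' by fact
 show "real_distribution (distr M borel V)" "real_distribution (distr M' borel V')"
  by (auto intro!: M.real_distribution_distr M'.real_distribution_distr)
 show "char (distr M borel V) = char (distr M' borel V')"
 proof
  fix t :: real
  define B where "B n = 2*(\<bar>t\<bar> ^ Suc n/fact (Suc n))" for n
  have diff: "cmod (char (distr M borel V) t - char (distr M' borel V') t) \<le> B n" for n
  proof -
   have e: "(\<integral>w. exp_poly t n (V w) \<partial>M) = (\<integral>w. exp_poly t n (V' w) \<partial>M')"
    using exp_poly_approx[where W=V and t=t and n=n, OF M _ V] exp_poly_approx[where W=V' and t=t and n=n, OF M' _ V'] mom by simp
   have "char (distr M borel V) t - char (distr M' borel V') t =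
    ((\<integral>w. iexp (t*V w) \<partial>M) - (\<integral>w. exp_poly t n (V w) \<partial>M)) - ((\<integral>w. iexp (t*V' w) \<partial>M') - (\<integral>w. exp_poly t n (V' w) \<partial>M'))"
    unfolding char_def e by (simp add: integral_distr)
   also have "cmod \<dots> \<le> cmod ((\<integral>w. iexp (t*V w) \<partial>M) - (\<integral>w. exp_poly t n (V w) \<partial>M)) + cmod ((\<integral>w. iexp (t*V' w) \<partial>M') - (\<integral>w. exp_poly t n (V' w) \<partial>M'))"
    by (rule norm_triangle_ineq4)
   also have "\<dots> \<le> B n" unfolding B_def
    using conjunct1[OF exp_poly_approx[where W=V and t=t and n=n, OF M _ V]]
     conjunct1[OF exp_poly_approx[where W=V' and t=t and n=n, OF M' _ V']] by simp
   finally show ?thesis .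
  qed
  have "(\<lambda>n. \<bar>t\<bar> ^ n/fact n) \<longlonglongrightarrow> 0"
   using summable_LIMSEQ_zero[OF summable_exp[of "\<bar>t\<bar>"]] by (simp add: field_simps)
  then have "B \<longlonglongrightarrow> 2*0" unfolding B_def by (intro tendsto_mult tendsto_const LIMSEQ_Suc)
  then have "cmod (char (distr M borel V) t - char (distr M' borel V') t) \<le> 0"
   by (intro LIMSEQ_le_const[of B]) (use diff in auto)
  then show "char (distr M borel V) t = char (distr M' borel V') t" by simp
 qed
qed

text \<open>
The values of the Laplace transform at the integers are the moments of the bounded variable
\<open>exp (- Y)\<close>, which determine its law and hence that of \<open>Y\<close>.
\<close>
lemma distr_eq_of_laplace_eq:
 assumes M: "prob_space M" and M': "prob_space M'"
  and [measurable]: "Y \<in> borel_measurable M" "Y' \<in> borel_measurable M'"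
  and Y: "\<And>w. 0 \<le> Y w" and Y': "\<And>w. 0 \<le> (Y' w :: real)"
  and lap: "\<And>k::nat. (\<integral>w. exp (- real k*Y w) \<partial>M) = (\<integral>w. exp (- real k*Y' w) \<partial>M')"
 shows "distr M borel Y = distr M' borel Y'"
proof -
 have "distr M borel (\<lambda>w. exp (- Y w)) = distr M' borel (\<lambda>w. exp (- Y' w))"
  using lap by (intro char_eq_of_bounded_moments_eq[OF M M']) (auto simp: Y Y' exp_of_nat_mult[symmetric])
 then have "distr (distr M borel (\<lambda>w. exp (- Y w))) borel (\<lambda>v. - ln v) = distr (distr M' borel (\<lambda>w. exp (- Y' w))) borel (\<lambda>v. - ln v)"
  by simp
 then show ?thesis by (subst (asm) (1 2) distr_distr) (auto simp: o_def)
qed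

definition chi_density :: "real \<Rightarrow> real \<Rightarrow> real" where
 "chi_density v x = (if 0 < v \<and> 0 < x then x powr (v/2 - 1)*exp (- x/2)/(2 powr (v/2)*Gamma (v/2)) else 0)"

lemma chi_square_density: "chi_square v = density lborel (\<lambda>x. ennreal (chi_density v x))"
 by (simp add: chi_square_def chi_density_def)

lemma chi_density_measurable[measurable]: "chi_density v \<in> borel_measurable borel"
 unfolding chi_density_def by measurable

lemma chi_density_nonneg: "0 \<le> chi_density v x"
 by (auto simp: chi_density_def intro!: mult_nonneg_nonneg divide_nonneg_nonneg Gamma_real_nonneg)

lemma chi_density_pos: "0 < v \<Longrightarrow> 0 < x \<Longrightarrow> 0 < chi_density v x"
 by (auto simp: chi_density_def intro!: mult_pos_pos divide_pos_pos Gamma_real_pos)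

lemma sets_chi_square[measurable_cong, simp]: "sets (chi_square v) = sets borel"
 by (simp add: chi_square_def)

lemma space_chi_square[simp]: "space (chi_square v) = UNIV"
 by (simp add: chi_square_def)

lemma nn_integral_gamma_scaled:
 assumes "0 < a" "0 < c"
 shows "(\<integral>\<^sup>+x. ennreal (indicator {0<..} x*(x powr (a - 1)*exp (- (c*x)))) \<partial>lborel) = ennreal (Gamma a/c powr a)"
proof -
 have "ennreal (Gamma a) = (\<integral>\<^sup>+t. ennreal (indicator {0..} t*t powr (a - 1)/exp t) \<partial>lborel)"
  using Gamma_conv_nn_integral_real[OF assms(1)] by simp
 also have "\<dots> = ennreal \<bar>c\<bar>*(\<integral>\<^sup>+x. ennreal (indicator {0..} (0 + c*x)*(0 + c*x) powr (a - 1)/exp (0 + c*x)) \<partial>lborel)"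
  using assms by (intro nn_integral_real_affine) auto
 also have "(\<integral>\<^sup>+x. ennreal (indicator {0..} (0 + c*x)*(0 + c*x) powr (a - 1)/exp (0 + c*x)) \<partial>lborel) =
  (\<integral>\<^sup>+x. ennreal (c powr (a - 1))*ennreal (indicator {0<..} x*(x powr (a - 1)*exp (- (c*x)))) \<partial>lborel)"
  by (intro nn_integral_cong) (use assms in \<open>auto simp: indicator_def powr_mult exp_minus field_simps zero_le_mult_iff ennreal_mult'[symmetric] split: if_splits\<close>)
 also have "\<dots> = ennreal (c powr (a - 1))*(\<integral>\<^sup>+x. ennreal (indicator {0<..} x*(x powr (a - 1)*exp (- (c*x)))) \<partial>lborel)"
  by (intro nn_integral_cmult) auto
 finally have "ennreal (Gamma a) = ennreal (c powr a)*(\<integral>\<^sup>+x. ennreal (indicator {0<..} x*(x powr (a - 1)*exp (- (c*x)))) \<partial>lborel)"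
  using assms by (simp add: mult.assoc[symmetric] ennreal_mult'[symmetric] powr_mult_base)
 then have "ennreal (1/c powr a)*ennreal (Gamma a) = ennreal (1/c powr a)*ennreal (c powr a)*(\<integral>\<^sup>+x. ennreal (indicator {0<..} x*(x powr (a - 1)*exp (- (c*x)))) \<partial>lborel)"
  by (simp add: mult.assoc)
 then show ?thesis using assms by (simp add: ennreal_mult'[symmetric])
qed

lemma nn_integral_chi_square_weighted:
 assumes v: "0 < v" and b: "0 \<le> b" and s: "s < 1/2"
 shows "(\<integral>\<^sup>+x. ennreal (chi_density v x*(x powr b*exp (s*x))) \<partial>lborel) =
  ennreal (Gamma (v/2 + b)/((1/2 - s) powr (v/2 + b)*(2 powr (v/2)*Gamma (v/2))))"
proof -
 have G: "Gamma (v/2) > 0" using v by (intro Gamma_real_pos) auto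
 let ?K = "1/(2 powr (v/2)*Gamma (v/2))"
 have "(\<integral>\<^sup>+x. ennreal (chi_density v x*(x powr b*exp (s*x))) \<partial>lborel) =
  (\<integral>\<^sup>+x. ennreal ?K*ennreal (indicator {0<..} x*(x powr (v/2 + b - 1)*exp (- ((1/2 - s)*x)))) \<partial>lborel)"
 proof (intro nn_integral_cong)
  fix x :: real
  show "ennreal (chi_density v x*(x powr b*exp (s*x))) = ennreal ?K*ennreal (indicator {0<..} x*(x powr (v/2 + b - 1)*exp (- ((1/2 - s)*x))))"
  proof (cases "x > 0")
   case True
   have "x powr (v/2 - 1)*exp (- x/2)*(x powr b*exp (s*x)) = (x powr (v/2 - 1)*x powr b)*(exp (- x/2)*exp (s*x))"
    by (simp add: mult_ac)
   also have "\<dots> = x powr (v/2 + b - 1)*exp (- ((1/2 - s)*x))"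
    unfolding powr_add[symmetric] exp_add[symmetric] by (simp add: algebra_simps)
   finally show ?thesis using True v G
    by (simp add: chi_density_def ennreal_mult'[symmetric])
  qed (simp add: chi_density_def)
 qed
 also have "\<dots> = ennreal ?K*ennreal (Gamma (v/2 + b)/(1/2 - s) powr (v/2 + b))"
  using v b s by (subst nn_integral_cmult) (auto simp: nn_integral_gamma_scaled)
 also have "\<dots> = ennreal (Gamma (v/2 + b)/((1/2 - s) powr (v/2 + b)*(2 powr (v/2)*Gamma (v/2))))"
  using G by (subst ennreal_mult'[symmetric]) (auto simp: field_simps)
 finally show ?thesis .
qed

lemma integral_chi_square_weighted:
 assumes v: "0 < v" and b: "0 \<le> b" and s: "s < 1/2"
 shows "integrable (chi_square v) (\<lambda>x. x powr b*exp (s*x))" (is ?I)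
  and "(\<integral>x. x powr b*exp (s*x) \<partial>chi_square v) = Gamma (v/2 + b)/((1/2 - s) powr (v/2 + b)*(2 powr (v/2)*Gamma (v/2)))" (is ?E)
proof -
 have nn: "0 \<le> Gamma (v/2 + b)/((1/2 - s) powr (v/2 + b)*(2 powr (v/2)*Gamma (v/2)))"
  using v b by (intro divide_nonneg_nonneg mult_nonneg_nonneg Gamma_real_nonneg) auto
 have "has_bochner_integral lborel (\<lambda>x. chi_density v x*(x powr b*exp (s*x))) (Gamma (v/2 + b)/((1/2 - s) powr (v/2 + b)*(2 powr (v/2)*Gamma (v/2))))"
  using nn_integral_chi_square_weighted[OF assms] nn
  by (intro has_bochner_integral_nn_integral) (auto simp: chi_density_nonneg)
 then show ?I ?E
  unfolding chi_square_density using chi_density_nonneg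
  by (auto simp: integrable_density integral_density has_bochner_integral_iff)
qed

lemma prob_space_chi_square: assumes v: "0 < v" shows "prob_space (chi_square v)"
proof
 have "emeasure (chi_square v) (space (chi_square v)) = (\<integral>\<^sup>+x. ennreal (chi_density v x*(x powr 0*exp (0*x))) \<partial>lborel)"
  unfolding chi_square_density
  by (subst emeasure_density) (auto intro!: nn_integral_cong simp: chi_density_def)
 also have "\<dots> = 1" using v less_imp_neq[OF Gamma_real_pos[of "v/2"]]
  by (subst nn_integral_chi_square_weighted) (simp_all add: powr_divide)
 finally show "emeasure (chi_square v) (space (chi_square v)) = 1" .
qed

lemma AE_chi_square_pos: "AE x in chi_square v. 0 < x"
 unfolding chi_square_density by (subst AE_density) (auto simp: chi_density_def)

text \<open>
The Gamma integral turns the moments into rising factorials; this is what makes the binomial series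
of \<open>char_chi_square_small\<close> appear.
\<close>
lemma chi_square_moment:
 assumes v: "0 < v"
 shows "integrable (chi_square v) (\<lambda>x. x ^ n)" (is ?I)
  and "(\<integral>x. x ^ n \<partial>chi_square v) = 2 ^ n*pochhammer (v/2) n" (is ?E)
proof -
 have ae: "AE x in chi_square v. x powr real n*exp (0*x) = x ^ n"
  using AE_chi_square_pos by eventually_elim (simp add: powr_realpow)
 have "integrable (chi_square v) (\<lambda>x. x powr real n*exp (0*x))"
  by (rule integral_chi_square_weighted[OF v]) auto
 then show ?I by (rule integrable_cong_AE_imp) (use ae in auto)
 have "(\<integral>x. x ^ n \<partial>chi_square v) = (\<integral>x. x powr real n*exp (0*x) \<partial>chi_square v)"
  using ae by (intro integral_cong_AE) auto
 also have "\<dots> = Gamma (v/2 + real n)/((1/2) powr (v/2 + real n)*(2 powr (v/2)*Gamma (v/2)))"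
  using integral_chi_square_weighted(2)[OF v, of "real n" 0] by simp
 also have "\<dots> = 2 ^ n*(Gamma (v/2 + real n)/Gamma (v/2))"
 proof -
  have "(1/2) powr (v/2 + real n)*2 powr (v/2) = 1/2 ^ n"
   by (simp add: powr_divide powr_add powr_realpow)
  then have "(1/2) powr (v/2 + real n)*(2 powr (v/2)*Gamma (v/2)) = 1/2 ^ n*Gamma (v/2)"
   by (metis mult.assoc)
  then show ?thesis by simp
 qed
 also have "Gamma (v/2 + real n)/Gamma (v/2) = pochhammer (v/2) n"
  using v by (intro pochhammer_Gamma[symmetric]) (auto elim!: nonpos_Ints_cases)
 finally show ?E .
qed

lemma chi_square_laplace:
 assumes v: "0 < v" and s: "0 \<le> s"
 shows "(\<integral>x. exp (- s*x) \<partial>chi_square v) = (1 + 2 * s) powr (- v/2)"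
proof -
 have "(\<integral>x. exp (- s*x) \<partial>chi_square v) = (\<integral>x. x powr 0*exp (- s*x) \<partial>chi_square v)"
 proof (intro integral_cong_AE)
  show "AE x in chi_square v. exp (- s*x) = x powr 0*exp (- s*x)"
   using AE_chi_square_pos[of v] by eventually_elim simp
 qed auto
 also have "\<dots> = 1/((1/2 + s) powr (v/2)*2 powr (v/2))"
  using integral_chi_square_weighted(2)[OF v, of 0 "- s"] s v less_imp_neq[OF Gamma_real_pos[of "v/2"]] by (simp add: zero_less_divide_iff)
 also have "\<dots> = (1 + 2 * s) powr (- v/2)"
 proof -
  have "(1/2 + s) powr (v/2)*2 powr (v/2) = (1 + 2 * s) powr (v/2)"
   using s by (subst powr_mult[symmetric]) (auto simp: algebra_simps)
  then show ?thesis by (simp add: powr_minus field_simps)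
 qed
 finally show ?thesis .
qed

lemma chi_square_mean_var:
 assumes v: "0 < v"
 shows "integrable (chi_square v) (\<lambda>x. x)" "(\<integral>x. x \<partial>chi_square v) = v"
  "integrable (chi_square v) (\<lambda>x. (x - v)\<^sup>2)" "(\<integral>x. (x - v)\<^sup>2 \<partial>chi_square v) = 2 * v"
proof -
 interpret prob_space "chi_square v" by (rule prob_space_chi_square[OF v])
 note m1 = chi_square_moment[OF v, of 1] and m2 = chi_square_moment[OF v, of 2]
 show i1: "integrable (chi_square v) (\<lambda>x. x)" and e1: "(\<integral>x. x \<partial>chi_square v) = v" using m1 by auto
 have eq: "(x - v)\<^sup>2 = x\<^sup>2 - 2 * v * x + v\<^sup>2" for x by (simp add: power2_eq_square algebra_simps)
 have i2: "integrable (chi_square v) (\<lambda>x. x\<^sup>2 - 2 * v * x)" using m2 i1 by (intro Bochner_Integration.integrable_diff integrable_mult_right) auto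
 show "integrable (chi_square v) (\<lambda>x. (x - v)\<^sup>2)" unfolding eq using i2 by auto
 have "(\<integral>x. (x - v)\<^sup>2 \<partial>chi_square v) = (\<integral>x. x\<^sup>2 \<partial>chi_square v) - 2 * v * v + v\<^sup>2"
  unfolding eq using i2 m2 i1 e1 prob_space by simp
 also have "\<dots> = 2 * v" using m2(2) by (simp add: pochhammer_Suc numeral_2_eq_2 power2_eq_square field_simps)
 finally show "(\<integral>x. (x - v)\<^sup>2 \<partial>chi_square v) = 2 * v" .
qed

lemma chi_square_abs_dev:
 assumes v: "0 < v"
 shows "(\<integral>x. \<bar>x - v\<bar> \<partial>chi_square v) \<le> 2 * v"
proof -
 interpret prob_space "chi_square v" by (rule prob_space_chi_square[OF v])
 note m = chi_square_mean_var[OF v]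
 have "(\<integral>x. \<bar>x - v\<bar> \<partial>chi_square v) \<le> (\<integral>x. x + v \<partial>chi_square v)"
 proof (intro integral_mono_AE)
  show "AE x in chi_square v. \<bar>x - v\<bar> \<le> x + v" using AE_chi_square_pos[of v] by eventually_elim (use v in simp)
 qed (use m in auto)
 also have "\<dots> = 2 * v" using m prob_space by simp
 finally show ?thesis .
qed

text \<open>Both Laplace transforms equal \<open>(1 + 2 * s) powr (- 1/2)\<close>.\<close>
lemma distr_normal_square:
 "distr std_normal_distribution borel (\<lambda>x. x\<^sup>2) = chi_square 1"
proof -
 interpret N: prob_space std_normal_distribution by (rule prob_space_normal_density) simp
 interpret X: prob_space "chi_square 1" by (rule prob_space_chi_square) simp
 \<comment> \<open>The comparison of Laplace transforms needs variables that are nonnegative everywhere, hence \<open>max 0\<close>.\<close>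
 have "distr std_normal_distribution borel (\<lambda>x. x\<^sup>2) = distr (chi_square 1) borel (\<lambda>x. max 0 x)"
 proof (rule distr_eq_of_laplace_eq[OF N.prob_space_axioms X.prob_space_axioms])
  fix k :: nat
  define s where "s = sqrt (1/(1 + 2*real k))"
  have s: "s > 0" "s\<^sup>2 = 1/(1 + 2*real k)" by (auto simp: s_def)
  have "(\<integral>x. exp (- real k*x\<^sup>2) \<partial>std_normal_distribution) = (\<integral>x. std_normal_density x*exp (- real k*x\<^sup>2) \<partial>lborel)"
   by (subst integral_density) auto
  also have "\<dots> = (\<integral>x. s*normal_density 0 s x \<partial>lborel)"
  proof (intro Bochner_Integration.integral_cong refl)
   fix x :: real
   have "std_normal_density x*exp (- real k*x\<^sup>2) = exp (- (x\<^sup>2)/2 + - real k*x\<^sup>2)/sqrt (2*pi)"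
    unfolding normal_density_def by (subst exp_add) simp
   also have "- (x\<^sup>2)/2 + - real k*x\<^sup>2 = - (x\<^sup>2)/(2 * s\<^sup>2)"
    unfolding s(2) by (simp add: field_simps)
   also have "exp (- (x\<^sup>2)/(2 * s\<^sup>2))/sqrt (2*pi) = s*normal_density 0 s x"
    using s(1) by (simp add: normal_density_def real_sqrt_mult)
   finally show "std_normal_density x*exp (- real k*x\<^sup>2) = s*normal_density 0 s x" .
  qed
  also have "\<dots> = s" using s(1) integral_normal_density[of s 0] by simp
  also have "\<dots> = (1 + 2*real k) powr (- 1/2)"
   by (simp add: s_def powr_minus powr_half_sqrt real_sqrt_divide inverse_eq_divide)
  also have "\<dots> = (\<integral>x. exp (- real k*x) \<partial>chi_square 1)" by (subst chi_square_laplace) auto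
  also have "\<dots> = (\<integral>x. exp (- real k*max 0 x) \<partial>chi_square 1)"
  proof (intro integral_cong_AE)
   show "AE x in chi_square 1. exp (- real k*x) = exp (- real k*max 0 x)"
    using AE_chi_square_pos[of 1] by eventually_elim simp
  qed auto
  finally show "(\<integral>x. exp (- real k*x\<^sup>2) \<partial>std_normal_distribution) = (\<integral>x. exp (- real k*max 0 x) \<partial>chi_square 1)" .
 qed auto
 also have "\<dots> = distr (chi_square 1) borel (\<lambda>x. x)"
 proof (intro distr_cong_AE refl)
  show "AE x in chi_square 1. max 0 x = x" using AE_chi_square_pos[of 1] by eventually_elim simp
 qed auto
 also have "\<dots> = chi_square 1" by (metis distr_id2 sets_chi_square)
 finally show ?thesis .
qed

section \<open>Fourth moments\<close>

lemma (in prob_space) integrable_power_of_fourth: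
 fixes X :: "'a \<Rightarrow> real"
 assumes [measurable]: "X \<in> borel_measurable M" and int: "integrable M (\<lambda>w. X w ^ 4)" and n: "n \<le> 4"
 shows "integrable M (\<lambda>w. X w ^ n)"
proof (rule Bochner_Integration.integrable_bound[of _ "\<lambda>w. 1 + X w ^ 4"])
 show "integrable M (\<lambda>w. 1 + X w ^ 4)" using int by auto
 show "AE w in M. norm (X w ^ n) \<le> norm (1 + X w ^ 4)"
 proof (intro AE_I2)
  fix w
  have "\<bar>X w\<bar> ^ n \<le> 1 + \<bar>X w\<bar> ^ 4"
  proof (cases "\<bar>X w\<bar> \<le> 1")
   case True
   then have "\<bar>X w\<bar> ^ n \<le> 1" by (intro power_le_one) auto
   then show ?thesis by (smt (verit) zero_le_power abs_ge_zero)
  next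
   case False
   then have "\<bar>X w\<bar> ^ n \<le> \<bar>X w\<bar> ^ 4" using n by (intro power_increasing) auto
   then show ?thesis by simp
  qed
  then show "norm (X w ^ n) \<le> norm (1 + X w ^ 4)" by (simp add: power_abs power_even_abs)
 qed
qed auto

lemma (in prob_space) integrable_mult_of_squares:
 fixes X Y :: "'a \<Rightarrow> real"
 assumes [measurable]: "X \<in> borel_measurable M" "Y \<in> borel_measurable M"
  and int: "integrable M (\<lambda>w. X w ^ 2)" "integrable M (\<lambda>w. Y w ^ 2)"
 shows "integrable M (\<lambda>w. X w*Y w)"
proof (rule Bochner_Integration.integrable_bound[of _ "\<lambda>w. X w ^ 2 + Y w ^ 2"])
 show "AE w in M. norm (X w*Y w) \<le> norm (X w ^ 2 + Y w ^ 2)"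
 proof (intro AE_I2)
  fix w
  have "2*(\<bar>X w\<bar>*\<bar>Y w\<bar>) \<le> X w ^ 2 + Y w ^ 2"
   using zero_le_power2[of "\<bar>X w\<bar> - \<bar>Y w\<bar>"] by (simp add: power2_diff mult_ac)
  moreover have "0 \<le> \<bar>X w\<bar>*\<bar>Y w\<bar>" by simp
  ultimately have "\<bar>X w\<bar>*\<bar>Y w\<bar> \<le> X w ^ 2 + Y w ^ 2" by linarith
  then show "norm (X w*Y w) \<le> norm (X w ^ 2 + Y w ^ 2)" by (simp add: abs_mult)
 qed
qed (use int in auto)

lemma (in prob_space) integrable_square_mult_of_fourth:
 fixes X Y :: "'a \<Rightarrow> real"
 assumes [measurable]: "X \<in> borel_measurable M" "Y \<in> borel_measurable M"
  and int: "integrable M (\<lambda>w. X w ^ 4)" "integrable M (\<lambda>w. Y w ^ 4)"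
 shows "integrable M (\<lambda>w. (X w)\<^sup>2*(Y w)\<^sup>2)" "integrable M (\<lambda>w. X w*Y w)"
proof -
 have [simp]: "((x :: real)\<^sup>2)\<^sup>2 = x ^ 4" for x by simp
 show "integrable M (\<lambda>w. (X w)\<^sup>2*(Y w)\<^sup>2)"
  by (rule integrable_mult_of_squares) (use int in auto)
 show "integrable M (\<lambda>w. X w*Y w)"
  using int by (intro integrable_mult_of_squares integrable_power_of_fourth[of X 2] integrable_power_of_fourth[of Y 2]) auto
qed

lemma fourth_power_add_le: "((x::real) + y) ^ 4 \<le> 8*x ^ 4 + 8*y ^ 4"
proof -
 have "(x + y)\<^sup>2 \<le> 2*x\<^sup>2 + 2*y\<^sup>2" using zero_le_power2[of "x - y"] by (simp add: power2_diff power2_sum)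
 then have "((x + y)\<^sup>2)\<^sup>2 \<le> (2*x\<^sup>2 + 2*y\<^sup>2)\<^sup>2" by (intro power_mono) auto
 also have "\<dots> \<le> 8*(x\<^sup>2)\<^sup>2 + 8*(y\<^sup>2)\<^sup>2" using zero_le_power2[of "x\<^sup>2 - y\<^sup>2"] by (simp add: power2_diff power2_sum algebra_simps)
 finally show ?thesis by simp
qed

lemma (in prob_space) integrable_fourth_add:
 fixes X Y :: "'a \<Rightarrow> real"
 assumes [measurable]: "X \<in> borel_measurable M" "Y \<in> borel_measurable M"
  and int: "integrable M (\<lambda>w. X w ^ 4)" "integrable M (\<lambda>w. Y w ^ 4)"
 shows "integrable M (\<lambda>w. (X w + Y w) ^ 4)"
 by (rule Bochner_Integration.integrable_bound[of _ "\<lambda>w. 8*X w ^ 4 + 8*Y w ^ 4"])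
  (use int fourth_power_add_le in auto)

lemma (in prob_space) integrable_fourth_sum:
 fixes X :: "'i \<Rightarrow> 'a \<Rightarrow> real"
 assumes "\<And>i. i \<in> I \<Longrightarrow> X i \<in> borel_measurable M" "\<And>i. i \<in> I \<Longrightarrow> integrable M (\<lambda>w. X i w ^ 4)"
 shows "integrable M (\<lambda>w. (\<Sum>i\<in>I. X i w) ^ 4)"
 using assms
proof (induction I rule: infinite_finite_induct)
 case (insert i I)
 then show ?case by (simp, intro integrable_fourth_add borel_measurable_sum) auto
qed auto

text \<open>
Cauchy-Schwarz, in the form in which the second moments are known only through upper bounds.
\<close>
lemma (in prob_space) expectation_mult_le_of_squares:
 fixes U V :: "'a \<Rightarrow> real"
 assumes [measurable]: "U \<in> borel_measurable M" "V \<in> borel_measurable M"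
  and int: "integrable M (\<lambda>w. U w ^ 2)" "integrable M (\<lambda>w. V w ^ 2)"
  and A: "0 \<le> A" "expectation (\<lambda>w. U w ^ 2) \<le> A\<^sup>2" and B: "0 \<le> B" "expectation (\<lambda>w. V w ^ 2) \<le> B\<^sup>2"
 shows "expectation (\<lambda>w. U w*V w) \<le> A*B"
proof -
 have iUV: "integrable M (\<lambda>w. U w*V w)" using int by (intro integrable_mult_of_squares) auto
 have bound: "expectation (\<lambda>w. U w*V w) \<le> (A + e)*(B + e)" if e: "e > 0" for e
 proof -
  define c where "c = (B + e)/(A + e)"
  have c: "c > 0" using A(1) B(1) e by (simp add: c_def)
  have "expectation (\<lambda>w. U w*V w) \<le> expectation (\<lambda>w. c/2*U w ^ 2 + 1/(2*c)*V w ^ 2)"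
  proof (intro integral_mono iUV)
   fix w
   have "0 \<le> (c*U w - V w)\<^sup>2/(2*c)" using c by auto
   then show "U w*V w \<le> c/2*U w ^ 2 + 1/(2*c)*V w ^ 2"
    using c by (simp add: power2_eq_square field_simps)
  qed (use int in auto)
  also have "\<dots> = c/2*expectation (\<lambda>w. U w ^ 2) + 1/(2*c)*expectation (\<lambda>w. V w ^ 2)"
   using int by simp
  also have "\<dots> \<le> c/2*(A + e)\<^sup>2 + 1/(2*c)*(B + e)\<^sup>2"
  proof (intro add_mono mult_left_mono)
   show "expectation (\<lambda>w. U w ^ 2) \<le> (A + e)\<^sup>2" using A e power_mono[of A "A + e" 2] by linarith
   show "expectation (\<lambda>w. V w ^ 2) \<le> (B + e)\<^sup>2" using B e power_mono[of B "B + e" 2] by linarith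
  qed (use c in auto)
  also have "\<dots> = (A + e)*(B + e)"
  proof -
   have "A + e \<noteq> 0" "B + e \<noteq> 0" using A B e by auto
   moreover have "(y/x)/2*x\<^sup>2 + 1/(2*(y/x))*y\<^sup>2 = x*y" if "x \<noteq> 0" "y \<noteq> 0" for x y :: real
    using that by (simp add: field_simps power2_eq_square)
   ultimately show ?thesis unfolding c_def by blast
  qed
  finally show ?thesis .
 qed
 have "((\<lambda>e. (A + e)*(B + e)) \<longlongrightarrow> (A + 0)*(B + 0)) (at_right 0)" by (intro tendsto_intros)
 then have "expectation (\<lambda>w. U w*V w) \<le> (A + 0)*(B + 0)"
  by (rule tendsto_lowerbound) (auto simp: eventually_at_filter intro!: always_eventually bound)
 then show ?thesis by simp
qed

text \<open>
The excess \<open>E S^4 - 3 * (E S^2)^2\<close> of the fourth moment over its Gaussian value is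
additive over independent centred summands.
\<close>
lemma (in prob_space) indep_sum_fourth_moment:
 fixes X :: "'i \<Rightarrow> 'a \<Rightarrow> real"
 assumes "finite I" "indep_vars (\<lambda>_. borel) X I"
  "\<And>i. i \<in> I \<Longrightarrow> integrable M (\<lambda>w. X i w ^ 4)" "\<And>i. i \<in> I \<Longrightarrow> expectation (X i) = 0"
 shows "integrable M (\<lambda>w. (\<Sum>i\<in>I. X i w) ^ 4) \<and> expectation (\<lambda>w. \<Sum>i\<in>I. X i w) = 0 \<and>
  expectation (\<lambda>w. (\<Sum>i\<in>I. X i w) ^ 2) = (\<Sum>i\<in>I. expectation (\<lambda>w. X i w ^ 2)) \<and>
  expectation (\<lambda>w. (\<Sum>i\<in>I. X i w) ^ 4) - 3*(expectation (\<lambda>w. (\<Sum>i\<in>I. X i w) ^ 2))\<^sup>2 =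
   (\<Sum>i\<in>I. expectation (\<lambda>w. X i w ^ 4) - 3*(expectation (\<lambda>w. X i w ^ 2))\<^sup>2)"
 using assms
proof (induction I)
 case empty
 then show ?case by simp
next
 case (insert i I)
 define S where "S w = (\<Sum>i\<in>I. X i w)" for w
 have rv: "X j \<in> borel_measurable M" if "j \<in> insert i I" for j
  using insert.prems(1) that unfolding indep_vars_def by auto
 have [measurable]: "X i \<in> borel_measurable M" using rv by simp
 have [measurable]: "S \<in> borel_measurable M" unfolding S_def by (intro borel_measurable_sum) (use rv in auto)
 have IH: "integrable M (\<lambda>w. S w ^ 4)" "expectation S = 0"
  "expectation (\<lambda>w. S w ^ 2) = (\<Sum>i\<in>I. expectation (\<lambda>w. X i w ^ 2))"
  "expectation (\<lambda>w. S w ^ 4) - 3*(expectation (\<lambda>w. S w ^ 2))\<^sup>2 =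
   (\<Sum>i\<in>I. expectation (\<lambda>w. X i w ^ 4) - 3*(expectation (\<lambda>w. X i w ^ 2))\<^sup>2)"
  using insert.IH[OF indep_vars_subset[OF insert.prems(1)]] insert.prems unfolding S_def by auto
 have ind: "indep_var borel (X i) borel S"
  unfolding S_def by (rule indep_vars_sum) (use insert in auto)
 have Xi: "integrable M (\<lambda>w. X i w ^ 4)" "expectation (X i) = 0" using insert.prems by auto
 have pX: "integrable M (\<lambda>w. X i w ^ n)" if "n \<le> 4" for n using Xi that by (intro integrable_power_of_fourth[of "X i" n]) auto
 have pS: "integrable M (\<lambda>w. S w ^ n)" if "n \<le> 4" for n using IH that by (intro integrable_power_of_fourth[of S n]) auto
 have prod: "integrable M (\<lambda>w. X i w ^ n*S w ^ k)"
  "expectation (\<lambda>w. X i w ^ n*S w ^ k) = expectation (\<lambda>w. X i w ^ n)*expectation (\<lambda>w. S w ^ k)" if "n \<le> 4" "k \<le> 4" for n k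
 proof -
  have iv: "indep_var borel (\<lambda>w. X i w ^ n) borel (\<lambda>w. S w ^ k)"
   using indep_var_compose[OF ind, of "\<lambda>x. x ^ n" borel "\<lambda>x. x ^ k" borel] by (simp add: o_def)
  show "integrable M (\<lambda>w. X i w ^ n*S w ^ k)"
   "expectation (\<lambda>w. X i w ^ n*S w ^ k) = expectation (\<lambda>w. X i w ^ n)*expectation (\<lambda>w. S w ^ k)"
   using indep_var_integrable[OF iv pX[OF that(1)] pS[OF that(2)]]
    indep_var_lebesgue_integral[OF iv pX[OF that(1)] pS[OF that(2)]] by auto
 qed
 have sum: "(\<Sum>i\<in>insert i I. X i w) = X i w + S w" for w unfolding S_def using insert.hyps by simp
 have e2: "(X i w + S w) ^ 2 = X i w ^ 2 + 2*(X i w ^ 1*S w ^ 1) + S w ^ 2" for w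
  by (simp add: power2_sum)
 have e4: "(X i w + S w) ^ 4 = X i w ^ 4 + 4*(X i w ^ 3*S w ^ 1) + 6*(X i w ^ 2*S w ^ 2) + 4*(X i w ^ 1*S w ^ 3) + S w ^ 4" for w
  by (simp add: algebra_simps power2_eq_square power3_eq_cube power4_eq_xxxx)
 have i1: "integrable M (X i)" "integrable M S" using pX[of 1] pS[of 1] by auto
 have 1: "integrable M (\<lambda>w. (X i w + S w) ^ 4)"
  unfolding e4 by (intro Bochner_Integration.integrable_add integrable_mult_right prod(1) pX pS) simp_all
 have 2: "expectation (\<lambda>w. X i w + S w) = 0" using i1 IH Xi by simp
 have 3: "expectation (\<lambda>w. (X i w + S w) ^ 2) = expectation (\<lambda>w. X i w ^ 2) + expectation (\<lambda>w. S w ^ 2)"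
  unfolding e2 using prod[of 1 1] pX[of 2] pS[of 2] Xi(2) by simp
 have 4: "expectation (\<lambda>w. (X i w + S w) ^ 4) = expectation (\<lambda>w. X i w ^ 4) + 6*(expectation (\<lambda>w. X i w ^ 2)*expectation (\<lambda>w. S w ^ 2)) + expectation (\<lambda>w. S w ^ 4)"
  unfolding e4 using prod[of 3 1] prod[of 2 2] prod[of 1 3] pX[of 4] pS[of 4] Xi(2) IH(2) by simp
 have "expectation (\<lambda>w. (X i w + S w) ^ 4) - 3*(expectation (\<lambda>w. (X i w + S w) ^ 2))\<^sup>2 =
  (expectation (\<lambda>w. X i w ^ 4) - 3*(expectation (\<lambda>w. X i w ^ 2))\<^sup>2) + (expectation (\<lambda>w. S w ^ 4) - 3*(expectation (\<lambda>w. S w ^ 2))\<^sup>2)"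
  unfolding 3 4 by (simp add: power2_sum algebra_simps)
 then show ?case unfolding sum using 1 2 3 IH insert.hyps by simp
qed

section \<open>Linear forms in independent isotropic vectors\<close>
lemma indep_vars_PiM_coordinates:
 assumes D: "\<And>i. i \<in> I \<Longrightarrow> prob_space (D i)" and I: "I \<noteq> {}"
 shows "prob_space.indep_vars (PiM I D) D (\<lambda>i \<omega>. \<omega> i) I"
proof -
 interpret P: prob_space "PiM I D" by (rule prob_space_PiM) (rule D)
 have "distr (PiM I D) (PiM I D) (\<lambda>\<omega>. \<lambda>i\<in>I. \<omega> i) = distr (PiM I D) (PiM I D) (\<lambda>\<omega>. \<omega>)"
  by (intro distr_cong refl) (auto simp: space_PiM PiE_def extensional_def fun_eq_iff)
 also have "\<dots> = PiM I D" by (rule distr_id)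
 also have "\<dots> = PiM I (\<lambda>i. distr (PiM I D) (D i) (\<lambda>\<omega>. \<omega> i))"
  by (intro PiM_cong refl) (simp add: distr_PiM_component D)
 finally show ?thesis using I by (subst P.indep_vars_iff_distr_eq_PiM') auto
qed

text \<open>
The moment information about a vector of factors that the proof uses: linear forms have Gaussian
first, second and fourth moments, except for an excess \<open>\<Delta>\<close> in each coordinate.
The standard Gaussian law is the case \<open>\<Delta> = 0\<close>, so both sides of the Lindeberg
replacement are covered.
\<close>
definition isotropic :: "nat \<Rightarrow> real \<Rightarrow> (nat \<Rightarrow> real) measure \<Rightarrow> bool" where
 "isotropic m \<Delta> \<mu> \<longleftrightarrow> prob_space \<mu> \<and> sets \<mu> = sets (PiM {..<m} (\<lambda>_. borel)) \<and>
  (\<forall>a<m. integrable \<mu> (\<lambda>z. z a ^ 4) \<and> (\<integral>z. z a \<partial>\<mu>) = 0) \<and>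
  (\<forall>a<m. \<forall>b<m. (\<integral>z. z a*z b \<partial>\<mu>) = (if a = b then 1 else 0)) \<and>
  (\<forall>\<beta>. (\<integral>z. (\<Sum>a<m. \<beta> a*z a) ^ 4 \<partial>\<mu>) = 3*(\<Sum>a<m. (\<beta> a)\<^sup>2)\<^sup>2 + \<Delta>*(\<Sum>a<m. \<beta> a ^ 4))"

lemma isotropicD:
 assumes "isotropic m \<Delta> \<mu>"
 shows "prob_space \<mu>" "sets \<mu> = sets (PiM {..<m} (\<lambda>_. borel))"
  "a < m \<Longrightarrow> (\<lambda>z. z a) \<in> borel_measurable \<mu>"
  "(\<lambda>z. \<Sum>a<m. \<beta> a*z a) \<in> borel_measurable \<mu>"
  "integrable \<mu> (\<lambda>z. (\<Sum>a<m. \<beta> a*z a) ^ 4)"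
  "(\<integral>z. (\<Sum>a<m. \<beta> a*z a) \<partial>\<mu>) = 0"
  "(\<integral>z. (\<Sum>a<m. \<beta> a*z a)\<^sup>2 \<partial>\<mu>) = (\<Sum>a<m. (\<beta> a)\<^sup>2)"
  "(\<integral>z. (\<Sum>a<m. \<beta> a*z a) ^ 4 \<partial>\<mu>) = 3*(\<Sum>a<m. (\<beta> a)\<^sup>2)\<^sup>2 + \<Delta>*(\<Sum>a<m. \<beta> a ^ 4)"
proof -
 show p: "prob_space \<mu>" and s: "sets \<mu> = sets (PiM {..<m} (\<lambda>_. borel))"
  and "(\<integral>z. (\<Sum>a<m. \<beta> a*z a) ^ 4 \<partial>\<mu>) = 3*(\<Sum>a<m. (\<beta> a)\<^sup>2)\<^sup>2 + \<Delta>*(\<Sum>a<m. \<beta> a ^ 4)"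
  using assms unfolding isotropic_def by auto
 interpret prob_space \<mu> by fact
 show c: "(\<lambda>z. z a) \<in> borel_measurable \<mu>" if "a < m" for a
  by (subst measurable_cong_sets[OF s refl]) (use that in auto)
 then show "(\<lambda>z. \<Sum>a<m. \<beta> a*z a) \<in> borel_measurable \<mu>" by (intro borel_measurable_sum) auto
 have i4: "integrable \<mu> (\<lambda>z. z a ^ 4)" if "a < m" for a using assms that unfolding isotropic_def by auto
 show "integrable \<mu> (\<lambda>z. (\<Sum>a<m. \<beta> a*z a) ^ 4)"
  by (intro integrable_fourth_sum) (use c i4 in \<open>auto simp: power_mult_distrib\<close>)
 have i1: "integrable \<mu> (\<lambda>z. z a)" if "a < m" for a using integrable_power_of_fourth[OF c i4, of a 1] that by simp
 have i2: "integrable \<mu> (\<lambda>z. z a*z b)" if "a < m" "b < m" for a b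
  using integrable_square_mult_of_fourth(2)[OF c c i4 i4, of a b] that by simp
 show "(\<integral>z. (\<Sum>a<m. \<beta> a*z a) \<partial>\<mu>) = 0"
  using i1 assms by (subst Bochner_Integration.integral_sum) (auto simp: isotropic_def)
 have "(\<integral>z. (\<Sum>a<m. \<beta> a*z a)\<^sup>2 \<partial>\<mu>) = (\<integral>z. (\<Sum>a<m. \<Sum>b<m. \<beta> a*\<beta> b*(z a*z b)) \<partial>\<mu>)"
  by (simp add: power2_eq_square sum_product mult_ac)
 also have "\<dots> = (\<Sum>a<m. \<Sum>b<m. \<beta> a*\<beta> b*(\<integral>z. z a*z b \<partial>\<mu>))"
  using i2 by (subst Bochner_Integration.integral_sum Bochner_Integration.integral_mult_right, auto)+
 also have "\<dots> = (\<Sum>a<m. \<Sum>b<m. if a = b then (\<beta> a)\<^sup>2 else 0)"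
  using assms by (intro sum.cong refl) (auto simp: isotropic_def power2_eq_square)
 finally show "(\<integral>z. (\<Sum>a<m. \<beta> a*z a)\<^sup>2 \<partial>\<mu>) = (\<Sum>a<m. (\<beta> a)\<^sup>2)" by simp
qed

lemma sum_fourth_le_square_sum: "(\<Sum>a\<in>A. (\<beta> a :: real) ^ 4) \<le> (\<Sum>a\<in>A. (\<beta> a)\<^sup>2)\<^sup>2"
proof (cases "finite A")
 case True
 then show ?thesis
 proof induction
  case (insert a A)
  have "0 \<le> 2*(\<beta> a)\<^sup>2*(\<Sum>a\<in>A. (\<beta> a)\<^sup>2)" by (intro mult_nonneg_nonneg sum_nonneg) auto
  then show ?case using insert by (simp add: power2_sum)
 qed simp
qed simp

text \<open>
Independent isotropic vectors, possibly with different laws and excesses; \<open>K\<close> bounds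
the fourth moments of normalized linear forms.
\<close>
locale isotropic_family =
 fixes m :: nat and D :: "'i \<Rightarrow> (nat \<Rightarrow> real) measure" and \<Delta> :: "'i \<Rightarrow> real" and K :: real and I :: "'i set"
 assumes iso: "\<And>i. isotropic m (\<Delta> i) (D i)" and K: "3 \<le> K" "\<And>i. \<Delta> i \<le> K - 3" and fin: "finite I"
begin

sublocale D: prob_space "D i" for i using isotropicD(1)[OF iso] .
sublocale product_sigma_finite D ..
sublocale P: prob_space "PiM I D" by (rule prob_space_PiM) unfold_locales

definition lin :: "('i \<Rightarrow> nat \<Rightarrow> real) \<Rightarrow> ('i \<Rightarrow> nat \<Rightarrow> real) \<Rightarrow> real" where
 "lin \<beta> \<omega> = (\<Sum>i\<in>I. \<Sum>a<m. \<beta> i a*\<omega> i a)"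

lemma coordinate_measurable: "i \<in> I \<Longrightarrow> a < m \<Longrightarrow> (\<lambda>\<omega>. \<omega> i a) \<in> borel_measurable (PiM I D)"
 using measurable_compose[OF measurable_component_singleton[of i I D] isotropicD(3)[OF iso[of i]]] by blast

lemma lin_measurable[measurable]: "lin \<beta> \<in> borel_measurable (PiM I D)"
 unfolding lin_def by (intro borel_measurable_sum borel_measurable_times coordinate_measurable) auto

lemma lin_moments:
 shows "integrable (PiM I D) (\<lambda>\<omega>. lin \<beta> \<omega> ^ 4)" and "P.expectation (lin \<beta>) = 0"
  and "P.expectation (\<lambda>\<omega>. (lin \<beta> \<omega>)\<^sup>2) = (\<Sum>i\<in>I. \<Sum>a<m. (\<beta> i a)\<^sup>2)"
  and "P.expectation (\<lambda>\<omega>. lin \<beta> \<omega> ^ 4) = 3*(\<Sum>i\<in>I. \<Sum>a<m. (\<beta> i a)\<^sup>2)\<^sup>2 + (\<Sum>i\<in>I. \<Delta> i*(\<Sum>a<m. \<beta> i a ^ 4))"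
proof -
 define X where "X i \<omega> = (\<Sum>a<m. \<beta> i a*\<omega> i a)" for i and \<omega> :: "'i \<Rightarrow> nat \<Rightarrow> real"
 have dX: "integrable (PiM I D) (\<lambda>\<omega>. f (\<omega> i))" if "i \<in> I" "integrable (D i) f" for f :: "_ \<Rightarrow> real" and i
 proof -
  have "integrable (distr (PiM I D) (D i) (\<lambda>\<omega>. \<omega> i)) f"
   using that by (subst distr_PiM_component) (auto intro: D.prob_space_axioms)
  then show ?thesis by (rule integrable_distr[rotated]) (use that in auto)
 qed
 have eX: "P.expectation (\<lambda>\<omega>. f (\<omega> i)) = (\<integral>z. f z \<partial>D i)" if "i \<in> I" "f \<in> borel_measurable (D i)" for f :: "_ \<Rightarrow> real" and i
 proof -
  have "(\<integral>z. f z \<partial>D i) = (\<integral>z. f z \<partial>distr (PiM I D) (D i) (\<lambda>\<omega>. \<omega> i))"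
   using that by (subst distr_PiM_component) (auto intro: D.prob_space_axioms)
  also have "\<dots> = P.expectation (\<lambda>\<omega>. f (\<omega> i))" using that by (subst integral_distr) auto
  finally show ?thesis by simp
 qed
 have mL: "(\<lambda>z. \<Sum>a<m. \<beta> i a*z a) \<in> borel_measurable (D i)" for i by (rule isotropicD(4)[OF iso])
 have ind: "P.indep_vars (\<lambda>_. borel) X I"
 proof (cases "I = {}")
  case False
  have "P.indep_vars (\<lambda>_. borel) (\<lambda>i \<omega>. (\<lambda>z. \<Sum>a<m. \<beta> i a*z a) (\<omega> i)) I"
   by (rule P.indep_vars_compose2[OF indep_vars_PiM_coordinates[OF _ False]])
    (auto intro: D.prob_space_axioms mL)
  then show ?thesis by (simp add: X_def[abs_def])
 next
  case True
  then show ?thesis unfolding P.indep_vars_def P.indep_sets_def by simp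
 qed
 have m4: "P.expectation (\<lambda>\<omega>. X i \<omega> ^ 4) = 3*(\<Sum>a<m. (\<beta> i a)\<^sup>2)\<^sup>2 + \<Delta> i*(\<Sum>a<m. \<beta> i a ^ 4)" if "i \<in> I" for i
  unfolding X_def using eX[OF that, of "\<lambda>z. (\<Sum>a<m. \<beta> i a*z a) ^ 4"] isotropicD(8)[OF iso] mL by simp
 have m2: "P.expectation (\<lambda>\<omega>. (X i \<omega>)\<^sup>2) = (\<Sum>a<m. (\<beta> i a)\<^sup>2)" if "i \<in> I" for i
  unfolding X_def using eX[OF that, of "\<lambda>z. (\<Sum>a<m. \<beta> i a*z a)\<^sup>2"] isotropicD(7)[OF iso] mL by simp
 have m1: "P.expectation (X i) = 0" if "i \<in> I" for i
  unfolding X_def using eX[OF that, of "\<lambda>z. (\<Sum>a<m. \<beta> i a*z a)"] isotropicD(6)[OF iso] mL by simp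
 have i4: "integrable (PiM I D) (\<lambda>\<omega>. X i \<omega> ^ 4)" if "i \<in> I" for i
  unfolding X_def by (rule dX[OF that]) (rule isotropicD(5)[OF iso])
 have lX: "lin \<beta> \<omega> = (\<Sum>i\<in>I. X i \<omega>)" for \<omega> by (simp add: lin_def X_def)
 note F = P.indep_sum_fourth_moment[OF fin ind i4 m1, folded lX]
 show "integrable (PiM I D) (\<lambda>\<omega>. lin \<beta> \<omega> ^ 4)" and "P.expectation (lin \<beta>) = 0" using F by auto
 show e2: "P.expectation (\<lambda>\<omega>. (lin \<beta> \<omega>)\<^sup>2) = (\<Sum>i\<in>I. \<Sum>a<m. (\<beta> i a)\<^sup>2)" using F m2 by simp
 have "P.expectation (\<lambda>\<omega>. lin \<beta> \<omega> ^ 4) - 3*(\<Sum>i\<in>I. \<Sum>a<m. (\<beta> i a)\<^sup>2)\<^sup>2 = (\<Sum>i\<in>I. \<Delta> i*(\<Sum>a<m. \<beta> i a ^ 4))"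
 proof -
  have "P.expectation (\<lambda>\<omega>. lin \<beta> \<omega> ^ 4) - 3*(\<Sum>i\<in>I. \<Sum>a<m. (\<beta> i a)\<^sup>2)\<^sup>2 =
   (\<Sum>i\<in>I. P.expectation (\<lambda>\<omega>. X i \<omega> ^ 4) - 3*(P.expectation (\<lambda>\<omega>. (X i \<omega>)\<^sup>2))\<^sup>2)"
   using F unfolding e2 by blast
  also have "\<dots> = (\<Sum>i\<in>I. \<Delta> i*(\<Sum>a<m. \<beta> i a ^ 4))"
   by (intro sum.cong refl) (simp add: m4 m2)
  finally show ?thesis .
 qed
 then show "P.expectation (\<lambda>\<omega>. lin \<beta> \<omega> ^ 4) = 3*(\<Sum>i\<in>I. \<Sum>a<m. (\<beta> i a)\<^sup>2)\<^sup>2 + (\<Sum>i\<in>I. \<Delta> i*(\<Sum>a<m. \<beta> i a ^ 4))" by simp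
qed

lemma lin_power_integrable: "n \<le> 4 \<Longrightarrow> integrable (PiM I D) (\<lambda>\<omega>. lin \<beta> \<omega> ^ n)"
 by (rule P.integrable_power_of_fourth) (auto intro: lin_moments)

lemma lin_fourth_le: "P.expectation (\<lambda>\<omega>. lin \<beta> \<omega> ^ 4) \<le> K*(\<Sum>i\<in>I. \<Sum>a<m. (\<beta> i a)\<^sup>2)\<^sup>2"
proof -
 have "(\<Sum>i\<in>I. \<Delta> i*(\<Sum>a<m. \<beta> i a ^ 4)) \<le> (\<Sum>i\<in>I. (K - 3)*(\<Sum>a<m. \<beta> i a ^ 4))"
  using K by (intro sum_mono mult_right_mono sum_nonneg) auto
 also have "\<dots> = (K - 3)*(\<Sum>(i, a)\<in>I \<times> {..<m}. \<beta> i a ^ 4)"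
  by (simp add: sum_distrib_left sum.cartesian_product case_prod_unfold)
 also have "\<dots> \<le> (K - 3)*(\<Sum>(i, a)\<in>I \<times> {..<m}. (\<beta> i a)\<^sup>2)\<^sup>2"
  using K sum_fourth_le_square_sum[of "\<lambda>(i, a). \<beta> i a" "I \<times> {..<m}"]
  by (intro mult_left_mono) (auto simp: case_prod_unfold)
 finally show ?thesis unfolding lin_moments(4) by (simp add: sum.cartesian_product algebra_simps)
qed

lemma lin_square_mult_le:
 "integrable (PiM I D) (\<lambda>\<omega>. (lin \<beta> \<omega>)\<^sup>2*(lin \<gamma> \<omega>)\<^sup>2)"
 "P.expectation (\<lambda>\<omega>. (lin \<beta> \<omega>)\<^sup>2*(lin \<gamma> \<omega>)\<^sup>2) \<le> K*(\<Sum>i\<in>I. \<Sum>a<m. (\<beta> i a)\<^sup>2)*(\<Sum>i\<in>I. \<Sum>a<m. (\<gamma> i a)\<^sup>2)"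
proof -
 show "integrable (PiM I D) (\<lambda>\<omega>. (lin \<beta> \<omega>)\<^sup>2*(lin \<gamma> \<omega>)\<^sup>2)"
  by (rule P.integrable_square_mult_of_fourth) (auto intro: lin_moments)
 have nn: "0 \<le> (\<Sum>i\<in>I. \<Sum>a<m. (\<beta> i a)\<^sup>2)" for \<beta> :: "'i \<Rightarrow> nat \<Rightarrow> real" by (intro sum_nonneg) auto
 have pp: "((x::real)\<^sup>2)\<^sup>2 = x ^ 4" for x by simp
 have "P.expectation (\<lambda>\<omega>. (lin \<beta> \<omega>)\<^sup>2*(lin \<gamma> \<omega>)\<^sup>2) \<le> (sqrt K*(\<Sum>i\<in>I. \<Sum>a<m. (\<beta> i a)\<^sup>2))*(sqrt K*(\<Sum>i\<in>I. \<Sum>a<m. (\<gamma> i a)\<^sup>2))"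
  using K lin_fourth_le[of \<beta>] lin_fourth_le[of \<gamma>] nn[of \<beta>] nn[of \<gamma>]
  by (intro P.expectation_mult_le_of_squares mult_nonneg_nonneg)
   (auto simp: pp power_mult_distrib intro: lin_moments)
 also have "\<dots> = K*(\<Sum>i\<in>I. \<Sum>a<m. (\<beta> i a)\<^sup>2)*(\<Sum>i\<in>I. \<Sum>a<m. (\<gamma> i a)\<^sup>2)"
  using K real_sqrt_mult_self[of K] by (simp add: mult_ac)
 finally show "P.expectation (\<lambda>\<omega>. (lin \<beta> \<omega>)\<^sup>2*(lin \<gamma> \<omega>)\<^sup>2) \<le> K*(\<Sum>i\<in>I. \<Sum>a<m. (\<beta> i a)\<^sup>2)*(\<Sum>i\<in>I. \<Sum>a<m. (\<gamma> i a)\<^sup>2)" .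
qed

lemma lin_sq_norm:
 fixes B :: "nat \<Rightarrow> 'i \<Rightarrow> nat \<Rightarrow> real"
 shows "integrable (PiM I D) (\<lambda>\<omega>. \<Sum>c<q. (lin (B c) \<omega>)\<^sup>2)"
  "P.expectation (\<lambda>\<omega>. \<Sum>c<q. (lin (B c) \<omega>)\<^sup>2) = (\<Sum>c<q. \<Sum>i\<in>I. \<Sum>a<m. (B c i a)\<^sup>2)"
  "integrable (PiM I D) (\<lambda>\<omega>. (\<Sum>c<q. (lin (B c) \<omega>)\<^sup>2)\<^sup>2)"
  "P.expectation (\<lambda>\<omega>. (\<Sum>c<q. (lin (B c) \<omega>)\<^sup>2)\<^sup>2) \<le> K*(\<Sum>c<q. \<Sum>i\<in>I. \<Sum>a<m. (B c i a)\<^sup>2)\<^sup>2"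
proof -
 show "integrable (PiM I D) (\<lambda>\<omega>. \<Sum>c<q. (lin (B c) \<omega>)\<^sup>2)"
  by (intro Bochner_Integration.integrable_sum lin_power_integrable) auto
 show "P.expectation (\<lambda>\<omega>. \<Sum>c<q. (lin (B c) \<omega>)\<^sup>2) = (\<Sum>c<q. \<Sum>i\<in>I. \<Sum>a<m. (B c i a)\<^sup>2)"
  by (subst Bochner_Integration.integral_sum) (auto simp: lin_moments intro: lin_power_integrable)
 have e: "(\<Sum>c<q. (lin (B c) \<omega>)\<^sup>2)\<^sup>2 = (\<Sum>c<q. \<Sum>d<q. (lin (B c) \<omega>)\<^sup>2*(lin (B d) \<omega>)\<^sup>2)" for \<omega>
  by (simp add: power2_eq_square[of "sum _ _"] sum_product)
 show "integrable (PiM I D) (\<lambda>\<omega>. (\<Sum>c<q. (lin (B c) \<omega>)\<^sup>2)\<^sup>2)"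
  unfolding e by (intro Bochner_Integration.integrable_sum lin_square_mult_le)
 have "P.expectation (\<lambda>\<omega>. (\<Sum>c<q. (lin (B c) \<omega>)\<^sup>2)\<^sup>2) = (\<Sum>c<q. \<Sum>d<q. P.expectation (\<lambda>\<omega>. (lin (B c) \<omega>)\<^sup>2*(lin (B d) \<omega>)\<^sup>2))"
  unfolding e using lin_square_mult_le(1)
  by (subst Bochner_Integration.integral_sum, force)+ simp
 also have "\<dots> \<le> (\<Sum>c<q. \<Sum>d<q. K*(\<Sum>i\<in>I. \<Sum>a<m. (B c i a)\<^sup>2)*(\<Sum>i\<in>I. \<Sum>a<m. (B d i a)\<^sup>2))"
  by (intro sum_mono lin_square_mult_le)
 also have "\<dots> = K*(\<Sum>c<q. \<Sum>i\<in>I. \<Sum>a<m. (B c i a)\<^sup>2)\<^sup>2"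
 proof -
  have "(\<Sum>c<q. \<Sum>d<q. K * s c * s d) = K*(\<Sum>c<q. s c)\<^sup>2" for s :: "nat \<Rightarrow> real"
   by (simp add: power2_eq_square sum_product sum_distrib_left mult_ac)
  then show ?thesis .
 qed
 finally show "P.expectation (\<lambda>\<omega>. (\<Sum>c<q. (lin (B c) \<omega>)\<^sup>2)\<^sup>2) \<le> K*(\<Sum>c<q. \<Sum>i\<in>I. \<Sum>a<m. (B c i a)\<^sup>2)\<^sup>2" .
qed

end

text \<open>
Taylor expansion to second order. The cubic remainder is bounded by \<open>\<eta> * L\<^sup>2 +
L\<^sup>4/\<eta>\<close>, which trades the missing third moment for second and fourth moments with a
free parameter \<open>\<eta>\<close>.
\<close>
lemma isotropic_char_expansion:
 fixes \<beta> :: "nat \<Rightarrow> real"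
 assumes iso: "isotropic m \<Delta> \<mu>" and K: "3 \<le> K" "\<Delta> \<le> K - 3" and \<eta>: "0 < \<eta>"
 defines "s \<equiv> \<Sum>a<m. (\<beta> a)\<^sup>2"
 shows "cmod ((\<integral>z. iexp (\<Sum>a<m. \<beta> a*z a) \<partial>\<mu>) - (1 - complex_of_real (s/2))) \<le> (\<eta> * s + K * s\<^sup>2/\<eta>)/12"
proof -
 interpret prob_space \<mu> by (rule isotropicD(1)[OF iso])
 define L where "L z = (\<Sum>a<m. \<beta> a*z a)" for z :: "nat \<Rightarrow> real"
 have [measurable]: "L \<in> borel_measurable \<mu>" unfolding L_def by (rule isotropicD(4)[OF iso])
 have i4: "integrable \<mu> (\<lambda>z. L z ^ 4)" unfolding L_def by (rule isotropicD(5)[OF iso])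
 have iL: "integrable \<mu> (\<lambda>z. L z ^ n)" if "n \<le> 4" for n using i4 that by (intro integrable_power_of_fourth[of L n]) auto
 have iL1: "integrable \<mu> L" and iL2: "integrable \<mu> (\<lambda>z. (L z)\<^sup>2)" using iL[of 1] iL[of 2] by auto
 have e1: "expectation L = 0" unfolding L_def by (rule isotropicD(6)[OF iso])
 have e2: "expectation (\<lambda>z. (L z)\<^sup>2) = s" unfolding L_def s_def by (rule isotropicD(7)[OF iso])
 have "expectation (\<lambda>z. L z ^ 4) = 3 * s\<^sup>2 + \<Delta>*(\<Sum>a<m. \<beta> a ^ 4)" unfolding L_def s_def by (rule isotropicD(8)[OF iso])
 also have "\<dots> \<le> 3 * s\<^sup>2 + (K - 3) * s\<^sup>2"
  using K sum_fourth_le_square_sum[of \<beta> "{..<m}"] unfolding s_def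
  by (intro add_left_mono mult_mono sum_nonneg order_refl) auto
 finally have e4: "expectation (\<lambda>z. L z ^ 4) \<le> K * s\<^sup>2" by (simp add: algebra_simps)
 have ie: "integrable \<mu> (\<lambda>z. iexp (L z))" by (rule integrable_iexp) auto
 define P where "P z = 1 + \<i>*complex_of_real (L z) - complex_of_real ((L z)\<^sup>2/2)" for z
 have iP: "integrable \<mu> P" unfolding P_def using iL1 iL2
  by (intro Bochner_Integration.integrable_add Bochner_Integration.integrable_diff integrable_mult_right integrable_of_real) auto
 have eP: "expectation P = 1 - complex_of_real (s/2)"
 proof -
  have "expectation P = (\<integral>z. 1 + \<i>*complex_of_real (L z) \<partial>\<mu>) - (\<integral>z. complex_of_real ((L z)\<^sup>2/2) \<partial>\<mu>)"
   unfolding P_def using iL1 iL2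
   by (intro Bochner_Integration.integral_diff Bochner_Integration.integrable_add integrable_mult_right integrable_of_real) auto
  also have "(\<integral>z. 1 + \<i>*complex_of_real (L z) \<partial>\<mu>) = 1 + \<i>*complex_of_real (expectation L)"
   using iL1 prob_space by (subst Bochner_Integration.integral_add) auto
  also have "(\<integral>z. complex_of_real ((L z)\<^sup>2/2) \<partial>\<mu>) = complex_of_real (s/2)"
  proof -
   have "(\<integral>z. complex_of_real ((L z)\<^sup>2/2) \<partial>\<mu>) = complex_of_real (\<integral>z. (L z)\<^sup>2/2 \<partial>\<mu>)"
    by (rule integral_complex_of_real)
   then show ?thesis using e2 by simp
  qed
  finally show ?thesis using e1 by simp
 qed
 have "cmod (expectation (\<lambda>z. iexp (L z)) - expectation P) = cmod (expectation (\<lambda>z. iexp (L z) - P z))"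
  using ie iP by simp
 also have "\<dots> \<le> expectation (\<lambda>z. cmod (iexp (L z) - P z))" by (rule integral_norm_bound)
 also have "\<dots> \<le> expectation (\<lambda>z. (\<eta>*(L z)\<^sup>2 + L z ^ 4/\<eta>)/12)"
 proof (intro integral_mono)
  fix z
  have P3: "P z = (\<Sum>k\<le>2. (\<i>*complex_of_real (L z)) ^ k/fact k)"
  proof -
   have "(\<Sum>k\<le>2. f k) = f 0 + f 1 + f 2" for f :: "nat \<Rightarrow> complex" by (simp add: numeral_2_eq_2)
   then show ?thesis unfolding P_def by (simp add: power_mult_distrib)
  qed
  have "cmod (iexp (L z) - P z) \<le> \<bar>L z\<bar> ^ 3/6"
   unfolding P3 using iexp_approx1[of "L z" 2] by (simp add: fact_numeral numeral_3_eq_3)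
  also have "\<bar>L z\<bar> ^ 3 \<le> (\<eta>*(L z)\<^sup>2 + L z ^ 4/\<eta>)/2"
  proof -
   have "0 \<le> \<bar>L z\<bar>\<^sup>2*(\<eta> - \<bar>L z\<bar>)\<^sup>2/\<eta>" using \<eta> by auto
   also have "\<dots> = \<eta>*(L z)\<^sup>2 + L z ^ 4/\<eta> - 2*\<bar>L z\<bar> ^ 3"
   proof -
    have "\<bar>L z\<bar>\<^sup>2*(\<eta> - \<bar>L z\<bar>)\<^sup>2 = \<eta>\<^sup>2*\<bar>L z\<bar>\<^sup>2 + \<bar>L z\<bar> ^ 4 - 2*\<eta>*\<bar>L z\<bar> ^ 3"
     by (simp add: power2_eq_square power3_eq_cube power4_eq_xxxx algebra_simps del: abs_mult_self_eq)
    then show ?thesis using \<eta> by (simp add: field_simps power2_eq_square power_even_abs)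
   qed
   finally show ?thesis by simp
  qed
  finally show "cmod (iexp (L z) - P z) \<le> (\<eta>*(L z)\<^sup>2 + L z ^ 4/\<eta>)/12" by simp
 qed (use ie iP iL2 i4 in auto)
 also have "\<dots> = (\<eta> * s + expectation (\<lambda>z. L z ^ 4)/\<eta>)/12"
  using iL2 i4 e2 by simp
 also have "\<dots> \<le> (\<eta> * s + K * s\<^sup>2/\<eta>)/12"
  using e4 \<eta> by (simp add: divide_right_mono)
 finally show ?thesis unfolding eP L_def .
qed

section \<open>Lindeberg replacement for quadratic forms without diagonal blocks\<close>
text \<open>
A quadratic form in the vectors \<open>\<omega> i\<close>, summed over ordered pairs of distinct
indices.
\<close>
definition offdiag_quad :: "nat \<Rightarrow> ('i \<Rightarrow> nat \<Rightarrow> 'i \<Rightarrow> nat \<Rightarrow> real) \<Rightarrow> 'i set \<Rightarrow> ('i \<Rightarrow> nat \<Rightarrow> real) \<Rightarrow> real" where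
 "offdiag_quad m A I \<omega> = (\<Sum>i\<in>I. \<Sum>j\<in>I - {i}. \<Sum>a<m. \<Sum>b<m. A i a j b*\<omega> i a*\<omega> j b)"

text \<open>Since no vector is multiplied by itself, the form is affine in each of them.\<close>
lemma offdiag_quad_insert:
 assumes i: "i \<notin> J" "finite J" and sym: "\<And>i a j b. A i a j b = A j b i a"
 shows "offdiag_quad m A (insert i J) \<omega> = offdiag_quad m A J \<omega> + (\<Sum>a<m. (2*(\<Sum>j\<in>J. \<Sum>b<m. A i a j b*\<omega> j b))*\<omega> i a)"
proof -
 let ?t = "\<lambda>i j. \<Sum>a<m. \<Sum>b<m. A i a j b*\<omega> i a*\<omega> j b"
 have tsym: "?t k i = ?t i k" for k
  by (subst sum.swap) (intro sum.cong refl, subst sym, simp add: mult_ac)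
 have "offdiag_quad m A (insert i J) \<omega> = (\<Sum>j\<in>J. ?t i j) + (\<Sum>k\<in>J. \<Sum>j\<in>insert i J - {k}. ?t k j)"
  unfolding offdiag_quad_def using i by (simp add: insert_Diff_if)
 also have "(\<Sum>k\<in>J. \<Sum>j\<in>insert i J - {k}. ?t k j) = (\<Sum>k\<in>J. ?t k i + (\<Sum>j\<in>J - {k}. ?t k j))"
 proof (intro sum.cong refl)
  fix k assume "k \<in> J"
  then have "insert i J - {k} = insert i (J - {k})" "i \<notin> J - {k}" using i by auto
  then show "(\<Sum>j\<in>insert i J - {k}. ?t k j) = ?t k i + (\<Sum>j\<in>J - {k}. ?t k j)" using i by simp
 qed
 also have "\<dots> = (\<Sum>k\<in>J. ?t i k) + offdiag_quad m A J \<omega>"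
  by (simp add: sum.distrib tsym offdiag_quad_def)
 finally have "offdiag_quad m A (insert i J) \<omega> = offdiag_quad m A J \<omega> + 2*(\<Sum>j\<in>J. ?t i j)" by simp
 also have "(\<Sum>j\<in>J. ?t i j) = (\<Sum>a<m. \<Sum>j\<in>J. \<Sum>b<m. A i a j b*\<omega> i a*\<omega> j b)"
  by (rule sum.swap)
 also have "\<dots> = (\<Sum>a<m. (\<Sum>j\<in>J. \<Sum>b<m. A i a j b*\<omega> j b)*\<omega> i a)"
  by (intro sum.cong refl) (simp add: sum_distrib_right sum_distrib_left mult_ac)
 also have "2*\<dots> = (\<Sum>a<m. (2*(\<Sum>j\<in>J. \<Sum>b<m. A i a j b*\<omega> j b))*\<omega> i a)"
  by (subst sum_distrib_left) (intro sum.cong refl, simp)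
 finally show ?thesis .
qed

lemma offdiag_quad_cong: "(\<And>i a. i \<in> I \<Longrightarrow> a < m \<Longrightarrow> \<omega> i a = \<omega>' i a) \<Longrightarrow> offdiag_quad m A I \<omega> = offdiag_quad m A I \<omega>'"
 unfolding offdiag_quad_def by (intro sum.cong refl) auto

lemma (in isotropic_family) offdiag_quad_measurable[measurable]: "offdiag_quad m A I \<in> borel_measurable (PiM I D)"
 unfolding offdiag_quad_def by (intro borel_measurable_sum borel_measurable_times coordinate_measurable borel_measurable_const) auto

text \<open>
Conditionally on the other vectors, the form is affine in the vector \<open>i\<close>, and both laws
of this vector give the same second-order expansion of the characteristic function. Integrating the
remainder over the other vectors leaves the influence \<open>l\<close> of the vector
\<open>i\<close> on the form.
\<close>
lemma lindeberg_swap_one: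
 fixes A :: "'i \<Rightarrow> nat \<Rightarrow> 'i \<Rightarrow> nat \<Rightarrow> real"
 assumes F: "isotropic_family m D \<Delta> K J" and F': "isotropic_family m D' \<Delta>' K J"
  and i: "i \<notin> J" and DD: "\<And>j. j \<in> J \<Longrightarrow> D j = D' j"
  and sym: "\<And>i a j b. A i a j b = A j b i a" and \<eta>: "0 < \<eta>"
 defines "l \<equiv> \<Sum>a<m. \<Sum>j\<in>J. \<Sum>b<m. (A i a j b)\<^sup>2"
 shows "cmod ((\<integral>\<omega>. iexp (\<theta> * offdiag_quad m A (insert i J) \<omega>) \<partial>PiM (insert i J) D) -
   (\<integral>\<omega>. iexp (\<theta> * offdiag_quad m A (insert i J) \<omega>) \<partial>PiM (insert i J) D'))
  \<le> (4*\<eta>*\<theta>\<^sup>2*l + 16*K\<^sup>2*\<theta> ^ 4*l\<^sup>2/\<eta>)/6"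
proof -
 interpret F: isotropic_family m D \<Delta> K J by fact
 interpret F': isotropic_family m D' \<Delta>' K J by fact
 interpret Fi: isotropic_family m D \<Delta> K "insert i J" using F.iso F.K F.fin by unfold_locales auto
 interpret F'i: isotropic_family m D' \<Delta>' K "insert i J" using F'.iso F'.K F'.fin by unfold_locales auto
 have PJ: "PiM J D = PiM J D'" using DD by (intro PiM_cong) auto
 define B where "B a j b = \<theta>*2*A i a j b" for a j b
 let ?Q = "\<lambda>\<omega>. iexp (\<theta> * offdiag_quad m A (insert i J) \<omega>)"
 let ?E = "\<lambda>\<mu> \<omega>. \<integral>y. iexp (\<Sum>a<m. F.lin (B a) \<omega>*y a) \<partial>\<mu>"
 define S where "S \<omega> = (\<Sum>a<m. (F.lin (B a) \<omega>)\<^sup>2)" for \<omega>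
 define H where "H \<mu> \<omega> = (\<integral>y. ?Q (fun_upd \<omega> i y) \<partial>\<mu>)" for \<mu> \<omega>
 have Heq: "H \<mu> \<omega> = iexp (\<theta> * offdiag_quad m A J \<omega>)*(\<integral>y. iexp (\<Sum>a<m. F.lin (B a) \<omega>*y a) \<partial>\<mu>)" for \<mu> \<omega>
 proof -
  have "\<theta> * offdiag_quad m A (insert i J) (fun_upd \<omega> i y) = \<theta> * offdiag_quad m A J \<omega> + (\<Sum>a<m. F.lin (B a) \<omega>*y a)" for y
  proof -
   have "offdiag_quad m A J (fun_upd \<omega> i y) = offdiag_quad m A J \<omega>" using i by (intro offdiag_quad_cong) auto
   moreover have "(\<Sum>j\<in>J. \<Sum>b<m. A i a j b*(fun_upd \<omega> i y) j b) = (\<Sum>j\<in>J. \<Sum>b<m. A i a j b*\<omega> j b)" for a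
    using i by (intro sum.cong refl) auto
   ultimately show ?thesis
    unfolding offdiag_quad_insert[OF i F.fin sym]
    by (simp add: F.lin_def B_def sum_distrib_left sum_distrib_right distrib_left mult_ac)
  qed
  then have "?Q (fun_upd \<omega> i y) = iexp (\<theta> * offdiag_quad m A J \<omega>)*iexp (\<Sum>a<m. F.lin (B a) \<omega>*y a)" for y
   by (simp only: of_real_add distrib_left exp_add)
  then show ?thesis unfolding H_def by simp
 qed
 have pt: "cmod (H (D i) \<omega> - H (D' i) \<omega>) \<le> (\<eta>*S \<omega> + K*(S \<omega>)\<^sup>2/\<eta>)/6" for \<omega>
 proof -
  let ?c = "1 - complex_of_real (S \<omega>/2)"
  have 1: "cmod (?E (D i) \<omega> - ?c) \<le> (\<eta>*S \<omega> + K*(S \<omega>)\<^sup>2/\<eta>)/12"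
   unfolding S_def by (rule isotropic_char_expansion[OF F.iso F.K \<eta>])
  have 2: "cmod (?E (D' i) \<omega> - ?c) \<le> (\<eta>*S \<omega> + K*(S \<omega>)\<^sup>2/\<eta>)/12"
   unfolding S_def by (rule isotropic_char_expansion[OF F'.iso F'.K \<eta>])
  have "H (D i) \<omega> - H (D' i) \<omega> = iexp (\<theta> * offdiag_quad m A J \<omega>) *
   ((?E (D i) \<omega> - ?c) - (?E (D' i) \<omega> - ?c))"
   unfolding Heq by (simp add: algebra_simps)
  then have "cmod (H (D i) \<omega> - H (D' i) \<omega>) = cmod ((?E (D i) \<omega> - ?c) - (?E (D' i) \<omega> - ?c))"
   by (simp add: norm_mult)
  also have "\<dots> \<le> cmod (?E (D i) \<omega> - ?c) + cmod (?E (D' i) \<omega> - ?c)"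
   by (rule norm_triangle_ineq4)
  finally show ?thesis using 1 2 by simp
 qed
 have iq: "integrable (PiM (insert i J) D) (\<lambda>\<omega>. ?Q \<omega>)"
  by (rule Fi.P.integrable_iexp) auto
 have iq': "integrable (PiM (insert i J) D') (\<lambda>\<omega>. ?Q \<omega>)"
  by (rule F'i.P.integrable_iexp) auto
 have E: "(\<integral>\<omega>. ?Q \<omega> \<partial>PiM (insert i J) D) = (\<integral>\<omega>. H (D i) \<omega> \<partial>PiM J D)"
  unfolding H_def by (rule F.product_integral_insert[OF F.fin i iq])
 have E': "(\<integral>\<omega>. ?Q \<omega> \<partial>PiM (insert i J) D') = (\<integral>\<omega>. H (D' i) \<omega> \<partial>PiM J D)"
  unfolding H_def PJ by (rule F'.product_integral_insert[OF F'.fin i iq'])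
 have intH: "integrable (PiM J E) (\<lambda>\<omega>. H (E i) \<omega>)" if E: "isotropic_family m E \<delta> K J" for E \<delta>
 proof -
  interpret E: isotropic_family m E \<delta> K J by fact
  interpret Ei: isotropic_family m E \<delta> K "insert i J" using E.iso E.K E.fin by unfold_locales auto
  have upd: "(\<lambda>(\<omega>, y). fun_upd \<omega> i y) \<in> measurable (PiM J E \<Otimes>\<^sub>M E i) (PiM (insert i J) E)" by (rule measurable_add_dim)
  have "(\<lambda>x. iexp (\<theta> * offdiag_quad m A (insert i J) (fun_upd (fst x) i (snd x)))) \<in> borel_measurable (PiM J E \<Otimes>\<^sub>M E i)"
   using measurable_compose[OF upd, of "\<lambda>\<omega>. ?Q \<omega>" borel] by (simp add: case_prod_unfold)
  then have m: "(\<lambda>\<omega>. H (E i) \<omega>) \<in> borel_measurable (PiM J E)" unfolding H_def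
   by (intro E.D.borel_measurable_lebesgue_integral) (simp add: case_prod_unfold)
  show ?thesis
  proof (rule E.P.integrable_const_bound[of _ 1, OF _ m], intro AE_I2)
   fix \<omega>
   have "cmod (H (E i) \<omega>) \<le> (\<integral>y. cmod (?Q (fun_upd \<omega> i y)) \<partial>E i)"
    unfolding H_def by (rule integral_norm_bound)
   also have "\<dots> = 1" by (simp add: E.D.prob_space)
   finally show "cmod (H (E i) \<omega>) \<le> 1" .
  qed
 qed
 have iH: "integrable (PiM J D) (H (D i))" using intH[OF F] .
 have iH': "integrable (PiM J D) (H (D' i))" using intH[OF F'] unfolding PJ .
 note N = F.lin_sq_norm[where q=m and B=B, folded S_def]
 have "cmod ((\<integral>\<omega>. H (D i) \<omega> \<partial>PiM J D) - (\<integral>\<omega>. H (D' i) \<omega> \<partial>PiM J D)) = cmod (\<integral>\<omega>. H (D i) \<omega> - H (D' i) \<omega> \<partial>PiM J D)"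
  using iH iH' by simp
 also have "\<dots> \<le> (\<integral>\<omega>. cmod (H (D i) \<omega> - H (D' i) \<omega>) \<partial>PiM J D)" by (rule integral_norm_bound)
 also have "\<dots> \<le> (\<integral>\<omega>. (\<eta>*S \<omega> + K*(S \<omega>)\<^sup>2/\<eta>)/6 \<partial>PiM J D)"
  by (intro integral_mono pt) (use iH iH' N in auto)
 also have "\<dots> = (\<eta>*(\<integral>\<omega>. S \<omega> \<partial>PiM J D) + K*(\<integral>\<omega>. (S \<omega>)\<^sup>2 \<partial>PiM J D)/\<eta>)/6"
  using N by simp
 also have "(\<integral>\<omega>. S \<omega> \<partial>PiM J D) = 4*\<theta>\<^sup>2*l"
  unfolding N(2) l_def B_def by (simp add: power_mult_distrib sum_distrib_left mult_ac)
 also have "(\<eta>*(4*\<theta>\<^sup>2*l) + K*(\<integral>\<omega>. (S \<omega>)\<^sup>2 \<partial>PiM J D)/\<eta>)/6 \<le> (\<eta>*(4*\<theta>\<^sup>2*l) + K*(K*(4*\<theta>\<^sup>2*l)\<^sup>2)/\<eta>)/6"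
 proof -
  have "(\<Sum>c<m. \<Sum>j\<in>J. \<Sum>a<m. (B c j a)\<^sup>2) = 4*\<theta>\<^sup>2*l"
   unfolding l_def B_def by (simp add: power_mult_distrib sum_distrib_left mult_ac)
  then have "(\<integral>\<omega>. (S \<omega>)\<^sup>2 \<partial>PiM J D) \<le> K*(4*\<theta>\<^sup>2*l)\<^sup>2" using N(4) by simp
  then show ?thesis using \<eta> F.K(1) by (intro divide_right_mono add_left_mono mult_left_mono) auto
 qed
 also have "\<dots> = (4*\<eta>*\<theta>\<^sup>2*l + 16*K\<^sup>2*\<theta> ^ 4*l\<^sup>2/\<eta>)/6"
  by (simp add: power_mult_distrib power2_eq_square power4_eq_xxxx mult_ac)
 finally show ?thesis unfolding E E' .
qed

text \<open>Telescoping over hybrids in which a growing set of vectors has been replaced.\<close>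
theorem lindeberg_offdiag_quad:
 fixes A :: "'i \<Rightarrow> nat \<Rightarrow> 'i \<Rightarrow> nat \<Rightarrow> real"
 assumes F: "isotropic_family m D \<Delta> K I" and F': "isotropic_family m D' \<Delta>' K I"
  and sym: "\<And>i a j b. A i a j b = A j b i a" and \<eta>: "0 < \<eta>"
 defines "l \<equiv> \<lambda>i. \<Sum>a<m. \<Sum>j\<in>I - {i}. \<Sum>b<m. (A i a j b)\<^sup>2"
 shows "cmod ((\<integral>\<omega>. iexp (\<theta> * offdiag_quad m A I \<omega>) \<partial>PiM I D) - (\<integral>\<omega>. iexp (\<theta> * offdiag_quad m A I \<omega>) \<partial>PiM I D'))
  \<le> (\<Sum>i\<in>I. (4*\<eta>*\<theta>\<^sup>2*l i + 16*K\<^sup>2*\<theta> ^ 4*(l i)\<^sup>2/\<eta>)/6)"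
proof -
 let ?e = "\<lambda>i. (4*\<eta>*\<theta>\<^sup>2*l i + 16*K\<^sup>2*\<theta> ^ 4*(l i)\<^sup>2/\<eta>)/6"
 interpret F: isotropic_family m D \<Delta> K I by fact
 interpret F': isotropic_family m D' \<Delta>' K I by fact
 define H where "H S = (\<lambda>i. if i \<in> S then D' i else D i)" for S
 define h where "h S = (\<lambda>i. if i \<in> S then \<Delta>' i else \<Delta> i)" for S
 define \<Phi> where "\<Phi> S = (\<integral>\<omega>. iexp (\<theta> * offdiag_quad m A I \<omega>) \<partial>PiM I (H S))" for S
 have hyb: "isotropic_family m (H S) (h S) K J" if "finite J" for S J
  using F.iso F'.iso F.K F'.K that by unfold_locales (auto simp: H_def h_def)
 have "cmod (\<Phi> {} - \<Phi> S) \<le> (\<Sum>i\<in>S. ?e i)" if "S \<subseteq> I" for S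
  using finite_subset[OF that F.fin] that
 proof (induction S)
  case (insert i S)
  then have ins: "insert i (I - {i}) = I" by auto
  have "cmod (\<Phi> S - \<Phi> (insert i S)) \<le> ?e i"
   using lindeberg_swap_one[OF hyb[of "I - {i}" S] hyb[of "I - {i}" "insert i S"], of i A \<eta> \<theta>] sym \<eta> F.fin
   unfolding \<Phi>_def ins l_def by (auto simp: H_def)
  moreover have "cmod (\<Phi> {} - \<Phi> (insert i S)) \<le> cmod (\<Phi> {} - \<Phi> S) + cmod (\<Phi> S - \<Phi> (insert i S))"
   using norm_triangle_ineq[of "\<Phi> {} - \<Phi> S" "\<Phi> S - \<Phi> (insert i S)"] by simp
  moreover have "(\<Sum>i\<in>insert i S. ?e i) =
   ?e i + (\<Sum>i\<in>S. ?e i)"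
   using insert by simp
  moreover have "cmod (\<Phi> {} - \<Phi> S) \<le> (\<Sum>i\<in>S. ?e i)"
   using insert by simp
  ultimately show ?case by linarith
 qed simp
 from this[OF order_refl] show ?thesis unfolding \<Phi>_def H_def
  using PiM_cong[of I I "\<lambda>i. if i \<in> I then D' i else D i" D'] by simp
qed

lemma distr_pair_snd:
 assumes "prob_space A" "prob_space B"
 shows "distr (A \<Otimes>\<^sub>M B) B snd = B"
proof -
 interpret A: prob_space A by fact
 interpret B: prob_space B by fact
 interpret pair_prob_space A B ..
 have "distr (A \<Otimes>\<^sub>M B) B snd = distr (distr (B \<Otimes>\<^sub>M A) (A \<Otimes>\<^sub>M B) (\<lambda>(x, y). (y, x))) B snd"
  by (subst distr_pair_swap) simp
 also have "\<dots> = distr (B \<Otimes>\<^sub>M A) B fst"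
  by (subst distr_distr) (auto simp: o_def case_prod_unfold)
 finally show ?thesis by (simp add: A.distr_pair_fst)
qed

lemma AE_pair_snd:
 assumes "prob_space A" "prob_space B" "AE y in B. P y"
 shows "AE w in A \<Otimes>\<^sub>M B. P (snd w)"
proof (rule AE_distrD[where f=snd])
 show "AE x in distr (A \<Otimes>\<^sub>M B) B snd. P x" unfolding distr_pair_snd[OF assms(1,2)] by (rule assms)
qed simp

section \<open>Squared norms of Gaussian vectors\<close>

abbreviation std_gaussian :: "nat \<Rightarrow> (nat \<Rightarrow> real) measure" where
 "std_gaussian m \<equiv> PiM {..<m} (\<lambda>_. std_normal_distribution)"

lemma prob_space_std_normal: "prob_space std_normal_distribution"
 by (rule prob_space_normal_density) simp

lemma prob_space_std_gaussian: "prob_space (std_gaussian m)"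
 by (intro prob_space_PiM prob_space_std_normal)

lemma integral_std_gaussian_component:
 fixes f :: "real \<Rightarrow> real"
 assumes a: "a < m" and [measurable]: "f \<in> borel_measurable borel"
 shows "(\<integral>z. f (z a) \<partial>std_gaussian m) = (\<integral>x. f x \<partial>std_normal_distribution)"
  and "integrable std_normal_distribution f \<Longrightarrow> integrable (std_gaussian m) (\<lambda>z. f (z a))"
proof -
 have d: "distr (std_gaussian m) std_normal_distribution (\<lambda>z. z a) = std_normal_distribution"
  using a by (intro distr_PiM_component prob_space_std_normal) auto
 have m: "(\<lambda>z. z a) \<in> measurable (std_gaussian m) std_normal_distribution"
  by (rule measurable_component_singleton) (use a in auto)
 have fm: "f \<in> borel_measurable std_normal_distribution" by simp
 have "(\<integral>x. f x \<partial>std_normal_distribution) = (\<integral>x. f x \<partial>distr (std_gaussian m) std_normal_distribution (\<lambda>z. z a))"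
  unfolding d ..
 also have "\<dots> = (\<integral>z. f (z a) \<partial>std_gaussian m)" by (rule integral_distr[OF m fm])
 finally show "(\<integral>z. f (z a) \<partial>std_gaussian m) = (\<integral>x. f x \<partial>std_normal_distribution)" ..
 assume "integrable std_normal_distribution f"
 then have "integrable (distr (std_gaussian m) std_normal_distribution (\<lambda>z. z a)) f" unfolding d .
 then show "integrable (std_gaussian m) (\<lambda>z. f (z a))" by (rule integrable_distr[OF m])
qed

lemma std_normal_moments:
 "integrable std_normal_distribution (\<lambda>x. x ^ k)" "(\<integral>x. x \<partial>std_normal_distribution) = 0"
 "(\<integral>x. x\<^sup>2 \<partial>std_normal_distribution) = 1" "(\<integral>x. x ^ 4 \<partial>std_normal_distribution) = 3"
 using integrable_std_normal_distribution_moment[of k] integral_std_normal_distribution_moment_odd[of 1]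
  std_normal_distribution_even_moments[of 1] std_normal_distribution_even_moments[of 2]
 by (auto simp: fact_numeral)

text \<open>
The fourth moment of a linear form follows from the additivity of the excess, which vanishes for a
normal coordinate.
\<close>
lemma isotropic_std_gaussian: "isotropic m 0 (std_gaussian m)"
proof -
 interpret P: prob_space "std_gaussian m" by (rule prob_space_std_gaussian)
 have i4: "integrable (std_gaussian m) (\<lambda>z. z a ^ 4)" if "a < m" for a
  by (rule integral_std_gaussian_component(2)[OF that, of "\<lambda>x. x ^ 4"]) (auto intro: std_normal_moments)
 have e1: "P.expectation (\<lambda>z. z a) = 0" if "a < m" for a
  using integral_std_gaussian_component(1)[OF that, of "\<lambda>x. x"] std_normal_moments by simp
 have e2: "P.expectation (\<lambda>z. (z a)\<^sup>2) = 1" if "a < m" for a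
  using integral_std_gaussian_component(1)[OF that, of "\<lambda>x. x\<^sup>2"] std_normal_moments by simp
 have e4: "P.expectation (\<lambda>z. z a ^ 4) = 3" if "a < m" for a
  using integral_std_gaussian_component(1)[OF that, of "\<lambda>x. x ^ 4"] std_normal_moments by simp
 have cm: "(\<lambda>z. z a) \<in> borel_measurable (std_gaussian m)" if "a < m" for a
  using measurable_component_singleton[of a "{..<m}" "\<lambda>_. std_normal_distribution"] that
  by (simp cong: measurable_cong_sets)
 have sum: "P.expectation (\<lambda>z. (\<Sum>a<m. \<beta> a*z a) ^ 2) = (\<Sum>a<m. (\<beta> a)\<^sup>2) \<and>
  P.expectation (\<lambda>z. (\<Sum>a<m. \<beta> a*z a) ^ 4) = 3*(\<Sum>a<m. (\<beta> a)\<^sup>2)\<^sup>2" for \<beta> :: "nat \<Rightarrow> real"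
 proof -
  have ind: "P.indep_vars (\<lambda>_. borel) (\<lambda>a z. \<beta> a*z a) {..<m}"
  proof (cases "m = 0")
   case False
   have "P.indep_vars (\<lambda>_. std_normal_distribution) (\<lambda>a z. z a) {..<m}"
    by (rule indep_vars_PiM_coordinates) (use False prob_space_std_normal in auto)
   then show ?thesis by (rule P.indep_vars_compose2) simp
  next
   case True
   then show ?thesis unfolding P.indep_vars_def P.indep_sets_def by simp
  qed
  have E: "P.expectation (\<lambda>z. \<beta> a*z a) = 0" "P.expectation (\<lambda>z. (\<beta> a*z a) ^ 2) = (\<beta> a)\<^sup>2"
   "P.expectation (\<lambda>z. (\<beta> a*z a) ^ 4) = 3*\<beta> a ^ 4" "integrable (std_gaussian m) (\<lambda>z. (\<beta> a*z a) ^ 4)" if "a < m" for a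
   using e1[OF that] e2[OF that] e4[OF that] i4[OF that] by (simp_all add: power_mult_distrib)
  have "integrable (std_gaussian m) (\<lambda>w. (\<Sum>i<m. \<beta> i*w i) ^ 4) \<and>
   P.expectation (\<lambda>w. \<Sum>i<m. \<beta> i*w i) = 0 \<and>
   P.expectation (\<lambda>w. (\<Sum>i<m. \<beta> i*w i) ^ 2) = (\<Sum>i<m. P.expectation (\<lambda>w. (\<beta> i*w i) ^ 2)) \<and>
   P.expectation (\<lambda>w. (\<Sum>i<m. \<beta> i*w i) ^ 4) - 3*(P.expectation (\<lambda>w. (\<Sum>i<m. \<beta> i*w i) ^ 2))\<^sup>2 =
   (\<Sum>i<m. P.expectation (\<lambda>w. (\<beta> i*w i) ^ 4) - 3*(P.expectation (\<lambda>w. (\<beta> i*w i) ^ 2))\<^sup>2)"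
   by (rule P.indep_sum_fourth_moment) (use ind E in auto)
  moreover have "(\<Sum>i<m. P.expectation (\<lambda>w. (\<beta> i*w i) ^ 2)) = (\<Sum>a<m. (\<beta> a)\<^sup>2)" using E by simp
  moreover have "(\<Sum>i<m. P.expectation (\<lambda>w. (\<beta> i*w i) ^ 4) - 3*(P.expectation (\<lambda>w. (\<beta> i*w i) ^ 2))\<^sup>2) = 0"
   using E by (intro sum.neutral) (simp add: power2_eq_square power4_eq_xxxx)
  ultimately show ?thesis by simp
 qed
 have cov: "P.expectation (\<lambda>z. z a*z b) = 0" if ab: "a < m" "b < m" "a \<noteq> b" for a b
 proof -
  define \<beta> :: "nat \<Rightarrow> real" where "\<beta> c = (if c = a then 1 else 0) + (if c = b then 1 else 0)" for c
  have lin: "(\<Sum>c<m. \<beta> c*z c) = z a + z b" for z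
   using ab by (simp add: \<beta>_def distrib_right sum.distrib if_distrib[of "\<lambda>x. x*_"] cong: if_cong)
  have sq: "(\<Sum>c<m. (\<beta> c)\<^sup>2) = 2"
  proof -
   have "(\<beta> c)\<^sup>2 = (if c = a then 1 else 0) + (if c = b then 1 else 0)" for c using ab by (auto simp: \<beta>_def)
   then show ?thesis using ab by (simp add: sum.distrib)
  qed
  have i2: "integrable (std_gaussian m) (\<lambda>z. (z c)\<^sup>2)" if "c < m" for c
   using P.integrable_power_of_fourth[OF cm[OF that] i4[OF that], of 2] by simp
  have ip: "integrable (std_gaussian m) (\<lambda>z. z a*z b)"
   using P.integrable_square_mult_of_fourth(2)[OF cm cm i4 i4, of a b] ab by simp
  have "2 = P.expectation (\<lambda>z. (z a + z b)\<^sup>2)" using sum[of \<beta>] unfolding lin sq by simp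
  also have "\<dots> = P.expectation (\<lambda>z. (z a)\<^sup>2 + (z b)\<^sup>2 + 2*(z a*z b))" by (simp add: power2_sum mult.assoc)
  also have "\<dots> = 1 + 1 + 2*P.expectation (\<lambda>z. z a*z b)"
   using i2[OF ab(1)] i2[OF ab(2)] ip e2[OF ab(1)] e2[OF ab(2)] by simp
  finally show ?thesis by simp
 qed
 have sets: "sets (std_gaussian m) = sets (PiM {..<m} (\<lambda>_. borel))" by (intro sets_PiM_cong) auto
 show ?thesis unfolding isotropic_def
  using sets P.prob_space_axioms i4 e1 e2 cov sum by (auto simp: power2_eq_square)
qed

lemma std_gaussian_char_lin:
 "(\<integral>z. iexp (\<Sum>a<m. \<beta> a*z a) \<partial>std_gaussian m) = complex_of_real (exp (- (\<Sum>a<m. (\<beta> a)\<^sup>2)/2))"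
proof -
 interpret N: prob_space std_normal_distribution by (rule prob_space_std_normal)
 interpret product_sigma_finite "\<lambda>_::nat. std_normal_distribution" ..
 have "(\<integral>z. iexp (\<Sum>a<m. \<beta> a*z a) \<partial>std_gaussian m) = (\<integral>z. (\<Prod>a<m. iexp (\<beta> a*z a)) \<partial>std_gaussian m)"
  by (simp add: exp_sum[symmetric] sum_distrib_left)
 also have "\<dots> = (\<Prod>a<m. \<integral>x. iexp (\<beta> a*x) \<partial>std_normal_distribution)"
  by (rule product_integral_prod) (auto intro!: N.integrable_iexp)
 also have "\<dots> = (\<Prod>a<m. complex_of_real (exp (- ((\<beta> a)\<^sup>2)/2)))"
  using char_std_normal_distribution unfolding char_def fun_eq_iff by simp
 also have "\<dots> = complex_of_real (exp (\<Sum>a<m. - ((\<beta> a)\<^sup>2)/2))" by (simp add: exp_sum)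
 finally show ?thesis by (simp add: sum_negf sum_divide_distrib)
qed

lemma std_gaussian_family_char_lin:
 fixes I :: "'i set"
 assumes "finite I"
 shows "(\<integral>\<omega>. iexp (\<Sum>i\<in>I. \<Sum>a<m. \<beta> i a*\<omega> i a) \<partial>PiM I (\<lambda>_. std_gaussian m)) = complex_of_real (exp (- (\<Sum>i\<in>I. \<Sum>a<m. (\<beta> i a)\<^sup>2)/2))"
proof -
 interpret N: prob_space "std_gaussian m" by (rule prob_space_std_gaussian)
 interpret product_sigma_finite "\<lambda>_::'i. std_gaussian m" ..
 have lm: "(\<lambda>z. \<Sum>a<m. \<beta> i a*z a) \<in> borel_measurable (std_gaussian m)" for i
  by (rule isotropicD(4)[OF isotropic_std_gaussian])
 have "(\<integral>\<omega>. iexp (\<Sum>i\<in>I. \<Sum>a<m. \<beta> i a*\<omega> i a) \<partial>PiM I (\<lambda>_. std_gaussian m)) = (\<integral>\<omega>. (\<Prod>i\<in>I. iexp (\<Sum>a<m. \<beta> i a*\<omega> i a)) \<partial>PiM I (\<lambda>_. std_gaussian m))"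
  using assms by (simp add: exp_sum[symmetric] sum_distrib_left)
 also have "\<dots> = (\<Prod>i\<in>I. \<integral>z. iexp (\<Sum>a<m. \<beta> i a*z a) \<partial>std_gaussian m)"
  by (rule product_integral_prod[OF assms]) (intro N.integrable_iexp, use lm in auto)
 also have "\<dots> = (\<Prod>i\<in>I. complex_of_real (exp (- (\<Sum>a<m. (\<beta> i a)\<^sup>2)/2)))"
  by (simp only: std_gaussian_char_lin)
 also have "\<dots> = complex_of_real (exp (\<Sum>i\<in>I. - (\<Sum>a<m. (\<beta> i a)\<^sup>2)/2))" using assms by (simp add: exp_sum)
 finally show ?thesis by (simp add: sum_negf sum_divide_distrib)
qed

text \<open>
Gaussian vectors with covariance \<open>\<Omega>\<close>, described by their characteristic
function. This form allows different linear images of independent normal variables to be compared.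
\<close>
definition gaussian_vec :: "'a measure \<Rightarrow> nat \<Rightarrow> (nat \<Rightarrow> 'a \<Rightarrow> real) \<Rightarrow> (nat \<Rightarrow> nat \<Rightarrow> real) \<Rightarrow> bool" where
 "gaussian_vec M q X \<Omega> \<longleftrightarrow> prob_space M \<and> (\<forall>c<q. X c \<in> borel_measurable M) \<and>
  (\<forall>h. (\<integral>w. iexp (\<Sum>c<q. h c*X c w) \<partial>M) = complex_of_real (exp (- (\<Sum>c<q. \<Sum>d<q. h c*h d*\<Omega> c d)/2)))"

text \<open>
The identity \<open>exp (- s * |X|\<^sup>2) = E exp (i * t * X \<bullet> h)\<close> with an
independent standard Gaussian vector \<open>h\<close> and \<open>t = sqrt (2 * s)\<close>, followed
by an exchange of the two integrations.
\<close>
lemma gaussian_vec_laplace_sq_norm: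
 assumes G: "gaussian_vec M q X \<Omega>" and s: "0 \<le> s"
 shows "complex_of_real (\<integral>w. exp (- s*(\<Sum>c<q. (X c w)\<^sup>2)) \<partial>M) =
  (\<integral>h. complex_of_real (exp (- s*(\<Sum>c<q. \<Sum>d<q. h c*h d*\<Omega> c d))) \<partial>std_gaussian q)"
proof -
 interpret M: prob_space M using G by (simp add: gaussian_vec_def)
 interpret H: prob_space "std_gaussian q" by (rule prob_space_std_gaussian)
 interpret pair_prob_space M "std_gaussian q" ..
 have X[measurable]: "X c \<in> borel_measurable M" if "c < q" for c using G that by (auto simp: gaussian_vec_def)
 have hm: "(\<lambda>z. z a) \<in> borel_measurable (std_gaussian q)" if "a < q" for a
  by (rule isotropicD(3)[OF isotropic_std_gaussian that])
 define t where "t = sqrt (2 * s)"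
 have t: "t\<^sup>2 = 2 * s" using s by (simp add: t_def)
 define f where "f w h = iexp (\<Sum>c<q. (t*X c w)*h c)" for w h
 have inner: "(\<integral>h. f w h \<partial>std_gaussian q) = complex_of_real (exp (- s*(\<Sum>c<q. (X c w)\<^sup>2)))" for w
  unfolding f_def std_gaussian_char_lin
  by (simp add: power_mult_distrib t sum_distrib_left[symmetric])
 have outer: "(\<integral>w. f w h \<partial>M) = complex_of_real (exp (- s*(\<Sum>c<q. \<Sum>d<q. h c*h d*\<Omega> c d)))" for h
 proof -
  have "(\<integral>w. f w h \<partial>M) = (\<integral>w. iexp (\<Sum>c<q. (t*h c)*X c w) \<partial>M)" by (simp add: f_def mult_ac)
  also have "\<dots> = complex_of_real (exp (- (\<Sum>c<q. \<Sum>d<q. (t*h c)*(t*h d)*\<Omega> c d)/2))"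
   by (rule G[unfolded gaussian_vec_def, THEN conjunct2, THEN conjunct2, rule_format, of "\<lambda>c. t*h c"])
  also have "(\<Sum>c<q. \<Sum>d<q. (t*h c)*(t*h d)*\<Omega> c d) = t\<^sup>2*(\<Sum>c<q. \<Sum>d<q. h c*h d*\<Omega> c d)"
   by (simp add: sum_distrib_left power2_eq_square mult_ac)
  finally show ?thesis by (simp add: t)
 qed
 have fm: "(\<lambda>x. \<Sum>c<q. (t*X c (fst x))*(snd x) c) \<in> borel_measurable (M \<Otimes>\<^sub>M std_gaussian q)"
  by (intro borel_measurable_sum borel_measurable_times borel_measurable_const)
   (auto intro!: measurable_compose[OF measurable_fst X] measurable_compose[OF measurable_snd hm])
 have int: "integrable (M \<Otimes>\<^sub>M std_gaussian q) (\<lambda>x. f (fst x) (snd x))"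
  unfolding f_def by (rule integrable_iexp) (use fm in auto)
 have "complex_of_real (\<integral>w. exp (- s*(\<Sum>c<q. (X c w)\<^sup>2)) \<partial>M) = (\<integral>w. (\<integral>h. f w h \<partial>std_gaussian q) \<partial>M)"
  unfolding inner by (rule integral_complex_of_real[symmetric])
 also have "\<dots> = (\<integral>h. (\<integral>w. f w h \<partial>M) \<partial>std_gaussian q)"
  using int by (intro Fubini_integral[symmetric]) (simp add: case_prod_unfold)
 finally show ?thesis unfolding outer .
qed

text \<open>
The Laplace transform of the squared norm involves only the covariance, so the law does, too.
\<close>
lemma gaussian_vec_sq_norm_law:
 assumes G: "gaussian_vec M q X \<Omega>" and G': "gaussian_vec M' q' X' \<Omega>'" and q: "q = q'"
  and O: "\<And>c d. c < q \<Longrightarrow> d < q \<Longrightarrow> \<Omega> c d = \<Omega>' c d"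
 shows "distr M borel (\<lambda>w. \<Sum>c<q. (X c w)\<^sup>2) = distr M' borel (\<lambda>w. \<Sum>c<q. (X' c w)\<^sup>2)"
proof (rule distr_eq_of_laplace_eq)
 show "prob_space M" "prob_space M'" using G G' by (auto simp: gaussian_vec_def)
 show "(\<lambda>w. \<Sum>c<q. (X c w)\<^sup>2) \<in> borel_measurable M" "(\<lambda>w. \<Sum>c<q. (X' c w)\<^sup>2) \<in> borel_measurable M'"
  using G G' q by (auto simp: gaussian_vec_def intro!: borel_measurable_sum borel_measurable_power)
 fix k :: nat
 have "(\<Sum>c<q. \<Sum>d<q. h c*h d*\<Omega> c d) = (\<Sum>c<q. \<Sum>d<q. h c*h d*\<Omega>' c d)" for h
  using O by (intro sum.cong refl) auto
 then have "complex_of_real (\<integral>w. exp (- real k*(\<Sum>c<q. (X c w)\<^sup>2)) \<partial>M) = complex_of_real (\<integral>w. exp (- real k*(\<Sum>c<q. (X' c w)\<^sup>2)) \<partial>M')"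
  using gaussian_vec_laplace_sq_norm[OF G, of "real k"] gaussian_vec_laplace_sq_norm[OF G', of "real k"] q by simp
 then show "(\<integral>w. exp (- real k*(\<Sum>c<q. (X c w)\<^sup>2)) \<partial>M) = (\<integral>w. exp (- real k*(\<Sum>c<q. (X' c w)\<^sup>2)) \<partial>M')"
  using of_real_eq_iff by blast
qed (auto intro: sum_nonneg)

lemma char_weighted_normal_squares:
 "(\<integral>z. iexp (\<Sum>r<q. u r*(z r)\<^sup>2) \<partial>std_gaussian q) = (\<Prod>r<q. char (chi_square 1) (u r))"
proof -
 interpret N: prob_space std_normal_distribution by (rule prob_space_std_normal)
 interpret product_sigma_finite "\<lambda>_::nat. std_normal_distribution" ..
 have "(\<integral>z. iexp (\<Sum>r<q. u r*(z r)\<^sup>2) \<partial>std_gaussian q) = (\<integral>z. (\<Prod>r<q. iexp (u r*(z r)\<^sup>2)) \<partial>std_gaussian q)"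
  by (simp add: exp_sum[symmetric] sum_distrib_left)
 also have "\<dots> = (\<Prod>r<q. \<integral>x. iexp (u r*x\<^sup>2) \<partial>std_normal_distribution)"
  by (rule product_integral_prod) (auto intro!: N.integrable_iexp)
 also have "\<dots> = (\<Prod>r<q. char (chi_square 1) (u r))"
  unfolding char_def distr_normal_square[symmetric] by (simp add: integral_distr)
 finally show ?thesis .
qed

text \<open>
Another Gaussian vector with the same covariance has independent coordinates in an orthonormal
eigenbasis, which makes its squared norm a weighted sum of independent squares.
\<close>
lemma gaussian_vec_sq_norm_char:
 assumes G: "gaussian_vec M q X \<Omega>"
  and \<Omega>: "\<And>c d. c < q \<Longrightarrow> d < q \<Longrightarrow> \<Omega> c d = (\<Sum>r<q. l r*Q c r*Q d r)"
  and orth: "\<And>r s. r < q \<Longrightarrow> s < q \<Longrightarrow> (\<Sum>c<q. Q c r*Q c s) = (if r = s then 1 else 0)"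
  and l: "\<And>r. r < q \<Longrightarrow> 0 \<le> l r"
 shows "char (distr M borel (\<lambda>w. \<Sum>c<q. (X c w)\<^sup>2)) t = (\<Prod>r<q. char (chi_square 1) (t*l r))"
proof -
 define Y where "Y c z = (\<Sum>r<q. (Q c r * sqrt (l r))*z r)" for c and z :: "nat \<Rightarrow> real"
 have hm: "(\<lambda>z. z a) \<in> borel_measurable (std_gaussian q)" if "a < q" for a
  by (rule isotropicD(3)[OF isotropic_std_gaussian that])
 have Ym: "Y c \<in> borel_measurable (std_gaussian q)" for c
  unfolding Y_def by (rule isotropicD(4)[OF isotropic_std_gaussian])
 have "gaussian_vec (std_gaussian q) q Y \<Omega>" unfolding gaussian_vec_def
 proof (intro conjI allI impI prob_space_std_gaussian Ym)
  fix h :: "nat \<Rightarrow> real"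
  have e: "(\<Sum>c<q. h c*Y c z) = (\<Sum>r<q. (\<Sum>c<q. h c*Q c r * sqrt (l r))*z r)" for z
   unfolding Y_def sum_distrib_left sum_distrib_right by (subst sum.swap) (simp add: mult_ac)
  have "(\<Sum>r<q. (\<Sum>c<q. h c*Q c r * sqrt (l r))\<^sup>2) = (\<Sum>r<q. \<Sum>c<q. \<Sum>d<q. h c*h d*(l r*Q c r*Q d r))"
  proof (intro sum.cong refl)
   fix r assume "r \<in> {..<q}"
   then have "sqrt (l r) * sqrt (l r) = l r" using l by simp
   then have e: "(h c*Q c r * sqrt (l r))*(h d*Q d r * sqrt (l r)) = h c*h d*(l r*Q c r*Q d r)" for c d
    by (metis (no_types, opaque_lifting) mult.assoc mult.commute)
   then show "(\<Sum>c<q. h c*Q c r * sqrt (l r))\<^sup>2 = (\<Sum>c<q. \<Sum>d<q. h c*h d*(l r*Q c r*Q d r))"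
    unfolding power2_eq_square sum_product by (intro sum.cong refl) (rule e)
  qed
  also have "\<dots> = (\<Sum>c<q. \<Sum>r<q. \<Sum>d<q. h c*h d*(l r*Q c r*Q d r))" by (rule sum.swap)
  also have "\<dots> = (\<Sum>c<q. \<Sum>d<q. \<Sum>r<q. h c*h d*(l r*Q c r*Q d r))" by (intro sum.cong refl sum.swap)
  also have "\<dots> = (\<Sum>c<q. \<Sum>d<q. h c*h d*\<Omega> c d)" by (simp add: \<Omega> sum_distrib_left)
  finally show "(\<integral>z. iexp (\<Sum>c<q. h c*Y c z) \<partial>std_gaussian q) = complex_of_real (exp (- (\<Sum>c<q. \<Sum>d<q. h c*h d*\<Omega> c d)/2))"
   unfolding e std_gaussian_char_lin by simp
 qed
 then have "distr M borel (\<lambda>w. \<Sum>c<q. (X c w)\<^sup>2) = distr (std_gaussian q) borel (\<lambda>z. \<Sum>c<q. (Y c z)\<^sup>2)"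
  by (rule gaussian_vec_sq_norm_law[OF G _ refl refl])
 moreover have "(\<Sum>c<q. (Y c z)\<^sup>2) = (\<Sum>r<q. l r*(z r)\<^sup>2)" for z
 proof -
  have "(\<Sum>c<q. (Y c z)\<^sup>2) = (\<Sum>c<q. \<Sum>r<q. \<Sum>s<q. (sqrt (l r)*z r*(sqrt (l s)*z s))*(Q c r*Q c s))"
   unfolding Y_def by (simp add: power2_eq_square sum_product mult_ac)
  also have "\<dots> = (\<Sum>r<q. \<Sum>s<q. \<Sum>c<q. (sqrt (l r)*z r*(sqrt (l s)*z s))*(Q c r*Q c s))"
   by (subst sum.swap) (intro sum.cong refl sum.swap)
  also have "\<dots> = (\<Sum>r<q. \<Sum>s<q. (sqrt (l r)*z r*(sqrt (l s)*z s))*(if r = s then 1 else 0))"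
   by (intro sum.cong refl) (simp add: sum_distrib_left[symmetric] orth)
  also have "\<dots> = (\<Sum>r<q. l r*(z r)\<^sup>2)"
  proof (intro sum.cong refl)
   fix r assume r: "r \<in> {..<q}"
   then have "sqrt (l r) * sqrt (l r) = l r" using l by simp
   then have "sqrt (l r)*z r*(sqrt (l r)*z r) = l r*(z r)\<^sup>2"
    unfolding power2_eq_square by (metis (no_types, opaque_lifting) mult.assoc mult.commute)
   then show "(\<Sum>s<q. (sqrt (l r)*z r*(sqrt (l s)*z s))*(if r = s then 1 else 0)) = l r*(z r)\<^sup>2"
    using r by (simp add: if_distrib cong: if_cong)
  qed
  finally show ?thesis .
 qed
 ultimately have "char (distr M borel (\<lambda>w. \<Sum>c<q. (X c w)\<^sup>2)) t = char (distr (std_gaussian q) borel (\<lambda>z. \<Sum>r<q. l r*(z r)\<^sup>2)) t" by simp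
 also have "\<dots> = (\<integral>z. iexp (t*(\<Sum>r<q. l r*(z r)\<^sup>2)) \<partial>std_gaussian q)"
  unfolding char_def
  by (subst integral_distr) (auto intro!: borel_measurable_sum borel_measurable_times borel_measurable_power hm)
 also have "\<dots> = (\<integral>z. iexp (\<Sum>r<q. (t*l r)*(z r)\<^sup>2) \<partial>std_gaussian q)" by (simp add: sum_distrib_left mult.assoc)
 also have "\<dots> = (\<Prod>r<q. char (chi_square 1) (t*l r))" by (rule char_weighted_normal_squares)
 finally show ?thesis .
qed

lemma (in prob_space) expectation_abs_le_sqrt:
 fixes X :: "'a \<Rightarrow> real"
 assumes [measurable]: "X \<in> borel_measurable M" and i: "integrable M (\<lambda>w. (X w)\<^sup>2)"
 shows "integrable M X" "expectation (\<lambda>w. \<bar>X w\<bar>) \<le> sqrt (expectation (\<lambda>w. (X w)\<^sup>2))"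
proof -
 show "integrable M X" using integrable_mult_of_squares[of X "\<lambda>_. 1"] i by simp
 have "expectation (\<lambda>w. \<bar>X w\<bar>*1) \<le> sqrt (expectation (\<lambda>w. (X w)\<^sup>2))*1"
  using i by (intro expectation_mult_le_of_squares) (auto simp: prob_space)
 then show "expectation (\<lambda>w. \<bar>X w\<bar>) \<le> sqrt (expectation (\<lambda>w. (X w)\<^sup>2))" by simp
qed

section \<open>Sums of many small chi-square variables\<close>

lemma Ln_second_order:
 fixes z :: complex
 assumes z: "cmod z \<le> 1/2"
 shows "cmod (Ln (1 + z) - z + z\<^sup>2/2) \<le> cmod z ^ 3"
proof -
 define f where "f n = - ((- z) ^ n)/of_nat n" for n :: nat
 have "f sums Ln (1 + z)" unfolding f_def using Ln_series'[of z] z by simp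
 then have "(\<lambda>n. f (n + 3)) sums (Ln (1 + z) - (\<Sum>n<3. f n))" by (rule sums_split_initial_segment)
 moreover have "(\<Sum>n<3. f n) = z - z\<^sup>2/2" by (simp add: f_def numeral_3_eq_3 power2_eq_square)
 ultimately have 1: "(\<lambda>n. f (n + 3)) sums (Ln (1 + z) - z + z\<^sup>2/2)" by (simp add: algebra_simps)
 have "(\<lambda>n. cmod z ^ 3/2*(1/2) ^ n) sums (cmod z ^ 3/2*(1/(1 - 1/2)))"
  by (intro sums_mult geometric_sums) auto
 then have 2: "(\<lambda>n. cmod z ^ 3/2*(1/2) ^ n) sums (cmod z ^ 3)" by simp
 have "cmod (f (n + 3)) \<le> cmod z ^ 3/2*(1/2) ^ n" for n
 proof -
  have "cmod (f (n + 3)) = cmod z ^ 3*cmod z ^ n/(real n + 3)"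
   by (simp add: f_def norm_divide norm_power power_add[symmetric] add.commute del: power_Suc) (metis norm_of_nat of_nat_add of_nat_numeral)
  also have "\<dots> \<le> cmod z ^ 3*(1/2) ^ n/2"
   using z by (intro frac_le mult_left_mono mult_nonneg_nonneg power_mono) auto
  finally show ?thesis by simp
 qed
 then show ?thesis by (rule norm_sums_le[OF 1 2])
qed

text \<open>
The moments identify the Taylor polynomials of the characteristic function with partial sums of the
binomial series of \<open>(1 - 2 * i * t) powr (- v/2)\<close>.
\<close>
lemma char_chi_square_small:
 assumes v: "0 < v" and t: "\<bar>t\<bar> < 1/2"
 shows "char (chi_square v) t = exp (- (of_real v/2)*Ln (1 - 2*\<i> * of_real t))"
proof -
 interpret prob_space "chi_square v" by (rule prob_space_chi_square[OF v])
 define z where "z = - 2*\<i>*complex_of_real t"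
 define a where "a = - complex_of_real v/2"
 have z: "cmod z < 1" using t by (simp add: z_def norm_mult)
 have term_eq: "(a gchoose k)*z ^ k = (\<i> * of_real t) ^ k/fact k * of_real (expectation (\<lambda>x. x ^ k))" for k
 proof -
  have "(a gchoose k)*z ^ k = ((-1) ^ k*z ^ k)*pochhammer (of_real (v/2)) k/fact k"
   unfolding gbinomial_pochhammer a_def by simp
  also have "(-1) ^ k*z ^ k = (2*\<i> * of_real t) ^ k"
   unfolding z_def power_mult_distrib[symmetric] by simp
  also have "(2*\<i> * of_real t) ^ k*pochhammer (of_real (v/2)) k/fact k = (\<i> * of_real t) ^ k/fact k * of_real (2 ^ k*pochhammer (v/2) k)"
   using pochhammer_of_real[of "v/2" k, where 'a=complex] by (simp add: power_mult_distrib)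
  finally show ?thesis using chi_square_moment(2)[OF v, of k] by simp
 qed
 have binom: "(\<lambda>k. (a gchoose k)*z ^ k) sums (1 + z) powr a" by (rule gen_binomial_complex[OF z])
 then have lim: "(\<lambda>n. \<Sum>k\<le>n. (a gchoose k)*z ^ k) \<longlonglongrightarrow> (1 + z) powr a" by (simp add: sums_def_le)
 have bound: "cmod (char (chi_square v) t - (\<Sum>k\<le>n. (a gchoose k)*z ^ k)) \<le> cmod ((a gchoose Suc n)*z ^ Suc n)" for n
 proof -
  define P where "P x = (\<Sum>k\<le>n. (\<i>*complex_of_real (t*x)) ^ k/fact k)" for x
  have P2: "P x = (\<Sum>k\<le>n. (\<i> * of_real t) ^ k/fact k*complex_of_real (x ^ k))" for x
   unfolding P_def by (intro sum.cong refl) (simp add: power_mult_distrib mult_ac)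
  have ix: "integrable (chi_square v) (\<lambda>x. x ^ k)" for k by (rule chi_square_moment(1)[OF v])
  have iP: "integrable (chi_square v) P" unfolding P2
   by (intro Bochner_Integration.integrable_sum integrable_mult_right) (use ix in \<open>auto simp del: of_real_power\<close>)
  have eP: "expectation P = (\<Sum>k\<le>n. (a gchoose k)*z ^ k)" unfolding P2 term_eq using ix
   by (subst Bochner_Integration.integral_sum) (auto intro!: integrable_mult_right simp del: of_real_power)
  have ie: "integrable (chi_square v) (\<lambda>x. iexp (t*x))" by (rule integrable_iexp) auto
  have "char (chi_square v) t - (\<Sum>k\<le>n. (a gchoose k)*z ^ k) = expectation (\<lambda>x. iexp (t*x) - P x)"
   unfolding char_def eP[symmetric] using ie iP by simp
  also have "cmod \<dots> \<le> expectation (\<lambda>x. cmod (iexp (t*x) - P x))" by (rule integral_norm_bound)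
  also have "\<dots> \<le> expectation (\<lambda>x. \<bar>t\<bar> ^ Suc n/fact (Suc n)*x ^ Suc n)"
  proof (intro integral_mono_AE)
   show "AE x in chi_square v. cmod (iexp (t*x) - P x) \<le> \<bar>t\<bar> ^ Suc n/fact (Suc n)*x ^ Suc n"
    using AE_chi_square_pos[of v]
   proof eventually_elim
    case (elim x)
    have "cmod (iexp (t*x) - P x) \<le> \<bar>t*x\<bar> ^ Suc n/fact (Suc n)"
     unfolding P_def by (rule iexp_approx1)
    also have "\<bar>t*x\<bar> ^ Suc n = \<bar>t\<bar> ^ Suc n*x ^ Suc n" using elim by (simp add: abs_mult power_mult_distrib)
    finally show ?case by simp
   qed
   show "integrable (chi_square v) (\<lambda>x. \<bar>t\<bar> ^ Suc n/fact (Suc n)*x ^ Suc n)"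
    by (rule integrable_mult_right[OF ix])
  qed (use ie iP in auto)
  also have "\<dots> = \<bar>t\<bar> ^ Suc n/fact (Suc n)*expectation (\<lambda>x. x ^ Suc n)"
   by (rule integral_mult_right_zero)
  also have "\<dots> = cmod ((a gchoose Suc n)*z ^ Suc n)"
  proof -
   have "0 \<le> expectation (\<lambda>x. x ^ Suc n)"
    using AE_chi_square_pos[of v] by (intro integral_nonneg_AE) (auto elim!: eventually_mono)
   then show ?thesis unfolding term_eq
    by (simp add: norm_mult norm_divide norm_power del: power_Suc fact_Suc)
  qed
  finally show ?thesis .
 qed
 have "(\<lambda>n. cmod ((a gchoose Suc n)*z ^ Suc n)) \<longlonglongrightarrow> 0"
  using LIMSEQ_Suc[OF summable_LIMSEQ_zero[OF sums_summable[OF binom]]] by (rule tendsto_norm_zero)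
 then have "(\<lambda>n. char (chi_square v) t - (\<Sum>k\<le>n. (a gchoose k)*z ^ k)) \<longlonglongrightarrow> 0"
  by (rule Lim_null_comparison[rotated]) (use bound in auto)
 then have "(\<lambda>n. char (chi_square v) t - (char (chi_square v) t - (\<Sum>k\<le>n. (a gchoose k)*z ^ k))) \<longlonglongrightarrow> char (chi_square v) t - 0"
  by (intro tendsto_diff tendsto_const)
 then have "(\<lambda>n. \<Sum>k\<le>n. (a gchoose k)*z ^ k) \<longlonglongrightarrow> char (chi_square v) t" by simp
 with lim have "char (chi_square v) t = (1 + z) powr a" by (rule LIMSEQ_unique[rotated])
 also have "\<dots> = exp (a*Ln (1 + z))"
 proof -
  have "1 + z \<noteq> 0" using z by (metis add_eq_0_iff less_irrefl norm_minus_cancel norm_one)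
  then show ?thesis by (simp add: powr_def)
 qed
 finally show ?thesis by (simp add: a_def z_def)
qed

text \<open>
In the exponent of the centred variable the linear term cancels and \<open>- v * t\<^sup>2\<close>
remains up to a cubic error.
\<close>
lemma centred_char_chi_square:
 assumes v: "0 < v" and t: "\<bar>t\<bar> \<le> 1/4"
 shows "\<exists>E. cmod E \<le> 8*\<bar>t\<bar> ^ 3 \<and> char (chi_square v) t*iexp (- (v * t)) = exp (- of_real (v * t\<^sup>2) - of_real (v/2)*E)"
proof -
 define z where "z = - 2*\<i>*complex_of_real t"
 define E where "E = Ln (1 + z) - z + z\<^sup>2/2"
 have cz: "cmod z = 2*\<bar>t\<bar>" by (simp add: z_def norm_mult)
 have "cmod E \<le> cmod z ^ 3" unfolding E_def by (rule Ln_second_order) (use t cz in auto)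
 then have 1: "cmod E \<le> 8*\<bar>t\<bar> ^ 3" by (simp add: cz power_mult_distrib)
 have "z\<^sup>2 = - 4*(complex_of_real t)\<^sup>2" by (simp add: z_def power_mult_distrib)
 then have L: "Ln (1 + z) = E + z + 2*(complex_of_real t)\<^sup>2" unfolding E_def by simp
 have "char (chi_square v) t*iexp (- (v * t)) = exp (- (of_real v/2)*Ln (1 + z))*iexp (- (v * t))"
  using char_chi_square_small[OF v, of t] t by (simp add: z_def)
 also have "\<dots> = exp (- (of_real v/2)*Ln (1 + z) + \<i> * of_real (- (v * t)))" by (simp add: exp_add[symmetric])
 also have "- (of_real v/2)*Ln (1 + z) + \<i> * of_real (- (v * t)) = - of_real (v * t\<^sup>2) - of_real (v/2)*E"
  unfolding L by (simp add: z_def algebra_simps)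
 finally show ?thesis using 1 by blast
qed

lemma char_affine:
 assumes "prob_space M" and [measurable]: "X \<in> borel_measurable M"
 shows "char (distr M borel (\<lambda>w. (X w - a)*b)) t = (\<integral>w. iexp (t*b*X w) \<partial>M)*iexp (- (a*(t*b)))"
proof -
 have "iexp (t*((X w - a)*b)) = iexp (t*b*X w)*iexp (- (a*(t*b)))" for w
  by (simp add: exp_add[symmetric] algebra_simps)
 then show ?thesis unfolding char_def by (subst integral_distr) simp_all
qed

lemma char_standardized_chi_square:
 assumes v: "0 < v"
 shows "char (distr (chi_square v) borel (\<lambda>x. (x - v)*b)) t = char (chi_square v) (t*b)*iexp (- (v * (t*b)))"
 using char_affine[OF prob_space_chi_square[OF v], of "\<lambda>x. x" v b t] by (simp add: char_def)

text \<open>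
When all weights are small, the cubic errors are negligible against the sum of the squared weights,
and only the Gaussian exponent \<open>- t\<^sup>2/2\<close> survives.
\<close>
lemma chi_square_sum_clt:
 fixes \<rho> :: "nat \<Rightarrow> nat \<Rightarrow> real"
 assumes nn: "\<And>k r. r < p k \<Longrightarrow> 0 \<le> \<rho> k r" and v: "\<And>k. 0 < v k"
  and sq: "eventually (\<lambda>k. v k*(\<Sum>r<p k. (\<rho> k r)\<^sup>2) = 1) sequentially"
  and small: "\<And>e. e > 0 \<Longrightarrow> eventually (\<lambda>k. \<forall>r<p k. \<rho> k r \<le> e) sequentially"
 shows "(\<lambda>k. \<Prod>r<p k. char (chi_square (v k)) (t*\<rho> k r/sqrt 2)*iexp (- (v k*(t*\<rho> k r/sqrt 2)))) \<longlonglongrightarrow> char std_normal_distribution t"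
proof -
 define u where "u k r = t*\<rho> k r/sqrt 2" for k r
 define E where "E k r = (SOME E. cmod E \<le> 8*\<bar>u k r\<bar> ^ 3 \<and> char (chi_square (v k)) (u k r)*iexp (- (v k*u k r)) = exp (- of_real (v k*(u k r)\<^sup>2) - of_real (v k/2)*E))" for k r
 have E: "cmod (E k r) \<le> 8*\<bar>u k r\<bar> ^ 3 \<and> char (chi_square (v k)) (u k r)*iexp (- (v k*u k r)) = exp (- of_real (v k*(u k r)\<^sup>2) - of_real (v k/2)*E k r)"
  if "\<bar>u k r\<bar> \<le> 1/4" for k r
  unfolding E_def by (rule someI_ex) (rule centred_char_chi_square[OF v that])
 have small': "eventually (\<lambda>k. \<forall>r<p k. \<bar>u k r\<bar> \<le> e) sequentially" if e: "e > 0" for e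
 proof -
  have "eventually (\<lambda>k. \<forall>r<p k. \<rho> k r \<le> e/(\<bar>t\<bar> + 1)) sequentially" using e by (intro small) auto
  then show ?thesis
  proof eventually_elim
   case (elim k)
   show ?case
   proof (intro allI impI)
    fix r assume r: "r < p k"
    have "\<bar>u k r\<bar> = \<bar>t\<bar>*\<rho> k r/sqrt 2" using nn[OF r] by (simp add: u_def abs_mult)
    also have "\<dots> \<le> \<bar>t\<bar>*\<rho> k r/1" using nn[OF r] by (intro divide_left_mono) auto
    also have "\<dots> \<le> (\<bar>t\<bar> + 1)*(e/(\<bar>t\<bar> + 1))" proof -
     have "\<rho> k r \<le> e/(\<bar>t\<bar> + 1)" using elim r by blast
     then show ?thesis using nn[OF r] unfolding div_by_1 by (auto intro!: mult_mono simp del: times_divide_eq_right)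
    qed
    also have "\<dots> = e" by simp
    finally show "\<bar>u k r\<bar> \<le> e" .
   qed
  qed
 qed
 define R where "R k = - (of_real (v k/2)*(\<Sum>r<p k. E k r))" for k
 have prod: "eventually (\<lambda>k. (\<Prod>r<p k. char (chi_square (v k)) (u k r)*iexp (- (v k*u k r))) = exp (- of_real (t\<^sup>2/2) + R k)) sequentially"
  using small'[of "1/4", simplified] sq
 proof eventually_elim
  case (elim k)
  have "(\<Prod>r<p k. char (chi_square (v k)) (u k r)*iexp (- (v k*u k r))) = (\<Prod>r<p k. exp (- of_real (v k*(u k r)\<^sup>2) - of_real (v k/2)*E k r))"
   using elim E by (intro prod.cong refl) (simp del: of_real_mult of_real_minus)
  also have "\<dots> = exp (\<Sum>r<p k. - of_real (v k*(u k r)\<^sup>2) - of_real (v k/2)*E k r)" by (simp add: exp_sum)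
  also have "(\<Sum>r<p k. - of_real (v k*(u k r)\<^sup>2) - of_real (v k/2)*E k r) = - of_real (\<Sum>r<p k. v k*(u k r)\<^sup>2) + R k"
   unfolding R_def by (simp add: sum_subtractf sum_negf sum_distrib_left)
  also have "(\<Sum>r<p k. v k*(u k r)\<^sup>2) = t\<^sup>2/2*(v k*(\<Sum>r<p k. (\<rho> k r)\<^sup>2))"
   by (simp add: u_def power_mult_distrib power_divide sum_distrib_left mult_ac)
  finally show ?case using elim by simp
 qed
 have "R \<longlonglongrightarrow> 0"
 proof (rule tendstoI)
  fix e :: real assume e: "e > 0"
  define d where "d = e/(4*t\<^sup>2 + 4)"
  have d: "d > 0" using e by (simp add: d_def add_nonneg_pos)
  show "eventually (\<lambda>k. dist (R k) 0 < e) sequentially"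
   using small'[of "1/4", simplified] small'[OF d] sq
  proof eventually_elim
   case (elim k)
   have "cmod (R k) \<le> v k/2*(\<Sum>r<p k. cmod (E k r))"
    unfolding R_def norm_minus_cancel norm_mult using v[of k] sum_norm_le[of "{..<p k}" "E k" "\<lambda>r. cmod (E k r)"]
    by (auto intro!: mult_left_mono)
   also have "\<dots> \<le> v k/2*(\<Sum>r<p k. 8*d*(u k r)\<^sup>2)"
   proof (intro mult_left_mono sum_mono)
    fix r assume r: "r \<in> {..<p k}"
    have "cmod (E k r) \<le> 8*\<bar>u k r\<bar> ^ 3" using E[of k r] elim r by simp
    also have "\<dots> = 8*\<bar>u k r\<bar>*(u k r)\<^sup>2" by (simp add: power3_eq_cube power2_eq_square)
    also have "\<dots> \<le> 8*d*(u k r)\<^sup>2" using elim r by (intro mult_right_mono mult_left_mono) auto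
    finally show "cmod (E k r) \<le> 8*d*(u k r)\<^sup>2" .
   qed (use v[of k] in auto)
   also have "\<dots> = 2*d*t\<^sup>2*(v k*(\<Sum>r<p k. (\<rho> k r)\<^sup>2))"
    by (simp add: u_def power_mult_distrib power_divide sum_distrib_left mult_ac)
   also have "\<dots> = 2*d*t\<^sup>2" using elim by simp
   also have "\<dots> < e"
   proof -
    have "2*t\<^sup>2*e < e*(4*t\<^sup>2 + 4)" using e zero_le_power2[of t] by (simp add: algebra_simps add_pos_nonneg add_strict_increasing)
    then show ?thesis unfolding d_def by (simp add: divide_less_eq mult_ac add_nonneg_pos)
   qed
   finally show ?case by simp
  qed
 qed
 then have "(\<lambda>k. exp (- of_real (t\<^sup>2/2) + R k)) \<longlonglongrightarrow> exp (- of_real (t\<^sup>2/2) + 0)" by (intro tendsto_intros)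
 then have "(\<lambda>k. exp (- of_real (t\<^sup>2/2) + R k)) \<longlonglongrightarrow> char std_normal_distribution t"
  unfolding char_std_normal_distribution by (simp add: exp_of_real[symmetric])
 then show ?thesis using prod unfolding u_def by (simp add: tendsto_cong)
qed

lemma standardized_chi_square_weak_conv_normal:
 assumes v: "\<And>k. 0 < v k" and lim: "filterlim v at_top sequentially"
 shows "weak_conv_m (\<lambda>k. distr (chi_square (v k)) borel (\<lambda>x. (x - v k)*(1/sqrt (2 * v k)))) std_normal_distribution"
proof (rule levy_continuity)
 show "real_distribution (distr (chi_square (v n)) borel (\<lambda>x. (x - v n)*(1/sqrt (2 * v n))))" for n
  by (rule prob_space.real_distribution_distr[OF prob_space_chi_square[OF v]]) simp
 show "real_distribution std_normal_distribution" by (rule real_dist_normal_dist)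
 fix t
 define \<rho> where "\<rho> k r = 1/sqrt (v k)" for k and r :: nat
 have "(\<lambda>k. \<Prod>r<Suc 0. char (chi_square (v k)) (t*\<rho> k r/sqrt 2)*iexp (- (v k*(t*\<rho> k r/sqrt 2)))) \<longlonglongrightarrow> char std_normal_distribution t"
 proof (rule chi_square_sum_clt[where p = "\<lambda>_. Suc 0", OF _ v])
  show "0 \<le> \<rho> k r" for k r using v[of k] by (simp add: \<rho>_def)
  show "\<forall>\<^sub>F k in sequentially. v k*(\<Sum>r<Suc 0. (\<rho> k r)\<^sup>2) = 1"
   using v by (intro always_eventually allI) (simp add: \<rho>_def power_divide less_imp_le less_imp_neq[symmetric])
  fix e :: real assume e: "e > 0"
  have "eventually (\<lambda>k. v k \<ge> (1/e)\<^sup>2) sequentially" using lim by (simp add: filterlim_at_top)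
  then show "\<forall>\<^sub>F k in sequentially. \<forall>r<Suc 0. \<rho> k r \<le> e"
  proof eventually_elim
   case (elim k)
   then have "1/e \<le> sqrt (v k)" using e real_le_rsqrt by blast
   then show ?case using e v[of k] by (auto simp: \<rho>_def field_simps)
  qed
 qed
 then show "(\<lambda>n. char (distr (chi_square (v n)) borel (\<lambda>x. (x - v n)*(1/sqrt (2 * v n)))) t) \<longlonglongrightarrow> char std_normal_distribution t"
  unfolding char_standardized_chi_square[OF v] by (simp add: \<rho>_def real_sqrt_mult mult_ac)
qed

section \<open>Mixtures of centred chi-square variables\<close>

abbreviation chi_seq :: "(nat \<Rightarrow> real) measure" where
 "chi_seq \<equiv> PiM UNIV (\<lambda>_::nat. chi_square 1)"

lemma prob_space_chi_square_1: "prob_space (chi_square 1)" by (rule prob_space_chi_square) simp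

lemma prob_space_chi_seq: "prob_space chi_seq" by (intro prob_space_PiM prob_space_chi_square_1)

lemma distr_chi_seq_component: "distr chi_seq (chi_square 1) (\<lambda>A. A r) = chi_square 1"
 by (intro distr_PiM_component prob_space_chi_square_1) auto

lemma chi_seq_abs_dev:
 "integrable chi_seq (\<lambda>A. A r - 1)" "(\<integral>A. \<bar>A r - 1\<bar> \<partial>chi_seq) \<le> 2"
proof -
 have m: "(\<lambda>A. A r) \<in> measurable chi_seq (chi_square 1)" by (rule measurable_component_singleton) simp
 have "integrable (chi_square 1) (\<lambda>x. x - 1)"
  using chi_square_mean_var(1)[of 1] prob_space.finite_measure[OF prob_space_chi_square_1]
  by (auto intro!: Bochner_Integration.integrable_diff finite_measure.integrable_const)
 then have "integrable (distr chi_seq (chi_square 1) (\<lambda>A. A r)) (\<lambda>x. x - 1)" unfolding distr_chi_seq_component .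
 then show "integrable chi_seq (\<lambda>A. A r - 1)" by (rule integrable_distr[OF m])
 have "(\<integral>A. \<bar>A r - 1\<bar> \<partial>chi_seq) = (\<integral>x. \<bar>x - 1\<bar> \<partial>distr chi_seq (chi_square 1) (\<lambda>A. A r))"
  by (rule integral_distr[OF m, symmetric]) measurable
 also have "\<dots> \<le> 2" unfolding distr_chi_seq_component using chi_square_abs_dev[of 1] by simp
 finally show "(\<integral>A. \<bar>A r - 1\<bar> \<partial>chi_seq) \<le> 2" .
qed

text \<open>The absolute series has finite expectation.\<close>
lemma AE_chi_seq_summable:
 assumes \<rho>: "\<And>r. 0 \<le> \<rho> r" "summable \<rho>"
 shows "AE A in chi_seq. summable (\<lambda>r. \<rho> r*(A r - 1)/sqrt 2)"
proof -
 interpret prob_space chi_seq by (rule prob_space_chi_seq)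
 have "(\<integral>\<^sup>+A. (\<Sum>r. ennreal (\<rho> r*\<bar>A r - 1\<bar>)) \<partial>chi_seq) = (\<Sum>r. \<integral>\<^sup>+A. ennreal (\<rho> r*\<bar>A r - 1\<bar>) \<partial>chi_seq)"
  by (rule nn_integral_suminf) measurable
 also have "\<dots> \<le> (\<Sum>r. ennreal (2*\<rho> r))"
 proof (intro suminf_le allI)
  fix r
  have "(\<integral>\<^sup>+A. ennreal (\<rho> r*\<bar>A r - 1\<bar>) \<partial>chi_seq) = ennreal (\<integral>A. \<rho> r*\<bar>A r - 1\<bar> \<partial>chi_seq)"
   using \<rho>(1)[of r] chi_seq_abs_dev(1)[of r] by (intro nn_integral_eq_integral) auto
  also have "\<dots> \<le> ennreal (2*\<rho> r)"
   using mult_left_mono[OF chi_seq_abs_dev(2)[of r] \<rho>(1)[of r]] by (intro ennreal_leI) (simp add: mult.commute)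
  finally show "(\<integral>\<^sup>+A. ennreal (\<rho> r*\<bar>A r - 1\<bar>) \<partial>chi_seq) \<le> ennreal (2*\<rho> r)" .
 qed auto
 also have "\<dots> = ennreal (\<Sum>r. 2*\<rho> r)" using \<rho> by (intro suminf_ennreal2) auto
 finally have "(\<integral>\<^sup>+A. (\<Sum>r. ennreal (\<rho> r*\<bar>A r - 1\<bar>)) \<partial>chi_seq) \<noteq> \<infinity>" by (auto simp: top_unique)
 then have "AE A in chi_seq. (\<Sum>r. ennreal (\<rho> r*\<bar>A r - 1\<bar>)) \<noteq> \<infinity>" by (intro nn_integral_PInf_AE) auto
 then show ?thesis
 proof eventually_elim
  case (elim A)
  have "summable (\<lambda>r. \<rho> r*\<bar>A r - 1\<bar>)" using elim \<rho>(1) by (intro summable_suminf_not_top) auto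
  then have "summable (\<lambda>r. norm (\<rho> r*(A r - 1)))" using \<rho>(1) by (simp add: abs_mult)
  then have "summable (\<lambda>r. \<rho> r*(A r - 1))" by (rule summable_norm_cancel)
  then show ?case by (rule summable_divide)
 qed
qed

lemma chi_mixture_measurable[measurable]: "(\<lambda>A. \<Sum>r. \<rho> r*(A r - 1)/sqrt 2) \<in> borel_measurable chi_seq"
 by measurable

lemma real_distribution_chi_square_mixture: "real_distribution (chi_square_mixture \<rho>)"
 unfolding chi_square_mixture_def
 by (rule prob_space.real_distribution_distr[OF prob_space_chi_seq]) simp

text \<open>
The characteristic function of \<open>(A - 1)/sqrt 2\<close> for a chi-square variable
\<open>A\<close> with one degree of freedom.
\<close>
definition chi_factor :: "real \<Rightarrow> complex" where
 "chi_factor u = char (chi_square 1) (u/sqrt 2)*iexp (- (u/sqrt 2))"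

lemma chi_factor_integral: "chi_factor u = (\<integral>x. iexp (u*((x - 1)/sqrt 2)) \<partial>chi_square 1)"
proof -
 have "iexp (u*((x - 1)/sqrt 2)) = iexp (u/sqrt 2*x)*iexp (- (u/sqrt 2))" for x
  by (simp add: exp_add[symmetric] algebra_simps diff_divide_distrib)
 then show ?thesis unfolding chi_factor_def char_def by simp
qed

lemma cmod_chi_factor_le: "cmod (chi_factor u) \<le> 1"
 using real_distribution.cmod_char_le_1[of "chi_square 1" "u/sqrt 2"] prob_space_chi_square_1
 by (simp add: chi_factor_def norm_mult real_distribution_def real_distribution_axioms_def)

lemma iexp_lipschitz: "cmod (iexp x - iexp y) \<le> \<bar>x - y\<bar>"
proof -
 have "iexp y*iexp (x - y) = iexp x" unfolding exp_add[symmetric] by (simp add: algebra_simps)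
 then have "iexp x - iexp y = iexp y*(iexp (x - y) - 1)" by (simp only: right_diff_distrib mult_1_right)
 then have "cmod (iexp x - iexp y) = cmod (iexp (x - y) - 1)" by (simp add: norm_mult)
 also have "\<dots> \<le> \<bar>x - y\<bar>" using iexp_approx1[of "x - y" 0] by simp
 finally show ?thesis .
qed

lemma chi_factor_lipschitz: "cmod (chi_factor u - chi_factor w) \<le> 2*\<bar>u - w\<bar>"
proof -
 interpret prob_space "chi_square 1" by (rule prob_space_chi_square_1)
 have ie: "integrable (chi_square 1) (\<lambda>x. iexp (c*((x - 1)/sqrt 2)))" for c
 proof (rule integrable_iexp)
  show "(\<lambda>x. complex_of_real (c*((x - 1)/sqrt 2))) \<in> borel_measurable (chi_square 1)" by measurable
 qed simp
 have i1: "integrable (chi_square 1) (\<lambda>x. \<bar>x - 1\<bar>)" using chi_square_mean_var(1)[of 1] by auto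
 have "cmod (chi_factor u - chi_factor w) = cmod (\<integral>x. iexp (u*((x - 1)/sqrt 2)) - iexp (w*((x - 1)/sqrt 2)) \<partial>chi_square 1)"
  unfolding chi_factor_integral using ie by simp
 also have "\<dots> \<le> (\<integral>x. cmod (iexp (u*((x - 1)/sqrt 2)) - iexp (w*((x - 1)/sqrt 2))) \<partial>chi_square 1)"
  by (rule integral_norm_bound)
 also have "\<dots> \<le> (\<integral>x. \<bar>u - w\<bar>*\<bar>x - 1\<bar> \<partial>chi_square 1)"
 proof (intro integral_mono)
  fix x :: real
  have "cmod (iexp (u*((x - 1)/sqrt 2)) - iexp (w*((x - 1)/sqrt 2))) \<le> \<bar>u*((x - 1)/sqrt 2) - w*((x - 1)/sqrt 2)\<bar>"
   by (rule iexp_lipschitz)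
  also have "\<dots> = \<bar>u - w\<bar>*\<bar>x - 1\<bar>/sqrt 2" by (simp add: left_diff_distrib[symmetric] diff_divide_distrib[symmetric] abs_mult)
  also have "\<dots> \<le> \<bar>u - w\<bar>*\<bar>x - 1\<bar>/1" by (intro divide_left_mono) auto
  finally show "cmod (iexp (u*((x - 1)/sqrt 2)) - iexp (w*((x - 1)/sqrt 2))) \<le> \<bar>u - w\<bar>*\<bar>x - 1\<bar>" by simp
 qed (use ie i1 in auto)
 also have "\<dots> = \<bar>u - w\<bar>*(\<integral>x. \<bar>x - 1\<bar> \<partial>chi_square 1)" by simp
 also have "\<dots> \<le> \<bar>u - w\<bar>*2" using chi_square_abs_dev[of 1] by (intro mult_left_mono) auto
 finally show ?thesis by (simp add: mult.commute)
qed

lemma char_chi_partial_sum: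
 "char (distr chi_seq borel (\<lambda>A. \<Sum>r<n. \<rho> r*(A r - 1)/sqrt 2)) t = (\<Prod>r<n. chi_factor (t*\<rho> r))"
proof -
 interpret prob_space chi_seq by (rule prob_space_chi_seq)
 have "indep_vars (\<lambda>_. chi_square 1) (\<lambda>r A. A r) UNIV"
  by (rule indep_vars_PiM_coordinates) (auto intro: prob_space_chi_square_1)
 then have "indep_vars (\<lambda>_. chi_square 1) (\<lambda>r A. A r) {..<n}" by (rule indep_vars_subset) auto
 then have "indep_vars (\<lambda>_. borel) (\<lambda>r A. \<rho> r*(A r - 1)/sqrt 2) {..<n}"
  by (rule indep_vars_compose2) measurable
 then have "char (distr chi_seq borel (\<lambda>A. \<Sum>r<n. \<rho> r*(A r - 1)/sqrt 2)) t =
  (\<Prod>r<n. char (distr chi_seq borel (\<lambda>A. \<rho> r*(A r - 1)/sqrt 2)) t)"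
  by (rule char_distr_sum)
 also have "\<dots> = (\<Prod>r<n. chi_factor (t*\<rho> r))"
 proof (intro prod.cong refl)
  fix r
  have m: "(\<lambda>A. A r) \<in> measurable chi_seq (chi_square 1)" by (rule measurable_component_singleton) simp
  have "char (distr chi_seq borel (\<lambda>A. \<rho> r*(A r - 1)/sqrt 2)) t = (\<integral>A. iexp (t*\<rho> r*((A r - 1)/sqrt 2)) \<partial>chi_seq)"
   unfolding char_def by (subst integral_distr) (auto simp: mult_ac)
  also have "\<dots> = (\<integral>x. iexp (t*\<rho> r*((x - 1)/sqrt 2)) \<partial>distr chi_seq (chi_square 1) (\<lambda>A. A r))"
   by (rule integral_distr[OF m, symmetric]) measurable
  finally show "char (distr chi_seq borel (\<lambda>A. \<rho> r*(A r - 1)/sqrt 2)) t = chi_factor (t*\<rho> r)"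
   unfolding distr_chi_seq_component chi_factor_integral .
 qed
 finally show ?thesis .
qed

text \<open>Partial sums converge almost surely, so dominated convergence applies.\<close>
lemma char_chi_square_mixture_limit:
 assumes \<rho>: "\<And>r. 0 \<le> \<rho> r" "summable \<rho>"
 shows "(\<lambda>n. \<Prod>r<n. chi_factor (t*\<rho> r)) \<longlonglongrightarrow> char (chi_square_mixture \<rho>) t"
proof -
 interpret prob_space chi_seq by (rule prob_space_chi_seq)
 have "(\<lambda>n. \<integral>A. iexp (t*(\<Sum>r<n. \<rho> r*(A r - 1)/sqrt 2)) \<partial>chi_seq) \<longlonglongrightarrow> (\<integral>A. iexp (t*(\<Sum>r. \<rho> r*(A r - 1)/sqrt 2)) \<partial>chi_seq)"
 proof (rule integral_dominated_convergence[where w="\<lambda>_. 1"])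
  show "AE A in chi_seq. (\<lambda>n. iexp (t*(\<Sum>r<n. \<rho> r*(A r - 1)/sqrt 2))) \<longlonglongrightarrow> iexp (t*(\<Sum>r. \<rho> r*(A r - 1)/sqrt 2))"
   using AE_chi_seq_summable[OF \<rho>]
  proof eventually_elim
   case (elim A)
   then have "(\<lambda>n. \<Sum>r<n. \<rho> r*(A r - 1)/sqrt 2) \<longlonglongrightarrow> (\<Sum>r. \<rho> r*(A r - 1)/sqrt 2)" by (rule summable_LIMSEQ)
   then show ?case by (intro tendsto_intros)
  qed
 qed auto
 moreover have "(\<integral>A. iexp (t*(\<Sum>r<n. \<rho> r*(A r - 1)/sqrt 2)) \<partial>chi_seq) = (\<Prod>r<n. chi_factor (t*\<rho> r))" for n
  unfolding char_chi_partial_sum[symmetric] char_def by (subst integral_distr) auto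
 moreover have "(\<integral>A. iexp (t*(\<Sum>r. \<rho> r*(A r - 1)/sqrt 2)) \<partial>chi_seq) = char (chi_square_mixture \<rho>) t"
  unfolding chi_square_mixture_def char_def by (subst integral_distr) auto
 ultimately show ?thesis by simp
qed

text \<open>
Scheffe's argument: for nonnegative rows whose sums converge to the sum of the limits, pointwise
convergence implies convergence of the sums of absolute differences. It suffices to control the
negative parts, which the limiting sequence dominates.
\<close>
lemma l1_convergence_of_rows:
 fixes a :: "nat \<Rightarrow> nat \<Rightarrow> real"
 assumes nn: "\<And>k r. r < p k \<Longrightarrow> 0 \<le> a k r" and \<rho>: "\<And>r. 0 \<le> \<rho> r" "summable \<rho>"
  and p: "filterlim p at_top sequentially"
  and pt: "\<And>r. (\<lambda>k. a k r) \<longlonglongrightarrow> \<rho> r"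
  and sum: "(\<lambda>k. \<Sum>r<p k. a k r) \<longlonglongrightarrow> (\<Sum>r. \<rho> r)"
 shows "(\<lambda>k. \<Sum>r<p k. \<bar>a k r - \<rho> r\<bar>) \<longlonglongrightarrow> 0"
proof -
 define N where "N k = (\<Sum>r<p k. max 0 (\<rho> r - a k r))" for k
 have N0: "N \<longlonglongrightarrow> 0"
 proof (rule tendstoI)
  fix e :: real assume e: "e > 0"
  have "(\<lambda>n. \<Sum>r. \<rho> (r + n)) \<longlonglongrightarrow> 0" by (rule suminf_exist_split2[OF \<rho>(2)])
  then obtain R where R: "(\<Sum>r. \<rho> (r + R)) < e/2"
   using order_tendstoD(2)[of _ 0 sequentially "e/2"] e unfolding eventually_sequentially by (metis half_gt_zero order_refl)
  have "(\<lambda>k. \<Sum>r<R. max 0 (\<rho> r - a k r)) \<longlonglongrightarrow> (\<Sum>r<R. max 0 (\<rho> r - \<rho> r))"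
   by (intro tendsto_sum tendsto_max tendsto_diff tendsto_const pt)
  then have "(\<lambda>k. \<Sum>r<R. max 0 (\<rho> r - a k r)) \<longlonglongrightarrow> 0" by simp
  then have "eventually (\<lambda>k. (\<Sum>r<R. max 0 (\<rho> r - a k r)) < e/2) sequentially" using e by (intro order_tendstoD) auto
  moreover have "eventually (\<lambda>k. R \<le> p k) sequentially" using p by (simp add: filterlim_at_top)
  ultimately show "eventually (\<lambda>k. dist (N k) 0 < e) sequentially"
  proof eventually_elim
   case (elim k)
   have "N k = (\<Sum>r<R. max 0 (\<rho> r - a k r)) + (\<Sum>r=R..<p k. max 0 (\<rho> r - a k r))"
    unfolding N_def lessThan_atLeast0 using elim(2) by (simp add: sum.atLeastLessThan_concat)
   also have "(\<Sum>r=R..<p k. max 0 (\<rho> r - a k r)) \<le> (\<Sum>r=R..<p k. \<rho> r)"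
    using nn \<rho>(1) by (intro sum_mono) auto
   also have "\<dots> = (\<Sum>r<p k - R. \<rho> (r + R))"
    using elim(2) sum.shift_bounds_nat_ivl[of \<rho> 0 R "p k - R"] by (simp add: atLeast0LessThan)
   also have "\<dots> \<le> (\<Sum>r. \<rho> (r + R))" using \<rho> by (intro sum_le_suminf) (auto simp: summable_iff_shift)
   finally have "N k < e" using elim(1) R by simp
   moreover have "N k \<ge> 0" unfolding N_def by (intro sum_nonneg) auto
   ultimately show ?case by simp
  qed
 qed
 have S: "(\<lambda>k. \<Sum>r<p k. \<rho> r) \<longlonglongrightarrow> (\<Sum>r. \<rho> r)"
  using filterlim_compose[OF summable_LIMSEQ[OF \<rho>(2)] p] .
 have "(\<lambda>k. (\<Sum>r<p k. a k r) - (\<Sum>r<p k. \<rho> r) + 2*N k) \<longlonglongrightarrow> (\<Sum>r. \<rho> r) - (\<Sum>r. \<rho> r) + 2*0"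
  by (intro tendsto_intros sum S N0)
 moreover have "(\<Sum>r<p k. a k r) - (\<Sum>r<p k. \<rho> r) + 2*N k = (\<Sum>r<p k. \<bar>a k r - \<rho> r\<bar>)" for k
  unfolding N_def sum_subtractf[symmetric] sum_distrib_left sum.distrib[symmetric]
  by (intro sum.cong refl) (auto simp: max_def abs_if)
 ultimately show ?thesis by simp
qed

text \<open>
Factors are Lipschitz and bounded by one, so products differ by at most the sum of the differences
of their arguments.
\<close>
lemma chi_factor_prod_tendsto_mixture:
 fixes a :: "nat \<Rightarrow> nat \<Rightarrow> real"
 assumes nn: "\<And>k r. r < p k \<Longrightarrow> 0 \<le> a k r" and \<rho>: "\<And>r. 0 \<le> \<rho> r" "summable \<rho>"
  and p: "filterlim p at_top sequentially"
  and pt: "\<And>r. (\<lambda>k. a k r) \<longlonglongrightarrow> \<rho> r"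
  and sum: "(\<lambda>k. \<Sum>r<p k. a k r) \<longlonglongrightarrow> (\<Sum>r. \<rho> r)"
 shows "(\<lambda>k. \<Prod>r<p k. chi_factor (t*a k r)) \<longlonglongrightarrow> char (chi_square_mixture \<rho>) t"
proof -
 have 1: "(\<lambda>k. \<Prod>r<p k. chi_factor (t*\<rho> r)) \<longlonglongrightarrow> char (chi_square_mixture \<rho>) t"
  using filterlim_compose[OF char_chi_square_mixture_limit[OF \<rho>] p] .
 have "(\<lambda>k. 2*\<bar>t\<bar>*(\<Sum>r<p k. \<bar>a k r - \<rho> r\<bar>)) \<longlonglongrightarrow> 2*\<bar>t\<bar>*0"
  by (intro tendsto_intros l1_convergence_of_rows[OF assms])
 then have z: "(\<lambda>k. 2*\<bar>t\<bar>*(\<Sum>r<p k. \<bar>a k r - \<rho> r\<bar>)) \<longlonglongrightarrow> 0" by simp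
 have "(\<lambda>k. (\<Prod>r<p k. chi_factor (t*a k r)) - (\<Prod>r<p k. chi_factor (t*\<rho> r))) \<longlonglongrightarrow> 0"
 proof (rule Lim_null_comparison[OF always_eventually z], intro allI)
  fix k
  have "cmod ((\<Prod>r<p k. chi_factor (t*a k r)) - (\<Prod>r<p k. chi_factor (t*\<rho> r))) \<le> (\<Sum>r<p k. cmod (chi_factor (t*a k r) - chi_factor (t*\<rho> r)))"
   by (rule norm_prod_diff) (auto intro: cmod_chi_factor_le)
  also have "\<dots> \<le> (\<Sum>r<p k. 2*\<bar>t*a k r - t*\<rho> r\<bar>)" by (intro sum_mono chi_factor_lipschitz)
  also have "\<dots> = 2*\<bar>t\<bar>*(\<Sum>r<p k. \<bar>a k r - \<rho> r\<bar>)"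
   unfolding sum_distrib_left by (intro sum.cong refl) (simp add: right_diff_distrib[symmetric] abs_mult)
  finally show "cmod ((\<Prod>r<p k. chi_factor (t*a k r)) - (\<Prod>r<p k. chi_factor (t*\<rho> r))) \<le> 2*\<bar>t\<bar>*(\<Sum>r<p k. \<bar>a k r - \<rho> r\<bar>)" .
 qed
 from tendsto_add[OF this 1] show ?thesis by simp
qed

text \<open>
Fubini, with the first coordinate split off: conditionally on the others, the series is an affine
function of it.
\<close>
lemma emeasure_chi_square_mixture_split:
 assumes \<rho>: "\<And>r. 0 \<le> \<rho> r" "summable \<rho>" and B: "B \<in> sets borel"
 shows "emeasure (chi_square_mixture \<rho>) B =
  (\<integral>\<^sup>+A. emeasure (chi_square 1) {a. \<rho> 0*(a - 1)/sqrt 2 + (\<Sum>r. \<rho> (Suc r)*(A r - 1)/sqrt 2) \<in> B} \<partial>chi_seq)"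
proof -
 interpret C: prob_space "chi_square 1" by (rule prob_space_chi_square_1)
 interpret S: prob_space chi_seq by (rule prob_space_chi_seq)
 interpret sequence_space "chi_square 1" ..
 interpret CS: pair_sigma_finite "chi_square 1" chi_seq ..
 let ?Z = "\<lambda>A. \<Sum>r. \<rho> r*(A r - 1)/sqrt 2"
 let ?Y = "\<lambda>A. \<Sum>r. \<rho> (Suc r)*(A r - 1)/sqrt 2"
 have cn: "(\<lambda>(s, \<omega>). case_nat s \<omega>) \<in> measurable (chi_square 1 \<Otimes>\<^sub>M chi_seq) chi_seq"
 proof (rule measurable_PiM_single')
  show "(\<lambda>\<omega>. (case \<omega> of (s, \<omega>) \<Rightarrow> case_nat s \<omega>) i) \<in> measurable (chi_square 1 \<Otimes>\<^sub>M chi_seq) (chi_square 1)" for i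
   by (cases i) (auto simp: case_prod_unfold cong: measurable_cong_sets)
 qed (auto simp: space_PiM)
 have Zm: "?Z \<in> borel_measurable chi_seq" by (rule chi_mixture_measurable)
 have Ym: "?Y \<in> borel_measurable chi_seq" by (rule chi_mixture_measurable[of "\<lambda>r. \<rho> (Suc r)"])
 have m2[measurable]: "(\<lambda>w. \<rho> 0*(fst w - 1)/sqrt 2 + ?Y (snd w)) \<in> borel_measurable (chi_square 1 \<Otimes>\<^sub>M chi_seq)"
  using measurable_compose[OF measurable_snd Ym] by measurable
 have "emeasure (chi_square_mixture \<rho>) B = (\<integral>\<^sup>+A. indicator B (?Z A) \<partial>chi_seq)"
  unfolding chi_square_mixture_def using B
  by (subst nn_integral_indicator[symmetric], simp, subst nn_integral_distr) auto
 also have "\<dots> = (\<integral>\<^sup>+A. indicator B (?Z A) \<partial>distr (chi_square 1 \<Otimes>\<^sub>M chi_seq) chi_seq (\<lambda>(s, \<omega>). case_nat s \<omega>))"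
  by (subst PiM_iter) simp
 also have "\<dots> = (\<integral>\<^sup>+w. indicator B (?Z (case_nat (fst w) (snd w))) \<partial>(chi_square 1 \<Otimes>\<^sub>M chi_seq))"
  using B by (subst nn_integral_distr[OF cn]) (auto simp: case_prod_unfold)
 also have "\<dots> = (\<integral>\<^sup>+w. indicator B (\<rho> 0*(fst w - 1)/sqrt 2 + ?Y (snd w)) \<partial>(chi_square 1 \<Otimes>\<^sub>M chi_seq))"
 proof (rule nn_integral_cong_AE)
  have sS: "AE A in chi_seq. summable (\<lambda>r. \<rho> (Suc r)*(A r - 1)/sqrt 2)"
   using \<rho> by (intro AE_chi_seq_summable) (auto simp: summable_Suc_iff)
  from AE_pair_snd[OF prob_space_chi_square_1 prob_space_chi_seq this]
  have "AE w in chi_square 1 \<Otimes>\<^sub>M chi_seq. summable (\<lambda>r. \<rho> (Suc r)*(snd w r - 1)/sqrt 2)" .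
  then show "AE w in chi_square 1 \<Otimes>\<^sub>M chi_seq. (indicator B (?Z (case_nat (fst w) (snd w))) :: ennreal) = indicator B (\<rho> 0*(fst w - 1)/sqrt 2 + ?Y (snd w))"
  proof eventually_elim
   case (elim w)
   let ?f = "\<lambda>r. \<rho> r*(case_nat (fst w) (snd w) r - 1)/sqrt 2"
   have "summable ?f" using elim by (subst summable_Suc_iff[symmetric]) simp
   then have "suminf ?f = ?f 0 + (\<Sum>r. ?f (Suc r))" by (subst suminf_split_head) auto
   then show ?case by simp
  qed
 qed
 also have "\<dots> = (\<integral>\<^sup>+A. \<integral>\<^sup>+a. indicator B (\<rho> 0*(a - 1)/sqrt 2 + ?Y A) \<partial>chi_square 1 \<partial>chi_seq)"
  using B by (subst CS.nn_integral_snd[symmetric]) auto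
 also have "\<dots> = (\<integral>\<^sup>+A. emeasure (chi_square 1) {a. \<rho> 0*(a - 1)/sqrt 2 + ?Y A \<in> B} \<partial>chi_seq)"
 proof (intro nn_integral_cong)
  fix A
  have "{a. \<rho> 0*(a - 1)/sqrt 2 + ?Y A \<in> B} = (\<lambda>a. \<rho> 0*(a - 1)/sqrt 2 + ?Y A) -` B \<inter> space borel" by auto
  also have "\<dots> \<in> sets borel" using B by (intro measurable_sets) auto
  finally have "{a. \<rho> 0*(a - 1)/sqrt 2 + ?Y A \<in> B} \<in> sets (chi_square 1)" by simp
  then show "(\<integral>\<^sup>+a. indicator B (\<rho> 0*(a - 1)/sqrt 2 + ?Y A) \<partial>chi_square 1) = emeasure (chi_square 1) {a. \<rho> 0*(a - 1)/sqrt 2 + ?Y A \<in> B}"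
   by (subst nn_integral_indicator[symmetric], assumption) (intro nn_integral_cong, simp add: indicator_def)
 qed
 finally show ?thesis .
qed

lemma chi_square_interval_pos:
 assumes v: "0 < v" shows "emeasure (chi_square v) {c..} > 0"
proof (rule ccontr)
 assume "\<not> ?thesis"
 then have "emeasure (chi_square v) {c..} = 0" by simp
 then have "AE x in chi_square v. x \<notin> {c..}" by (subst AE_iff_measurable[of "{c..}"]) auto
 then have "AE x in lborel. 0 < chi_density v x \<longrightarrow> x \<notin> {c..}" unfolding chi_square_density by (subst (asm) AE_density) auto
 then have "AE x in lborel. x \<notin> {max c 0 <..max c 0 + 1}"
  by eventually_elim (use chi_density_pos[OF v] in auto)
 then have "emeasure lborel {max c 0 <..max c 0 + 1} = 0"
  by (subst (asm) AE_iff_measurable[of "{max c 0 <..max c 0 + 1}"]) auto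
 then show False by simp
qed

lemma chi_square_singleton: "emeasure (chi_square v) {x} = 0"
proof -
 have "AE t in lborel. t \<noteq> x" by (rule AE_lborel_singleton)
 then have "(\<integral>\<^sup>+t. ennreal (chi_density v t)*indicator {x} t \<partial>lborel) = 0"
  by (subst nn_integral_0_iff_AE) (auto elim!: eventually_mono)
 then show ?thesis unfolding chi_square_density by (simp add: emeasure_density)
qed

text \<open>
A positive first weight suffices: conditionally on the other coordinates, the law is an affine image
of a chi-square law, which has no atoms and charges every right half-line.
\<close>
lemma chi_square_mixture_continuous_positive:
 assumes \<rho>: "\<And>r. 0 \<le> \<rho> r" "summable \<rho>" and \<rho>0: "0 < \<rho> 0"
 shows "isCont (cdf (chi_square_mixture \<rho>)) x" "0 < measure (chi_square_mixture \<rho>) {x..}"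
proof -
 interpret real_distribution "chi_square_mixture \<rho>" by (rule real_distribution_chi_square_mixture)
 let ?Y = "\<lambda>A. \<Sum>r. \<rho> (Suc r)*(A r - 1)/sqrt 2"
 have eq1: "{a. \<rho> 0*(a - 1)/sqrt 2 + y \<in> {x}} = {1 + (x - y) * sqrt 2/\<rho> 0}" for y
  using \<rho>0 by (auto simp: field_simps)
 have eq2: "{a. \<rho> 0*(a - 1)/sqrt 2 + y \<in> {x..}} = {1 + (x - y) * sqrt 2/\<rho> 0..}" for y
  using \<rho>0 by (auto simp: field_simps)
 have "emeasure (chi_square_mixture \<rho>) {x} = 0"
  by (subst emeasure_chi_square_mixture_split[OF \<rho>]) (simp_all add: eq1[simplified] chi_square_singleton)
 then show "isCont (cdf (chi_square_mixture \<rho>)) x" by (simp add: isCont_cdf measure_def)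
 have "emeasure (chi_square_mixture \<rho>) {x..} \<noteq> 0"
 proof
  assume z: "emeasure (chi_square_mixture \<rho>) {x..} = 0"
  have Ym[measurable]: "?Y \<in> borel_measurable chi_seq" by (rule chi_mixture_measurable[of "\<lambda>r. \<rho> (Suc r)"])
  have e: "emeasure (chi_square 1) {c..} = ennreal (1 - measure (chi_square 1) {..<c})" for c
  proof -
   interpret C: prob_space "chi_square 1" by (rule prob_space_chi_square_1)
   have "- {..<c} = {c..}" by auto
   then show ?thesis using C.prob_compl[of "{..<c}"] by (simp add: C.emeasure_eq_measure Compl_eq_Diff_UNIV)
  qed
  have mono: "(\<lambda>c. measure (chi_square 1) {..<c}) \<in> borel_measurable borel"
  proof (rule borel_measurable_mono, rule monoI)
   interpret C: prob_space "chi_square 1" by (rule prob_space_chi_square_1)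
   show "measure (chi_square 1) {..<c} \<le> measure (chi_square 1) {..<d}" if "c \<le> d" for c d
    using that by (intro C.finite_measure_mono) auto
  qed
  have m: "(\<lambda>A. emeasure (chi_square 1) {1 + (x - ?Y A) * sqrt 2/\<rho> 0..}) \<in> borel_measurable chi_seq"
   unfolding e using mono by measurable
  have "(\<integral>\<^sup>+A. emeasure (chi_square 1) {1 + (x - ?Y A) * sqrt 2/\<rho> 0..} \<partial>chi_seq) = 0"
   using z by (subst (asm) emeasure_chi_square_mixture_split[OF \<rho>]) (simp_all add: eq2[simplified])
  then have "AE A in chi_seq. emeasure (chi_square 1) {1 + (x - ?Y A) * sqrt 2/\<rho> 0..} = 0"
   using m by (subst (asm) nn_integral_0_iff_AE) auto
  then have "AE A in chi_seq. False"
  proof eventually_elim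
   case (elim A)
   then show ?case using chi_square_interval_pos[of 1 "1 + (x - ?Y A) * sqrt 2/\<rho> 0"] by simp
  qed
  then show False using prob_space.AE_False[OF prob_space_chi_seq] by blast
 qed
 then show "0 < measure (chi_square_mixture \<rho>) {x..}"
  by (simp add: emeasure_eq_measure zero_less_measure_iff)
qed

section \<open>Percentiles of F distributions\<close>

lemma cdf_density_strict:
 fixes f :: "real \<Rightarrow> real"
 assumes [measurable]: "f \<in> borel_measurable borel" and prob: "prob_space (density lborel (\<lambda>x. ennreal (f x)))"
  and pos: "\<And>x. l < x \<Longrightarrow> 0 < f x" and xy: "x < y" "l < y"
 shows "cdf (density lborel (\<lambda>x. ennreal (f x))) x < cdf (density lborel (\<lambda>x. ennreal (f x))) y"
proof -
 let ?M = "density lborel (\<lambda>x. ennreal (f x))"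
 interpret prob_space ?M by fact
 define x' where "x' = max x l"
 have x': "x' < y" "x \<le> x'" "l \<le> x'" using xy by (auto simp: x'_def)
 have "emeasure ?M {x'<..y} \<noteq> 0"
 proof
  assume "emeasure ?M {x'<..y} = 0"
  then have "(\<integral>\<^sup>+t. ennreal (f t)*indicator {x'<..y} t \<partial>lborel) = 0" by (simp add: emeasure_density)
  then have "AE t in lborel. ennreal (f t)*indicator {x'<..y} t = 0" by (subst (asm) nn_integral_0_iff_AE) auto
  then have "AE t in lborel. t \<notin> {x'<..y}"
  proof eventually_elim
   case (elim t)
   show ?case
   proof
    assume t: "t \<in> {x'<..y}"
    then have "f t > 0" using x' by (intro pos) auto
    with elim t show False by (simp add: indicator_def)
   qed
  qed
  then have "emeasure lborel {x'<..y} = 0"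
   by (subst (asm) AE_iff_measurable[of "{x'<..y}"]) auto
  then show False using x' by simp
 qed
 then have "0 < measure ?M {x'<..y}" by (simp add: measure_eq_emeasure_eq_ennreal emeasure_eq_measure zero_less_measure_iff)
 also have "\<dots> \<le> measure ?M {x<..y}" using x' by (intro finite_measure_mono) auto
 also have "\<dots> = cdf ?M y - cdf ?M x"
 proof -
  have "{..y} = {..x} \<union> {x<..y}" "{..x} \<inter> {x<..y} = {}" using xy by auto
  then have "measure ?M {..y} = measure ?M {..x} + measure ?M {x<..y}"
   using finite_measure_Union[of "{..x}" "{x<..y}"] by auto
  then show ?thesis by (simp add: cdf_def)
 qed
 finally show ?thesis by simp
qed

lemma density_no_atom:
 assumes [measurable]: "f \<in> borel_measurable borel"
 shows "measure (density lborel (\<lambda>x. ennreal (f x))) {x} = 0"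
proof -
 have "AE t in lborel. t \<noteq> x" by (rule AE_lborel_singleton)
 then have "(\<integral>\<^sup>+t. ennreal (f t)*indicator {x} t \<partial>lborel) = 0"
  by (subst nn_integral_0_iff_AE) (auto elim!: eventually_mono)
 then show ?thesis by (simp add: measure_def emeasure_density)
qed

lemma cdf_affine:
 assumes M: "real_distribution M" and b: "0 < b"
 shows "cdf (distr M borel (\<lambda>x. (x - a)*b)) y = cdf M (a + y/b)"
proof -
 interpret real_distribution M by fact
 have "cdf (distr M borel (\<lambda>x. (x - a)*b)) y = measure M ((\<lambda>x. (x - a)*b) -` {..y} \<inter> space M)"
  unfolding cdf_def by (rule measure_distr) auto
 also have "(\<lambda>x. (x - a)*b) -` {..y} \<inter> space M = {..a + y/b}" using b by (auto simp: field_simps)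
 finally show ?thesis by (simp add: cdf_def)
qed

lemma real_distribution_chi_square: "0 < v \<Longrightarrow> real_distribution (chi_square v)"
 by (simp add: real_distribution_def real_distribution_axioms_def prob_space_chi_square)

lemma cdf_chi_square_strict:
 assumes v: "0 < v" and xy: "x < y" "0 < cdf (chi_square v) x"
 shows "cdf (chi_square v) x < cdf (chi_square v) y"
proof -
 have "0 < y"
 proof (rule ccontr)
  assume "\<not> 0 < y"
  then have "x < 0" using xy by simp
  have "AE t in chi_square v. t \<notin> {..x}" using AE_chi_square_pos[of v] by eventually_elim (use \<open>x < 0\<close> in auto)
  then have "emeasure (chi_square v) {..x} = 0" by (subst (asm) AE_iff_measurable[of "{..x}"]) auto
  then show False using xy by (simp add: cdf_def measure_def)
 qed
 then show ?thesis unfolding chi_square_density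
  using prob_space_chi_square[OF v] xy unfolding chi_square_density
  by (intro cdf_density_strict[where l=0]) (auto simp: chi_density_pos v)
qed

lemma cdf_normal_strict: "x < y \<Longrightarrow> cdf std_normal_distribution x < cdf std_normal_distribution y"
 using cdf_density_strict[of std_normal_density "x - 1" x y] prob_space_normal_density[of 1 0]
 by (auto simp: normal_density_pos)

lemma isCont_cdf_normal: "isCont (cdf std_normal_distribution) x"
proof -
 interpret real_distribution std_normal_distribution by (rule real_dist_normal_dist)
 show ?thesis using isCont_cdf density_no_atom[of std_normal_density x] by simp
qed

lemma isCont_cdf_chi_square: "0 < v \<Longrightarrow> isCont (cdf (chi_square v)) x"
proof -
 assume v: "0 < v"
 interpret real_distribution "chi_square v" by (rule real_distribution_chi_square[OF v])
 show ?thesis using isCont_cdf density_no_atom[of "chi_density v" x] unfolding chi_square_density by simp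
qed

text \<open>
Densities with parameters in a compact interval are dominated by a multiple of the sum of the
densities at its two ends.
\<close>
lemma cdf_chi_square_tendsto:
 assumes v: "\<And>k. 0 < v k" and D: "v \<longlonglongrightarrow> D" "0 < D" and x: "x \<longlonglongrightarrow> x0"
 shows "(\<lambda>k. cdf (chi_square (v k)) (x k)) \<longlonglongrightarrow> cdf (chi_square D) x0"
proof -
 define K where "K w = 2 powr (w/2)*Gamma (w/2)" for w :: real
 have Kpos: "K w > 0" if "w > 0" for w using that by (auto simp: K_def intro!: mult_pos_pos Gamma_real_pos)
 have KD: "(\<lambda>k. K (v k)) \<longlonglongrightarrow> K D" unfolding K_def
  using D(2) by (intro tendsto_intros D(1)) (auto elim!: nonpos_Ints_cases)
 have ev: "eventually (\<lambda>k. v k > D/2 \<and> v k < 2*D \<and> K (v k) > K D/2) sequentially"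
  using order_tendstoD(1)[OF D(1), of "D/2"] order_tendstoD(2)[OF D(1), of "2*D"] order_tendstoD(1)[OF KD, of "K D/2"] D(2) Kpos[OF D(2)]
  by (auto elim!: eventually_elim2 eventually_rev_mp simp: eventually_conj_iff)
 then obtain N where N: "\<And>k. k \<ge> N \<Longrightarrow> v k > D/2 \<and> v k < 2*D \<and> K (v k) > K D/2"
  unfolding eventually_sequentially by blast
 have cdf_int: "cdf (chi_square w) y = (\<integral>t. chi_density w t*indicator {..y} t \<partial>lborel)" if "0 < w" for w y
 proof -
  interpret prob_space "chi_square w" by (rule prob_space_chi_square[OF that])
  have "cdf (chi_square w) y = (\<integral>t. indicator {..y} t \<partial>chi_square w)" by (simp add: cdf_def)
  also have "\<dots> = (\<integral>t. chi_density w t*indicator {..y} t \<partial>lborel)"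
   unfolding chi_square_density by (subst integral_density) (auto simp: chi_density_nonneg)
  finally show ?thesis .
 qed
 have intd: "integrable lborel (chi_density w)" if w: "0 < w" for w
  using prob_space.emeasure_space_1[OF prob_space_chi_square[OF w]]
  unfolding chi_square_density
  by (intro integrableI_nonneg) (auto simp: emeasure_density chi_density_nonneg)
 define w where "w t = (2/K D)*(K (D/2)*chi_density (D/2) t + K (2*D)*chi_density (2*D) t)" for t
 have "(\<lambda>k. \<integral>t. chi_density (v (k + N)) t*indicator {..x (k + N)} t \<partial>lborel) \<longlonglongrightarrow> (\<integral>t. chi_density D t*indicator {..x0} t \<partial>lborel)"
 proof (rule integral_dominated_convergence[where w=w])
  show "integrable lborel w" unfolding w_def using D(2) by (intro integrable_mult_right Bochner_Integration.integrable_add intd) auto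
  show "AE t in lborel. (\<lambda>k. chi_density (v (k + N)) t*indicator {..x (k + N)} t) \<longlonglongrightarrow> chi_density D t*indicator {..x0} t"
   using AE_lborel_singleton[of x0]
  proof eventually_elim
   case (elim t)
   have x': "(\<lambda>k. x (k + N)) \<longlonglongrightarrow> x0" and v': "(\<lambda>k. v (k + N)) \<longlonglongrightarrow> D" and K': "(\<lambda>k. K (v (k + N))) \<longlonglongrightarrow> K D"
    using x D(1) KD by (auto intro: LIMSEQ_ignore_initial_segment)
   have "eventually (\<lambda>k. indicator {..x (k + N)} t = (indicator {..x0} t :: real)) sequentially"
   proof (cases "t < x0")
    case True
    from order_tendstoD(1)[OF x' True] show ?thesis by eventually_elim (use True in \<open>simp add: indicator_def\<close>)
   next
    case False
    then have "x0 < t" using elim by simp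
    from order_tendstoD(2)[OF x' this] show ?thesis by eventually_elim (use \<open>x0 < t\<close> in \<open>simp add: indicator_def\<close>)
   qed
   then have i: "(\<lambda>k. indicator {..x (k + N)} t :: real) \<longlonglongrightarrow> indicator {..x0} t" by (rule tendsto_eventually)
   have "(\<lambda>k. chi_density (v (k + N)) t) \<longlonglongrightarrow> chi_density D t"
   proof (cases "0 < t")
    case True
    have "(\<lambda>k. t powr (v (k + N)/2 - 1)*exp (- t/2)/K (v (k + N))) \<longlonglongrightarrow> t powr (D/2 - 1)*exp (- t/2)/K D"
     using True Kpos[OF D(2)] by (intro tendsto_intros v' K') auto
    then show ?thesis using True v D(2) by (simp add: chi_density_def K_def)
   qed (simp add: chi_density_def)
   then show ?case by (intro tendsto_mult i)
  qed
  show "AE t in lborel. norm (chi_density (v (k + N)) t*indicator {..x (k + N)} t) \<le> w t" for k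
  proof (intro AE_I2)
   fix t :: real
   have vk: "v (k + N) > D/2" "v (k + N) < 2*D" "K (v (k + N)) > K D/2" using N[of "k + N"] by auto
   have "norm (chi_density (v (k + N)) t*indicator {..x (k + N)} t) \<le> chi_density (v (k + N)) t"
    using chi_density_nonneg[of "v (k + N)" t] by (auto simp: indicator_def)
   also have "\<dots> \<le> w t"
   proof (cases "0 < t")
    case True
    have pw: "t powr (v (k + N)/2 - 1) \<le> t powr (D/4 - 1) + t powr (D - 1)"
    proof (cases "t \<le> 1")
     case True
     then have "t powr (v (k + N)/2 - 1) \<le> t powr (D/4 - 1)" using \<open>0 < t\<close> vk by (intro powr_mono') auto
     then show ?thesis using powr_ge_zero[of t "D - 1"] by linarith
    next
     case False
     then have "t powr (v (k + N)/2 - 1) \<le> t powr (D - 1)" using vk by (intro powr_mono) auto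
     then show ?thesis using powr_ge_zero[of t "D/4 - 1"] by linarith
    qed
    have "chi_density (v (k + N)) t = t powr (v (k + N)/2 - 1)*exp (- t/2)/K (v (k + N))"
     using True v by (simp add: chi_density_def K_def)
    also have "\<dots> \<le> (t powr (D/4 - 1) + t powr (D - 1))*exp (- t/2)/(K D/2)"
     using vk Kpos[OF D(2)] by (intro frac_le mult_right_mono pw mult_nonneg_nonneg add_nonneg_nonneg) auto
    also have "\<dots> = w t"
    proof -
     have "Gamma (D/4) > 0" "Gamma D > 0" using D(2) by (auto intro: Gamma_real_pos)
     then have G: "Gamma (D/4) \<noteq> 0" "Gamma D \<noteq> 0" by auto
     have "K (D/2)*chi_density (D/2) t = t powr (D/4 - 1)*exp (- t/2)"
      using True D(2) G by (simp add: chi_density_def K_def)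
     moreover have "K (2*D)*chi_density (2*D) t = t powr (D - 1)*exp (- t/2)"
      using True D(2) G by (simp add: chi_density_def K_def)
     ultimately show ?thesis unfolding w_def by (simp add: distrib_right)
    qed
    finally show ?thesis .
   qed (use Kpos[of "D/2"] Kpos[of "2*D"] Kpos[OF D(2)] D(2) in \<open>simp add: chi_density_def w_def\<close>)
   finally show "norm (chi_density (v (k + N)) t*indicator {..x (k + N)} t) \<le> w t" .
  qed
 qed auto
 then have "(\<lambda>k. cdf (chi_square (v (k + N))) (x (k + N))) \<longlonglongrightarrow> cdf (chi_square D) x0"
  using cdf_int v D(2) by simp
 then show ?thesis by (rule LIMSEQ_offset)
qed

lemma standardized_chi_square_weak_conv:
 assumes v: "\<And>k. 0 < v k" and D: "v \<longlonglongrightarrow> D" "0 < D"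
 shows "weak_conv_m (\<lambda>k. distr (chi_square (v k)) borel (\<lambda>x. (x - v k)*(1/sqrt (2 * v k)))) (distr (chi_square D) borel (\<lambda>x. (x - D)*(1/sqrt (2*D))))"
 unfolding weak_conv_m_def weak_conv_def
proof (intro allI impI)
 fix y
 have "(\<lambda>k. cdf (chi_square (v k)) (v k + y/(1/sqrt (2 * v k)))) \<longlonglongrightarrow> cdf (chi_square D) (D + y/(1/sqrt (2*D)))"
  using D(2) by (intro cdf_chi_square_tendsto v D tendsto_intros) auto
 then show "(\<lambda>k. cdf (distr (chi_square (v k)) borel (\<lambda>x. (x - v k)*(1/sqrt (2 * v k)))) y) \<longlonglongrightarrow> cdf (distr (chi_square D) borel (\<lambda>x. (x - D)*(1/sqrt (2*D)))) y"
  using v D(2) by (simp add: cdf_affine real_distribution_chi_square del: times_divide_eq_right)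
qed

text \<open>
The event that the F ratio exceeds \<open>1 + sqrt (2/v1) * y\<close> compares the standardized
numerator with \<open>y\<close> plus \<open>sqrt (v1/2)\<close> times the deviation of the
normalized denominator from one. That deviation is of order \<open>sqrt (1/v2)\<close> and therefore
negligible.
\<close>
lemma F_upper_tendsto:
 assumes v: "\<And>k. 0 < v1 k" "\<And>k. 0 < v2 k" and \<alpha>: "0 < \<alpha>" "\<alpha> < 1"
  and weak: "weak_conv_m (\<lambda>k. distr (chi_square (v1 k)) borel (\<lambda>x. (x - v1 k)*(1/sqrt (2 * v1 k)))) \<mu>"
  and \<mu>: "real_distribution \<mu>" and cont: "\<And>x. isCont (cdf \<mu>) x"
  and strict: "\<And>x y. x < y \<Longrightarrow> 0 < cdf \<mu> x \<Longrightarrow> cdf \<mu> x < cdf \<mu> y"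
  and ratio: "(\<lambda>k. v1 k/v2 k) \<longlonglongrightarrow> 0" and low: "0 < b" "\<And>k. b \<le> v1 k"
 shows "(\<lambda>k. (F_upper (v1 k) (v2 k) \<alpha> - 1)/sqrt (2/v1 k)) \<longlonglongrightarrow> upper_percentile \<mu> \<alpha>"
 unfolding F_upper_def
proof (rule upper_percentile_tendsto[OF \<mu> strict])
 let ?M = "\<lambda>k. chi_square (v1 k) \<Otimes>\<^sub>M chi_square (v2 k)"
 have P1: "prob_space (chi_square (v1 k))" and P2: "prob_space (chi_square (v2 k))" for k using prob_space_chi_square v by auto
 have P: "prob_space (?M k)" for k using P1 P2 by (intro prob_space_pair)
 have Fm: "(\<lambda>(a, b). (a/v1 k)/(b/v2 k)) \<in> borel_measurable (?M k)" for k by measurable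
 show "prob_space (F_distribution (v1 k) (v2 k))" for k
  unfolding F_distribution_def by (rule prob_space.prob_space_distr[OF P Fm])
 show "sets (F_distribution (v1 k) (v2 k)) = sets borel" for k by (simp add: F_distribution_def)
 show "0 < sqrt (2/v1 k)" for k using v by simp
 fix y
 define U where "U k w = (fst w - v1 k)*(1/sqrt (2 * v1 k))" for k and w :: "real \<times> real"
 define g where "g k = 1 + sqrt (2/v1 k)*y" for k
 define V where "V k w = y + sqrt (v1 k/2)*g k*(snd w/v2 k - 1)" for k and w :: "real \<times> real"
 have Um[measurable]: "U k \<in> borel_measurable (?M k)" and Vm[measurable]: "V k \<in> borel_measurable (?M k)" for k
  unfolding U_def V_def by measurable
 have dU: "distr (?M k) borel (U k) = distr (chi_square (v1 k)) borel (\<lambda>x. (x - v1 k)*(1/sqrt (2 * v1 k)))" for k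
 proof -
  interpret P2: prob_space "chi_square (v2 k)" by (rule P2)
  have "distr (?M k) borel (U k) = distr (distr (?M k) (chi_square (v1 k)) fst) borel (\<lambda>x. (x - v1 k)*(1/sqrt (2 * v1 k)))"
   by (subst distr_distr) (auto simp: U_def[abs_def] o_def)
  then show ?thesis by (simp add: P2.distr_pair_fst)
 qed
 have Vp: "tendsto_in_prob ?M V y"
 proof (rule in_prob_of_L1[OF P])
  have i: "integrable (?M k) (\<lambda>w. snd w/v2 k - 1) \<and> (\<integral>w. \<bar>snd w/v2 k - 1\<bar> \<partial>?M k) \<le> sqrt (2/v2 k)" for k
  proof -
   interpret P1: prob_space "chi_square (v1 k)" by (rule P1)
   interpret P2: prob_space "chi_square (v2 k)" by (rule P2)
   interpret pair_prob_space "chi_square (v1 k)" "chi_square (v2 k)" ..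
   note m = chi_square_mean_var[OF v(2)[of k]]
   have e: "(x/v2 k - 1)\<^sup>2 = (1/(v2 k)\<^sup>2)*(x - v2 k)\<^sup>2" for x
    using v(2)[of k] by (simp add: power2_eq_square field_simps)
   have dsnd: "distr (?M k) (chi_square (v2 k)) snd = chi_square (v2 k)" by (rule distr_pair_snd[OF P1 P2])
   have i0: "integrable (chi_square (v2 k)) (\<lambda>x. x/v2 k - 1)" using m by auto
   then have "integrable (distr (?M k) (chi_square (v2 k)) snd) (\<lambda>x. x/v2 k - 1)" unfolding dsnd .
   then have 1: "integrable (?M k) (\<lambda>w. snd w/v2 k - 1)" by (rule integrable_distr[rotated]) auto
   have "(\<integral>w. \<bar>snd w/v2 k - 1\<bar> \<partial>?M k) = (\<integral>x. \<bar>x/v2 k - 1\<bar> \<partial>distr (?M k) (chi_square (v2 k)) snd)"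
    by (subst integral_distr) auto
   also have "\<dots> = P2.expectation (\<lambda>x. \<bar>x/v2 k - 1\<bar>*1)" unfolding dsnd by simp
   also have "\<dots> \<le> sqrt (2/v2 k)*1"
   proof (rule P2.expectation_mult_le_of_squares)
    show "P2.expectation (\<lambda>x. \<bar>x/v2 k - 1\<bar>\<^sup>2) \<le> (sqrt (2/v2 k))\<^sup>2"
    proof -
     have "P2.expectation (\<lambda>x. \<bar>x/v2 k - 1\<bar>\<^sup>2) = 2 * v2 k/(v2 k)\<^sup>2" using m by (simp add: e)
     also have "\<dots> = 2/v2 k" using v(2)[of k] by (simp add: power2_eq_square)
     finally show ?thesis using v(2)[of k] by simp
    qed
    show "integrable (chi_square (v2 k)) (\<lambda>w. \<bar>w/v2 k - 1\<bar>\<^sup>2)" using m by (simp add: e)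
   qed (use v(2)[of k] P2.prob_space in auto)
   finally show ?thesis using 1 by simp
  qed
  show "integrable (?M k) (V k)" for k
  proof -
   interpret prob_space "?M k" by (rule P)
   show ?thesis unfolding V_def using i[of k] by auto
  qed
  show "(\<lambda>k. \<integral>w. \<bar>V k w - y\<bar> \<partial>?M k) \<longlonglongrightarrow> 0"
  proof (rule tendsto_sandwich[OF _ _ tendsto_const])
   have gb: "\<bar>g k\<bar> \<le> 1 + sqrt (2/b)*\<bar>y\<bar>" for k
   proof -
    have "sqrt (2/v1 k) \<le> sqrt (2/b)" using low v(1)[of k] by (simp add: frac_le)
    then have "sqrt (2/v1 k)*\<bar>y\<bar> \<le> sqrt (2/b)*\<bar>y\<bar>" by (rule mult_right_mono) simp
    moreover have "\<bar>g k\<bar> \<le> 1 + sqrt (2/v1 k)*\<bar>y\<bar>" unfolding g_def using v(1)[of k]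
     by (intro order_trans[OF abs_triangle_ineq]) (simp add: abs_mult)
    ultimately show ?thesis by linarith
   qed
   have "(\<lambda>k. (1 + sqrt (2/b)*\<bar>y\<bar>) * sqrt (v1 k/v2 k)) \<longlonglongrightarrow> (1 + sqrt (2/b)*\<bar>y\<bar>) * sqrt 0"
    by (intro tendsto_intros ratio)
   then show "(\<lambda>k. (1 + sqrt (2/b)*\<bar>y\<bar>) * sqrt (v1 k/v2 k)) \<longlonglongrightarrow> 0" by simp
   show "\<forall>\<^sub>F k in sequentially. (\<integral>w. \<bar>V k w - y\<bar> \<partial>?M k) \<le> (1 + sqrt (2/b)*\<bar>y\<bar>) * sqrt (v1 k/v2 k)"
   proof (intro always_eventually allI)
    fix k
    have s: "0 \<le> sqrt (v1 k/2)" using v(1)[of k] by simp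
    have "(\<integral>w. \<bar>V k w - y\<bar> \<partial>?M k) = (sqrt (v1 k/2)*\<bar>g k\<bar>)*(\<integral>w. \<bar>snd w/v2 k - 1\<bar> \<partial>?M k)"
     unfolding V_def using s by (simp add: abs_mult)
    also have "\<dots> \<le> (sqrt (v1 k/2)*(1 + sqrt (2/b)*\<bar>y\<bar>)) * sqrt (2/v2 k)"
     using s gb[of k] i[of k] low(1) by (intro mult_mono mult_left_mono) (auto intro!: mult_nonneg_nonneg add_nonneg_nonneg)
    also have "\<dots> = (1 + sqrt (2/b)*\<bar>y\<bar>)*(sqrt (v1 k/2) * sqrt (2/v2 k))" by simp
    also have "sqrt (v1 k/2) * sqrt (2/v2 k) = sqrt (v1 k/v2 k)" by (simp add: real_sqrt_mult[symmetric])
    finally show "(\<integral>w. \<bar>V k w - y\<bar> \<partial>?M k) \<le> (1 + sqrt (2/b)*\<bar>y\<bar>) * sqrt (v1 k/v2 k)" .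
   qed
  qed (auto intro!: always_eventually integral_nonneg_AE)
 qed
 have "(\<lambda>k. measure (?M k) {w \<in> space (?M k). U k w > V k w}) \<longlonglongrightarrow> 1 - cdf \<mu> y"
 proof (rule slutsky_tail_fixed[OF P Um Vm _ cont Vp])
  show "weak_conv_m (\<lambda>k. distr (?M k) borel (U k)) \<mu>" unfolding dU by (rule weak)
  show "{w \<in> space (?M k). V k w < U k w} \<in> sets (?M k)" for k by measurable
 qed auto
 moreover have "measure (F_distribution (v1 k) (v2 k)) {1 + sqrt (2/v1 k)*y<..} = measure (?M k) {w \<in> space (?M k). U k w > V k w}" for k
 proof -
  interpret P1: prob_space "chi_square (v1 k)" by (rule P1)
  interpret P2: prob_space "chi_square (v2 k)" by (rule P2)
  interpret PP: pair_prob_space "chi_square (v1 k)" "chi_square (v2 k)" ..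
  have "AE w in ?M k. 0 < snd w"
   by (rule AE_pair_snd[OF P1 P2 AE_chi_square_pos])
  then have ae: "AE w in ?M k. ((fst w/v1 k)/(snd w/v2 k) > g k) = (U k w > V k w)"
  proof eventually_elim
   case (elim w)
   have v: "0 < v1 k" "0 < v2 k" using assms(1,2) by auto
   define s where "s = sqrt (v1 k/2)"
   have s: "s > 0" "s * s = v1 k/2" using v by (auto simp: s_def)
   have s2: "sqrt (2/v1 k) = 1/s" by (simp add: s_def real_sqrt_divide)
   have s3: "1/sqrt (2 * v1 k) = s/v1 k"
   proof -
    have "sqrt (2 * v1 k) * s = v1 k" using v by (simp add: s_def real_sqrt_mult[symmetric] power2_eq_square[symmetric])
    then show ?thesis using v s by (simp add: field_simps)
   qed
   have Ue: "U k w = s*(fst w/v1 k - 1)" unfolding U_def s3 using v by (simp add: field_simps)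
   have Ve: "V k w = s*(g k*(snd w/v2 k) - 1)"
    unfolding V_def g_def s2 s_def[symmetric] using s v by (simp add: field_simps)
   have pos: "snd w/v2 k > 0" using elim v by simp
   have "((fst w/v1 k)/(snd w/v2 k) > g k) = (fst w/v1 k > g k*(snd w/v2 k))"
    by (simp only: pos_less_divide_eq[OF pos])
   also have "\<dots> = (U k w > V k w)" unfolding Ue Ve using s by (simp add: mult_less_cancel_left_pos)
   finally show ?case .
  qed
  have "measure (F_distribution (v1 k) (v2 k)) {1 + sqrt (2/v1 k)*y<..} = measure (?M k) {w \<in> space (?M k). (fst w/v1 k)/(snd w/v2 k) > g k}"
   unfolding F_distribution_def using Fm[of k]
   by (subst measure_distr) (auto simp: g_def case_prod_unfold intro!: arg_cong[where f="measure (?M k)"])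
  also have "\<dots> = measure (?M k) {w \<in> space (?M k). U k w > V k w}"
  proof (rule measure_eq_AE)
   show "AE x in ?M k. (x \<in> {w \<in> space (?M k). g k < fst w/v1 k/(snd w/v2 k)}) = (x \<in> {w \<in> space (?M k). V k w < U k w})"
    using ae by eventually_elim auto
  qed measurable
  finally show ?thesis .
 qed
 ultimately show "(\<lambda>k. measure (F_distribution (v1 k) (v2 k)) {1 + sqrt (2/v1 k)*y<..}) \<longlonglongrightarrow> 1 - cdf \<mu> y" by simp
qed (use \<alpha> in auto)

lemma chi_density_joint_measurable[measurable]:
 "(\<lambda>(v, x). chi_density v x) \<in> borel_measurable (borel \<Otimes>\<^sub>M borel)"
proof -
 have "(\<lambda>v::real. if v \<in> {0<..} then Gamma (v/2) else 1) \<in> borel_measurable borel"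
 proof (rule borel_measurable_continuous_on_if)
  show "continuous_on {0<..} (\<lambda>v::real. Gamma (v/2))"
   by (rule continuous_on_compose2[of "{0<..}" Gamma])
    (auto intro!: continuous_on_Gamma continuous_intros elim!: nonpos_Ints_cases)
 qed auto
 then have [measurable]: "(\<lambda>v::real. if 0 < v then Gamma (v/2) else 1) \<in> borel_measurable borel" by simp
 have "(\<lambda>(v, x). chi_density v x) = (\<lambda>w. if 0 < fst w \<and> 0 < snd w then snd w powr (fst w/2 - 1)*exp (- snd w/2)/(2 powr (fst w/2)*(if 0 < fst w then Gamma (fst w/2) else 1)) else 0)"
  by (auto simp: chi_density_def fun_eq_iff)
 also have "\<dots> \<in> borel_measurable (borel \<Otimes>\<^sub>M borel)" by measurable
 finally show ?thesis .
qed

text \<open>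
By right continuity, the percentile is at most \<open>x\<close> if and only if the tail beyond
\<open>x\<close> has a probability of at most \<open>\<alpha>\<close>, and tail probabilities are
integrals of jointly measurable densities. Parameters outside the positive quadrant give a null
measure and thus one constant value.
\<close>
lemma F_upper_measurable:
 assumes \<alpha>: "0 < \<alpha>" "\<alpha> < 1"
 shows "(\<lambda>v. F_upper (fst v) (snd v) \<alpha>) \<in> borel_measurable (borel \<Otimes>\<^sub>M borel)"
proof -
 define H where "H v x = (\<integral>\<^sup>+a. (\<integral>\<^sup>+b. ennreal (chi_density (fst v) a)*(ennreal (chi_density (snd v) b)*indicator {w. (a/fst v)/(b/snd v) > x} b) \<partial>lborel) \<partial>lborel)" for v :: "real \<times> real" and x :: real
 have Hm: "(\<lambda>v. H v x) \<in> borel_measurable (borel \<Otimes>\<^sub>M borel)" for x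
 proof -
  have [measurable]: "(\<lambda>w::(real \<times> real) \<times> real. chi_density (fst (fst w)) (snd w)) \<in> borel_measurable ((borel \<Otimes>\<^sub>M borel) \<Otimes>\<^sub>M lborel)"
   using measurable_compose[OF _ chi_density_joint_measurable, of "\<lambda>w. (fst (fst w), snd w)"] by simp
  have [measurable]: "(\<lambda>w::((real \<times> real) \<times> real) \<times> real. chi_density (snd (fst (fst w))) (snd w)) \<in> borel_measurable (((borel \<Otimes>\<^sub>M borel) \<Otimes>\<^sub>M lborel) \<Otimes>\<^sub>M lborel)"
   using measurable_compose[OF _ chi_density_joint_measurable, of "\<lambda>w. (snd (fst (fst w)), snd w)"] by simp
  show ?thesis unfolding H_def indicator_def by measurable
 qed
 have HF: "emeasure (F_distribution (fst v) (snd v)) {x<..} = H v x" if v: "0 < fst v" "0 < snd v" for v x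
 proof -
  interpret P1: prob_space "chi_square (fst v)" by (rule prob_space_chi_square[OF v(1)])
  interpret P2: prob_space "chi_square (snd v)" by (rule prob_space_chi_square[OF v(2)])
  interpret PP: pair_prob_space "chi_square (fst v)" "chi_square (snd v)" ..
  let ?A = "{w. (fst w/fst v)/(snd w/snd v) > x}"
  have A: "?A \<in> sets (chi_square (fst v) \<Otimes>\<^sub>M chi_square (snd v))"
  proof -
   have "{w \<in> space (chi_square (fst v) \<Otimes>\<^sub>M chi_square (snd v)). (fst w/fst v)/(snd w/snd v) > x} \<in> sets (chi_square (fst v) \<Otimes>\<^sub>M chi_square (snd v))"
    by measurable
   then show ?thesis by (simp add: space_pair_measure)
  qed
  have "emeasure (F_distribution (fst v) (snd v)) {x<..} = emeasure (chi_square (fst v) \<Otimes>\<^sub>M chi_square (snd v)) ?A"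
   unfolding F_distribution_def
   by (subst emeasure_distr) (auto simp: case_prod_unfold space_pair_measure intro!: arg_cong[where f="emeasure _"])
  also have "\<dots> = (\<integral>\<^sup>+a. \<integral>\<^sup>+b. indicator ?A (a, b) \<partial>chi_square (snd v) \<partial>chi_square (fst v))"
   by (rule P2.emeasure_pair_measure[OF A])
  also have "\<dots> = H v x" unfolding H_def chi_square_density
   by (subst nn_integral_density, measurable)+
    (auto intro!: nn_integral_cong simp: nn_integral_cmult[symmetric] indicator_def)
  finally show ?thesis .
 qed
 define c where "c = Inf (UNIV :: real set)"
 have nonpos: "F_upper (fst v) (snd v) \<alpha> = c" if "\<not> (0 < fst v \<and> 0 < snd v)" for v
 proof -
  have null: "emeasure (chi_square w) A = 0" if "\<not> 0 < w" for w and A :: "real set"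
  proof -
   have "chi_density w = (\<lambda>_. 0)" using that by (simp add: chi_density_def fun_eq_iff)
   then have "emeasure (chi_square w) UNIV = 0" unfolding chi_square_density by (subst emeasure_density) auto
   then show ?thesis using emeasure_mono[of A UNIV "chi_square w"] by simp
  qed
  have "finite_measure (chi_square w)" for w
  proof (cases "0 < w")
   case True
   then show ?thesis using prob_space_chi_square prob_space.finite_measure by blast
  next
   case False
   then show ?thesis using null by (intro finite_measureI) simp
  qed
  then interpret S: finite_measure "chi_square (snd v)" .
  have "emeasure (chi_square (fst v) \<Otimes>\<^sub>M chi_square (snd v)) UNIV = 0"
  proof -
   have "emeasure (chi_square (fst v) \<Otimes>\<^sub>M chi_square (snd v)) (UNIV \<times> UNIV) = emeasure (chi_square (fst v)) UNIV*emeasure (chi_square (snd v)) UNIV"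
    by (rule S.emeasure_pair_measure_Times) auto
   then show ?thesis using that null by (cases "0 < fst v") auto
  qed
  then have "emeasure (F_distribution (fst v) (snd v)) A = 0" for A
   unfolding F_distribution_def
  proof (cases "A \<in> sets borel")
   case True
   let ?P = "chi_square (fst v) \<Otimes>\<^sub>M chi_square (snd v)"
   have "emeasure ?P B = 0" for B
    using emeasure_space[of ?P B] \<open>emeasure ?P UNIV = 0\<close> by (simp add: space_pair_measure)
   moreover have "(\<lambda>(a, b). a/fst v/(b/snd v)) \<in> borel_measurable ?P" by measurable
   ultimately show "emeasure (distr ?P borel (\<lambda>(a, b). a/fst v/(b/snd v))) A = 0"
    using True by (simp add: emeasure_distr)
  qed (simp add: emeasure_notin_sets)
  then show ?thesis by (simp add: F_upper_def upper_percentile_def c_def measure_def less_imp_le[OF \<alpha>(1)])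
 qed
 have iff: "F_upper (fst v) (snd v) \<alpha> \<le> x \<longleftrightarrow> H v x \<le> ennreal \<alpha>" if v: "0 < fst v" "0 < snd v" for v x
 proof -
  interpret P1: prob_space "chi_square (fst v)" by (rule prob_space_chi_square[OF v(1)])
  interpret P2: prob_space "chi_square (snd v)" by (rule prob_space_chi_square[OF v(2)])
  interpret PP: pair_prob_space "chi_square (fst v)" "chi_square (snd v)" ..
  let ?F = "F_distribution (fst v) (snd v)"
  interpret F: real_distribution ?F unfolding F_distribution_def
   by (rule PP.real_distribution_distr) measurable
  have tl: "F.prob {x<..} = 1 - cdf ?F x" for x unfolding cdf_def
   using F.prob_compl[of "{..x}"] by (simp add: Compl_eq_Diff_UNIV[symmetric] Compl_atMost)
  let ?A = "{x. F.prob {x<..} \<le> \<alpha>}"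
  have A: "?A = {x. 1 - \<alpha> \<le> cdf ?F x}" by (auto simp: tl)
  have ne: "?A \<noteq> {}"
  proof -
   have "eventually (\<lambda>x. cdf ?F x > 1 - \<alpha>) at_top" using F.cdf_lim_at_top_prob \<alpha> by (intro order_tendstoD) auto
   then obtain x where "cdf ?F x > 1 - \<alpha>" by (auto simp: eventually_at_top_linorder)
   then show ?thesis unfolding A by (auto intro: less_imp_le)
  qed
  have bdd: "bdd_below ?A"
  proof -
   have "eventually (\<lambda>x. cdf ?F x < 1 - \<alpha>) at_bot" using F.cdf_lim_at_bot \<alpha> by (intro order_tendstoD) auto
   then obtain L where L: "\<And>x. x \<le> L \<Longrightarrow> cdf ?F x < 1 - \<alpha>" by (auto simp: eventually_at_bot_linorder)
   show ?thesis unfolding A by (rule bdd_belowI[of _ L]) (use L in \<open>simp, meson linear not_le\<close>)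
  qed
  have "F_upper (fst v) (snd v) \<alpha> \<le> x \<longleftrightarrow> x \<in> ?A"
  proof
   assume "x \<in> ?A"
   then show "F_upper (fst v) (snd v) \<alpha> \<le> x" unfolding F_upper_def upper_percentile_def by (intro cInf_lower bdd)
  next
   assume le: "F_upper (fst v) (snd v) \<alpha> \<le> x"
   have "1 - \<alpha> \<le> cdf ?F y" if y: "x < y" for y
   proof -
    obtain a where "a \<in> ?A" "a < y" using cInf_lessD[OF ne, of y] le y unfolding F_upper_def upper_percentile_def by auto
    then show ?thesis using F.cdf_nondecreasing[of a y] unfolding A by auto
   qed
   then have "eventually (\<lambda>y. 1 - \<alpha> \<le> cdf ?F y) (at_right x)" by (auto simp: eventually_at_filter)
   moreover have "(cdf ?F \<longlongrightarrow> cdf ?F x) (at_right x)" using F.cdf_is_right_cont[of x] by (simp add: continuous_within)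
   ultimately have "1 - \<alpha> \<le> cdf ?F x" by (intro tendsto_lowerbound) auto
   then show "x \<in> ?A" unfolding A by simp
  qed
  also have "\<dots> \<longleftrightarrow> H v x \<le> ennreal \<alpha>"
   unfolding HF[OF v, symmetric] F.emeasure_eq_measure using \<alpha> by (simp add: ennreal_le_iff)
  finally show ?thesis .
 qed
 show ?thesis
 proof (rule borel_measurableI_le)
  fix x
  have "{v \<in> space (borel \<Otimes>\<^sub>M borel). F_upper (fst v) (snd v) \<alpha> \<le> x} =
   {v \<in> space (borel \<Otimes>\<^sub>M borel). if 0 < fst v \<and> 0 < snd v then H v x \<le> ennreal \<alpha> else c \<le> x}"
  proof -
   have "(F_upper (fst v) (snd v) \<alpha> \<le> x) = (if 0 < fst v \<and> 0 < snd v then H v x \<le> ennreal \<alpha> else c \<le> x)" for v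
    using iff[of v x] nonpos[of v] by (cases "0 < fst v \<and> 0 < snd v") auto
   then show ?thesis by simp
  qed
  also have "\<dots> \<in> sets (borel \<Otimes>\<^sub>M borel)" using Hm[of x] by measurable
  finally show "{v \<in> space (borel \<Otimes>\<^sub>M borel). F_upper (fst v) (snd v) \<alpha> \<le> x} \<in> sets (borel \<Otimes>\<^sub>M borel)" .
 qed
qed

section \<open>Variances of sums of squares and isotropic laws\<close>

text \<open>
Polarization: the product of two squares is a combination of fourth powers of sums and differences
of the two forms.
\<close>
lemma (in isotropic_family) lin_sq_mult_expectation:
 "P.expectation (\<lambda>\<omega>. (lin \<beta> \<omega>)\<^sup>2*(lin \<gamma> \<omega>)\<^sup>2) =
  (\<Sum>i\<in>I. \<Sum>a<m. (\<beta> i a)\<^sup>2)*(\<Sum>i\<in>I. \<Sum>a<m. (\<gamma> i a)\<^sup>2) + 2*(\<Sum>i\<in>I. \<Sum>a<m. \<beta> i a*\<gamma> i a)\<^sup>2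
  + (\<Sum>i\<in>I. \<Delta> i*(\<Sum>a<m. (\<beta> i a)\<^sup>2*(\<gamma> i a)\<^sup>2))"
proof -
 define s where "s \<beta> = (\<Sum>i\<in>I. \<Sum>a<m. (\<beta> i a)\<^sup>2)" for \<beta> :: "'i \<Rightarrow> nat \<Rightarrow> real"
 define ip where "ip = (\<Sum>i\<in>I. \<Sum>a<m. \<beta> i a*\<gamma> i a)"
 define f where "f \<beta> = (\<Sum>i\<in>I. \<Delta> i*(\<Sum>a<m. \<beta> i a ^ 4))" for \<beta> :: "'i \<Rightarrow> nat \<Rightarrow> real"
 have m4: "P.expectation (\<lambda>\<omega>. lin \<beta> \<omega> ^ 4) = 3*(s \<beta>)\<^sup>2 + f \<beta>" for \<beta> using lin_moments(4)[of \<beta>] by (simp add: s_def f_def)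
 have lin_add: "lin (\<lambda>i a. \<beta> i a + \<gamma> i a) \<omega> = lin \<beta> \<omega> + lin \<gamma> \<omega>" "lin (\<lambda>i a. \<beta> i a - \<gamma> i a) \<omega> = lin \<beta> \<omega> - lin \<gamma> \<omega>" for \<omega>
  by (simp_all add: lin_def distrib_right left_diff_distrib sum.distrib sum_subtractf)
 have s_add: "s (\<lambda>i a. \<beta> i a + \<gamma> i a) = s \<beta> + s \<gamma> + 2*ip" "s (\<lambda>i a. \<beta> i a - \<gamma> i a) = s \<beta> + s \<gamma> - 2*ip"
  by (simp_all add: s_def ip_def power2_sum power2_diff sum.distrib sum_subtractf sum_distrib_left mult_ac)
 have pol: "x\<^sup>2*y\<^sup>2 = ((x + y) ^ 4 + (x - y) ^ 4 - 2*x ^ 4 - 2*y ^ 4)/12" for x y :: real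
  by (simp add: power2_eq_square power4_eq_xxxx algebra_simps)
 have fpol: "(f (\<lambda>i a. \<beta> i a + \<gamma> i a) + f (\<lambda>i a. \<beta> i a - \<gamma> i a) - 2*f \<beta> - 2*f \<gamma>)/12 = (\<Sum>i\<in>I. \<Delta> i*(\<Sum>a<m. (\<beta> i a)\<^sup>2*(\<gamma> i a)\<^sup>2))"
  unfolding f_def sum_distrib_left sum.distrib[symmetric] sum_subtractf[symmetric] sum_divide_distrib
  by (intro sum.cong refl) (subst pol, simp add: field_simps)
 have "P.expectation (\<lambda>\<omega>. (lin \<beta> \<omega>)\<^sup>2*(lin \<gamma> \<omega>)\<^sup>2) =
  P.expectation (\<lambda>\<omega>. (lin (\<lambda>i a. \<beta> i a + \<gamma> i a) \<omega> ^ 4 + lin (\<lambda>i a. \<beta> i a - \<gamma> i a) \<omega> ^ 4 - 2*lin \<beta> \<omega> ^ 4 - 2*lin \<gamma> \<omega> ^ 4)/12)"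
  unfolding pol lin_add ..
 also have "\<dots> = ((3*(s (\<lambda>i a. \<beta> i a + \<gamma> i a))\<^sup>2 + f (\<lambda>i a. \<beta> i a + \<gamma> i a)) + (3*(s (\<lambda>i a. \<beta> i a - \<gamma> i a))\<^sup>2 + f (\<lambda>i a. \<beta> i a - \<gamma> i a)) - 2*(3*(s \<beta>)\<^sup>2 + f \<beta>) - 2*(3*(s \<gamma>)\<^sup>2 + f \<gamma>))/12"
  using lin_moments(1) by (simp add: m4)
 also have "\<dots> = s \<beta> * s \<gamma> + 2*ip\<^sup>2 + (f (\<lambda>i a. \<beta> i a + \<gamma> i a) + f (\<lambda>i a. \<beta> i a - \<gamma> i a) - 2*f \<beta> - 2*f \<gamma>)/12"
  unfolding s_add by (simp add: power2_eq_square field_simps)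
 finally show ?thesis unfolding fpol unfolding s_def ip_def .
qed

text \<open>The two terms are the Gaussian variance and the correction by the excess fourth moments.\<close>
lemma (in isotropic_family) lin_sq_sum_variance:
 fixes B :: "'c \<Rightarrow> 'i \<Rightarrow> nat \<Rightarrow> real"
 defines "S \<equiv> \<lambda>Q. \<Sum>c\<in>Q. \<Sum>i\<in>I. \<Sum>a<m. (B c i a)\<^sup>2"
 shows "integrable (PiM I D) (\<lambda>\<omega>. ((\<Sum>c\<in>Q. (lin (B c) \<omega>)\<^sup>2) - S Q)\<^sup>2)"
  and "P.expectation (\<lambda>\<omega>. ((\<Sum>c\<in>Q. (lin (B c) \<omega>)\<^sup>2) - S Q)\<^sup>2) =
  2*(\<Sum>c\<in>Q. \<Sum>d\<in>Q. (\<Sum>i\<in>I. \<Sum>a<m. B c i a*B d i a)\<^sup>2) + (\<Sum>i\<in>I. \<Delta> i*(\<Sum>a<m. (\<Sum>c\<in>Q. (B c i a)\<^sup>2)\<^sup>2))"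
proof -
 let ?P = "\<lambda>c d i. \<Delta> i*(\<Sum>a<m. (B c i a)\<^sup>2*(B d i a)\<^sup>2)"
 define s where "s c = (\<Sum>i\<in>I. \<Sum>a<m. (B c i a)\<^sup>2)" for c
 define ip where "ip c d = (\<Sum>i\<in>I. \<Sum>a<m. B c i a*B d i a)" for c d
 define Y where "Y \<omega> = (\<Sum>c\<in>Q. (lin (B c) \<omega>)\<^sup>2)" for \<omega>
 have SQ: "S Q = (\<Sum>c\<in>Q. s c)" unfolding S_def s_def ..
 have sq: "(\<Sum>c\<in>Q. x c)\<^sup>2 = (\<Sum>c\<in>Q. \<Sum>d\<in>Q. x c*x d)" for x :: "'c \<Rightarrow> real"
  unfolding power2_eq_square by (rule sum_product)
 have iY: "integrable (PiM I D) Y" unfolding Y_def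
  by (intro Bochner_Integration.integrable_sum lin_power_integrable) auto
 have iY2: "integrable (PiM I D) (\<lambda>\<omega>. (Y \<omega>)\<^sup>2)" unfolding Y_def sq
  by (intro Bochner_Integration.integrable_sum lin_square_mult_le)
 have eY: "P.expectation Y = S Q" unfolding Y_def SQ s_def
  using lin_power_integrable[of 2] by (simp add: Bochner_Integration.integral_sum lin_moments)
 have e: "(Y \<omega> - S Q)\<^sup>2 = (Y \<omega>)\<^sup>2 - 2*S Q*Y \<omega> + (S Q)\<^sup>2" for \<omega> by (simp add: power2_diff mult_ac)
 have "integrable (PiM I D) (\<lambda>\<omega>. (Y \<omega> - S Q)\<^sup>2)" unfolding e using iY iY2
  by (intro Bochner_Integration.integrable_add Bochner_Integration.integrable_diff) auto
 then show "integrable (PiM I D) (\<lambda>\<omega>. ((\<Sum>c\<in>Q. (lin (B c) \<omega>)\<^sup>2) - S Q)\<^sup>2)" unfolding Y_def .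
 have "P.expectation (\<lambda>\<omega>. (Y \<omega> - S Q)\<^sup>2) = P.expectation (\<lambda>\<omega>. (Y \<omega>)\<^sup>2) - 2*S Q*S Q + (S Q)\<^sup>2"
  unfolding e using iY iY2 eY P.prob_space by simp
 also have "P.expectation (\<lambda>\<omega>. (Y \<omega>)\<^sup>2) = (\<Sum>c\<in>Q. \<Sum>d\<in>Q. s c * s d + 2*(ip c d)\<^sup>2 + (\<Sum>i\<in>I. ?P c d i))"
  unfolding Y_def sq using lin_square_mult_le(1)
  by (simp add: Bochner_Integration.integral_sum lin_sq_mult_expectation s_def ip_def)
 also have "\<dots> = (S Q)\<^sup>2 + 2*(\<Sum>c\<in>Q. \<Sum>d\<in>Q. (ip c d)\<^sup>2) + (\<Sum>c\<in>Q. \<Sum>d\<in>Q. \<Sum>i\<in>I. ?P c d i)"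
  unfolding SQ sq by (simp add: sum.distrib sum_distrib_left)
 also have "(\<Sum>c\<in>Q. \<Sum>d\<in>Q. \<Sum>i\<in>I. ?P c d i) = (\<Sum>c\<in>Q. \<Sum>i\<in>I. \<Sum>d\<in>Q. ?P c d i)"
  by (intro sum.cong refl sum.swap)
 also have "\<dots> = (\<Sum>i\<in>I. \<Sum>c\<in>Q. \<Sum>d\<in>Q. ?P c d i)" by (rule sum.swap)
 also have "\<dots> = (\<Sum>i\<in>I. \<Delta> i*(\<Sum>a<m. (\<Sum>c\<in>Q. (B c i a)\<^sup>2)\<^sup>2))"
 proof (intro sum.cong refl)
  fix i
  have "(\<Sum>a<m. (\<Sum>c\<in>Q. (B c i a)\<^sup>2)\<^sup>2) = (\<Sum>a<m. \<Sum>c\<in>Q. \<Sum>d\<in>Q. (B c i a)\<^sup>2*(B d i a)\<^sup>2)" unfolding sq ..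
  also have "\<dots> = (\<Sum>c\<in>Q. \<Sum>a<m. \<Sum>d\<in>Q. (B c i a)\<^sup>2*(B d i a)\<^sup>2)" by (rule sum.swap)
  also have "\<dots> = (\<Sum>c\<in>Q. \<Sum>d\<in>Q. \<Sum>a<m. (B c i a)\<^sup>2*(B d i a)\<^sup>2)" by (intro sum.cong refl sum.swap)
  finally show "(\<Sum>c\<in>Q. \<Sum>d\<in>Q. ?P c d i) = \<Delta> i*(\<Sum>a<m. (\<Sum>c\<in>Q. (B c i a)\<^sup>2)\<^sup>2)"
   by (simp add: sum_distrib_left)
 qed
 finally show "P.expectation (\<lambda>\<omega>. ((\<Sum>c\<in>Q. (lin (B c) \<omega>)\<^sup>2) - S Q)\<^sup>2) =
  2*(\<Sum>c\<in>Q. \<Sum>d\<in>Q. (\<Sum>i\<in>I. \<Sum>a<m. B c i a*B d i a)\<^sup>2) + (\<Sum>i\<in>I. \<Delta> i*(\<Sum>a<m. (\<Sum>c\<in>Q. (B c i a)\<^sup>2)\<^sup>2))"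
  unfolding Y_def ip_def by (simp add: power2_eq_square)
qed

lemma prod_list_eq_prod_count:
 fixes f :: "'a \<Rightarrow> 'b::comm_monoid_mult"
 assumes "finite X" "set xs \<subseteq> X"
 shows "(\<Prod>x\<leftarrow>xs. f x) = (\<Prod>a\<in>X. f a ^ count_list xs a)"
 using assms(2)
proof (induction xs)
 case (Cons x xs)
 have "(\<Prod>a\<in>X. f a ^ count_list (x # xs) a) = (\<Prod>a\<in>X. (if a = x then f a else 1)*f a ^ count_list xs a)"
  by (intro prod.cong refl) auto
 also have "\<dots> = f x*(\<Prod>a\<in>X. f a ^ count_list xs a)"
  using Cons assms(1) by (simp add: prod.distrib)
 finally show ?case using Cons by simp
qed simp

text \<open>
A product over a list with repetitions is a product of powers of distinct coordinates, to which the
factorization hypothesis applies.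
\<close>
lemma moment_condition_list:
 assumes mc: "moment_condition M m \<Delta> Z" and xs: "xs \<noteq> []" "set xs \<subseteq> {..<m}" "length xs \<le> 8"
 shows "(\<integral>w. (\<Prod>x\<leftarrow>xs. Z w $ x) \<partial>M) = (\<Prod>a\<in>set xs. \<integral>w. (Z w $ a) ^ count_list xs a \<partial>M)"
proof -
 obtain h where h: "bij_betw h {1..card (set xs)} (set xs)" using ex_bij_betw_nat_finite_1[of "set xs"] by auto
 let ?q = "card (set xs)" and ?e = "\<lambda>s. count_list xs (h s)"
 have hin: "h s \<in> set xs" if "s \<in> {1..?q}" for s using h that by (auto simp: bij_betw_def)
 have q1: "?q \<ge> 1" using xs(1) by (simp add: Suc_le_eq card_gt_0_iff)
 have e1: "\<forall>s\<in>{1..?q}. ?e s \<ge> 1 \<and> h s < m"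
 proof (intro ballI conjI)
  fix s assume s: "s \<in> {1..?q}"
  have "?e s \<noteq> 0" using hin[OF s] count_list_0_iff by metis
  then show "?e s \<ge> 1" by simp
  show "h s < m" using hin[OF s] xs(2) by auto
 qed
 have inj: "inj_on h {1..?q}" using h by (simp add: bij_betw_def)
 have s8: "(\<Sum>s=1..?q. ?e s) \<le> 8"
 proof -
  have "(\<Sum>s=1..?q. ?e s) = (\<Sum>a\<in>set xs. count_list xs a)" by (rule sum.reindex_bij_betw[OF h])
  also have "\<dots> = length xs" by (rule sum_count_set) auto
  finally show ?thesis using xs(3) by simp
 qed
 have "(\<integral>w. (\<Prod>s=1..?q. (Z w $ h s) ^ ?e s) \<partial>M) = (\<Prod>s=1..?q. \<integral>w. (Z w $ h s) ^ ?e s \<partial>M)"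
  by (rule mc[unfolded moment_condition_def, THEN conjunct2, THEN spec, THEN spec, THEN spec, THEN mp])
   (intro conjI q1 e1 inj s8)
 moreover have "(\<Prod>s=1..?q. (Z w $ h s) ^ ?e s) = (\<Prod>x\<leftarrow>xs. Z w $ x)" for w
 proof -
  have "(\<Prod>s=1..?q. (Z w $ h s) ^ ?e s) = (\<Prod>a\<in>set xs. (Z w $ a) ^ count_list xs a)" by (rule prod.reindex_bij_betw[OF h])
  also have "\<dots> = (\<Prod>x\<leftarrow>xs. Z w $ x)" by (rule prod_list_eq_prod_count[symmetric]) auto
  finally show ?thesis .
 qed
 moreover have "(\<Prod>s=1..?q. \<integral>w. (Z w $ h s) ^ ?e s \<partial>M) = (\<Prod>a\<in>set xs. \<integral>w. (Z w $ a) ^ count_list xs a \<partial>M)"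
  by (rule prod.reindex_bij_betw[OF h])
 ultimately show ?thesis by (simp only:)
qed

lemma sum_triple_product: 
 fixes f g h :: "'a \<Rightarrow> real"
 shows "(\<Sum>a\<in>A. f a)*(\<Sum>b\<in>A. g b)*(\<Sum>c\<in>A. h c) = (\<Sum>a\<in>A. \<Sum>b\<in>A. \<Sum>c\<in>A. f a*g b*h c)"
 unfolding sum_product sum_distrib_right by (intro sum.cong refl) (simp add: sum_distrib_left mult_ac)

text \<open>
Only mixed moments of total order at most four occur, so that uncorrelatedness, the factorization of
these moments and the fourth moments determine the result. The induction separates one coordinate at
a time.
\<close>
lemma (in prob_space) fourth_moment_of_mixed:
 fixes Z :: "nat \<Rightarrow> 'a \<Rightarrow> real"
 assumes rv: "\<And>a. a < m \<Longrightarrow> Z a \<in> borel_measurable M" and i4: "\<And>a. a < m \<Longrightarrow> integrable M (\<lambda>w. Z a w ^ 4)"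
  and e4: "\<And>a. a < m \<Longrightarrow> expectation (\<lambda>w. Z a w ^ 4) = 3 + \<Delta>"
  and cov: "\<And>a b. a < m \<Longrightarrow> b < m \<Longrightarrow> expectation (\<lambda>w. Z a w*Z b w) = (if a = b then 1 else 0)"
  and m3: "\<And>a b c d. a < m \<Longrightarrow> b < m \<Longrightarrow> c < m \<Longrightarrow> d < m \<Longrightarrow> d \<notin> {a, b, c} \<Longrightarrow> expectation (\<lambda>w. Z a w*Z b w*Z c w*Z d w) = 0"
  and m2: "\<And>a b d. a < m \<Longrightarrow> b < m \<Longrightarrow> d < m \<Longrightarrow> d \<noteq> a \<Longrightarrow> d \<noteq> b \<Longrightarrow> expectation (\<lambda>w. Z a w*Z b w*Z d w*Z d w) = (if a = b then 1 else 0)"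
  and q: "q \<le> m"
 shows "expectation (\<lambda>w. (\<Sum>a<q. \<beta> a*Z a w) ^ 4) = 3*(\<Sum>a<q. (\<beta> a)\<^sup>2)\<^sup>2 + \<Delta>*(\<Sum>a<q. \<beta> a ^ 4)"
 using q
proof (induction q)
 case (Suc q)
 have q: "q < m" using Suc.prems by simp
 define S where "S w = (\<Sum>a<q. \<beta> a*Z a w)" for w
 have ip: "integrable M (\<lambda>w. Z a w*Z b w*Z c w*Z d w)" if "a < m" "b < m" "c < m" "d < m" for a b c d
 proof -
  have "integrable M (\<lambda>w. (Z a w*Z b w)*(Z c w*Z d w))"
  proof (rule integrable_mult_of_squares)
   show "integrable M (\<lambda>w. (Z a w*Z b w)\<^sup>2)" unfolding power_mult_distrib
    by (rule integrable_square_mult_of_fourth) (use that rv i4 in auto)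
   show "integrable M (\<lambda>w. (Z c w*Z d w)\<^sup>2)" unfolding power_mult_distrib
    by (rule integrable_square_mult_of_fourth) (use that rv i4 in auto)
  qed (use that rv in auto)
  then show ?thesis by (simp add: mult.assoc)
 qed
 have S1: "S w*Z q w*Z q w*Z q w = (\<Sum>a<q. \<beta> a*(Z q w*Z q w*Z q w*Z a w))" for w
  unfolding S_def sum_distrib_right by (intro sum.cong refl) (simp add: mult_ac)
 have S2: "S w*S w*Z q w*Z q w = (\<Sum>a<q. \<Sum>b<q. \<beta> a*\<beta> b*(Z a w*Z b w*Z q w*Z q w))" for w
  unfolding S_def sum_product unfolding sum_distrib_right by (intro sum.cong refl) (simp add: mult_ac)
 have S3: "S w*S w*S w*Z q w = (\<Sum>a<q. \<Sum>b<q. \<Sum>c<q. \<beta> a*\<beta> b*\<beta> c*(Z a w*Z b w*Z c w*Z q w))" for w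
  unfolding S_def sum_triple_product unfolding sum_distrib_right by (intro sum.cong refl) (simp add: mult_ac)
 have i1: "integrable M (\<lambda>w. S w*Z q w*Z q w*Z q w)" and i2: "integrable M (\<lambda>w. S w*S w*Z q w*Z q w)"
  and i3: "integrable M (\<lambda>w. S w*S w*S w*Z q w)"
  unfolding S1 S2 S3 using q by (auto intro!: Bochner_Integration.integrable_sum integrable_mult_right ip)
 have iS: "integrable M (\<lambda>w. S w ^ 4)" unfolding S_def
  by (intro integrable_fourth_sum) (use q rv i4 in \<open>auto simp: power_mult_distrib\<close>)
 have E1: "expectation (\<lambda>w. S w*Z q w*Z q w*Z q w) = 0"
  unfolding S1 using q m3 ip by (subst Bochner_Integration.integral_sum) auto
 have E3: "expectation (\<lambda>w. S w*S w*S w*Z q w) = 0"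
 proof -
  have i: "integrable M (\<lambda>w. \<beta> a*\<beta> b*\<beta> c*(Z a w*Z b w*Z c w*Z q w))" if "a < q" "b < q" "c < q" for a b c
   using that q by (intro integrable_mult_right ip) auto
  have "expectation (\<lambda>w. \<Sum>c<q. \<beta> a*\<beta> b*\<beta> c*(Z a w*Z b w*Z c w*Z q w)) = 0" if "a < q" "b < q" for a b
   using that q m3 i by (subst Bochner_Integration.integral_sum) auto
  then have "expectation (\<lambda>w. \<Sum>b<q. \<Sum>c<q. \<beta> a*\<beta> b*\<beta> c*(Z a w*Z b w*Z c w*Z q w)) = 0" if "a < q" for a
   using that i by (subst Bochner_Integration.integral_sum) (auto intro!: Bochner_Integration.integrable_sum)
  then show ?thesis unfolding S3
   using i by (subst Bochner_Integration.integral_sum) (auto intro!: Bochner_Integration.integrable_sum)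
 qed
 have E2: "expectation (\<lambda>w. S w*S w*Z q w*Z q w) = (\<Sum>a<q. (\<beta> a)\<^sup>2)"
 proof -
  have "expectation (\<lambda>w. S w*S w*Z q w*Z q w) = (\<Sum>a<q. \<Sum>b<q. \<beta> a*\<beta> b*(if a = b then 1 else 0))"
  proof -
   have i: "integrable M (\<lambda>w. \<beta> a*\<beta> b*(Z a w*Z b w*Z q w*Z q w))" if "a < q" "b < q" for a b
    using that q by (intro integrable_mult_right ip) auto
   have "expectation (\<lambda>w. \<Sum>b<q. \<beta> a*\<beta> b*(Z a w*Z b w*Z q w*Z q w)) = (\<Sum>b<q. \<beta> a*\<beta> b*(if a = b then 1 else 0))" if "a < q" for a
    using that q m2 i by (subst Bochner_Integration.integral_sum) (auto intro!: sum.cong)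
   then show ?thesis unfolding S2
    using i by (subst Bochner_Integration.integral_sum) (auto intro!: Bochner_Integration.integrable_sum)
  qed
  also have "\<dots> = (\<Sum>a<q. (\<beta> a)\<^sup>2)" by (intro sum.cong refl) (simp add: if_distrib power2_eq_square cong: if_cong)
  finally show ?thesis .
 qed
 have e: "(S w + \<beta> q*Z q w) ^ 4 = S w ^ 4 + 4*\<beta> q*(S w*S w*S w*Z q w) + 6*(\<beta> q)\<^sup>2*(S w*S w*Z q w*Z q w) + 4*\<beta> q ^ 3*(S w*Z q w*Z q w*Z q w) + \<beta> q ^ 4*Z q w ^ 4" for w
  by (simp add: algebra_simps power2_eq_square power3_eq_cube power4_eq_xxxx)
 have "expectation (\<lambda>w. (\<Sum>a<Suc q. \<beta> a*Z a w) ^ 4) = expectation (\<lambda>w. (S w + \<beta> q*Z q w) ^ 4)" by (simp add: S_def)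
 also have "\<dots> = expectation (\<lambda>w. S w ^ 4) + 6*(\<beta> q)\<^sup>2*(\<Sum>a<q. (\<beta> a)\<^sup>2) + \<beta> q ^ 4*(3 + \<Delta>)"
  unfolding e using iS i1 i2 i3 i4[OF q] by (simp add: E1 E2 E3 e4[OF q])
 also have "expectation (\<lambda>w. S w ^ 4) = 3*(\<Sum>a<q. (\<beta> a)\<^sup>2)\<^sup>2 + \<Delta>*(\<Sum>a<q. \<beta> a ^ 4)" unfolding S_def using Suc by simp
 finally show ?case by (simp add: power2_sum power2_eq_square power4_eq_xxxx algebra_simps)
qed simp

lemma vec_borel_coordinates_measurable:
 "(\<lambda>v. \<lambda>a\<in>{..<d}. v $ a) \<in> measurable (vec_borel d) (PiM {..<d} (\<lambda>_. borel))"
 unfolding vec_borel_def by (rule measurable_vimage_algebra1) (auto simp: space_PiM)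

lemma isotropic_of_moment_condition:
 assumes M: "prob_space M" and mc: "moment_condition M m \<Delta> Z" and hm: "has_mean_cov M m Z (0\<^sub>v m) (1\<^sub>m m)"
 shows "isotropic m \<Delta> (distr M (PiM {..<m} (\<lambda>_. borel)) (\<lambda>w. \<lambda>a\<in>{..<m}. Z w $ a))"
proof -
 interpret prob_space M by fact
 let ?Z = "\<lambda>w. \<lambda>a\<in>{..<m}. Z w $ a"
 let ?p = "\<lambda>xs. \<Prod>e\<in>set xs. \<integral>w. (Z w $ e) ^ count_list xs e \<partial>M"
 let ?R = "PiM {..<m} (\<lambda>_. borel) :: (nat \<Rightarrow> real) measure"
 have Zv: "Z \<in> measurable M (vec_borel m)" using hm by (simp add: has_mean_cov_def)
 have Zm: "?Z \<in> measurable M ?R"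
  by (rule measurable_compose[OF Zv vec_borel_coordinates_measurable])
 have Za: "(\<lambda>w. Z w $ a) \<in> borel_measurable M" if "a < m" for a
  using measurable_compose[OF Zm measurable_component_singleton[of a "{..<m}" "\<lambda>_. borel"]] that by simp
 have i4: "integrable M (\<lambda>w. (Z w $ a) ^ 4)" "expectation (\<lambda>w. (Z w $ a) ^ 4) = 3 + \<Delta>" if "a < m" for a
  using mc that by (auto simp: moment_condition_def)
 have e1: "expectation (\<lambda>w. Z w $ a) = 0" if "a < m" for a using hm that by (auto simp: has_mean_cov_def)
 have cov: "expectation (\<lambda>w. Z w $ a*Z w $ b) = (if a = b then 1 else 0)" if "a < m" "b < m" for a b
  using hm that by (auto simp: has_mean_cov_def)
 have m3: "expectation (\<lambda>w. Z w $ a*Z w $ b*Z w $ c*Z w $ d) = 0" if "a < m" "b < m" "c < m" "d < m" "d \<notin> {a, b, c}" for a b c d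
 proof -
  have "expectation (\<lambda>w. \<Prod>x\<leftarrow>[a, b, c, d]. Z w $ x) = (\<Prod>e\<in>set [a, b, c, d]. \<integral>w. (Z w $ e) ^ count_list [a, b, c, d] e \<partial>M)"
   by (rule moment_condition_list[OF mc]) (use that in auto)
  also have "\<dots> = 0"
  proof (rule prod_zero)
   show "\<exists>e\<in>set [a, b, c, d]. (\<integral>w. (Z w $ e) ^ count_list [a, b, c, d] e \<partial>M) = 0"
    using that e1 by (intro bexI[of _ d]) auto
  qed simp
  finally show ?thesis by (simp add: mult.assoc)
 qed
 have m2: "expectation (\<lambda>w. Z w $ a*Z w $ b*Z w $ d*Z w $ d) = (if a = b then 1 else 0)" if "a < m" "b < m" "d < m" "d \<noteq> a" "d \<noteq> b" for a b d
 proof -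
  have L: "expectation (\<lambda>w. \<Prod>x\<leftarrow>[a, b, d, d]. Z w $ x) = ?p [a, b, d, d]"
   by (rule moment_condition_list[OF mc]) (use that in auto)
  have "?p [a, b, d, d] = (if a = b then 1 else 0)"
  proof (cases "a = b")
   case True
   have c2: "(\<integral>w. (Z w $ a)\<^sup>2 \<partial>M) = 1" if "a < m" for a using cov[OF that that] by (simp add: power2_eq_square)
   have "?p [a, b, d, d] = (\<Prod>e\<in>{a, d}. \<integral>w. (Z w $ e)\<^sup>2 \<partial>M)"
   proof (rule prod.cong)
    show "set [a, b, d, d] = {a, d}" using True by auto
    fix e assume "e \<in> {a, d}"
    then have "count_list [a, b, d, d] e = 2" using True that by auto
    then show "(\<integral>w. (Z w $ e) ^ count_list [a, b, d, d] e \<partial>M) = (\<integral>w. (Z w $ e)\<^sup>2 \<partial>M)" by (simp only:)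
   qed
   also have "\<dots> = 1" using c2[OF that(1)] c2[OF that(3)] that(4) by (subst prod.insert) auto
   finally show ?thesis using True by simp
  next
   case False
   have "?p [a, b, d, d] = 0"
   proof (rule prod_zero)
    show "\<exists>e\<in>set [a, b, d, d]. (\<integral>w. (Z w $ e) ^ count_list [a, b, d, d] e \<partial>M) = 0"
     using that e1 False by (intro bexI[of _ a]) auto
   qed simp
   then show ?thesis using False by simp
  qed
  then show ?thesis using L by (simp add: mult.assoc)
 qed
 have co: "(\<lambda>a\<in>{..<m}. Z w $ a) a = Z w $ a" if "a < m" for a w using that by simp
 have cm: "(\<lambda>z. z a) \<in> borel_measurable ?R" if "a < m" for a using that by auto
 have lm: "(\<lambda>z. \<Sum>a<m. \<beta> a*z a) \<in> borel_measurable ?R" for \<beta> by (intro borel_measurable_sum borel_measurable_times cm) auto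
 show ?thesis unfolding isotropic_def
 proof (intro conjI allI impI)
  show "prob_space (distr M ?R ?Z)" by (rule prob_space_distr[OF Zm])
  show "integrable (distr M ?R ?Z) (\<lambda>z. z a ^ 4)" if "a < m" for a
   using that i4 cm[OF that] by (subst integrable_distr_eq[OF Zm]) auto
  show "(\<integral>z. z a \<partial>distr M ?R ?Z) = 0" if "a < m" for a
   using that e1 cm[OF that] by (subst integral_distr[OF Zm]) auto
  show "(\<integral>z. z a*z b \<partial>distr M ?R ?Z) = (if a = b then 1 else 0)" if "a < m" "b < m" for a b
   using that cov cm[OF that(1)] cm[OF that(2)] by (subst integral_distr[OF Zm]) auto
  fix \<beta> :: "nat \<Rightarrow> real"
  have "(\<integral>z. (\<Sum>a<m. \<beta> a*z a) ^ 4 \<partial>distr M ?R ?Z) = expectation (\<lambda>w. (\<Sum>a<m. \<beta> a*Z w $ a) ^ 4)"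
   using lm by (subst integral_distr[OF Zm]) auto
  also have "\<dots> = 3*(\<Sum>a<m. (\<beta> a)\<^sup>2)\<^sup>2 + \<Delta>*(\<Sum>a<m. \<beta> a ^ 4)"
   by (rule fourth_moment_of_mixed[where m=m and q=m]) (use Za i4 cov m3 m2 in auto)
  finally show "(\<integral>z. (\<Sum>a<m. \<beta> a*z a) ^ 4 \<partial>distr M ?R ?Z) = 3*(\<Sum>a<m. (\<beta> a)\<^sup>2)\<^sup>2 + \<Delta>*(\<Sum>a<m. \<beta> a ^ 4)" .
 qed simp
qed

section \<open>The numerator minus the denominator as a quadratic form\<close>

lemma sum_sample_index:
 "(\<Sum>u\<in>sample_index N. f u) = (\<Sum>j=1..N 1. f (1, j)) + (\<Sum>j=1..N 2. f (2, j))"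
proof -
 have eq: "sample_index N = Pair 1 ` {1..N 1} \<union> Pair 2 ` {1..N 2}" by (auto simp: sample_index_def)
 show ?thesis unfolding eq by (subst sum.union_disjoint) (auto simp: sum.reindex inj_on_def)
qed

lemma finite_sample_index: "finite (sample_index N)"
 by (auto simp: sample_index_def)

text \<open>
The deterministic data of the two samples in coordinates: \<open>\<Gamma> i\<close> are the
loadings, \<open>S i\<close> the covariance matrices, \<open>Om\<close> the pooled one with traces
\<open>T1\<close> and \<open>T2\<close> of its first and second power. The vectors \<open>x\<close>
are the centred observations, \<open>T0\<close> is the numerator of the statistic for equal means
and \<open>tro\<close> its denominator. \<open>C\<close> and \<open>A\<close> are the coefficients
of the quadratic form \<open>(T0 - tro)/\<sigma>\<close>.
\<close>
locale two_sample_factors =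
 fixes p m :: nat and N :: "nat \<Rightarrow> nat" and \<Gamma> :: "nat \<Rightarrow> nat \<Rightarrow> nat \<Rightarrow> real"
 assumes N: "2 \<le> N 1" "2 \<le> N 2"
begin

abbreviation I where "I \<equiv> sample_index N"
definition n :: real where "n = real (N 1 + N 2)"
definition wt :: "nat \<Rightarrow> real" where "wt i = real (N (3 - i))/n"
definition S :: "nat \<Rightarrow> nat \<Rightarrow> nat \<Rightarrow> real" where "S i c d = (\<Sum>a<m. \<Gamma> i c a*\<Gamma> i d a)"
definition Om :: "nat \<Rightarrow> nat \<Rightarrow> real" where "Om c d = wt 1*S 1 c d + wt 2*S 2 c d"
definition tr2 :: "nat \<Rightarrow> nat \<Rightarrow> real" where "tr2 i j = (\<Sum>c<p. \<Sum>d<p. S i c d*S j c d)"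
definition T1 :: real where "T1 = (\<Sum>c<p. Om c c)"
definition T2 :: real where "T2 = (\<Sum>c<p. \<Sum>d<p. (Om c d)\<^sup>2)"
definition \<sigma> :: real where "\<sigma> = sqrt (2*T2)"
definition \<nu> :: real where "\<nu> = real (min (N 1) (N 2)) - 1"
definition x :: "nat \<Rightarrow> nat \<times> nat \<Rightarrow> (nat \<times> nat \<Rightarrow> nat \<Rightarrow> real) \<Rightarrow> real" where
 "x c u \<omega> = (\<Sum>a<m. \<Gamma> (fst u) c a*\<omega> u a)"
definition xb :: "nat \<Rightarrow> nat \<Rightarrow> (nat \<times> nat \<Rightarrow> nat \<Rightarrow> real) \<Rightarrow> real" where
 "xb i c \<omega> = (\<Sum>j=1..N i. x c (i, j) \<omega>)/real (N i)"
definition T0 :: "(nat \<times> nat \<Rightarrow> nat \<Rightarrow> real) \<Rightarrow> real" where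
 "T0 \<omega> = real (N 1)*real (N 2)/n*(\<Sum>c<p. (xb 1 c \<omega> - xb 2 c \<omega>)\<^sup>2)"
definition tro :: "(nat \<times> nat \<Rightarrow> nat \<Rightarrow> real) \<Rightarrow> real" where
 "tro \<omega> = (\<Sum>c<p. wt 1*((\<Sum>j=1..N 1. (x c (1, j) \<omega> - xb 1 c \<omega>)\<^sup>2)/(real (N 1) - 1))
  + wt 2*((\<Sum>j=1..N 2. (x c (2, j) \<omega> - xb 2 c \<omega>)\<^sup>2)/(real (N 2) - 1)))"
definition C :: "nat \<times> nat \<Rightarrow> nat \<times> nat \<Rightarrow> real" where
 "C u v = (if fst u = fst v then wt (fst u)/(real (N (fst u)) - 1) else - (1/n))"
definition A :: "nat \<times> nat \<Rightarrow> nat \<Rightarrow> nat \<times> nat \<Rightarrow> nat \<Rightarrow> real" where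
 "A u a v b = C u v/\<sigma>*(\<Sum>c<p. \<Gamma> (fst u) c a*\<Gamma> (fst v) c b)"

lemma n_pos: "0 < n" using N by (simp add: n_def)
lemma N_pos: "0 < real (N 1)" "0 < real (N 2)" "0 < real (N 1) - 1" "0 < real (N 2) - 1" using N by auto
lemma wt_nonneg: "0 \<le> wt i" using n_pos by (simp add: wt_def)
lemma wt12: "wt 1 = real (N 2)/n" "wt 2 = real (N 1)/n" by (simp_all add: wt_def)
lemma \<nu>_pos: "0 < \<nu>" "1 \<le> \<nu>" "\<nu> \<le> real (N 1) - 1" "\<nu> \<le> real (N 2) - 1" using N by (auto simp: \<nu>_def min_def)

lemma S_sym: "S i c d = S i d c" by (simp add: S_def mult.commute)

lemma A_sym: "A u a v b = A v b u a"
proof -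
 have "C u v = C v u" by (auto simp: C_def)
 then show ?thesis by (simp add: A_def mult.commute)
qed

text \<open>
Written with Gram matrices, the trace of the product of two covariance matrices is visibly
nonnegative.
\<close>
lemma tr2_gram: "tr2 i j = (\<Sum>a<m. \<Sum>b<m. (\<Sum>c<p. \<Gamma> i c a*\<Gamma> j c b)\<^sup>2)"
proof -
 have "(\<Sum>a<m. \<Sum>b<m. (\<Sum>c<p. \<Gamma> i c a*\<Gamma> j c b)\<^sup>2) = (\<Sum>a<m. \<Sum>b<m. \<Sum>c<p. \<Sum>d<p. (\<Gamma> i c a*\<Gamma> i d a)*(\<Gamma> j c b*\<Gamma> j d b))"
  unfolding power2_eq_square sum_product by (intro sum.cong refl) (simp add: mult_ac)
 also have "\<dots> = (\<Sum>a<m. \<Sum>c<p. \<Sum>b<m. \<Sum>d<p. (\<Gamma> i c a*\<Gamma> i d a)*(\<Gamma> j c b*\<Gamma> j d b))"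
  by (intro sum.cong refl sum.swap)
 also have "\<dots> = (\<Sum>c<p. \<Sum>a<m. \<Sum>b<m. \<Sum>d<p. (\<Gamma> i c a*\<Gamma> i d a)*(\<Gamma> j c b*\<Gamma> j d b))" by (rule sum.swap)
 also have "\<dots> = (\<Sum>c<p. \<Sum>a<m. \<Sum>d<p. \<Sum>b<m. (\<Gamma> i c a*\<Gamma> i d a)*(\<Gamma> j c b*\<Gamma> j d b))"
  by (intro sum.cong refl sum.swap)
 also have "\<dots> = (\<Sum>c<p. \<Sum>d<p. \<Sum>a<m. \<Sum>b<m. (\<Gamma> i c a*\<Gamma> i d a)*(\<Gamma> j c b*\<Gamma> j d b))"
  by (intro sum.cong refl sum.swap)
 also have "\<dots> = tr2 i j" unfolding tr2_def S_def sum_product ..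
 finally show ?thesis by simp
qed

lemma tr2_nonneg: "0 \<le> tr2 i j" unfolding tr2_gram by (intro sum_nonneg) auto

lemma T2_eq: "T2 = (wt 1)\<^sup>2*tr2 1 1 + 2*wt 1*wt 2*tr2 1 2 + (wt 2)\<^sup>2*tr2 2 2"
proof -
 have "(Om c d)\<^sup>2 = (wt 1)\<^sup>2*(S 1 c d*S 1 c d) + 2*wt 1*wt 2*(S 1 c d*S 2 c d) + (wt 2)\<^sup>2*(S 2 c d*S 2 c d)" for c d
  by (simp add: Om_def power2_eq_square algebra_simps)
 then show ?thesis unfolding T2_def tr2_def by (simp add: sum.distrib sum_distrib_left)
qed

lemma tr2_le_T2: "(wt 1)\<^sup>2*tr2 1 1 + (wt 2)\<^sup>2*tr2 2 2 \<le> T2"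
 unfolding T2_eq using tr2_nonneg[of 1 2] wt_nonneg[of 1] wt_nonneg[of 2] by simp

lemma weighted_traces_le:
 "(wt 1)\<^sup>2/(real (N 1) - 1)*tr2 1 1 + (wt 2)\<^sup>2/(real (N 2) - 1)*tr2 2 2 \<le> T2/\<nu>"
proof -
 have "(wt 1)\<^sup>2/(real (N 1) - 1)*tr2 1 1 + (wt 2)\<^sup>2/(real (N 2) - 1)*tr2 2 2 \<le> (wt 1)\<^sup>2/\<nu>*tr2 1 1 + (wt 2)\<^sup>2/\<nu>*tr2 2 2"
  using \<nu>_pos tr2_nonneg N_pos by (intro add_mono mult_right_mono divide_left_mono) auto
 also have "\<dots> = ((wt 1)\<^sup>2*tr2 1 1 + (wt 2)\<^sup>2*tr2 2 2)/\<nu>" by (simp add: add_divide_distrib)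
 also have "\<dots> \<le> T2/\<nu>" using tr2_le_T2 \<nu>_pos by (intro divide_right_mono) auto
 finally show ?thesis .
qed

lemma T2_nonneg: "0 \<le> T2" unfolding T2_def by (intro sum_nonneg) auto

lemma S_diag_nonneg: "0 \<le> S i c c" unfolding S_def by (intro sum_nonneg) auto

lemma Om_diag_nonneg: "0 \<le> Om c c" unfolding Om_def using S_diag_nonneg wt_nonneg by auto

lemma T1_nonneg: "0 \<le> T1" unfolding T1_def by (intro sum_nonneg Om_diag_nonneg)

lemma sum_sq_identities:
 fixes f :: "nat \<Rightarrow> real"
 assumes k: "0 < real k"
 shows "(\<Sum>j=1..k. (f j - (\<Sum>j=1..k. f j)/real k)\<^sup>2) = (\<Sum>j=1..k. (f j)\<^sup>2) - (\<Sum>j=1..k. f j)\<^sup>2/real k"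
proof -
 define s where "s = (\<Sum>j=1..k. f j)"
 have "(\<Sum>j=1..k. (f j - c)\<^sup>2) = (\<Sum>j=1..k. (f j)\<^sup>2) - 2*c * s + real k*c\<^sup>2" for c
  by (simp add: power2_diff sum.distrib sum_subtractf sum_distrib_left s_def mult_ac)
 then have "(\<Sum>j=1..k. (f j - s/real k)\<^sup>2) = (\<Sum>j=1..k. (f j)\<^sup>2) - 2*(s/real k) * s + real k*(s/real k)\<^sup>2" .
 also have "\<dots> = (\<Sum>j=1..k. (f j)\<^sup>2) - s\<^sup>2/real k" using k by (simp add: power2_eq_square field_simps)
 finally show ?thesis by (simp add: s_def)
qed

text \<open>
The within-sample squares cancel: the denominator is an unbiased estimate of the mean of the
numerator, sample by sample.
\<close>
lemma offdiag_quad_eq: "offdiag_quad m A I \<omega> = (T0 \<omega> - tro \<omega>)/\<sigma>"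
proof -
 let ?q = "\<lambda>u v c. C u v/\<sigma>*(x c u \<omega>*x c v \<omega>)"
 have D: "(\<Sum>v\<in>I - {u}. f v) = (\<Sum>v\<in>I. f v) - f u" if "u \<in> I" for u and f :: "nat \<times> nat \<Rightarrow> real"
  using that finite_sample_index by (simp add: sum_diff1)
 have bil: "(\<Sum>a<m. \<Sum>b<m. A u a v b*\<omega> u a*\<omega> v b) = (\<Sum>c<p. ?q u v c)" for u v
 proof -
  have "(\<Sum>a<m. \<Sum>b<m. A u a v b*\<omega> u a*\<omega> v b) = (\<Sum>a<m. \<Sum>b<m. \<Sum>c<p. C u v/\<sigma>*((\<Gamma> (fst u) c a*\<omega> u a)*(\<Gamma> (fst v) c b*\<omega> v b)))"
   unfolding A_def by (intro sum.cong refl) (simp add: sum_distrib_left sum_distrib_right mult_ac)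
  also have "\<dots> = (\<Sum>a<m. \<Sum>c<p. \<Sum>b<m. C u v/\<sigma>*((\<Gamma> (fst u) c a*\<omega> u a)*(\<Gamma> (fst v) c b*\<omega> v b)))"
   by (intro sum.cong refl sum.swap)
  also have "\<dots> = (\<Sum>c<p. \<Sum>a<m. \<Sum>b<m. C u v/\<sigma>*((\<Gamma> (fst u) c a*\<omega> u a)*(\<Gamma> (fst v) c b*\<omega> v b)))"
   by (rule sum.swap)
  also have "\<dots> = (\<Sum>c<p. ?q u v c)"
   unfolding x_def sum_product unfolding sum_distrib_left ..
  finally show ?thesis .
 qed
 have "offdiag_quad m A I \<omega> = (\<Sum>u\<in>I. (\<Sum>v\<in>I. \<Sum>c<p. ?q u v c) - (\<Sum>c<p. ?q u u c))"
  unfolding offdiag_quad_def bil by (intro sum.cong refl D)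
 also have "\<dots> = (\<Sum>u\<in>I. \<Sum>v\<in>I. \<Sum>c<p. ?q u v c) - (\<Sum>u\<in>I. \<Sum>c<p. ?q u u c)"
  by (rule sum_subtractf)
 also have "(\<Sum>u\<in>I. \<Sum>v\<in>I. \<Sum>c<p. ?q u v c) = (\<Sum>c<p. \<Sum>u\<in>I. \<Sum>v\<in>I. ?q u v c)"
  by (simp only: sum.swap[of _ "{..<p}" I])
 also have "(\<Sum>u\<in>I. \<Sum>c<p. ?q u u c) = (\<Sum>c<p. \<Sum>u\<in>I. ?q u u c)"
  by (rule sum.swap)
 also have "(\<Sum>c<p. \<Sum>u\<in>I. \<Sum>v\<in>I. ?q u v c) - (\<Sum>c<p. \<Sum>u\<in>I. ?q u u c) =
  (\<Sum>c<p. (\<Sum>u\<in>I. \<Sum>v\<in>I. ?q u v c) - (\<Sum>u\<in>I. ?q u u c))"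
  by (rule sum_subtractf[symmetric])
 also have "\<dots> = (\<Sum>c<p. (real (N 1)*real (N 2)/n*(xb 1 c \<omega> - xb 2 c \<omega>)\<^sup>2 -
  (wt 1*((\<Sum>j=1..N 1. (x c (1, j) \<omega> - xb 1 c \<omega>)\<^sup>2)/(real (N 1) - 1))
  + wt 2*((\<Sum>j=1..N 2. (x c (2, j) \<omega> - xb 2 c \<omega>)\<^sup>2)/(real (N 2) - 1))))/\<sigma>)"
 proof (intro sum.cong refl)
  fix c
  define a where "a = (\<Sum>j=1..N 1. x c (1, j) \<omega>)"
  define b where "b = (\<Sum>j=1..N 2. x c (2, j) \<omega>)"
  define a2 where "a2 = (\<Sum>j=1..N 1. (x c (1, j) \<omega>)\<^sup>2)"
  define b2 where "b2 = (\<Sum>j=1..N 2. (x c (2, j) \<omega>)\<^sup>2)"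
  define n1 where "n1 = real (N 1)"
  define n2 where "n2 = real (N 2)"
  have np: "n1 > 1" "n2 > 1" "n = n1 + n2" using N by (auto simp: n1_def n2_def n_def)
  define C1 where "C1 = wt 1/(n1 - 1)"
  define C2 where "C2 = wt 2/(n2 - 1)"
  define C0 where "C0 = - (1/n)"
  have Cs: "C (1, j) (1, k) = C1" "C (2, j) (2, k) = C2" "C (1, j) (2, k) = C0" "C (2, j) (1, k) = C0" for j k
   by (simp_all add: C_def C1_def C2_def C0_def n1_def n2_def)
  have in1: "(\<Sum>v\<in>I. C (1, j) v/\<sigma>*(x c (1, j) \<omega>*x c v \<omega>)) = x c (1, j) \<omega>*((C1*a + C0*b)/\<sigma>)" for j
   unfolding sum_sample_index a_def b_def by (simp add: Cs sum_distrib_left sum_divide_distrib add_divide_distrib distrib_left mult_ac del: One_nat_def)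
  have in2: "(\<Sum>v\<in>I. C (2, j) v/\<sigma>*(x c (2, j) \<omega>*x c v \<omega>)) = x c (2, j) \<omega>*((C0*a + C2*b)/\<sigma>)" for j
   unfolding sum_sample_index a_def b_def by (simp add: Cs sum_distrib_left sum_divide_distrib add_divide_distrib distrib_left mult_ac del: One_nat_def)
  have L1: "(\<Sum>u\<in>I. \<Sum>v\<in>I. ?q u v c) = a*((C1*a + C0*b)/\<sigma>) + b*((C0*a + C2*b)/\<sigma>)"
   unfolding sum_sample_index[where f = "\<lambda>u. \<Sum>v\<in>I. ?q u v c"] in1 in2
   unfolding a_def b_def by (simp only: sum_distrib_right)
  have L2: "(\<Sum>u\<in>I. ?q u u c) = (C1*a2 + C2*b2)/\<sigma>"
   unfolding sum_sample_index a2_def b2_def by (simp add: Cs sum_distrib_left sum_divide_distrib add_divide_distrib power2_eq_square del: One_nat_def)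
  have xb: "xb 1 c \<omega> = a/n1" "xb 2 c \<omega> = b/n2" by (simp_all add: xb_def a_def b_def n1_def n2_def)
  have v1: "(\<Sum>j=1..N 1. (x c (1, j) \<omega> - xb 1 c \<omega>)\<^sup>2) = a2 - a\<^sup>2/n1"
   using sum_sq_identities[of "N 1" "\<lambda>j. x c (1, j) \<omega>"] N_pos unfolding xb_def a_def a2_def n1_def by simp
  have v2: "(\<Sum>j=1..N 2. (x c (2, j) \<omega> - xb 2 c \<omega>)\<^sup>2) = b2 - b\<^sup>2/n2"
   using sum_sq_identities[of "N 2" "\<lambda>j. x c (2, j) \<omega>"] N_pos unfolding xb_def b_def b2_def n2_def by simp
  have w: "wt 1 = n2/n" "wt 2 = n1/n" by (simp_all add: wt12 n1_def n2_def del: One_nat_def)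
  have nn: "n \<noteq> 0" "n1 \<noteq> 0" "n2 \<noteq> 0" "n1 - 1 \<noteq> 0" "n2 - 1 \<noteq> 0" using np by auto
  have e1: "n1*n2/n*(a/n1 - b/n2)\<^sup>2 = n2/n*(a\<^sup>2/n1) - 2*(a*b)/n + n1/n*(b\<^sup>2/n2)"
   using nn by (simp add: power2_eq_square field_simps)
  have e2: "a\<^sup>2/n1 - (a2 - a\<^sup>2/n1)/(n1 - 1) = (a\<^sup>2 - a2)/(n1 - 1)"
   using nn by (simp add: field_simps) (simp add: power2_eq_square algebra_simps)?
  have e3: "b\<^sup>2/n2 - (b2 - b\<^sup>2/n2)/(n2 - 1) = (b\<^sup>2 - b2)/(n2 - 1)"
   using nn by (simp add: field_simps) (simp add: power2_eq_square algebra_simps)?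
  have "n1*n2/n*(a/n1 - b/n2)\<^sup>2 - (n2/n*((a2 - a\<^sup>2/n1)/(n1 - 1)) + n1/n*((b2 - b\<^sup>2/n2)/(n2 - 1))) =
   n2/n*(a\<^sup>2/n1 - (a2 - a\<^sup>2/n1)/(n1 - 1)) + n1/n*(b\<^sup>2/n2 - (b2 - b\<^sup>2/n2)/(n2 - 1)) - 2*(a*b)/n"
   unfolding e1 by (simp add: right_diff_distrib)
  also have "\<dots> = n2/n*((a\<^sup>2 - a2)/(n1 - 1)) + n1/n*((b\<^sup>2 - b2)/(n2 - 1)) - 2*(a*b)/n" unfolding e2 e3 ..
  also have "\<dots> = (a*(C1*a + C0*b) + b*(C0*a + C2*b)) - (C1*a2 + C2*b2)"
   unfolding C1_def C2_def C0_def w by (simp add: power2_eq_square algebra_simps diff_divide_distrib)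
  finally show "(\<Sum>u\<in>I. \<Sum>v\<in>I. ?q u v c) - (\<Sum>u\<in>I. ?q u u c) =
   (real (N 1)*real (N 2)/n*(xb 1 c \<omega> - xb 2 c \<omega>)\<^sup>2 -
   (wt 1*((\<Sum>j=1..N 1. (x c (1, j) \<omega> - xb 1 c \<omega>)\<^sup>2)/(real (N 1) - 1))
   + wt 2*((\<Sum>j=1..N 2. (x c (2, j) \<omega> - xb 2 c \<omega>)\<^sup>2)/(real (N 2) - 1))))/\<sigma>"
   unfolding L1 L2 v1 v2 unfolding xb w n1_def[symmetric] n2_def[symmetric]
   by (simp add: add_divide_distrib[symmetric] diff_divide_distrib[symmetric])
 qed
 also have "\<dots> = (T0 \<omega> - tro \<omega>)/\<sigma>"
  unfolding T0_def tro_def by (simp add: sum_divide_distrib[symmetric] sum_subtractf sum_distrib_left)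
 finally show ?thesis .
qed

text \<open>The influence of a single observation on the quadratic form.\<close>
definition ell :: "nat \<times> nat \<Rightarrow> real" where
 "ell u = (\<Sum>a<m. \<Sum>v\<in>I - {u}. \<Sum>b<m. (A u a v b)\<^sup>2)"

lemma ell_eq: "ell u = (\<Sum>v\<in>I - {u}. (C u v)\<^sup>2/\<sigma>\<^sup>2*tr2 (fst u) (fst v))"
proof -
 have "ell u = (\<Sum>v\<in>I - {u}. \<Sum>a<m. \<Sum>b<m. (A u a v b)\<^sup>2)" unfolding ell_def by (rule sum.swap)
 also have "\<dots> = (\<Sum>v\<in>I - {u}. (C u v)\<^sup>2/\<sigma>\<^sup>2*tr2 (fst u) (fst v))"
  unfolding tr2_gram A_def power_mult_distrib power_divide unfolding sum_distrib_left ..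
 finally show ?thesis .
qed

text \<open>
The coefficients between an observation and the others are of the order of the inverse of the sample
size, and the traces that they multiply are part of \<open>T2\<close>, by which the form is
normalized.
\<close>
lemma ell_le:
 assumes u: "u \<in> I" and T2: "0 < T2"
 shows "ell u \<le> 1/(2*(real (N (fst u)) - 1))"
proof -
 have s2: "\<sigma>\<^sup>2 = 2*T2" using T2 by (simp add: \<sigma>_def)
 have key: "ell u \<le> 1/(2*(real (N i) - 1))"
  if i: "u = (i, j)" "i \<in> {1, 2}" "j \<in> {1..N i}" and k: "k = 3 - i"
   and T: "T2 = (wt i)\<^sup>2*tr2 i i + 2*wt i*wt k*tr2 i k + (wt k)\<^sup>2*tr2 k k" and sub: "\<And>f :: nat \<times> nat \<Rightarrow> real. (\<Sum>v\<in>I. f v) = (\<Sum>l=1..N i. f (i, l)) + (\<Sum>l=1..N k. f (k, l))" and wk: "wt k = real (N i)/n" "wt i = real (N k)/n" and ik: "i \<noteq> k" and Ni: "0 < real (N i) - 1"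
  for i j k
 proof -
  let ?f = "\<lambda>v. (C u v)\<^sup>2/\<sigma>\<^sup>2*tr2 (fst u) (fst v)"
  have f1: "?f (i, l) = (wt i/(real (N i) - 1))\<^sup>2/\<sigma>\<^sup>2*tr2 i i" for l by (simp add: C_def i(1))
  have f2: "?f (k, l) = (1/n)\<^sup>2/\<sigma>\<^sup>2*tr2 i k" for l using ik by (simp add: C_def i(1))
  have fu: "?f u = (wt i/(real (N i) - 1))\<^sup>2/\<sigma>\<^sup>2*tr2 i i" using f1[of j] i(1) by simp
  have sumf: "(\<Sum>v\<in>I. ?f v) = real (N i)*((wt i/(real (N i) - 1))\<^sup>2/\<sigma>\<^sup>2*tr2 i i) + real (N k)*((1/n)\<^sup>2/\<sigma>\<^sup>2*tr2 i k)"
   unfolding sub f1 f2 by simp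
  have "ell u = (\<Sum>v\<in>I. ?f v) - ?f u"
   unfolding ell_eq using u finite_sample_index by (simp add: sum_diff1)
  also have "\<dots> = (real (N i) - 1)*((wt i/(real (N i) - 1))\<^sup>2/\<sigma>\<^sup>2*tr2 i i) + real (N k)*((1/n)\<^sup>2/\<sigma>\<^sup>2*tr2 i k)"
   unfolding sumf fu by (simp add: left_diff_distrib diff_divide_distrib)
  also have "\<dots> = ((wt i)\<^sup>2*tr2 i i/(real (N i) - 1) + wt i*wt k*tr2 i k/real (N i))/\<sigma>\<^sup>2"
  proof -
   have "real (N k)*((1/n)\<^sup>2/\<sigma>\<^sup>2*tr2 i k) = wt i*wt k*tr2 i k/real (N i)/\<sigma>\<^sup>2"
    unfolding wk using Ni n_pos by (simp add: power2_eq_square field_simps)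
   moreover have "(real (N i) - 1)*((wt i/(real (N i) - 1))\<^sup>2/\<sigma>\<^sup>2*tr2 i i) = (wt i)\<^sup>2*tr2 i i/(real (N i) - 1)/\<sigma>\<^sup>2"
    using Ni by (simp add: power2_eq_square)
   ultimately show ?thesis by (simp add: add_divide_distrib)
  qed
  also have "\<dots> \<le> (T2/(real (N i) - 1))/\<sigma>\<^sup>2"
  proof (intro divide_right_mono)
   have "wt i*wt k*tr2 i k/real (N i) \<le> wt i*wt k*tr2 i k/(real (N i) - 1)"
    using Ni wt_nonneg tr2_nonneg by (intro divide_left_mono) auto
   moreover have "(wt i)\<^sup>2*tr2 i i + wt i*wt k*tr2 i k \<le> T2"
    unfolding T using wt_nonneg[of i] wt_nonneg[of k] tr2_nonneg[of i k] tr2_nonneg[of k k] by simp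
   then have "((wt i)\<^sup>2*tr2 i i + wt i*wt k*tr2 i k)/(real (N i) - 1) \<le> T2/(real (N i) - 1)"
    using Ni by (intro divide_right_mono) auto
   ultimately show "(wt i)\<^sup>2*tr2 i i/(real (N i) - 1) + wt i*wt k*tr2 i k/real (N i) \<le> T2/(real (N i) - 1)"
    by (simp add: add_divide_distrib)
  qed simp
  also have "\<dots> = 1/(2*(real (N i) - 1))" unfolding s2 using T2 by simp
  finally show ?thesis .
 qed
 have tr2_sym: "tr2 2 1 = tr2 1 2" by (simp add: tr2_def mult.commute)
 obtain i j where ij: "u = (i, j)" by (cases u)
 have jj: "j \<in> {1..N i}" using u by (simp add: sample_index_def ij)
 have "i = 1 \<or> i = 2" using u by (auto simp: sample_index_def ij)
 then show ?thesis
 proof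
  assume i: "i = 1"
  have "ell u \<le> 1/(2*(real (N 1) - 1))"
   by (rule key[of 1 j 2]) (use i jj ij N_pos in \<open>simp_all add: T2_eq sum_sample_index wt12 del: One_nat_def\<close>)
  then show ?thesis by (simp only: ij i fst_conv)
 next
  assume i: "i = 2"
  have "ell u \<le> 1/(2*(real (N 2) - 1))"
   by (rule key[of 2 j 1]) (use i jj ij N_pos in \<open>simp_all add: T2_eq sum_sample_index wt12 tr2_sym del: One_nat_def\<close>)
  then show ?thesis by (simp only: ij i fst_conv)
 qed
qed

lemma ell_nonneg: "0 \<le> ell u" unfolding ell_def by (intro sum_nonneg) auto

text \<open>
The parameter \<open>\<eta> = 1/sqrt \<nu>\<close> balances the two parts of the remainder, as each
influence is at most \<open>1/\<nu>\<close> and their sum is bounded.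
\<close>
lemma lindeberg_error:
 assumes T2: "0 < T2" and K: "0 \<le> K"
 shows "(\<Sum>u\<in>I. (4*(1/sqrt \<nu>)*\<theta>\<^sup>2*ell u + 16*K\<^sup>2*\<theta> ^ 4*(ell u)\<^sup>2/(1/sqrt \<nu>))/6) \<le> (4*\<theta>\<^sup>2 + 16*K\<^sup>2*\<theta> ^ 4)/sqrt \<nu>"
proof -
 let ?e = "\<lambda>u. (4*(1/sqrt \<nu>)*\<theta>\<^sup>2*ell u + 16*K\<^sup>2*\<theta> ^ 4*(ell u)\<^sup>2/(1/sqrt \<nu>))/6" and ?c = "4*\<theta>\<^sup>2 + 16*K\<^sup>2*\<theta> ^ 4"
 have sn: "0 < sqrt \<nu>" using \<nu>_pos by simp
 have l\<nu>: "ell u \<le> 1/\<nu>" if "u \<in> I" for u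
 proof -
  have "fst u \<in> {1, 2}" using that by (auto simp: sample_index_def)
  then have "\<nu> \<le> 2*(real (N (fst u)) - 1)" using \<nu>_pos by auto
  then have "1/(2*(real (N (fst u)) - 1)) \<le> 1/\<nu>" using \<nu>_pos by (intro frac_le) auto
  then show ?thesis using ell_le[OF that T2] by linarith
 qed
 have tot: "(\<Sum>u\<in>I. ell u) \<le> 2"
 proof -
  have h: "real k*(1/(2*(real k - 1))) \<le> 1" if "2 \<le> k" for k :: nat
   using that by (simp add: divide_le_eq)
  have "(\<Sum>u\<in>I. ell u) \<le> (\<Sum>u\<in>I. 1/(2*(real (N (fst u)) - 1)))" by (intro sum_mono ell_le T2)
  also have "\<dots> = real (N 1)*(1/(2*(real (N 1) - 1))) + real (N 2)*(1/(2*(real (N 2) - 1)))"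
   by (simp add: sum_sample_index)
  also have "\<dots> \<le> 1 + 1" using h N by (intro add_mono) auto
  finally show ?thesis by simp
 qed
 have "(\<Sum>u\<in>I. ?e u) \<le>
  (\<Sum>u\<in>I. ell u*(?c/sqrt \<nu>/6))"
 proof (intro sum_mono)
  fix u assume u: "u \<in> I"
  have "(ell u)\<^sup>2/(1/sqrt \<nu>) = ell u*(ell u * sqrt \<nu>)" by (simp add: power2_eq_square)
  also have "\<dots> \<le> ell u*(1/\<nu> * sqrt \<nu>)" using l\<nu>[OF u] ell_nonneg sn by (intro mult_left_mono mult_right_mono) auto
  also have "1/\<nu> * sqrt \<nu> = 1/sqrt \<nu>" using \<nu>_pos by (simp add: field_simps)
  finally have "16*K\<^sup>2*\<theta> ^ 4*((ell u)\<^sup>2/(1/sqrt \<nu>)) \<le> 16*K\<^sup>2*\<theta> ^ 4*(ell u*(1/sqrt \<nu>))"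
   by (intro mult_left_mono) auto
  moreover have "ell u*(?c/sqrt \<nu>/6) = (4*(1/sqrt \<nu>)*\<theta>\<^sup>2*ell u + 16*K\<^sup>2*\<theta> ^ 4*(ell u*(1/sqrt \<nu>)))/6"
   by (simp add: algebra_simps add_divide_distrib)
  ultimately show "?e u \<le> ell u*(?c/sqrt \<nu>/6)"
   by (simp only: times_divide_eq_right[symmetric] divide_right_mono add_left_mono)
 qed
 also have "\<dots> = (\<Sum>u\<in>I. ell u)*(?c/sqrt \<nu>/6)" by (rule sum_distrib_right[symmetric])
 also have "\<dots> \<le> 6*(?c/sqrt \<nu>/6)"
  using tot sn by (intro mult_right_mono divide_nonneg_nonneg add_nonneg_nonneg mult_nonneg_nonneg) auto
 also have "\<dots> = ?c/sqrt \<nu>"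
 proof -
  have "6*(Y/6) = Y" for Y :: real by simp
  then show ?thesis .
 qed
 finally show ?thesis .
qed

end

section \<open>The trace estimator and the limiting characteristic function\<close>

lemma centering_matrix_idempotent:
 assumes "j \<in> {1..k}" "j' \<in> {1..k}"
 shows "(\<Sum>l=1..k. (of_bool (j = l) - 1/real k)*(of_bool (j' = l) - 1/real k)) = of_bool (j = j') - 1/real k"
proof -
 have k: "real k \<noteq> 0" using assms by auto
 have e: "(of_bool (j = l) - 1/real k)*(of_bool (j' = l) - 1/real k) =
  (if l = j then of_bool (j' = j) else 0) - (if l = j then 1/real k else 0) - (if l = j' then 1/real k else 0) + 1/(real k)\<^sup>2" for l
  by (auto simp: algebra_simps power2_eq_square)
 have "(\<Sum>l=1..k. (of_bool (j = l) - 1/real k)*(of_bool (j' = l) - 1/real k)) = of_bool (j' = j) - 1/real k - 1/real k + real k*(1/(real k)\<^sup>2)"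
  unfolding e using assms by (simp add: sum.distrib sum_subtractf)
 also have "real k*(1/(real k)\<^sup>2) = 1/real k" using k by (simp add: power2_eq_square)
 finally show ?thesis by (cases "j = j'") auto
qed

text \<open>
The probabilistic part: the law of all factors is the product of the isotropic laws
\<open>D\<close>.
\<close>
locale two_sample_law = two_sample_factors p m N \<Gamma> + isotropic_family m D \<Delta> K "sample_index N"
 for p m :: nat and N :: "nat \<Rightarrow> nat" and \<Gamma> :: "nat \<Rightarrow> nat \<Rightarrow> nat \<Rightarrow> real"
  and D :: "nat \<times> nat \<Rightarrow> (nat \<Rightarrow> real) measure" and \<Delta> :: "nat \<times> nat \<Rightarrow> real" and K :: real
begin

lemma x_lin: "u \<in> I \<Longrightarrow> x c u \<omega> = lin (\<lambda>v a. of_bool (u = v)*\<Gamma> (fst v) c a) \<omega>"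
proof -
 assume u: "u \<in> I"
 have "lin (\<lambda>v a. of_bool (u = v)*\<Gamma> (fst v) c a) \<omega> = (\<Sum>v\<in>I. if v = u then x c u \<omega> else 0)"
  unfolding lin_def by (intro sum.cong refl) (auto simp: x_def)
 then show ?thesis using u finite_sample_index by simp
qed

lemma x_xb_lin:
 assumes u: "u \<in> I"
 shows "x c u \<omega> - xb (fst u) c \<omega> = lin (\<lambda>v a. (if fst u = fst v then of_bool (u = v) - 1/real (N (fst u)) else 0)*\<Gamma> (fst v) c a) \<omega>"
proof -
 have "xb (fst u) c \<omega> = (\<Sum>v\<in>I. if fst u = fst v then x c v \<omega>/real (N (fst u)) else 0)"
 proof -
  have "fst u = 1 \<or> fst u = 2" using u by (auto simp: sample_index_def)
  then show ?thesis by (auto simp: sum_sample_index xb_def sum_divide_distrib)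
 qed
 also have "\<dots> = lin (\<lambda>v a. (if fst u = fst v then 1/real (N (fst u)) else 0)*\<Gamma> (fst v) c a) \<omega>"
  unfolding lin_def by (intro sum.cong refl) (auto simp: x_def sum_divide_distrib)
 finally have xb: "xb (fst u) c \<omega> = lin (\<lambda>v a. (if fst u = fst v then 1/real (N (fst u)) else 0)*\<Gamma> (fst v) c a) \<omega>" .
 show ?thesis unfolding x_lin[OF u] xb unfolding lin_def sum_subtractf[symmetric]
  by (intro sum.cong refl) (auto simp: algebra_simps)
qed

text \<open>
The rows of the centring projection of each sample, scaled such that the trace estimate is the sum
of the squares of the linear forms \<open>Bt\<close>.
\<close>
definition w :: "nat \<times> nat \<Rightarrow> nat \<times> nat \<Rightarrow> real" where
 "w u v = (if fst u = fst v then sqrt (wt (fst u)/(real (N (fst u)) - 1))*(of_bool (u = v) - 1/real (N (fst u))) else 0)"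

definition Bt :: "(nat \<times> nat) \<times> nat \<Rightarrow> nat \<times> nat \<Rightarrow> nat \<Rightarrow> real" where
 "Bt q v a = w (fst q) v * \<Gamma> (fst v) (snd q) a"

lemma lin_scale: "lin (\<lambda>v a. r*\<beta> v a) \<omega> = r*lin \<beta> \<omega>"
 by (simp add: lin_def sum_distrib_left mult_ac)

lemma sum_pairs: "(\<Sum>q\<in>I \<times> {..<p}. f q) = (\<Sum>u\<in>I. \<Sum>c<p. f (u, c))"
 by (simp add: sum.cartesian_product case_prod_unfold)

lemma tro_lin: "tro \<omega> = (\<Sum>q\<in>I \<times> {..<p}. (lin (Bt q) \<omega>)\<^sup>2)"
proof -
 have L: "(lin (Bt (u, c)) \<omega>)\<^sup>2 = wt (fst u)/(real (N (fst u)) - 1)*(x c u \<omega> - xb (fst u) c \<omega>)\<^sup>2" if u: "u \<in> I" for u c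
 proof -
  define r where "r = sqrt (wt (fst u)/(real (N (fst u)) - 1))"
  have "fst u = 1 \<or> fst u = 2" using u by (auto simp: sample_index_def)
  then have "0 \<le> wt (fst u)/(real (N (fst u)) - 1)" using wt_nonneg N_pos by (auto simp: divide_nonneg_pos)
  then have r2: "r\<^sup>2 = wt (fst u)/(real (N (fst u)) - 1)" by (simp add: r_def)
  have "Bt (u, c) = (\<lambda>v a. r*((if fst u = fst v then of_bool (u = v) - 1/real (N (fst u)) else 0)*\<Gamma> (fst v) c a))"
   by (auto simp: Bt_def w_def r_def fun_eq_iff)
  then have "lin (Bt (u, c)) \<omega> = r*(x c u \<omega> - xb (fst u) c \<omega>)"
   by (simp only: x_xb_lin[OF u] lin_scale)
  then show ?thesis by (simp add: power_mult_distrib r2)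
 qed
 have "(\<Sum>q\<in>I \<times> {..<p}. (lin (Bt q) \<omega>)\<^sup>2) = (\<Sum>u\<in>I. \<Sum>c<p. (lin (Bt (u, c)) \<omega>)\<^sup>2)"
  by (simp add: sum.cartesian_product case_prod_unfold)
 also have "\<dots> = (\<Sum>u\<in>I. \<Sum>c<p. wt (fst u)/(real (N (fst u)) - 1)*(x c u \<omega> - xb (fst u) c \<omega>)\<^sup>2)"
  by (intro sum.cong refl L)
 also have "\<dots> = (\<Sum>c<p. \<Sum>u\<in>I. wt (fst u)/(real (N (fst u)) - 1)*(x c u \<omega> - xb (fst u) c \<omega>)\<^sup>2)"
  by (rule sum.swap)
 also have "\<dots> = tro \<omega>" unfolding tro_def sum_sample_index fst_conv sum_distrib_left[symmetric]
  by (simp only: times_divide_eq_left times_divide_eq_right)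
 finally show ?thesis ..
qed

text \<open>The Gram matrix of the rows \<open>w\<close>: a projection is its own square.\<close>
definition w2 :: "nat \<times> nat \<Rightarrow> nat \<times> nat \<Rightarrow> real" where
 "w2 u v = (if fst u = fst v then wt (fst u)/(real (N (fst u)) - 1)*(of_bool (u = v) - 1/real (N (fst u))) else 0)"

lemma sum_sample:
 assumes i: "i = 1 \<or> i = 2"
 shows "(\<Sum>v\<in>I. if i = fst v then f v else 0) = (\<Sum>l=1..N i. f (i, l))"
 using i by (auto simp: sum_sample_index)

lemma w_product:
 assumes u: "u \<in> I" "u' \<in> I"
 shows "(\<Sum>v\<in>I. w u v * w u' v * f (fst v)) = w2 u u'*f (fst u)"
proof (cases "fst u = fst u'")
 case False
 then have "(\<Sum>v\<in>I. w u v * w u' v * f (fst v)) = 0" by (intro sum.neutral) (auto simp: w_def)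
 then show ?thesis using False by (simp add: w2_def)
next
 case True
 define i where "i = fst u"
 have i: "i = 1 \<or> i = 2" using u by (auto simp: sample_index_def i_def)
 obtain j j' where j: "u = (i, j)" "u' = (i, j')" using True by (metis i_def prod.collapse)
 have jj: "j \<in> {1..N i}" "j' \<in> {1..N i}" using u by (auto simp: j sample_index_def)
 have g: "0 \<le> wt i/(real (N i) - 1)" using i wt_nonneg N_pos by (auto simp: divide_nonneg_pos)
 have "(\<Sum>v\<in>I. w u v * w u' v * f (fst v)) = (\<Sum>v\<in>I. if i = fst v then w u v * w u' v * f i else 0)"
  by (intro sum.cong refl) (auto simp: w_def i_def)
 also have "\<dots> = (\<Sum>l=1..N i. w (i, j) (i, l)*w (i, j') (i, l)*f i)" unfolding j by (rule sum_sample[OF i])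
 also have "\<dots> = (\<Sum>l=1..N i. (wt i/(real (N i) - 1)*f i)*((of_bool (j = l) - 1/real (N i))*(of_bool (j' = l) - 1/real (N i))))"
 proof (intro sum.cong refl)
  fix l
  define s where "s = sqrt (wt i/(real (N i) - 1))"
  have ss: "wt i/(real (N i) - 1) = s * s" using g unfolding s_def by (simp only: real_sqrt_mult_self abs_of_nonneg)
  have "w (i, j) (i, l) = s*(of_bool (j = l) - 1/real (N i))" "w (i, j') (i, l) = s*(of_bool (j' = l) - 1/real (N i))"
   unfolding w_def s_def by simp_all
  then show "w (i, j) (i, l)*w (i, j') (i, l)*f i = (wt i/(real (N i) - 1)*f i)*((of_bool (j = l) - 1/real (N i))*(of_bool (j' = l) - 1/real (N i)))"
   unfolding ss by (simp only: mult_ac)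
 qed
 also have "\<dots> = (wt i/(real (N i) - 1)*f i)*(of_bool (j = j') - 1/real (N i))"
  unfolding sum_distrib_left[symmetric] using jj by (subst centering_matrix_idempotent) auto
 finally show ?thesis by (simp add: w2_def j)
qed

lemma w2_diag:
 assumes "u \<in> I" shows "w2 u u = wt (fst u)/real (N (fst u))"
proof -
 have "fst u = 1 \<or> fst u = 2" using assms by (auto simp: sample_index_def)
 then have pos: "0 < real (N (fst u))" "0 < real (N (fst u)) - 1" using N_pos by auto
 have h: "v/(a - 1)*(1 - 1/a) = v/a" if "0 < a" "0 < a - 1" for a v :: real using that by (simp add: field_simps)
 show ?thesis unfolding w2_def using h[OF pos] by simp
qed

lemma w2_sq_sum:
 "(\<Sum>u\<in>I. \<Sum>v\<in>I. (w2 u v)\<^sup>2*f (fst u)) = (wt 1)\<^sup>2/(real (N 1) - 1)*f 1 + (wt 2)\<^sup>2/(real (N 2) - 1)*f 2"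
proof -
 have inner: "(\<Sum>v\<in>I. (w2 u v)\<^sup>2*f (fst u)) = ((wt (fst u))\<^sup>2/(real (N (fst u)) - 1)*f (fst u))/real (N (fst u))" if u: "u \<in> I" for u
 proof -
  define i where "i = fst u"
  have i: "i = 1 \<or> i = 2" using u by (auto simp: sample_index_def i_def)
  obtain j where j: "u = (i, j)" by (metis i_def prod.collapse)
  have jj: "j \<in> {1..N i}" using u by (auto simp: j sample_index_def)
  have Ni: "0 < real (N i)" "0 < real (N i) - 1" using i N_pos by auto
  have "(\<Sum>v\<in>I. (w2 u v)\<^sup>2*f (fst u)) = (\<Sum>v\<in>I. if i = fst v then (w2 u v)\<^sup>2*f i else 0)"
   by (intro sum.cong refl) (auto simp: w2_def i_def)
  also have "\<dots> = (\<Sum>l=1..N i. (w2 (i, j) (i, l))\<^sup>2*f i)" unfolding j by (rule sum_sample[OF i])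
  also have "\<dots> = (\<Sum>l=1..N i. ((wt i/(real (N i) - 1))\<^sup>2*f i)*((of_bool (j = l) - 1/real (N i))*(of_bool (j = l) - 1/real (N i))))"
   by (intro sum.cong refl) (simp add: w2_def power2_eq_square mult_ac)
  also have "\<dots> = ((wt i/(real (N i) - 1))\<^sup>2*f i)*(1 - 1/real (N i))"
   unfolding sum_distrib_left[symmetric] using jj by (subst centering_matrix_idempotent) auto
  also have "1 - 1/real (N i) = (real (N i) - 1)/real (N i)" using Ni by (simp add: field_simps)
  also have "((wt i/(real (N i) - 1))\<^sup>2*f i)*((real (N i) - 1)/real (N i)) = ((wt i)\<^sup>2/(real (N i) - 1)*f i)/real (N i)"
   using Ni by (simp add: power2_eq_square)
  finally show ?thesis by (simp add: i_def)
 qed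
 have "(\<Sum>u\<in>I. \<Sum>v\<in>I. (w2 u v)\<^sup>2*f (fst u)) = (\<Sum>u\<in>I. ((wt (fst u))\<^sup>2/(real (N (fst u)) - 1)*f (fst u))/real (N (fst u)))"
  by (intro sum.cong refl inner)
 also have "\<dots> = (wt 1)\<^sup>2/(real (N 1) - 1)*f 1 + (wt 2)\<^sup>2/(real (N 2) - 1)*f 2"
 proof -
  have h: "(\<Sum>j=1..k. X/real k) = X" if "0 < real k" for k X using that by simp
  show ?thesis unfolding sum_sample_index fst_conv h[OF N_pos(1)] h[OF N_pos(2)] ..
 qed
 finally show ?thesis .
qed

lemma Bt_gram:
 assumes "u \<in> I" "u' \<in> I"
 shows "(\<Sum>v\<in>I. \<Sum>a<m. Bt (u, c) v a*Bt (u', d) v a) = w2 u u'*S (fst u) c d"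
proof -
 have "(\<Sum>v\<in>I. \<Sum>a<m. Bt (u, c) v a*Bt (u', d) v a) = (\<Sum>v\<in>I. w u v * w u' v * S (fst v) c d)"
  unfolding Bt_def S_def by (simp add: sum_distrib_left mult_ac)
 then show ?thesis using w_product[OF assms, of "\<lambda>i. S i c d"] by simp
qed

lemma tro_mean: "(\<Sum>q\<in>I \<times> {..<p}. \<Sum>v\<in>I. \<Sum>a<m. (Bt q v a)\<^sup>2) = T1"
proof -
 have "(\<Sum>q\<in>I \<times> {..<p}. \<Sum>v\<in>I. \<Sum>a<m. (Bt q v a)\<^sup>2) = (\<Sum>u\<in>I. \<Sum>c<p. \<Sum>v\<in>I. \<Sum>a<m. Bt (u, c) v a*Bt (u, c) v a)"
  unfolding sum_pairs power2_eq_square ..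
 also have "\<dots> = (\<Sum>u\<in>I. \<Sum>c<p. wt (fst u)/real (N (fst u))*S (fst u) c c)"
  by (intro sum.cong refl) (simp add: Bt_gram w2_diag)
 also have "\<dots> = (\<Sum>c<p. \<Sum>u\<in>I. wt (fst u)/real (N (fst u))*S (fst u) c c)" by (rule sum.swap)
 also have "\<dots> = T1" 
 proof -
  have h: "(\<Sum>j=1..k. v/real k*t) = v * t" if "0 < real k" for k v t using that by simp
  show ?thesis unfolding T1_def Om_def sum_sample_index fst_conv h[OF N_pos(1)] h[OF N_pos(2)] ..
 qed
 finally show ?thesis .
qed

text \<open>
The Gaussian part is a sum of traces of squared covariance matrices, each divided by its sample size
less one; the excess part has the same order.
\<close>
lemma tro_variance:
 "integrable (PiM I D) (\<lambda>\<omega>. (tro \<omega> - T1)\<^sup>2)"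
 "P.expectation (\<lambda>\<omega>. (tro \<omega> - T1)\<^sup>2) \<le> (K - 1)*T2/\<nu>"
proof -
 let ?B = "\<lambda>v a. (\<Sum>q\<in>I \<times> {..<p}. (Bt q v a)\<^sup>2)" and ?w = "\<lambda>v. wt (fst v)/real (N (fst v))"
 note V = lin_sq_sum_variance[where B = Bt and Q = "I \<times> {..<p}", unfolded tro_mean, folded tro_lin]
 show "integrable (PiM I D) (\<lambda>\<omega>. (tro \<omega> - T1)\<^sup>2)" by (rule V(1))
 have A1: "(\<Sum>q\<in>I \<times> {..<p}. \<Sum>r\<in>I \<times> {..<p}. (\<Sum>v\<in>I. \<Sum>a<m. Bt q v a*Bt r v a)\<^sup>2) =
  (wt 1)\<^sup>2/(real (N 1) - 1)*tr2 1 1 + (wt 2)\<^sup>2/(real (N 2) - 1)*tr2 2 2"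
 proof -
  have "(\<Sum>q\<in>I \<times> {..<p}. \<Sum>r\<in>I \<times> {..<p}. (\<Sum>v\<in>I. \<Sum>a<m. Bt q v a*Bt r v a)\<^sup>2) =
   (\<Sum>u\<in>I. \<Sum>c<p. \<Sum>u'\<in>I. \<Sum>d<p. (\<Sum>v\<in>I. \<Sum>a<m. Bt (u, c) v a*Bt (u', d) v a)\<^sup>2)"
   unfolding sum_pairs ..
  also have "\<dots> = (\<Sum>u\<in>I. \<Sum>c<p. \<Sum>u'\<in>I. \<Sum>d<p. (w2 u u')\<^sup>2*(S (fst u) c d*S (fst u) c d))"
   by (intro sum.cong refl) (simp add: Bt_gram power_mult_distrib power2_eq_square)
  also have "\<dots> = (\<Sum>u\<in>I. \<Sum>u'\<in>I. \<Sum>c<p. \<Sum>d<p. (w2 u u')\<^sup>2*(S (fst u) c d*S (fst u) c d))"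
   by (intro sum.cong refl sum.swap)
  also have "\<dots> = (\<Sum>u\<in>I. \<Sum>u'\<in>I. (w2 u u')\<^sup>2*tr2 (fst u) (fst u))"
   unfolding tr2_def by (simp add: sum_distrib_left)
  finally show ?thesis using w2_sq_sum[of "\<lambda>i. tr2 i i"] by simp
 qed
 have diag_le: "(\<Sum>a<m. (\<Sum>c<p. (\<Gamma> i c a)\<^sup>2)\<^sup>2) \<le> tr2 i i" for i
 proof -
  have "(\<Sum>a<m. (\<Sum>c<p. (\<Gamma> i c a)\<^sup>2)\<^sup>2) \<le> (\<Sum>a<m. \<Sum>b<m. (\<Sum>c<p. \<Gamma> i c a*\<Gamma> i c b)\<^sup>2)"
  proof (intro sum_mono)
   fix a assume "a \<in> {..<m}"
   then show "(\<Sum>c<p. (\<Gamma> i c a)\<^sup>2)\<^sup>2 \<le> (\<Sum>b<m. (\<Sum>c<p. \<Gamma> i c a*\<Gamma> i c b)\<^sup>2)"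
    using member_le_sum[of a "{..<m}" "\<lambda>b. (\<Sum>c<p. \<Gamma> i c a*\<Gamma> i c b)\<^sup>2"] by (simp add: power2_eq_square)
  qed
  then show ?thesis unfolding tr2_gram .
 qed
 have A2: "(\<Sum>v\<in>I. \<Delta> v * (\<Sum>a<m. (?B v a)\<^sup>2)) \<le>
  (K - 3)*((wt 1)\<^sup>2/(real (N 1) - 1)*tr2 1 1 + (wt 2)\<^sup>2/(real (N 2) - 1)*tr2 2 2)"
 proof -
  have col: "(?B v a) = wt (fst v)/real (N (fst v))*(\<Sum>c<p. (\<Gamma> (fst v) c a)\<^sup>2)" if v: "v \<in> I" for v a
  proof -
   have wsym: "w u v = w v u" for u by (auto simp: w_def)
   have "(?B v a) = (\<Sum>u\<in>I. \<Sum>c<p. (Bt (u, c) v a)\<^sup>2)"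
    by (simp add: sum.cartesian_product case_prod_unfold)
   also have "\<dots> = (\<Sum>u\<in>I. w v u*w v u*1)*(\<Sum>c<p. (\<Gamma> (fst v) c a)\<^sup>2)"
    unfolding sum_product by (intro sum.cong refl) (simp add: Bt_def wsym power_mult_distrib power2_eq_square)
   finally show ?thesis using w_product[OF v v, of "\<lambda>_. 1"] w2_diag[OF v] by simp
  qed
  have "(\<Sum>v\<in>I. \<Delta> v * (\<Sum>a<m. (?B v a)\<^sup>2)) \<le> (\<Sum>v\<in>I. (K - 3)*((?w v)\<^sup>2*tr2 (fst v) (fst v)))"
  proof (intro sum_mono)
   fix v assume v: "v \<in> I"
   have "(\<Sum>a<m. (?B v a)\<^sup>2) = (?w v)\<^sup>2*(\<Sum>a<m. (\<Sum>c<p. (\<Gamma> (fst v) c a)\<^sup>2)\<^sup>2)"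
    unfolding col[OF v] power_mult_distrib by (rule sum_distrib_left[symmetric])
   also have "\<dots> \<le> (?w v)\<^sup>2*tr2 (fst v) (fst v)" by (intro mult_left_mono diag_le) auto
   finally have le: "(\<Sum>a<m. (?B v a)\<^sup>2) \<le> (?w v)\<^sup>2*tr2 (fst v) (fst v)" .
   show "\<Delta> v * (\<Sum>a<m. (?B v a)\<^sup>2) \<le> (K - 3)*((?w v)\<^sup>2*tr2 (fst v) (fst v))"
    using K le by (intro mult_mono sum_nonneg) auto
  qed
  also have "\<dots> = (K - 3)*((wt 1)\<^sup>2/real (N 1)*tr2 1 1 + (wt 2)\<^sup>2/real (N 2)*tr2 2 2)"
  proof -
   have h: "(\<Sum>j=1..k. c*((v/real k)\<^sup>2*t)) = c*(v\<^sup>2/real k*t)" if "0 < real k" for k c v t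
    using that by (simp add: power2_eq_square)
   show ?thesis unfolding sum_sample_index fst_conv h[OF N_pos(1)] h[OF N_pos(2)] by (simp only: distrib_left)
  qed
  also have "\<dots> \<le> (K - 3)*((wt 1)\<^sup>2/(real (N 1) - 1)*tr2 1 1 + (wt 2)\<^sup>2/(real (N 2) - 1)*tr2 2 2)"
   using K N_pos tr2_nonneg by (intro mult_left_mono add_mono mult_right_mono divide_left_mono) auto
  finally show ?thesis .
 qed
 define R where "R = (wt 1)\<^sup>2/(real (N 1) - 1)*tr2 1 1 + (wt 2)\<^sup>2/(real (N 2) - 1)*tr2 2 2"
 have "P.expectation (\<lambda>\<omega>. (tro \<omega> - T1)\<^sup>2) \<le> 2*R + (K - 3)*R"
  unfolding R_def V(2) A1 by (intro add_left_mono A2)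
 also have "\<dots> = (K - 1)*R" by (simp add: algebra_simps)
 also have "\<dots> \<le> (K - 1)*(T2/\<nu>)" using weighted_traces_le K unfolding R_def by (intro mult_left_mono) auto
 finally show "P.expectation (\<lambda>\<omega>. (tro \<omega> - T1)\<^sup>2) \<le> (K - 1)*T2/\<nu>" by simp
qed

lemma tro_measurable[measurable]: "tro \<in> borel_measurable (PiM I D)"
proof -
 have "tro = (\<lambda>\<omega>. \<Sum>q\<in>I \<times> {..<p}. (lin (Bt q) \<omega>)\<^sup>2)" by (simp add: fun_eq_iff tro_lin)
 then show ?thesis by simp
qed

lemma tro_L1:
 "integrable (PiM I D) (\<lambda>\<omega>. tro \<omega> - T1)"
 "P.expectation (\<lambda>\<omega>. \<bar>tro \<omega> - T1\<bar>) \<le> sqrt ((K - 1)*T2/\<nu>)"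
proof -
 note e = P.expectation_abs_le_sqrt[of "\<lambda>\<omega>. tro \<omega> - T1"]
 show "integrable (PiM I D) (\<lambda>\<omega>. tro \<omega> - T1)" using tro_variance by (intro e) auto
 have "P.expectation (\<lambda>\<omega>. \<bar>tro \<omega> - T1\<bar>) \<le> sqrt (P.expectation (\<lambda>\<omega>. (tro \<omega> - T1)\<^sup>2))" using tro_variance by (intro e) auto
 also have "\<dots> \<le> sqrt ((K - 1)*T2/\<nu>)" using tro_variance by simp
 finally show "P.expectation (\<lambda>\<omega>. \<bar>tro \<omega> - T1\<bar>) \<le> sqrt ((K - 1)*T2/\<nu>)" .
qed

text \<open>
The linear forms whose squares add up to \<open>T0\<close>; their covariance matrix is
\<open>Om\<close>, whatever the sample sizes are.
\<close>
definition Bx :: "nat \<Rightarrow> nat \<times> nat \<Rightarrow> nat \<Rightarrow> real" where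
 "Bx c v a = sqrt (real (N 1)*real (N 2)/n)*(if fst v = 1 then 1/real (N 1) else - 1/real (N 2))*\<Gamma> (fst v) c a"

lemma Bx_lin: "lin (Bx c) \<omega> = sqrt (real (N 1)*real (N 2)/n)*(xb 1 c \<omega> - xb 2 c \<omega>)"
 unfolding lin_def sum_sample_index Bx_def xb_def x_def
 by (simp add: sum_distrib_left sum_divide_distrib sum_subtractf right_diff_distrib sum_negf mult_ac)

lemma Bx_gram: "(\<Sum>v\<in>I. \<Sum>a<m. Bx c v a*Bx d v a) = Om c d"
proof -
 define g where "g = real (N 1)*real (N 2)/n"
 have "0 \<le> g" unfolding g_def using N_pos n_pos by auto
 then have g: "sqrt g * sqrt g = g" by simp
 have 1: "(\<Sum>a<m. Bx c (1, j) a*Bx d (1, j) a) = g/(real (N 1))\<^sup>2*S 1 c d" for j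
 proof -
  have "Bx c (1, j) a*Bx d (1, j) a = (sqrt g * sqrt g)/(real (N 1))\<^sup>2*(\<Gamma> 1 c a*\<Gamma> 1 d a)" for a
   unfolding Bx_def g_def[symmetric] by (simp add: power2_eq_square)
  then show ?thesis unfolding g S_def by (simp add: sum_distrib_left)
 qed
 have 2: "(\<Sum>a<m. Bx c (2, j) a*Bx d (2, j) a) = g/(real (N 2))\<^sup>2*S 2 c d" for j
 proof -
  have "Bx c (2, j) a*Bx d (2, j) a = (sqrt g * sqrt g)/(real (N 2))\<^sup>2*(\<Gamma> 2 c a*\<Gamma> 2 d a)" for a
   unfolding Bx_def g_def[symmetric] by (simp add: power2_eq_square)
  then show ?thesis unfolding g S_def by (simp add: sum_distrib_left)
 qed
 have "real (N 1)*(g/(real (N 1))\<^sup>2) = wt 1" "real (N 2)*(g/(real (N 2))\<^sup>2) = wt 2"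
  unfolding g_def wt12 using N_pos by (simp_all add: power2_eq_square)
 moreover have "(\<Sum>j=1..k. v * t) = (real k * v)*t" for k v t by simp
 ultimately show ?thesis unfolding sum_sample_index 1 2 Om_def by (simp only:)
qed

lemma lin_combination: "lin (\<lambda>v a. \<Sum>c<p. h c*Bx c v a) \<omega> = (\<Sum>c<p. h c*lin (Bx c) \<omega>)"
proof -
 have "lin (\<lambda>v a. \<Sum>c<p. h c*Bx c v a) \<omega> = (\<Sum>v\<in>I. \<Sum>a<m. \<Sum>c<p. h c*(Bx c v a*\<omega> v a))"
  unfolding lin_def by (simp add: sum_distrib_right mult.assoc)
 also have "\<dots> = (\<Sum>v\<in>I. \<Sum>c<p. \<Sum>a<m. h c*(Bx c v a*\<omega> v a))" by (intro sum.cong refl sum.swap)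
 also have "\<dots> = (\<Sum>c<p. \<Sum>v\<in>I. \<Sum>a<m. h c*(Bx c v a*\<omega> v a))" by (rule sum.swap)
 finally show ?thesis unfolding lin_def by (simp add: sum_distrib_left)
qed

lemma Bx_quadratic: "(\<Sum>v\<in>I. \<Sum>a<m. (\<Sum>c<p. h c*Bx c v a)\<^sup>2) = (\<Sum>c<p. \<Sum>d<p. h c*h d*Om c d)"
proof -
 let ?t = "\<lambda>v a c d. h c*h d*(Bx c v a*Bx d v a)"
 have "(\<Sum>v\<in>I. \<Sum>a<m. (\<Sum>c<p. h c*Bx c v a)\<^sup>2) = (\<Sum>v\<in>I. \<Sum>a<m. \<Sum>c<p. \<Sum>d<p. ?t v a c d)"
  unfolding power2_eq_square sum_product by (intro sum.cong refl) (simp add: mult_ac)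
 also have "\<dots> = (\<Sum>v\<in>I. \<Sum>c<p. \<Sum>a<m. \<Sum>d<p. ?t v a c d)" by (intro sum.cong refl sum.swap)
 also have "\<dots> = (\<Sum>c<p. \<Sum>v\<in>I. \<Sum>a<m. \<Sum>d<p. ?t v a c d)" by (rule sum.swap)
 also have "\<dots> = (\<Sum>c<p. \<Sum>v\<in>I. \<Sum>d<p. \<Sum>a<m. ?t v a c d)" by (intro sum.cong refl sum.swap)
 also have "\<dots> = (\<Sum>c<p. \<Sum>d<p. \<Sum>v\<in>I. \<Sum>a<m. ?t v a c d)" by (intro sum.cong refl sum.swap)
 also have "\<dots> = (\<Sum>c<p. \<Sum>d<p. h c*h d*Om c d)" by (intro sum.cong refl) (simp add: Bx_gram[symmetric] sum_distrib_left)
 finally show ?thesis .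
qed

lemma T0_lin: "T0 \<omega> = (\<Sum>c<p. (lin (Bx c) \<omega>)\<^sup>2)"
proof -
 define g where "g = real (N 1)*real (N 2)/n"
 have "0 \<le> g" unfolding g_def using N_pos n_pos by auto
 then show ?thesis unfolding T0_def Bx_lin g_def[symmetric] by (simp add: power_mult_distrib sum_distrib_left)
qed

lemma T0_measurable[measurable]: "T0 \<in> borel_measurable (PiM I D)"
proof -
 have "T0 = (\<lambda>\<omega>. \<Sum>c<p. (lin (Bx c) \<omega>)\<^sup>2)" by (simp add: fun_eq_iff T0_lin)
 then show ?thesis by simp
qed

lemma cross_term:
 fixes \<delta> :: "nat \<Rightarrow> real"
 defines "cr \<equiv> \<lambda>\<omega>. real (N 1)*real (N 2)/n*(\<Sum>c<p. \<delta> c*(xb 1 c \<omega> - xb 2 c \<omega>))"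
 shows "cr \<in> borel_measurable (PiM I D)" "integrable (PiM I D) (\<lambda>\<omega>. (cr \<omega>)\<^sup>2)"
  "P.expectation (\<lambda>\<omega>. (cr \<omega>)\<^sup>2) = real (N 1)*real (N 2)/n*(\<Sum>c<p. \<Sum>d<p. \<delta> c*\<delta> d*Om c d)"
proof -
 define g where "g = real (N 1)*real (N 2)/n"
 have g0: "0 \<le> g" using N_pos n_pos by (simp add: g_def)
 then have gg: "sqrt g * sqrt g = g" by simp
 define \<beta> where "\<beta> v a = sqrt g*(\<Sum>c<p. \<delta> c*Bx c v a)" for v a
 have cr: "cr \<omega> = lin \<beta> \<omega>" for \<omega>
 proof -
  have "lin \<beta> \<omega> = sqrt g*lin (\<lambda>v a. \<Sum>c<p. \<delta> c*Bx c v a) \<omega>" unfolding \<beta>_def by (rule lin_scale)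
  also have "lin (\<lambda>v a. \<Sum>c<p. \<delta> c*Bx c v a) \<omega> = (\<Sum>c<p. \<delta> c*lin (Bx c) \<omega>)" by (rule lin_combination)
  also have "sqrt g*(\<Sum>c<p. \<delta> c*lin (Bx c) \<omega>) = (sqrt g * sqrt g)*(\<Sum>c<p. \<delta> c*(xb 1 c \<omega> - xb 2 c \<omega>))"
   unfolding Bx_lin g_def[symmetric] by (simp add: sum_distrib_left mult_ac del: real_sqrt_mult_self)
  finally show ?thesis unfolding cr_def gg g_def[symmetric] ..
 qed
 have cr': "cr = lin \<beta>" using cr by auto
 show "cr \<in> borel_measurable (PiM I D)" unfolding cr' by simp
 show "integrable (PiM I D) (\<lambda>\<omega>. (cr \<omega>)\<^sup>2)" unfolding cr' by (rule lin_power_integrable) simp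
 have "P.expectation (\<lambda>\<omega>. (cr \<omega>)\<^sup>2) = (\<Sum>v\<in>I. \<Sum>a<m. (\<beta> v a)\<^sup>2)" unfolding cr' by (rule lin_moments(3))
 also have "\<dots> = g*(\<Sum>v\<in>I. \<Sum>a<m. (\<Sum>c<p. \<delta> c*Bx c v a)\<^sup>2)"
  unfolding \<beta>_def power_mult_distrib using g0 by (simp add: sum_distrib_left)
 also have "\<dots> = g*(\<Sum>c<p. \<Sum>d<p. \<delta> c*\<delta> d*Om c d)" unfolding Bx_quadratic ..
 finally show "P.expectation (\<lambda>\<omega>. (cr \<omega>)\<^sup>2) = real (N 1)*real (N 2)/n*(\<Sum>c<p. \<Sum>d<p. \<delta> c*\<delta> d*Om c d)"
  unfolding g_def .
qed

end

text \<open>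
For Gaussian factors \<open>T0\<close> is the squared norm of a Gaussian vector, and
\<open>tro\<close> may be replaced by its mean at a cost that \<open>tro_L1\<close> controls.
\<close>
lemma (in two_sample_factors) char_limit_gaussian:
 assumes T2: "0 < T2" and K: "3 \<le> K"
  and Om: "\<And>c d. c < p \<Longrightarrow> d < p \<Longrightarrow> Om c d = (\<Sum>r<p. l r*Q c r*Q d r)"
  and orth: "\<And>r s. r < p \<Longrightarrow> s < p \<Longrightarrow> (\<Sum>c<p. Q c r*Q c s) = (if r = s then 1 else 0)"
  and l: "\<And>r. r < p \<Longrightarrow> 0 \<le> l r" and T1: "T1 = (\<Sum>r<p. l r)"
 shows "cmod ((\<integral>\<omega>. iexp (\<theta> * offdiag_quad m A I \<omega>) \<partial>PiM I (\<lambda>_. std_gaussian m)) - (\<Prod>r<p. chi_factor (\<theta>*(l r/sqrt T2)))) \<le> \<bar>\<theta>\<bar> * sqrt ((K - 1)/(2*\<nu>))"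
proof -
 interpret two_sample_law p m N \<Gamma> "\<lambda>_. std_gaussian m" "\<lambda>_. 0" K
  using isotropic_std_gaussian K finite_sample_index by unfold_locales auto
 let ?e = "\<lambda>\<omega>. \<theta>*((T0 \<omega> - T1)/\<sigma>)" and ?d = "\<lambda>\<omega>. \<theta>*((T0 \<omega> - tro \<omega>)/\<sigma>)"
 let ?P = "PiM I (\<lambda>_. std_gaussian m)"
 have \<sigma>: "0 < \<sigma>" using T2 by (simp add: \<sigma>_def)
 have G: "gaussian_vec ?P p (\<lambda>c. lin (Bx c)) Om" unfolding gaussian_vec_def
 proof (intro conjI allI impI)
  show "prob_space ?P" by (rule P.prob_space_axioms)
  show "lin (Bx c) \<in> borel_measurable ?P" for c by simp
  fix h :: "nat \<Rightarrow> real"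
  have lh: "(\<Sum>c<p. h c*lin (Bx c) \<omega>) = (\<Sum>v\<in>I. \<Sum>a<m. (\<Sum>c<p. h c*Bx c v a)*\<omega> v a)" for \<omega>
   by (simp only: lin_combination[symmetric] lin_def[of "\<lambda>v a. \<Sum>c<p. h c*Bx c v a"])
  show "(\<integral>\<omega>. iexp (\<Sum>c<p. h c*lin (Bx c) \<omega>) \<partial>?P) = complex_of_real (exp (- (\<Sum>c<p. \<Sum>d<p. h c*h d*Om c d)/2))"
   unfolding lh std_gaussian_family_char_lin[OF finite_sample_index] Bx_quadratic ..
 qed
 have E0: "(\<integral>\<omega>. iexp (?e \<omega>) \<partial>?P) = (\<Prod>r<p. chi_factor (\<theta>*(l r/sqrt T2)))"
 proof -
  have T0': "T0 = (\<lambda>\<omega>. \<Sum>c<p. (lin (Bx c) \<omega>)\<^sup>2)" by (simp add: fun_eq_iff T0_lin)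
  have "(\<integral>\<omega>. iexp (?e \<omega>) \<partial>?P) = char (distr ?P borel (\<lambda>\<omega>. (T0 \<omega> - T1)*(1/\<sigma>))) \<theta>"
   unfolding char_def by (subst integral_distr) auto
  also have "\<dots> = (\<integral>\<omega>. iexp (\<theta>*(1/\<sigma>)*T0 \<omega>) \<partial>?P)*iexp (- (T1*(\<theta>*(1/\<sigma>))))"
   by (rule char_affine[OF P.prob_space_axioms]) simp
  also have "(\<integral>\<omega>. iexp (\<theta>*(1/\<sigma>)*T0 \<omega>) \<partial>?P) = char (distr ?P borel T0) (\<theta>/\<sigma>)"
   unfolding char_def by (subst integral_distr) auto
  also have "\<dots> = (\<Prod>r<p. char (chi_square 1) (\<theta>/\<sigma>*l r))"
   unfolding T0' by (rule gaussian_vec_sq_norm_char[OF G Om orth l])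
  also have "iexp (- (T1*(\<theta>*(1/\<sigma>)))) = (\<Prod>r<p. iexp (- (\<theta>/\<sigma>*l r)))"
   unfolding T1 by (simp add: exp_sum[symmetric] sum_negf sum_distrib_left sum_distrib_right sum_divide_distrib mult_ac)
  also have "(\<Prod>r<p. char (chi_square 1) (\<theta>/\<sigma>*l r))*(\<Prod>r<p. iexp (- (\<theta>/\<sigma>*l r))) = (\<Prod>r<p. chi_factor (\<theta>*(l r/sqrt T2)))"
   unfolding prod.distrib[symmetric]
   by (intro prod.cong refl) (simp add: chi_factor_def \<sigma>_def real_sqrt_mult mult_ac)
  finally show ?thesis .
 qed
 have i1: "integrable ?P (\<lambda>\<omega>. iexp (?d \<omega>))" "integrable ?P (\<lambda>\<omega>. iexp (?e \<omega>))"
  by (rule P.integrable_iexp; simp)+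
 have "cmod ((\<integral>\<omega>. iexp (?d \<omega>) \<partial>?P) - (\<integral>\<omega>. iexp (?e \<omega>) \<partial>?P)) =
  cmod (\<integral>\<omega>. iexp (?d \<omega>) - iexp (?e \<omega>) \<partial>?P)"
  using i1 by simp
 also have "\<dots> \<le> (\<integral>\<omega>. cmod (iexp (?d \<omega>) - iexp (?e \<omega>)) \<partial>?P)"
  by (rule integral_norm_bound)
 also have "\<dots> \<le> (\<integral>\<omega>. \<bar>\<theta>\<bar>/\<sigma>*\<bar>tro \<omega> - T1\<bar> \<partial>?P)"
 proof (intro integral_mono)
  fix \<omega>
  have "cmod (iexp (?d \<omega>) - iexp (?e \<omega>)) \<le> \<bar>?d \<omega> - ?e \<omega>\<bar>"
   by (rule iexp_lipschitz)
  also have "?d \<omega> - ?e \<omega> = - (\<theta>/\<sigma>*(tro \<omega> - T1))"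
   by (simp add: algebra_simps diff_divide_distrib)
  also have "\<bar>- (\<theta>/\<sigma>*(tro \<omega> - T1))\<bar> = \<bar>\<theta>\<bar>/\<sigma>*\<bar>tro \<omega> - T1\<bar>" using \<sigma> by (simp add: abs_mult)
  finally show "cmod (iexp (?d \<omega>) - iexp (?e \<omega>)) \<le> \<bar>\<theta>\<bar>/\<sigma>*\<bar>tro \<omega> - T1\<bar>" .
 qed (use i1 tro_L1 in auto)
 also have "\<dots> = \<bar>\<theta>\<bar>/\<sigma>*(\<integral>\<omega>. \<bar>tro \<omega> - T1\<bar> \<partial>?P)" by simp
 also have "\<dots> \<le> \<bar>\<theta>\<bar>/\<sigma> * sqrt ((K - 1)*T2/\<nu>)" using \<sigma> tro_L1 by (intro mult_left_mono) auto
 also have "\<dots> = \<bar>\<theta>\<bar>*(sqrt ((K - 1)*T2/\<nu>)/\<sigma>)" by simp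
 also have "sqrt ((K - 1)*T2/\<nu>)/\<sigma> = sqrt ((K - 1)/(2*\<nu>))"
 proof -
  have "sqrt ((K - 1)*T2/\<nu>)/\<sigma> = sqrt ((K - 1)*T2/\<nu>/(2*T2))" unfolding \<sigma>_def by (rule real_sqrt_divide[symmetric])
  also have "(K - 1)*T2/\<nu>/(2*T2) = (K - 1)/(2*\<nu>)" using T2 \<nu>_pos by (simp add: field_simps)
  finally show ?thesis .
 qed
 finally show ?thesis unfolding E0 offdiag_quad_eq .
qed

text \<open>
The first error is that of the Lindeberg replacement, the second that of the trace estimate.
\<close>
lemma (in two_sample_law) char_limit_bound:
 assumes T2: "0 < T2"
  and Om: "\<And>c d. c < p \<Longrightarrow> d < p \<Longrightarrow> Om c d = (\<Sum>r<p. l r*Q c r*Q d r)"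
  and orth: "\<And>r s. r < p \<Longrightarrow> s < p \<Longrightarrow> (\<Sum>c<p. Q c r*Q c s) = (if r = s then 1 else 0)"
  and l: "\<And>r. r < p \<Longrightarrow> 0 \<le> l r" and T1: "T1 = (\<Sum>r<p. l r)"
 shows "cmod ((\<integral>\<omega>. iexp (\<theta> * offdiag_quad m A I \<omega>) \<partial>PiM I D) - (\<Prod>r<p. chi_factor (\<theta>*(l r/sqrt T2)))) \<le>
  (4*\<theta>\<^sup>2 + 16*K\<^sup>2*\<theta> ^ 4)/sqrt \<nu> + \<bar>\<theta>\<bar> * sqrt ((K - 1)/(2*\<nu>))"
proof -
 let ?E = "\<integral>\<omega>. iexp (\<theta> * offdiag_quad m A I \<omega>) \<partial>PiM I D"
 let ?G = "\<integral>\<omega>. iexp (\<theta> * offdiag_quad m A I \<omega>) \<partial>PiM I (\<lambda>_. std_gaussian m)"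
 let ?L = "\<Prod>r<p. chi_factor (\<theta>*(l r/sqrt T2))"
 have G: "isotropic_family m (\<lambda>_. std_gaussian m) (\<lambda>_. 0) K I"
  using isotropic_std_gaussian K finite_sample_index by unfold_locales auto
 have "cmod (?E - ?G) \<le> (\<Sum>u\<in>I. (4*(1/sqrt \<nu>)*\<theta>\<^sup>2*ell u + 16*K\<^sup>2*\<theta> ^ 4*(ell u)\<^sup>2/(1/sqrt \<nu>))/6)"
  unfolding ell_def using \<nu>_pos
  by (intro lindeberg_offdiag_quad[OF isotropic_family_axioms G]) (auto intro: A_sym)
 also have "\<dots> \<le> (4*\<theta>\<^sup>2 + 16*K\<^sup>2*\<theta> ^ 4)/sqrt \<nu>" using K by (intro lindeberg_error T2) auto
 finally have 1: "cmod (?E - ?G) \<le> (4*\<theta>\<^sup>2 + 16*K\<^sup>2*\<theta> ^ 4)/sqrt \<nu>" .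
 have 2: "cmod (?G - ?L) \<le> \<bar>\<theta>\<bar> * sqrt ((K - 1)/(2*\<nu>))" by (rule char_limit_gaussian[OF T2 K(1) Om orth l T1])
 have "cmod (?E - ?L) \<le> cmod (?E - ?G) + cmod (?G - ?L)" using norm_triangle_ineq[of "?E - ?G" "?G - ?L"] by simp
 with 1 2 show ?thesis by linarith
qed

lemma spectral_product:
 fixes Q :: "nat \<Rightarrow> nat \<Rightarrow> real" and f g :: "nat \<Rightarrow> real"
 assumes orth: "\<And>r s. r < p \<Longrightarrow> s < p \<Longrightarrow> (\<Sum>c<p. Q c r*Q c s) = (if r = s then 1 else 0)"
 shows "(\<Sum>e<p. (\<Sum>r<p. f r*Q c r*Q e r)*(\<Sum>s<p. g s*Q e s*Q d s)) = (\<Sum>r<p. f r*g r*Q c r*Q d r)"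
proof -
 have "(\<Sum>e<p. (\<Sum>r<p. f r*Q c r*Q e r)*(\<Sum>s<p. g s*Q e s*Q d s)) = (\<Sum>e<p. \<Sum>r<p. \<Sum>s<p. f r*Q c r*g s*Q d s*(Q e r*Q e s))"
  unfolding sum_product by (intro sum.cong refl) (simp add: mult_ac)
 also have "\<dots> = (\<Sum>r<p. \<Sum>e<p. \<Sum>s<p. f r*Q c r*g s*Q d s*(Q e r*Q e s))" by (rule sum.swap)
 also have "\<dots> = (\<Sum>r<p. \<Sum>s<p. \<Sum>e<p. f r*Q c r*g s*Q d s*(Q e r*Q e s))" by (intro sum.cong refl sum.swap)
 also have "\<dots> = (\<Sum>r<p. \<Sum>s<p. f r*Q c r*g s*Q d s*(if r = s then 1 else 0))"
  by (intro sum.cong refl) (simp add: sum_distrib_left[symmetric] orth)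
 also have "\<dots> = (\<Sum>r<p. f r*g r*Q c r*Q d r)"
  by (intro sum.cong refl) (simp add: if_distrib mult_ac cong: if_cong)
 finally show ?thesis .
qed

lemma spectral_trace:
 assumes orth: "\<And>r s. r < p \<Longrightarrow> s < p \<Longrightarrow> (\<Sum>c<p. Q c r*Q c s) = (if r = s then 1 else (0::real))"
 shows "(\<Sum>c<p. \<Sum>r<p. f r*Q c r*Q c r) = (\<Sum>r<p. f r)"
proof -
 have "(\<Sum>c<p. \<Sum>r<p. f r*Q c r*Q c r) = (\<Sum>r<p. \<Sum>c<p. f r*(Q c r*Q c r))" by (subst sum.swap) (simp add: mult_ac)
 also have "\<dots> = (\<Sum>r<p. f r)" by (intro sum.cong refl) (simp add: sum_distrib_left[symmetric] orth)
 finally show ?thesis .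
qed

section \<open>Power of a studentized test\<close>

lemma in_prob_modify:
 assumes prob: "\<And>k. prob_space (M k)"
  and [measurable]: "\<And>k. V k \<in> borel_measurable (M k)" "\<And>k. W k \<in> borel_measurable (M k)"
  and W: "tendsto_in_prob M W c"
  and ne: "(\<lambda>k. \<P>(w in M k. V k w \<noteq> W k w)) \<longlonglongrightarrow> 0"
 shows "tendsto_in_prob M V c"
 unfolding tendsto_in_prob_def
proof (intro allI impI)
 fix e :: real assume e: "e > 0"
 have "(\<lambda>k. \<P>(w in M k. \<bar>W k w - c\<bar> > e) + \<P>(w in M k. V k w \<noteq> W k w)) \<longlonglongrightarrow> 0 + 0"
  using W e unfolding tendsto_in_prob_def by (intro tendsto_add ne) auto
 then have lim: "(\<lambda>k. \<P>(w in M k. \<bar>W k w - c\<bar> > e) + \<P>(w in M k. V k w \<noteq> W k w)) \<longlonglongrightarrow> 0" by simp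
 show "(\<lambda>k. \<P>(w in M k. \<bar>V k w - c\<bar> > e)) \<longlonglongrightarrow> 0"
 proof (rule tendsto_sandwich[OF _ _ tendsto_const lim])
  show "\<forall>\<^sub>F k in sequentially. \<P>(w in M k. \<bar>V k w - c\<bar> > e) \<le> \<P>(w in M k. \<bar>W k w - c\<bar> > e) + \<P>(w in M k. V k w \<noteq> W k w)"
  proof (intro always_eventually allI)
   fix k
   interpret prob_space "M k" by (rule prob)
   have "{w \<in> space (M k). \<bar>V k w - c\<bar> > e} \<subseteq> {w \<in> space (M k). \<bar>W k w - c\<bar> > e} \<union> {w \<in> space (M k). V k w \<noteq> W k w}" by auto
   then have "\<P>(w in M k. \<bar>V k w - c\<bar> > e) \<le> measure (M k) ({w \<in> space (M k). \<bar>W k w - c\<bar> > e} \<union> {w \<in> space (M k). V k w \<noteq> W k w})"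
    by (intro finite_measure_mono) auto
   also have "\<dots> \<le> \<P>(w in M k. \<bar>W k w - c\<bar> > e) + \<P>(w in M k. V k w \<noteq> W k w)"
    by (intro measure_Un_le) auto
   finally show "\<P>(w in M k. \<bar>V k w - c\<bar> > e) \<le> \<P>(w in M k. \<bar>W k w - c\<bar> > e) + \<P>(w in M k. V k w \<noteq> W k w)" .
  qed
 qed (auto intro: always_eventually)
qed

text \<open>
Degrees of freedom perturbed by factors tending to one. The perturbed sequences are truncated from
below to keep them positive; this changes only finitely many terms.
\<close>
lemma critical_value_tendsto:
 assumes \<alpha>: "0 < \<alpha>" "\<alpha> < 1" and d: "\<And>k. 1 \<le> d1 k" "\<And>k. 0 < d2 k" and d12: "(\<lambda>k. d1 k/d2 k) \<longlonglongrightarrow> 0"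
  and weak: "\<And>v. (\<And>k. 0 < v k) \<Longrightarrow> (\<lambda>k. v k/d1 k) \<longlonglongrightarrow> 1 \<Longrightarrow>
   weak_conv_m (\<lambda>k. distr (chi_square (v k)) borel (\<lambda>x. (x - v k)*(1/sqrt (2 * v k)))) \<mu>"
  and \<mu>: "real_distribution \<mu>" and cont: "\<And>x. isCont (cdf \<mu>) x"
  and strict: "\<And>x y. x < y \<Longrightarrow> 0 < cdf \<mu> x \<Longrightarrow> cdf \<mu> x < cdf \<mu> y"
  and a: "a \<longlonglongrightarrow> 1" and b: "b \<longlonglongrightarrow> 1"
 shows "(\<lambda>k. (F_upper (a k*d1 k) (b k*d2 k) \<alpha> - 1) * sqrt (d1 k/2)) \<longlonglongrightarrow> upper_percentile \<mu> \<alpha>"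
proof -
 define a' where "a' k = max (a k) (1/2)" for k
 define b' where "b' k = max (b k) (1/2)" for k
 have a': "a' \<longlonglongrightarrow> 1" using tendsto_max[OF a tendsto_const[of "1/2"]] by (simp add: a'_def[abs_def])
 have b': "b' \<longlonglongrightarrow> 1" using tendsto_max[OF b tendsto_const[of "1/2"]] by (simp add: b'_def[abs_def])
 have pos: "1/2 \<le> a' k" "1/2 \<le> b' k" "0 < a' k" "0 < b' k" "0 < d1 k" "d1 k \<noteq> 0" for k
  using d(1)[of k] by (auto simp: a'_def b'_def)
 have L: "(\<lambda>k. (F_upper (a' k*d1 k) (b' k*d2 k) \<alpha> - 1)/sqrt (2/(a' k*d1 k))) \<longlonglongrightarrow> upper_percentile \<mu> \<alpha>"
 proof (rule F_upper_tendsto[OF _ _ \<alpha> _ \<mu> cont strict _ _])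
  show "0 < a' k*d1 k" "0 < b' k*d2 k" for k using pos[of k] d by auto
  show "weak_conv_m (\<lambda>k. distr (chi_square (a' k*d1 k)) borel (\<lambda>x. (x - a' k*d1 k)*(1/sqrt (2*(a' k*d1 k))))) \<mu>"
   using pos a' by (intro weak) auto
  have "(\<lambda>k. a' k/b' k*(d1 k/d2 k)) \<longlonglongrightarrow> 1/1*0" by (intro tendsto_intros a' b' d12) auto
  then show "(\<lambda>k. a' k*d1 k/(b' k*d2 k)) \<longlonglongrightarrow> 0" by simp
  show "0 < (1/2 :: real)" by simp
  show "1/2 \<le> a' k*d1 k" for k
   using mult_mono[of "1/2" "a' k" 1 "d1 k"] pos[of k] d(1)[of k] by simp
 qed
 have "(\<lambda>k. (F_upper (a' k*d1 k) (b' k*d2 k) \<alpha> - 1)/sqrt (2/(a' k*d1 k))/sqrt (a' k)) \<longlonglongrightarrow> upper_percentile \<mu> \<alpha>/sqrt 1"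
  by (intro tendsto_intros L a') auto
 moreover have "\<forall>\<^sub>F k in sequentially. (F_upper (a' k*d1 k) (b' k*d2 k) \<alpha> - 1)/sqrt (2/(a' k*d1 k))/sqrt (a' k) = (F_upper (a k*d1 k) (b k*d2 k) \<alpha> - 1) * sqrt (d1 k/2)"
 proof -
  have "\<forall>\<^sub>F k in sequentially. a k > 1/2" "\<forall>\<^sub>F k in sequentially. b k > 1/2"
   using order_tendstoD(1)[OF a, of "1/2"] order_tendstoD(1)[OF b, of "1/2"] by auto
  then show ?thesis
  proof eventually_elim
   case (elim k)
   have e: "a' k = a k" "b' k = b k" using elim by (auto simp: a'_def b'_def)
   show ?case unfolding e using elim pos[of k] by (simp add: real_sqrt_divide real_sqrt_mult field_simps)
  qed
 qed
 ultimately show ?thesis by (simp add: tendsto_cong)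
qed

text \<open>
Here \<open>U\<close> is the standardized quadratic form, \<open>R\<close> the ratio of the trace
estimate to the trace, \<open>X\<close> the cross term, \<open>f1\<close> and \<open>f2\<close> are
the estimated degrees of freedom and \<open>r * s\<close> is the shift. The event of rejection
becomes a tail event for \<open>U\<close> at a random threshold that converges in probability, to
which \<open>slutsky_tail\<close> applies.
\<close>
lemma studentized_test_power:
 fixes U R X f1 f2 F :: "nat \<Rightarrow> 'w \<Rightarrow> real" and d1 d2 sh s :: "nat \<Rightarrow> real"
 assumes prob: "\<And>k. prob_space (M k)"
  and meas[measurable]: "\<And>k. U k \<in> borel_measurable (M k)" "\<And>k. R k \<in> borel_measurable (M k)"
   "\<And>k. X k \<in> borel_measurable (M k)" "\<And>k. f1 k \<in> borel_measurable (M k)" "\<And>k. f2 k \<in> borel_measurable (M k)"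
  and F: "\<And>k w. w \<in> space (M k) \<Longrightarrow> F k w = (U k w + R k w * sqrt (d1 k/2) + 2*X k w + r k * s k)/(R k w * sqrt (d1 k/2))"
  and R0: "\<And>k w. w \<in> space (M k) \<Longrightarrow> 0 \<le> R k w"
  and weakU: "weak_conv_m (\<lambda>k. distr (M k) borel (U k)) \<nu>"
  and \<nu>: "real_distribution \<nu>" and cont\<nu>: "\<And>x. isCont (cdf \<nu>) x" and pos\<nu>: "\<And>x. 0 < measure \<nu> {x..}"
  and \<alpha>: "0 < \<alpha>" "\<alpha> < 1" and d: "\<And>k. 1 \<le> d1 k" "\<And>k. 0 < d2 k" and d12: "(\<lambda>k. d1 k/d2 k) \<longlonglongrightarrow> 0"
  and weak: "\<And>v. (\<And>k. 0 < v k) \<Longrightarrow> (\<lambda>k. v k/d1 k) \<longlonglongrightarrow> 1 \<Longrightarrow>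
   weak_conv_m (\<lambda>k. distr (chi_square (v k)) borel (\<lambda>x. (x - v k)*(1/sqrt (2 * v k)))) \<mu>"
  and \<mu>: "real_distribution \<mu>" and cont: "\<And>x. isCont (cdf \<mu>) x"
  and strict: "\<And>x y. x < y \<Longrightarrow> 0 < cdf \<mu> x \<Longrightarrow> cdf \<mu> x < cdf \<mu> y"
  and ratio1: "tendsto_in_prob M (\<lambda>k w. f1 k w/d1 k) 1" and ratio2: "tendsto_in_prob M (\<lambda>k w. f2 k w/d2 k) 1"
  and R1: "tendsto_in_prob M R 1" and X: "tendsto_in_prob M X 0"
  and s: "\<And>k. 0 \<le> s k" and r: "r \<longlonglongrightarrow> 1" and b: "b \<longlonglongrightarrow> upper_percentile \<mu> \<alpha>"
 shows "(\<lambda>k. \<P>(w in M k. F k w \<ge> F_upper (f1 k w) (f2 k w) \<alpha>)) \<sim>[sequentially] (\<lambda>k. measure \<nu> {b k - s k..})"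
proof -
 let ?pw = "\<lambda>k. \<P>(w in M k. F k w \<ge> F_upper (f1 k w) (f2 k w) \<alpha>)" and ?tl = "\<lambda>k. measure \<nu> {b k - s k..}"
 interpret \<nu>: real_distribution \<nu> by fact
 define c where "c = upper_percentile \<mu> \<alpha>"
 have h: "0 < sqrt (d1 k/2)" for k using d(1)[of k] by simp
 define Fh where "Fh k w = F_upper (f1 k w) (f2 k w) \<alpha>" for k w
 have Fh[measurable]: "Fh k \<in> borel_measurable (M k)" for k
 proof -
  have "(\<lambda>w. (f1 k w, f2 k w)) \<in> measurable (M k) (borel \<Otimes>\<^sub>M borel)" by measurable
  from measurable_compose[OF this F_upper_measurable[OF \<alpha>]] show ?thesis by (simp add: Fh_def[abs_def])
 qed
 define W where "W k w = (Fh k w - 1) * sqrt (d1 k/2)*R k w - 2*X k w" for k w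
 have W[measurable]: "W k \<in> borel_measurable (M k)" for k unfolding W_def by measurable
 \<comment> \<open>Where the trace estimate vanishes, the statistic is \<open>0\<close> and the threshold is chosen to reproduce the event.\<close>
 define V where "V k w = (if 0 < R k w then W k w else if Fh k w \<le> 0 then U k w + r k * s k else U k w + r k * s k + 1)" for k w
 have V[measurable]: "V k \<in> borel_measurable (M k)" for k unfolding V_def by measurable
 have Wc: "tendsto_in_prob M W c"
 proof -
  define Y where "Y k w = ((f1 k w/d1 k, f2 k w/d2 k), (R k w, X k w))" for k w
  define g where "g k v = (F_upper (fst (fst v)*d1 k) (snd (fst v)*d2 k) \<alpha> - 1) * sqrt (d1 k/2)*fst (snd v) - 2 * snd (snd v)" for k and v :: "(real \<times> real) \<times> (real \<times> real)"
  have gY: "g k (Y k w) = W k w" for k w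
   using d(1)[of k] d(2)[of k] by (simp add: g_def Y_def W_def Fh_def)
  have "tendsto_in_prob M (\<lambda>k w. g k (Y k w)) c"
  proof (rule in_prob_mapping[OF prob, where x = "((1, 1), (1, 0))"])
   show "{w \<in> space (M k). dist (Y k w) ((1, 1), (1, 0)) > e} \<in> sets (M k)" for k e
    unfolding Y_def dist_Pair_Pair by measurable
   have m: "{w \<in> space (M k). dist (f w) (q::real) > e} \<in> sets (M k)" if [measurable]: "f \<in> borel_measurable (M k)" for k f q e
    by measurable
   have t: "(\<lambda>k. measure (M k) {w \<in> space (M k). dist (f k w) q > e}) \<longlonglongrightarrow> 0" if "tendsto_in_prob M f q" "e > 0" for f q e
    using that unfolding tendsto_in_prob_def by (simp add: dist_real_def)
   have m2: "{w \<in> space (M k). dist (f w, g w) (q::real, q'::real) > e} \<in> sets (M k)" if [measurable]: "f \<in> borel_measurable (M k)" "g \<in> borel_measurable (M k)" for k f g q q' e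
    unfolding dist_Pair_Pair by measurable
   show "(\<lambda>k. measure (M k) {w \<in> space (M k). dist (Y k w) ((1, 1), (1, 0)) > e}) \<longlonglongrightarrow> 0" if e: "e > 0" for e
    unfolding Y_def
   proof (rule in_prob_dist_pair[OF prob _ _ _ _ e])
    show "(\<lambda>k. measure (M k) {w \<in> space (M k). dist (f1 k w/d1 k, f2 k w/d2 k) (1, 1) > e}) \<longlonglongrightarrow> 0" if "e > 0" for e
     by (rule in_prob_dist_pair[OF prob m m t[OF ratio1] t[OF ratio2] that]) measurable
    show "(\<lambda>k. measure (M k) {w \<in> space (M k). dist (R k w, X k w) (1, 0) > e}) \<longlonglongrightarrow> 0" if "e > 0" for e
     by (rule in_prob_dist_pair[OF prob m m t[OF R1] t[OF X] that]) measurable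
   qed (rule m2; measurable)+
   fix a :: "nat \<Rightarrow> (real \<times> real) \<times> (real \<times> real)" assume a: "a \<longlonglongrightarrow> ((1, 1), (1, 0))"
   have a1: "(\<lambda>k. fst (fst (a k))) \<longlonglongrightarrow> 1" "(\<lambda>k. snd (fst (a k))) \<longlonglongrightarrow> 1" "(\<lambda>k. fst (snd (a k))) \<longlonglongrightarrow> 1" "(\<lambda>k. snd (snd (a k))) \<longlonglongrightarrow> 0"
    using tendsto_fst[OF tendsto_fst[OF a]] tendsto_snd[OF tendsto_fst[OF a]] tendsto_fst[OF tendsto_snd[OF a]] tendsto_snd[OF tendsto_snd[OF a]] by simp_all
   have "(\<lambda>k. g k (a k)) \<longlonglongrightarrow> c*1 - 2*0"
    unfolding g_def c_def
    by (intro tendsto_intros critical_value_tendsto[OF \<alpha> d d12 weak \<mu> cont strict] a1) auto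
   then show "(\<lambda>k. g k (a k)) \<longlonglongrightarrow> c" by simp
  qed
  then show ?thesis by (simp add: gY)
 qed
 have Vc: "tendsto_in_prob M V c"
 proof (rule in_prob_modify[OF prob V W Wc])
  have "(\<lambda>k. \<P>(w in M k. \<bar>R k w - 1\<bar> > 1/2)) \<longlonglongrightarrow> 0" by (rule R1[unfolded tendsto_in_prob_def, rule_format]) simp
  then show "(\<lambda>k. \<P>(w in M k. V k w \<noteq> W k w)) \<longlonglongrightarrow> 0"
  proof (rule tendsto_sandwich[OF _ _ tendsto_const, rotated 2])
   show "\<forall>\<^sub>F k in sequentially. \<P>(w in M k. V k w \<noteq> W k w) \<le> \<P>(w in M k. \<bar>R k w - 1\<bar> > 1/2)"
   proof (intro always_eventually allI)
    fix k
    interpret prob_space "M k" by (rule prob)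
    show "\<P>(w in M k. V k w \<noteq> W k w) \<le> \<P>(w in M k. \<bar>R k w - 1\<bar> > 1/2)"
     by (intro finite_measure_mono) (auto simp: V_def)
   qed
  qed (auto intro: always_eventually)
 qed
 have ev: "?pw k = \<P>(w in M k. U k w \<ge> V k w - r k * s k)" for k
 proof (intro arg_cong[where f = "measure (M k)"] Collect_cong conj_cong refl)
  fix w assume w: "w \<in> space (M k)"
  show "(F k w \<ge> F_upper (f1 k w) (f2 k w) \<alpha>) = (U k w \<ge> V k w - r k * s k)"
  proof (cases "0 < R k w")
   case True
   define t where "t = R k w * sqrt (d1 k/2)"
   have t: "0 < t" using True h by (simp add: t_def)
   have "(F k w \<ge> Fh k w) = (Fh k w*t \<le> U k w + t + 2*X k w + r k * s k)"
    unfolding F[OF w] t_def[symmetric] using t by (simp add: pos_le_divide_eq)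
   also have "\<dots> = (U k w \<ge> (Fh k w - 1)*t - 2*X k w - r k * s k)" by (auto simp: algebra_simps)
   also have "(Fh k w - 1)*t - 2*X k w = V k w" using True by (simp add: V_def W_def t_def mult_ac)
   finally show ?thesis by (simp add: Fh_def)
  next
   case False
   then have "R k w = 0" using R0[OF w] by simp
   then show ?thesis using False by (simp add: F[OF w] V_def Fh_def)
  qed
 qed
 have diff: "(\<lambda>k. ?pw k - ?tl k) \<longlonglongrightarrow> 0"
  unfolding ev by (rule slutsky_tail[OF prob meas(1) V weakU \<nu> cont\<nu> Vc s r]) (use b c_def in simp)
 \<comment> \<open>A nonnegative shift can only enlarge the limiting probability, which therefore stays away from zero.\<close>
 define q where "q = measure \<nu> {c + 1..}"
 have q: "0 < q" unfolding q_def by (rule pos\<nu>)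
 have low: "\<forall>\<^sub>F k in sequentially. q \<le> ?tl k"
 proof -
  have "\<forall>\<^sub>F k in sequentially. b k < c + 1" using order_tendstoD(2)[OF b, of "c + 1"] by (simp add: c_def)
  then show ?thesis
  proof eventually_elim
   case (elim k)
   then show ?case unfolding q_def using s[of k] by (intro \<nu>.finite_measure_mono) auto
  qed
 qed
 have "(\<lambda>k. (?pw k - ?tl k)/?tl k) \<longlonglongrightarrow> 0"
 proof (rule Lim_null_comparison)
  show "(\<lambda>k. \<bar>?pw k - ?tl k\<bar>/q) \<longlonglongrightarrow> 0"
   using tendsto_divide[OF tendsto_rabs_zero[OF diff] tendsto_const[of q]] q by simp
  show "\<forall>\<^sub>F k in sequentially. norm ((?pw k - ?tl k)/?tl k) \<le> \<bar>?pw k - ?tl k\<bar>/q"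
   using low by eventually_elim (use q in \<open>simp add: frac_le\<close>)
 qed
 from tendsto_add[OF this tendsto_const[of 1]]
 have "(\<lambda>k. (?pw k - ?tl k)/?tl k + 1) \<longlonglongrightarrow> 1" by simp
 then have "(\<lambda>k. ?pw k/?tl k) \<longlonglongrightarrow> 1"
 proof (rule Lim_transform_eventually)
  show "\<forall>\<^sub>F k in sequentially. (?pw k - ?tl k)/?tl k + 1 = ?pw k/?tl k"
   using low by eventually_elim (use q in \<open>simp add: field_simps\<close>)
 qed
 then show ?thesis by (rule asymp_equivI')
qed

section \<open>From matrices to coordinates\<close>

lemma trace_mult:
 assumes "A \<in> carrier_mat p p" "B \<in> carrier_mat p p"
 shows "trace (A*B) = (\<Sum>c<p. \<Sum>d<p. A $$ (c, d)*B $$ (d, c))"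
 using assms unfolding trace_def by (auto simp: scalar_prod_def atLeast0LessThan intro!: sum.cong)

lemma trace_carrier: "A \<in> carrier_mat p p \<Longrightarrow> trace A = (\<Sum>c<p. A $$ (c, c))"
 by (auto simp: trace_def)

lemma pooled_carrier: "S 1 \<in> carrier_mat p p \<Longrightarrow> S 2 \<in> carrier_mat p p \<Longrightarrow> pooled N S \<in> carrier_mat p p"
 by (simp add: pooled_def)

lemma pooled_entry:
 assumes "S 1 \<in> carrier_mat p p" "S 2 \<in> carrier_mat p p" "c < p" "d < p"
 shows "pooled N S $$ (c, d) = real (N 2)/real (N 1 + N 2)*S 1 $$ (c, d) + real (N 1)/real (N 1 + N 2)*S 2 $$ (c, d)"
 using assms by (simp add: pooled_def del: One_nat_def)

lemma sample_cov_carrier: "sample_cov p n x \<in> carrier_mat p p" by (simp add: sample_cov_def)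

lemma quadratic_form:
 fixes v :: "real vec"
 assumes "A \<in> carrier_mat p p" "v \<in> carrier_vec p"
 shows "v \<bullet> (A *\<^sub>v v) = (\<Sum>c<p. \<Sum>d<p. v $ c * v $ d*A $$ (c, d))"
 using assms by (auto simp: scalar_prod_def atLeast0LessThan sum_distrib_left mult_ac intro!: sum.cong)

lemma sq_norm_vec_sum: "v \<in> carrier_vec p \<Longrightarrow> sq_norm_vec v = (\<Sum>c<p. (v $ c)\<^sup>2)"
 by (auto simp: sq_norm_vec_def scalar_prod_def atLeast0LessThan power2_eq_square)

lemma dof_hat_measurable:
 fixes y :: "nat \<Rightarrow> nat \<Rightarrow> 'w \<Rightarrow> real vec"
 assumes y: "\<And>i j a. (i, j) \<in> sample_index N \<Longrightarrow> a < p \<Longrightarrow> (\<lambda>w. y i j w $ a) \<in> borel_measurable M"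
 shows "(\<lambda>w. dof1_hat p N (\<lambda>i j. y i j w)) \<in> borel_measurable M"
  "(\<lambda>w. dof2_hat p N (\<lambda>i j. y i j w)) \<in> borel_measurable M"
proof -
 have e: "(\<lambda>w. sample_cov p (N i) (\<lambda>j. y i j w) $$ (a, b)) \<in> borel_measurable M" if "i = 1 \<or> i = 2" "a < p" "b < p" for i a b
 proof -
  have [measurable]: "(\<lambda>w. y i j w $ a) \<in> borel_measurable M" "(\<lambda>w. y i j w $ b) \<in> borel_measurable M" if "j \<in> {1..N i}" for j
   using y that \<open>i = 1 \<or> i = 2\<close> \<open>a < p\<close> \<open>b < p\<close> by (auto simp: sample_index_def)
  show ?thesis using that(2,3) unfolding sample_cov_def sample_mean_def
   by (simp del: One_nat_def)
 qed
 have t1: "(\<lambda>w. trace (sample_cov p (N i) (\<lambda>j. y i j w))) \<in> borel_measurable M" if i: "i = 1 \<or> i = 2" for i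
  unfolding trace_carrier[OF sample_cov_carrier] by (intro borel_measurable_sum e i) auto
 have t2: "(\<lambda>w. trace (sample_cov p (N i) (\<lambda>j. y i j w) * sample_cov p (N i') (\<lambda>j. y i' j w))) \<in> borel_measurable M"
  if i: "i = 1 \<or> i = 2" "i' = 1 \<or> i' = 2" for i i'
  unfolding trace_mult[OF sample_cov_carrier sample_cov_carrier]
  by (intro borel_measurable_sum borel_measurable_times e i) auto
 note T[measurable] = t1[of 1, simplified] t1[of 2, simplified] t2[of 1 1, simplified] t2[of 1 2, simplified] t2[of 2 2, simplified]
 show "(\<lambda>w. dof1_hat p N (\<lambda>i j. y i j w)) \<in> borel_measurable M"
  unfolding dof1_hat_def Let_def est_pooled_sq_trace_def est_pooled_trace_sq_def est_sq_trace_def est_trace_sq_def One_nat_def by measurable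
 show "(\<lambda>w. dof2_hat p N (\<lambda>i j. y i j w)) \<in> borel_measurable M"
  unfolding dof2_hat_def Let_def est_pooled_sq_trace_def dof2_denom_def est_sq_trace_def est_trace_sq_def One_nat_def by measurable
qed

text \<open>One instance of the factor model with both samples of size at least two.\<close>
locale factor_sample =
 fixes M :: "'w measure" and p m :: nat and N :: "nat \<Rightarrow> nat" and mu :: "nat \<Rightarrow> real vec" and Sg :: "nat \<Rightarrow> real mat"
  and y :: "nat \<Rightarrow> nat \<Rightarrow> 'w \<Rightarrow> real vec" and G :: "nat \<Rightarrow> real mat" and z :: "nat \<Rightarrow> nat \<Rightarrow> 'w \<Rightarrow> real vec" and \<Delta> :: real
 assumes prob: "prob_space M" and model: "factor_model M p m N mu Sg y G z"
  and moments: "\<And>i j. (i, j) \<in> sample_index N \<Longrightarrow> moment_condition M m \<Delta> (z i j)"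
  and sizes: "2 \<le> N 1" "2 \<le> N 2"
  and means: "mu 1 \<in> carrier_vec p" "mu 2 \<in> carrier_vec p"
begin

sublocale prob_space M by (rule prob)

lemma G_carrier: "i = 1 \<or> i = 2 \<Longrightarrow> G i \<in> carrier_mat p m" and Sg_eq: "i = 1 \<or> i = 2 \<Longrightarrow> Sg i = G i*transpose_mat (G i)"
 using model unfolding factor_model_def by auto

lemma z_mean_cov: "u \<in> sample_index N \<Longrightarrow> has_mean_cov M m (z (fst u) (snd u)) (0\<^sub>v m) (1\<^sub>m m)"
 using model unfolding factor_model_def by (auto simp: case_prod_unfold)

lemma z_measurable: "u \<in> sample_index N \<Longrightarrow> z (fst u) (snd u) \<in> measurable M (vec_borel m)"
 using z_mean_cov by (simp add: has_mean_cov_def)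

definition Z :: "nat \<times> nat \<Rightarrow> 'w \<Rightarrow> nat \<Rightarrow> real" where
 "Z u w = (\<lambda>a\<in>{..<m}. z (fst u) (snd u) w $ a)"

definition Dz :: "nat \<times> nat \<Rightarrow> (nat \<Rightarrow> real) measure" where
 "Dz u = (if u \<in> sample_index N then distr M (PiM {..<m} (\<lambda>_. borel)) (Z u) else std_gaussian m)"

text \<open>
All factors jointly; by independence their law is the product law that governs the coordinate
version of the problem.
\<close>
definition \<zeta> :: "'w \<Rightarrow> nat \<times> nat \<Rightarrow> nat \<Rightarrow> real" where
 "\<zeta> w = (\<lambda>u\<in>sample_index N. Z u w)"

lemma Z_measurable: "u \<in> sample_index N \<Longrightarrow> Z u \<in> measurable M (PiM {..<m} (\<lambda>_. borel))"
 unfolding Z_def[abs_def] by (rule measurable_compose[OF z_measurable vec_borel_coordinates_measurable])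

sublocale L: two_sample_law p m N "\<lambda>i c a. G i $$ (c, a)" Dz "\<lambda>u. if u \<in> sample_index N then \<Delta> else 0" "3 + \<bar>\<Delta>\<bar>"
proof (unfold_locales, rule sizes(1), rule sizes(2))
 fix u :: "nat \<times> nat"
 show "isotropic m (if u \<in> sample_index N then \<Delta> else 0) (Dz u)"
 proof (cases "u \<in> sample_index N")
  case True
  then have "isotropic m \<Delta> (distr M (PiM {..<m} (\<lambda>_. borel)) (\<lambda>w. \<lambda>a\<in>{..<m}. z (fst u) (snd u) w $ a))"
   by (intro isotropic_of_moment_condition prob moments z_mean_cov) auto
  then show ?thesis using True by (simp add: Dz_def Z_def[abs_def])
 qed (simp add: Dz_def isotropic_std_gaussian)
qed (auto simp: finite_sample_index)

lemma sets_PiM_Dz: "sets (PiM (sample_index N) Dz) = sets (PiM (sample_index N) (\<lambda>_. PiM {..<m} (\<lambda>_. borel)))"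
 by (intro sets_PiM_cong) (auto simp: Dz_def)

lemma \<zeta>_measurable[measurable]: "\<zeta> \<in> measurable M (PiM (sample_index N) Dz)"
 unfolding measurable_cong_sets[OF refl sets_PiM_Dz] \<zeta>_def[abs_def]
 by (rule measurable_restrict) (rule Z_measurable)

lemma distr_\<zeta>: "distr M (PiM (sample_index N) Dz) \<zeta> = PiM (sample_index N) Dz"
proof -
 let ?R = "PiM {..<m} (\<lambda>_. borel) :: (nat \<Rightarrow> real) measure"
 have "(1, 1) \<in> sample_index N" using sizes by (simp add: sample_index_def)
 then have ne: "sample_index N \<noteq> {}" by (metis empty_iff)
 have "indep_vars (\<lambda>_. vec_borel m) (\<lambda>(i, j). z i j) (sample_index N)"
  using model by (simp add: factor_model_def)
 then have "indep_vars (\<lambda>_. vec_borel m) (\<lambda>u. z (fst u) (snd u)) (sample_index N)"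
  by (simp add: case_prod_unfold)
 from indep_vars_compose2[OF this, of "\<lambda>_ v. \<lambda>a\<in>{..<m}. v $ a" "\<lambda>_. ?R"]
 have "indep_vars (\<lambda>_. ?R) (\<lambda>u w. \<lambda>a\<in>{..<m}. z (fst u) (snd u) w $ a) (sample_index N)" using vec_borel_coordinates_measurable by blast
 then have "indep_vars (\<lambda>_. ?R) Z (sample_index N)" unfolding Z_def[abs_def] .
 then have "distr M (PiM (sample_index N) (\<lambda>_. ?R)) \<zeta> = PiM (sample_index N) (\<lambda>u. distr M ?R (Z u))"
  using indep_vars_iff_distr_eq_PiM'[where I = "sample_index N" and X = Z and M' = "\<lambda>_. ?R", OF ne Z_measurable] unfolding \<zeta>_def[abs_def] by (simp only:)
 also have "\<dots> = PiM (sample_index N) Dz" by (intro PiM_cong) (auto simp: Dz_def)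
 also have "distr M (PiM (sample_index N) (\<lambda>_. ?R)) \<zeta> = distr M (PiM (sample_index N) Dz) \<zeta>"
  by (intro distr_cong refl) (simp add: sets_PiM_Dz)
 finally show ?thesis .
qed

lemma integral_\<zeta>:
 fixes f :: "_ \<Rightarrow> 'b::{banach, second_countable_topology}"
 assumes "f \<in> borel_measurable (PiM (sample_index N) Dz)"
 shows "(\<integral>w. f (\<zeta> w) \<partial>M) = (\<integral>\<omega>. f \<omega> \<partial>PiM (sample_index N) Dz)"
 using integral_distr[OF \<zeta>_measurable assms] by (simp add: distr_\<zeta>)

lemma integrable_\<zeta>:
 fixes f :: "_ \<Rightarrow> 'b::{banach, second_countable_topology}"
 assumes "integrable (PiM (sample_index N) Dz) f"
 shows "integrable M (\<lambda>w. f (\<zeta> w))"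
 using integrable_distr[OF \<zeta>_measurable, of f] assms by (simp add: distr_\<zeta>)

lemma idx: "i = 1 \<or> i = 2 \<Longrightarrow> j \<in> {1..N i} \<Longrightarrow> (i, j) \<in> sample_index N" by (auto simp: sample_index_def)

lemma N_pos: "i = 1 \<or> i = 2 \<Longrightarrow> 0 < real (N i)" using sizes by auto

lemma y_entry:
 assumes i: "i = 1 \<or> i = 2" and j: "j \<in> {1..N i}" and w: "w \<in> space M" and c: "c < p"
 shows "y i j w $ c = mu i $ c + L.x c (i, j) (\<zeta> w)"
proof -
 have I: "(i, j) \<in> sample_index N" by (rule idx[OF i j])
 have yw: "y i j w = mu i + G i *\<^sub>v z i j w" using model I w by (auto simp: factor_model_def)
 have "z i j w \<in> space (vec_borel m)" using measurable_space[OF z_measurable[OF I] w] by simp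
 then have zc: "dim_vec (z i j w) = m" unfolding vec_borel_def space_vimage_algebra by (rule carrier_vecD)
 have "(G i *\<^sub>v z i j w) $ c = (\<Sum>a<m. G i $$ (c, a)*z i j w $ a)"
  using G_carrier[OF i] c zc by (auto simp: scalar_prod_def atLeast0LessThan intro!: sum.cong)
 also have "\<dots> = L.x c (i, j) (\<zeta> w)" unfolding L.x_def using I by (auto simp: \<zeta>_def Z_def intro!: sum.cong)
 finally show ?thesis unfolding yw using G_carrier[OF i] c by simp
qed

lemma y_entry_measurable:
 assumes "(i, j) \<in> sample_index N" "c < p"
 shows "(\<lambda>w. y i j w $ c) \<in> borel_measurable M"
proof -
 have ij: "i = 1 \<or> i = 2" "j \<in> {1..N i}" using assms(1) by (auto simp: sample_index_def)
 have m: "L.x c (i, j) \<in> borel_measurable (PiM (sample_index N) Dz)"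
 proof -
  have "L.x c (i, j) = L.lin (\<lambda>v a. of_bool ((i, j) = v)*G (fst v) $$ (c, a))"
   by (rule ext) (rule L.x_lin[OF assms(1)])
  then show ?thesis by (simp only: L.lin_measurable)
 qed
 have "(\<lambda>w. mu i $ c + L.x c (i, j) (\<zeta> w)) \<in> borel_measurable M"
  using measurable_compose[OF \<zeta>_measurable m] by simp
 then show ?thesis by (subst measurable_cong[OF y_entry[OF ij _ assms(2)]]) auto
qed

lemma mean_entry:
 assumes i: "i = 1 \<or> i = 2" and w: "w \<in> space M" and c: "c < p"
 shows "sample_mean p (N i) (\<lambda>j. y i j w) $ c = mu i $ c + L.xb i c (\<zeta> w)"
proof -
 have "(\<Sum>j=1..N i. y i j w $ c) = (\<Sum>j=1..N i. mu i $ c + L.x c (i, j) (\<zeta> w))"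
  by (intro sum.cong refl y_entry[OF i _ w c])
 then show ?thesis using N_pos[OF i] c by (simp add: sample_mean_def L.xb_def sum.distrib add_divide_distrib del: One_nat_def)
qed

lemma cov_entry:
 assumes i: "i = 1 \<or> i = 2" and w: "w \<in> space M" and c: "c < p"
 shows "sample_cov p (N i) (\<lambda>j. y i j w) $$ (c, c) = (\<Sum>j=1..N i. (L.x c (i, j) (\<zeta> w) - L.xb i c (\<zeta> w))\<^sup>2)/(real (N i) - 1)"
proof -
 have "(\<Sum>j=1..N i. (y i j w $ c - sample_mean p (N i) (\<lambda>j. y i j w) $ c)*(y i j w $ c - sample_mean p (N i) (\<lambda>j. y i j w) $ c)) =
  (\<Sum>j=1..N i. (L.x c (i, j) (\<zeta> w) - L.xb i c (\<zeta> w))\<^sup>2)"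
 proof (intro sum.cong refl)
  fix j assume j: "j \<in> {1..N i}"
  have e: "y i j w $ c - sample_mean p (N i) (\<lambda>j. y i j w) $ c = L.x c (i, j) (\<zeta> w) - L.xb i c (\<zeta> w)"
   unfolding y_entry[OF i j w c] mean_entry[OF i w c] by (rule add_diff_cancel_left)
  show "(y i j w $ c - sample_mean p (N i) (\<lambda>j. y i j w) $ c)*(y i j w $ c - sample_mean p (N i) (\<lambda>j. y i j w) $ c) = (L.x c (i, j) (\<zeta> w) - L.xb i c (\<zeta> w))\<^sup>2"
   unfolding e by (rule power2_eq_square[symmetric])
 qed
 then show ?thesis using c by (simp add: sample_cov_def del: One_nat_def)
qed

lemma trace_pooled_cov:
 assumes w: "w \<in> space M"
 shows "trace (pooled N (\<lambda>i. sample_cov p (N i) (\<lambda>j. y i j w))) = L.tro (\<zeta> w)"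
proof -
 have "trace (pooled N (\<lambda>i. sample_cov p (N i) (\<lambda>j. y i j w))) = (\<Sum>c<p. pooled N (\<lambda>i. sample_cov p (N i) (\<lambda>j. y i j w)) $$ (c, c))"
  by (intro trace_carrier pooled_carrier sample_cov_carrier)
 also have "\<dots> = L.tro (\<zeta> w)" unfolding L.tro_def
 proof (intro sum.cong refl)
  fix c assume "c \<in> {..<p}"
  then have c: "c < p" by simp
  show "pooled N (\<lambda>i. sample_cov p (N i) (\<lambda>j. y i j w)) $$ (c, c) =
   L.wt 1*((\<Sum>j=1..N 1. (L.x c (1, j) (\<zeta> w) - L.xb 1 c (\<zeta> w))\<^sup>2)/(real (N 1) - 1)) +
   L.wt 2*((\<Sum>j=1..N 2. (L.x c (2, j) (\<zeta> w) - L.xb 2 c (\<zeta> w))\<^sup>2)/(real (N 2) - 1))"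
   unfolding pooled_entry[where S = "\<lambda>i. sample_cov p (N i) (\<lambda>j. y i j w)", OF sample_cov_carrier sample_cov_carrier c c]
    cov_entry[of 1, OF disjI1[OF refl] w c] cov_entry[of 2, OF disjI2[OF refl] w c] L.wt12 L.n_def ..
 qed
 finally show ?thesis .
qed

lemma tro_nonneg: "0 \<le> L.tro \<omega>"
 unfolding L.tro_def using L.wt_nonneg L.N_pos by (intro sum_nonneg add_nonneg_nonneg mult_nonneg_nonneg divide_nonneg_nonneg) auto

definition \<delta> :: "nat \<Rightarrow> real" where "\<delta> c = mu 1 $ c - mu 2 $ c"
definition cr :: "(nat \<times> nat \<Rightarrow> nat \<Rightarrow> real) \<Rightarrow> real" where
 "cr \<omega> = real (N 1)*real (N 2)/L.n*(\<Sum>c<p. \<delta> c*(L.xb 1 c \<omega> - L.xb 2 c \<omega>))"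
definition sh :: real where "sh = real (N 1)*real (N 2)/L.n*(\<Sum>c<p. (\<delta> c)\<^sup>2)"

lemma sq_norm_mean_difference: "sq_norm_vec (mu 1 - mu 2) = (\<Sum>c<p. (\<delta> c)\<^sup>2)"
 using sq_norm_vec_sum[of "mu 1 - mu 2" p] means by (simp add: \<delta>_def del: One_nat_def)

lemma F_stat_eq:
 assumes w: "w \<in> space M"
 shows "F_stat p N (\<lambda>i j. y i j w) = (L.T0 (\<zeta> w) + 2*cr (\<zeta> w) + sh)/L.tro (\<zeta> w)"
proof -
 let ?v = "sample_mean p (N 1) (\<lambda>j. y 1 j w) - sample_mean p (N 2) (\<lambda>j. y 2 j w)"
 have "sq_norm_vec ?v = (\<Sum>c<p. (?v $ c)\<^sup>2)" by (rule sq_norm_vec_sum) (simp add: sample_mean_def del: One_nat_def)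
 also have "\<dots> = (\<Sum>c<p. (L.xb 1 c (\<zeta> w) - L.xb 2 c (\<zeta> w))\<^sup>2 + 2*(\<delta> c*(L.xb 1 c (\<zeta> w) - L.xb 2 c (\<zeta> w))) + (\<delta> c)\<^sup>2)"
 proof (intro sum.cong refl)
  fix c assume "c \<in> {..<p}"
  then have c: "c < p" by simp
  have "?v $ c = sample_mean p (N 1) (\<lambda>j. y 1 j w) $ c - sample_mean p (N 2) (\<lambda>j. y 2 j w) $ c"
   using c by (intro index_minus_vec) (simp add: sample_mean_def)
  also have "\<dots> = \<delta> c + (L.xb 1 c (\<zeta> w) - L.xb 2 c (\<zeta> w))"
   unfolding mean_entry[of 1, OF disjI1[OF refl] w c] mean_entry[of 2, OF disjI2[OF refl] w c] \<delta>_def by simp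
  finally show "(?v $ c)\<^sup>2 = (L.xb 1 c (\<zeta> w) - L.xb 2 c (\<zeta> w))\<^sup>2 + 2*(\<delta> c*(L.xb 1 c (\<zeta> w) - L.xb 2 c (\<zeta> w))) + (\<delta> c)\<^sup>2"
   by (simp add: power2_sum del: One_nat_def)
 qed
 finally have sq: "sq_norm_vec ?v = (\<Sum>c<p. (L.xb 1 c (\<zeta> w) - L.xb 2 c (\<zeta> w))\<^sup>2) + 2*(\<Sum>c<p. \<delta> c*(L.xb 1 c (\<zeta> w) - L.xb 2 c (\<zeta> w))) + (\<Sum>c<p. (\<delta> c)\<^sup>2)"
  by (simp add: sum.distrib sum_distrib_left)
 have "real (N 1)*real (N 2)/real (N 1 + N 2) * sq_norm_vec ?v = L.T0 (\<zeta> w) + 2*cr (\<zeta> w) + sh"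
  unfolding sq L.n_def[symmetric] L.T0_def cr_def sh_def by (simp only: distrib_left mult.left_commute)
 then show ?thesis unfolding F_stat_def trace_pooled_cov[OF w] by (simp only:)
qed

end

section \<open>Spectrum of the pooled covariance and standardization\<close>

lemma spectral_quadratic:
 fixes Q :: "nat \<Rightarrow> nat \<Rightarrow> real" and f :: "nat \<Rightarrow> real"
 assumes orth: "\<And>r s. r < p \<Longrightarrow> s < p \<Longrightarrow> (\<Sum>c<p. Q c r*Q c s) = (if r = s then 1 else 0)" and s: "s < p"
 shows "(\<Sum>c<p. \<Sum>d<p. Q c s*Q d s*(\<Sum>r<p. f r*Q c r*Q d r)) = f s"
proof -
 have inner: "(\<Sum>d<p. Q c s*Q d s*(\<Sum>r<p. f r*Q c r*Q d r)) = f s*(Q c s*Q c s)" for c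
 proof -
  have "(\<Sum>d<p. Q c s*Q d s*(\<Sum>r<p. f r*Q c r*Q d r)) = (\<Sum>d<p. \<Sum>r<p. Q c s*f r*Q c r*(Q d r*Q d s))"
   unfolding sum_distrib_left by (intro sum.cong refl) (simp add: mult_ac)
  also have "\<dots> = (\<Sum>r<p. \<Sum>d<p. Q c s*f r*Q c r*(Q d r*Q d s))" by (rule sum.swap)
  also have "\<dots> = (\<Sum>r<p. if r = s then Q c s*f r*Q c r else 0)"
   by (intro sum.cong refl) (simp add: sum_distrib_left[symmetric] orth s)
  finally show ?thesis using s by (simp add: mult_ac)
 qed
 show ?thesis unfolding inner sum_distrib_left[symmetric] using orth[OF s s] by simp
qed

text \<open>
Cauchy-Schwarz twice: \<open>(q \<bullet> S q)\<^sup>2 \<le> q \<bullet> S\<^sup>2 q\<close> for a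
unit vector \<open>q\<close>, and \<open>q \<bullet> S\<^sup>2 q\<close> is bounded by the Frobenius
norm of \<open>S\<^sup>2\<close>.
\<close>
lemma quadratic_form_fourth_power_le:
 fixes S :: "nat \<Rightarrow> nat \<Rightarrow> real" and q :: "nat \<Rightarrow> real"
 assumes sym: "\<And>c d. S c d = S d c" and unit: "(\<Sum>c<p. (q c)\<^sup>2) = 1"
 shows "(\<Sum>c<p. \<Sum>d<p. q c*q d*S c d) ^ 4 \<le> (\<Sum>c<p. \<Sum>d<p. (\<Sum>e<p. S c e*S e d)\<^sup>2)"
proof -
 define g where "g c = (\<Sum>d<p. S c d*q d)" for c
 define R where "R = (\<Sum>d<p. \<Sum>e<p. q d*q e*(\<Sum>c<p. S d c*S c e))"
 have a: "(\<Sum>c<p. \<Sum>d<p. q c*q d*S c d) = (\<Sum>c<p. q c*g c)"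
  unfolding g_def sum_distrib_left by (intro sum.cong refl) (simp add: mult_ac)
 have b: "(\<Sum>c<p. (g c)\<^sup>2) = R"
 proof -
  have "(\<Sum>c<p. (g c)\<^sup>2) = (\<Sum>c<p. \<Sum>d<p. \<Sum>e<p. q d*q e*(S d c*S c e))"
   unfolding g_def power2_eq_square sum_product by (intro sum.cong refl) (use sym in \<open>simp add: mult_ac\<close>)
  also have "\<dots> = (\<Sum>d<p. \<Sum>c<p. \<Sum>e<p. q d*q e*(S d c*S c e))" by (rule sum.swap)
  also have "\<dots> = (\<Sum>d<p. \<Sum>e<p. \<Sum>c<p. q d*q e*(S d c*S c e))" by (intro sum.cong refl sum.swap)
  finally show ?thesis by (simp add: R_def sum_distrib_left)
 qed
 have 1: "(\<Sum>c<p. q c*g c)\<^sup>2 \<le> R"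
  using Cauchy_Schwarz_ineq_sum[of q g "{..<p}"] unfolding unit b by simp
 have 2: "R\<^sup>2 \<le> (\<Sum>c<p. \<Sum>d<p. (\<Sum>e<p. S c e*S e d)\<^sup>2)"
 proof -
  have u2: "(\<Sum>x\<in>{..<p} \<times> {..<p}. (q (fst x)*q (snd x))\<^sup>2) = 1"
  proof -
   have "(\<Sum>x\<in>{..<p} \<times> {..<p}. (q (fst x)*q (snd x))\<^sup>2) = (\<Sum>c<p. \<Sum>d<p. (q c)\<^sup>2*(q d)\<^sup>2)"
    by (simp add: sum.cartesian_product case_prod_unfold power_mult_distrib)
   also have "\<dots> = (\<Sum>c<p. (q c)\<^sup>2)*(\<Sum>d<p. (q d)\<^sup>2)" by (rule sum_product[symmetric])
   finally show ?thesis unfolding unit by simp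
  qed
  have RR: "R = (\<Sum>x\<in>{..<p} \<times> {..<p}. (q (fst x)*q (snd x))*(\<Sum>e<p. S (fst x) e*S e (snd x)))"
   unfolding R_def by (simp add: sum.cartesian_product case_prod_unfold)
  have "R\<^sup>2 \<le> (\<Sum>x\<in>{..<p} \<times> {..<p}. (q (fst x)*q (snd x))\<^sup>2)*(\<Sum>x\<in>{..<p} \<times> {..<p}. (\<Sum>e<p. S (fst x) e*S e (snd x))\<^sup>2)"
   unfolding RR by (rule Cauchy_Schwarz_ineq_sum)
  also have "\<dots> = (\<Sum>x\<in>{..<p} \<times> {..<p}. (\<Sum>e<p. S (fst x) e*S e (snd x))\<^sup>2)" unfolding u2 by simp
  also have "\<dots> = (\<Sum>c<p. \<Sum>d<p. (\<Sum>e<p. S c e*S e d)\<^sup>2)" by (simp add: sum.cartesian_product case_prod_unfold)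
  finally show ?thesis .
 qed
 have "(\<Sum>c<p. \<Sum>d<p. q c*q d*S c d) ^ 4 = ((\<Sum>c<p. q c*g c)\<^sup>2)\<^sup>2" unfolding a by (simp flip: power_mult)
 also have "\<dots> \<le> R\<^sup>2" by (intro power_mono 1) simp
 finally show ?thesis using 2 by simp
qed

context two_sample_factors begin

lemma quadratic_S: "(\<Sum>c<p. \<Sum>d<p. q c*q d*S i c d) = (\<Sum>a<m. (\<Sum>c<p. q c*\<Gamma> i c a)\<^sup>2)"
proof -
 have "(\<Sum>a<m. (\<Sum>c<p. q c*\<Gamma> i c a)\<^sup>2) = (\<Sum>a<m. \<Sum>c<p. \<Sum>d<p. q c*q d*(\<Gamma> i c a*\<Gamma> i d a))"
  unfolding power2_eq_square sum_product by (intro sum.cong refl) (simp add: mult_ac)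
 also have "\<dots> = (\<Sum>c<p. \<Sum>a<m. \<Sum>d<p. q c*q d*(\<Gamma> i c a*\<Gamma> i d a))" by (rule sum.swap)
 also have "\<dots> = (\<Sum>c<p. \<Sum>d<p. \<Sum>a<m. q c*q d*(\<Gamma> i c a*\<Gamma> i d a))" by (intro sum.cong refl sum.swap)
 finally show ?thesis unfolding S_def by (simp add: sum_distrib_left)
qed

lemma quadratic_S_nonneg: "0 \<le> (\<Sum>c<p. \<Sum>d<p. q c*q d*S i c d)"
 unfolding quadratic_S by (intro sum_nonneg) auto

lemma quadratic_Om: "(\<Sum>c<p. \<Sum>d<p. q c*q d*Om c d) = wt 1*(\<Sum>c<p. \<Sum>d<p. q c*q d*S 1 c d) + wt 2*(\<Sum>c<p. \<Sum>d<p. q c*q d*S 2 c d)"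
 unfolding Om_def by (simp add: sum_distrib_left sum.distrib distrib_left mult_ac)

lemma wt_le_1: "wt 1 \<le> 1" "wt 2 \<le> 1"
 using n_pos unfolding wt12 by (simp_all add: n_def divide_le_eq)

lemma Om_sym: "Om c d = Om d c" unfolding Om_def using S_sym by metis

text \<open>
As all traces of products are nonnegative, weights bounded below by \<open>c0\<close> may be
replaced by \<open>c0\<close>.
\<close>
lemma trace_sum_sq_le:
 assumes "0 \<le> c0" "c0 \<le> wt 1" "c0 \<le> wt 2"
 shows "c0\<^sup>2*(tr2 1 1 + 2*tr2 1 2 + tr2 2 2) \<le> T2"
proof -
 have "c0*c0*tr2 1 1 \<le> wt 1*wt 1*tr2 1 1" "c0*c0*tr2 1 2 \<le> wt 1*wt 2*tr2 1 2" "c0*c0*tr2 2 2 \<le> wt 2*wt 2*tr2 2 2"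
  using assms tr2_nonneg wt_nonneg by (intro mult_right_mono mult_mono; auto)+
 then show ?thesis unfolding T2_eq power2_eq_square by (simp add: distrib_left)
qed

end

definition observed_shift :: "(nat \<Rightarrow> nat) \<Rightarrow> (nat \<Rightarrow> real vec) \<Rightarrow> (nat \<Rightarrow> real mat) \<Rightarrow> real" where
 "observed_shift N mu Sg = real (N 1)*real (N 2)/real (N 1 + N 2) * sq_norm_vec (mu 1 - mu 2)/sqrt (2*trace (pooled N Sg*pooled N Sg))"

text \<open>A bound on the second moment of the standardized cross term.\<close>
definition cross_bound :: "(nat \<Rightarrow> nat) \<Rightarrow> (nat \<Rightarrow> real vec) \<Rightarrow> (nat \<Rightarrow> real mat) \<Rightarrow> real" where
 "cross_bound N mu Sg = real (N 1)*real (N 2)/real (N 1 + N 2) *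
  ((mu 1 - mu 2) \<bullet> (Sg 1 *\<^sub>v (mu 1 - mu 2)) + (mu 1 - mu 2) \<bullet> (Sg 2 *\<^sub>v (mu 1 - mu 2)))/(2*trace (pooled N Sg*pooled N Sg))"

text \<open>
The probabilistic information about the statistic that the asymptotic argument needs:
\<open>U\<close> has nearly the characteristic function of a weighted sum of centred chi-square
variables, \<open>R\<close> is close to one and \<open>X\<close> to zero.
\<close>
definition standardized_decomposition ::
  "'w measure \<Rightarrow> nat \<Rightarrow> (nat \<Rightarrow> nat) \<Rightarrow> (nat \<Rightarrow> real vec) \<Rightarrow> (nat \<Rightarrow> real mat) \<Rightarrow> (nat \<Rightarrow> nat \<Rightarrow> 'w \<Rightarrow> real vec)
  \<Rightarrow> real \<Rightarrow> ('w \<Rightarrow> real) \<Rightarrow> ('w \<Rightarrow> real) \<Rightarrow> ('w \<Rightarrow> real) \<Rightarrow> bool" where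
 "standardized_decomposition M p N mu Sg y \<Delta> U R X \<longleftrightarrow>
  (U \<in> borel_measurable M \<and> R \<in> borel_measurable M \<and> X \<in> borel_measurable M) \<and>
  (\<forall>w\<in>space M. 0 \<le> R w \<and> F_stat p N (\<lambda>i j. y i j w) =
   (U w + R w * sqrt (dof1 N Sg/2) + 2*X w + observed_shift N mu Sg)
   / (R w * sqrt (dof1 N Sg/2))) \<and>
  (\<forall>\<theta>. cmod (char (distr M borel U) \<theta> - (\<Prod>r<p. chi_factor (\<theta>*rel_eigenvalue (pooled N Sg) r))) \<le>
   (4*\<theta>\<^sup>2 + 16*(3 + \<bar>\<Delta>\<bar>)\<^sup>2*\<theta> ^ 4)/sqrt (real (min (N 1) (N 2)) - 1) + \<bar>\<theta>\<bar> * sqrt ((2 + \<bar>\<Delta>\<bar>)/(2*(real (min (N 1) (N 2)) - 1)))) \<and>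
  (integrable M R \<and> (\<integral>w. \<bar>R w - 1\<bar> \<partial>M) \<le> sqrt ((2 + \<bar>\<Delta>\<bar>)/(real (min (N 1) (N 2)) - 1))) \<and>
  (integrable M X \<and> (\<integral>w. \<bar>X w\<bar> \<partial>M) \<le> sqrt (cross_bound N mu Sg))"

context factor_sample begin

lemma Sg_carrier:
 assumes i: "i = 1 \<or> i = 2" shows "Sg i \<in> carrier_mat p p"
 using G_carrier[OF i] unfolding Sg_eq[OF i] by (auto intro!: mult_carrier_mat)

lemma Sg_entry:
 assumes i: "i = 1 \<or> i = 2" and "c < p" "d < p"
 shows "Sg i $$ (c, d) = L.S i c d"
 unfolding Sg_eq[OF i] L.S_def using G_carrier[OF i] assms(2,3) by (auto simp: scalar_prod_def atLeast0LessThan intro!: sum.cong)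

lemma trace_Sg_Sg:
 assumes i: "i = 1 \<or> i = 2" and j: "j = 1 \<or> j = 2"
 shows "trace (Sg i*Sg j) = L.tr2 i j"
 unfolding trace_mult[OF Sg_carrier[OF i] Sg_carrier[OF j]] L.tr2_def
 by (intro sum.cong refl) (auto simp: Sg_entry[OF i] Sg_entry[OF j] L.S_sym)

lemma trace_combination_sq:
 "trace ((a \<cdot>\<^sub>m Sg 1 + b \<cdot>\<^sub>m Sg 2)*(a \<cdot>\<^sub>m Sg 1 + b \<cdot>\<^sub>m Sg 2)) = a\<^sup>2*L.tr2 1 1 + 2*a*b*L.tr2 1 2 + b\<^sup>2*L.tr2 2 2"
proof -
 have c: "a \<cdot>\<^sub>m Sg 1 + b \<cdot>\<^sub>m Sg 2 \<in> carrier_mat p p" using Sg_carrier[of 1] Sg_carrier[of 2] by simp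
 have e: "(a \<cdot>\<^sub>m Sg 1 + b \<cdot>\<^sub>m Sg 2) $$ (c, d) = a*L.S 1 c d + b*L.S 2 c d" if "c < p" "d < p" for c d
  using that Sg_carrier[of 1] Sg_carrier[of 2] Sg_entry[of 1 c d] Sg_entry[of 2 c d] by simp
 have "trace ((a \<cdot>\<^sub>m Sg 1 + b \<cdot>\<^sub>m Sg 2)*(a \<cdot>\<^sub>m Sg 1 + b \<cdot>\<^sub>m Sg 2)) = (\<Sum>x<p. \<Sum>d<p. (a*L.S 1 x d + b*L.S 2 x d)*(a*L.S 1 d x + b*L.S 2 d x))"
  unfolding trace_mult[OF c c] by (intro sum.cong refl) (simp add: e del: One_nat_def)
 also have "\<dots> = (\<Sum>x<p. \<Sum>d<p. a\<^sup>2*(L.S 1 x d*L.S 1 x d) + 2*a*b*(L.S 1 x d*L.S 2 x d) + b\<^sup>2*(L.S 2 x d*L.S 2 x d))"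
 proof (intro sum.cong refl)
  fix x d
  show "(a*L.S 1 x d + b*L.S 2 x d)*(a*L.S 1 d x + b*L.S 2 d x) = a\<^sup>2*(L.S 1 x d*L.S 1 x d) + 2*a*b*(L.S 1 x d*L.S 2 x d) + b\<^sup>2*(L.S 2 x d*L.S 2 x d)"
   unfolding L.S_sym[of 1 d x] L.S_sym[of 2 d x] by (simp add: power2_eq_square algebra_simps)
 qed
 finally show ?thesis unfolding L.tr2_def by (simp add: sum.distrib sum_distrib_left)
qed

lemma pooled_Sg_carrier: "pooled N Sg \<in> carrier_mat p p"
 using Sg_carrier by (intro pooled_carrier) auto

lemma pooled_Sg_entry: "c < p \<Longrightarrow> d < p \<Longrightarrow> pooled N Sg $$ (c, d) = L.Om c d"
 using pooled_entry[OF Sg_carrier[of 1] Sg_carrier[of 2]] Sg_entry[of 1 c d] Sg_entry[of 2 c d]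
 by (simp add: L.Om_def L.wt12 L.n_def del: One_nat_def)

lemma trace_pooled: "trace (pooled N Sg) = L.T1"
 unfolding trace_carrier[OF pooled_Sg_carrier] L.T1_def by (intro sum.cong refl) (simp add: pooled_Sg_entry)

lemma trace_pooled_sq: "trace (pooled N Sg*pooled N Sg) = L.T2"
 unfolding pooled_def trace_combination_sq L.T2_eq L.wt12 L.n_def ..

lemma trace_sum_sq: "trace ((Sg 1 + Sg 2)*(Sg 1 + Sg 2)) = L.tr2 1 1 + 2*L.tr2 1 2 + L.tr2 2 2"
proof -
 have "1 \<cdot>\<^sub>m Sg 1 + 1 \<cdot>\<^sub>m Sg 2 = Sg 1 + Sg 2"
  using Sg_carrier[of 1] Sg_carrier[of 2] by (intro eq_matI) auto
 then show ?thesis using trace_combination_sq[of 1 1] by simp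
qed

lemma trace_Sg_fourth:
 assumes i: "i = 1 \<or> i = 2"
 shows "trace (Sg i*Sg i*Sg i*Sg i) = (\<Sum>c<p. \<Sum>d<p. (\<Sum>e<p. L.S i c e*L.S i e d)\<^sup>2)"
proof -
 note C = Sg_carrier[OF i]
 have C2: "Sg i*Sg i \<in> carrier_mat p p" using C by simp
 have e: "(Sg i*Sg i) $$ (c, d) = (\<Sum>e<p. L.S i c e*L.S i e d)" if "c < p" "d < p" for c d
  using C that by (auto simp: scalar_prod_def atLeast0LessThan Sg_entry[OF i] intro!: sum.cong)
 have sym: "(\<Sum>e<p. L.S i d e*L.S i e c) = (\<Sum>e<p. L.S i c e*L.S i e d)" for c d
  by (intro sum.cong refl) (metis L.S_sym mult.commute)
 have assoc: "Sg i*Sg i*Sg i*Sg i = (Sg i*Sg i)*(Sg i*Sg i)"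
  using C C2 by (metis assoc_mult_mat)
 show ?thesis
  unfolding assoc trace_mult[OF C2 C2] by (simp add: e sym power2_eq_square)
qed

lemma dof1_eq: "dof1 N Sg = L.T1\<^sup>2/L.T2"
 by (simp add: dof1_def trace_pooled trace_pooled_sq)

lemma dof2_denom_eq:
 "dof2_denom N (trace (Sg 1*Sg 1)) (trace (Sg 2*Sg 2)) = (L.wt 1)\<^sup>2/(real (N 1) - 1)*L.tr2 1 1 + (L.wt 2)\<^sup>2/(real (N 2) - 1)*L.tr2 2 2"
 using trace_Sg_Sg[of 1 1] trace_Sg_Sg[of 2 2]
 by (simp add: dof2_denom_def L.wt12 L.n_def power_divide del: One_nat_def)

lemma dof2_denom_le: "dof2_denom N (trace (Sg 1*Sg 1)) (trace (Sg 2*Sg 2)) \<le> L.T2/L.\<nu>"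
 unfolding dof2_denom_eq by (rule L.weighted_traces_le)

lemma dof2_denom_nonneg: "0 \<le> dof2_denom N (trace (Sg 1*Sg 1)) (trace (Sg 2*Sg 2))"
 unfolding dof2_denom_eq using L.tr2_nonneg L.N_pos by (intro add_nonneg_nonneg mult_nonneg_nonneg divide_nonneg_nonneg) auto

abbreviation lam :: "nat \<Rightarrow> real" where "lam r \<equiv> eigenvalues_desc (pooled N Sg) ! r"

lemma spectrum:
 obtains Q where "\<And>r s. r < p \<Longrightarrow> s < p \<Longrightarrow> (\<Sum>c<p. Q c r*Q c s) = (if r = s then 1 else 0)"
  "\<And>c d. c < p \<Longrightarrow> d < p \<Longrightarrow> L.Om c d = (\<Sum>r<p. lam r*Q c r*Q d r)"
  "length (eigenvalues_desc (pooled N Sg)) = p"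
proof -
 have "transpose_mat (pooled N Sg) = pooled N Sg"
  using pooled_Sg_carrier by (intro eq_matI) (auto simp: pooled_Sg_entry L.Om_sym)
 from spectral_decomposition[OF pooled_Sg_carrier this] obtain Q where
  Q: "\<forall>r<p. \<forall>s<p. (\<Sum>c<p. Q c r*Q c s) = (if r = s then 1 else 0)"
  "\<forall>a<p. \<forall>b<p. pooled N Sg $$ (a, b) = (\<Sum>r<p. lam r*Q a r*Q b r)"
  "length (eigenvalues_desc (pooled N Sg)) = p" by blast
 show ?thesis by (rule that[of Q]) (use Q pooled_Sg_entry in auto)
qed

text \<open>An eigenvalue is the value of the quadratic form at a unit eigenvector.\<close>
lemma lam_eq:
 assumes r: "r < p"
 obtains q where "(\<Sum>c<p. (q c)\<^sup>2) = 1" "lam r = (\<Sum>c<p. \<Sum>d<p. q c*q d*L.Om c d)"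
proof -
 obtain Q where Q: "\<And>r s. r < p \<Longrightarrow> s < p \<Longrightarrow> (\<Sum>c<p. Q c r*Q c s) = (if r = s then 1 else 0)"
  "\<And>c d. c < p \<Longrightarrow> d < p \<Longrightarrow> L.Om c d = (\<Sum>r<p. lam r*Q c r*Q d r)"
  by (rule spectrum) blast
 have "lam r = (\<Sum>c<p. \<Sum>d<p. Q c r*Q d r*L.Om c d)"
  using spectral_quadratic[of p Q r lam, OF Q(1) r] by (simp add: Q(2))
 moreover have "(\<Sum>c<p. (Q c r)\<^sup>2) = 1" using Q(1)[OF r r] by (simp add: power2_eq_square)
 ultimately show ?thesis using that[of "\<lambda>c. Q c r"] by blast
qed

lemma lam_nonneg: "r < p \<Longrightarrow> 0 \<le> lam r"
 by (rule lam_eq[of r]) (auto simp: L.quadratic_Om intro!: add_nonneg_nonneg mult_nonneg_nonneg L.wt_nonneg L.quadratic_S_nonneg)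

lemma lam_sums: "L.T1 = (\<Sum>r<p. lam r)" "L.T2 = (\<Sum>r<p. (lam r)\<^sup>2)"
proof -
 obtain Q where Q: "\<And>r s. r < p \<Longrightarrow> s < p \<Longrightarrow> (\<Sum>c<p. Q c r*Q c s) = (if r = s then 1 else 0)"
  "\<And>c d. c < p \<Longrightarrow> d < p \<Longrightarrow> L.Om c d = (\<Sum>r<p. lam r*Q c r*Q d r)"
  by (rule spectrum) blast
 show "L.T1 = (\<Sum>r<p. lam r)" unfolding L.T1_def using spectral_trace[of p Q lam, OF Q(1)] by (simp add: Q(2))
 have "L.T2 = (\<Sum>c<p. \<Sum>e<p. (\<Sum>r<p. lam r*Q c r*Q e r)*(\<Sum>s<p. lam s*Q e s*Q c s))"
  unfolding L.T2_def power2_eq_square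
 proof (intro sum.cong refl)
  fix c e assume "c \<in> {..<p}" "e \<in> {..<p}"
  then show "L.Om c e*L.Om c e = (\<Sum>r<p. lam r*Q c r*Q e r)*(\<Sum>s<p. lam s*Q e s*Q c s)"
   using Q(2)[of c e] Q(2)[of e c] L.Om_sym[of c e] by simp
 qed
 also have "\<dots> = (\<Sum>c<p. \<Sum>r<p. lam r*lam r*Q c r*Q c r)" 
  by (rule sum.cong[OF refl], rule spectral_product[OF Q(1)])
 also have "\<dots> = (\<Sum>r<p. lam r*lam r)" by (rule spectral_trace[OF Q(1)])
 finally show "L.T2 = (\<Sum>r<p. (lam r)\<^sup>2)" by (simp add: power2_eq_square)
qed

lemma T2_le_T1_sq: "L.T2 \<le> L.T1\<^sup>2"
proof -
 have "(\<Sum>r<p. (lam r)\<^sup>2) \<le> (\<Sum>r<p. lam r*(\<Sum>s<p. lam s))"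
 proof (intro sum_mono)
  fix r assume r: "r \<in> {..<p}"
  have "lam r \<le> (\<Sum>s<p. lam s)" using r lam_nonneg by (intro member_le_sum) auto
  then show "(lam r)\<^sup>2 \<le> lam r*(\<Sum>s<p. lam s)" using r lam_nonneg by (simp add: power2_eq_square mult_left_mono)
 qed
 then show ?thesis unfolding lam_sums by (simp add: sum_distrib_right[symmetric] power2_eq_square)
qed

lemma rel_eq: "rel_eigenvalue (pooled N Sg) r = lam r/sqrt L.T2"
 by (simp add: rel_eigenvalue_def trace_pooled_sq)

lemma rel_nonneg: "r < p \<Longrightarrow> 0 \<le> rel_eigenvalue (pooled N Sg) r"
 unfolding rel_eq using lam_nonneg L.T2_nonneg by simp

lemma rel_sum: "(\<Sum>r<p. rel_eigenvalue (pooled N Sg) r) = L.T1/sqrt L.T2"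
 unfolding rel_eq lam_sums(1) by (rule sum_divide_distrib[symmetric])

lemma rel_sq_sum: "0 < L.T2 \<Longrightarrow> (\<Sum>r<p. (rel_eigenvalue (pooled N Sg) r)\<^sup>2) = 1"
 unfolding rel_eq power_divide by (simp add: sum_divide_distrib[symmetric] lam_sums(2)[symmetric])

lemma rel_antimono: "r \<le> s \<Longrightarrow> s < p \<Longrightarrow> rel_eigenvalue (pooled N Sg) s \<le> rel_eigenvalue (pooled N Sg) r"
proof -
 assume rs: "r \<le> s" "s < p"
 have "length (eigenvalues_desc (pooled N Sg)) = p" by (rule spectrum) blast
 then show ?thesis unfolding rel_eq using rs L.T2_nonneg by (intro divide_right_mono eigenvalues_desc_antimono) auto
qed

text \<open>
An eigenvalue of the pooled matrix is at most the sum of the two quadratic forms at its eigenvector,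
and each of these is bounded by the fourth root of the trace of a fourth power.
\<close>
lemma rel_le:
 assumes T2: "0 < L.T2" and \<eta>: "0 \<le> \<eta>" and r: "r < p"
  and tr: "\<And>i. i = 1 \<or> i = 2 \<Longrightarrow> trace (Sg i*Sg i*Sg i*Sg i) \<le> \<eta> ^ 4*L.T2\<^sup>2"
 shows "rel_eigenvalue (pooled N Sg) r \<le> 2*\<eta>"
proof -
 obtain q where q: "(\<Sum>c<p. (q c)\<^sup>2) = 1" "lam r = (\<Sum>c<p. \<Sum>d<p. q c*q d*L.Om c d)" using lam_eq[OF r] .
 define a where "a i = (\<Sum>c<p. \<Sum>d<p. q c*q d*L.S i c d)" for i
 have a: "0 \<le> a i" "a i \<le> \<eta> * sqrt L.T2" if i: "i = 1 \<or> i = 2" for i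
 proof -
  show "0 \<le> a i" unfolding a_def by (rule L.quadratic_S_nonneg)
  have "a i ^ 4 \<le> trace (Sg i*Sg i*Sg i*Sg i)"
   unfolding a_def trace_Sg_fourth[OF i] by (rule quadratic_form_fourth_power_le[OF L.S_sym q(1)])
  also have "\<dots> \<le> \<eta> ^ 4*L.T2\<^sup>2" by (rule tr[OF i])
  also have "\<dots> = (\<eta> * sqrt L.T2) ^ 4"
  proof -
   have "sqrt L.T2 ^ 4 = ((sqrt L.T2)\<^sup>2)\<^sup>2" by (simp flip: power_mult)
   then show ?thesis using T2 by (simp add: power_mult_distrib)
  qed
  finally have "a i ^ Suc 3 \<le> (\<eta> * sqrt L.T2) ^ Suc 3" by simp
  then show "a i \<le> \<eta> * sqrt L.T2" by (rule power_le_imp_le_base) (use \<eta> T2 in simp)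
 qed
 have "lam r = L.wt 1*a 1 + L.wt 2*a 2" unfolding q(2) L.quadratic_Om a_def ..
 also have "\<dots> \<le> 1*(\<eta> * sqrt L.T2) + 1*(\<eta> * sqrt L.T2)"
  using a L.wt_le_1 L.wt_nonneg by (intro add_mono mult_mono) auto
 finally show ?thesis unfolding rel_eq using T2 by (simp add: divide_le_eq)
qed

lemma standardized_decomposition_exists:
 assumes T2: "0 < trace (pooled N Sg*pooled N Sg)"
 shows "\<exists>U R X. standardized_decomposition M p N mu Sg y \<Delta> U R X"
proof -
 have T2: "0 < L.T2" using T2 by (simp only: trace_pooled_sq)
 have \<sigma>: "0 < L.\<sigma>" using T2 by (simp add: L.\<sigma>_def)
 have "0 < L.T1\<^sup>2" using T2 T2_le_T1_sq by linarith
 then have T1: "0 < L.T1" using L.T1_nonneg by (simp add: zero_less_power2)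
 have sT: "sqrt L.T2 \<le> L.T1" using T2_le_T1_sq T1 by (intro real_le_lsqrt) auto
 define U where "U w = (L.T0 (\<zeta> w) - L.tro (\<zeta> w))/L.\<sigma>" for w
 define R where "R w = L.tro (\<zeta> w)/L.T1" for w
 define X where "X w = cr (\<zeta> w)/L.\<sigma>" for w
 let ?P = "PiM (sample_index N) Dz"
 have crm: "cr \<in> borel_measurable ?P" "integrable ?P (\<lambda>\<omega>. (cr \<omega>)\<^sup>2)"
  "(\<integral>\<omega>. (cr \<omega>)\<^sup>2 \<partial>?P) = real (N 1)*real (N 2)/L.n*(\<Sum>c<p. \<Sum>d<p. \<delta> c*\<delta> d*L.Om c d)"
  unfolding cr_def[abs_def] by (rule L.cross_term)+
 have [measurable]: "(\<lambda>w. L.T0 (\<zeta> w)) \<in> borel_measurable M" "(\<lambda>w. L.tro (\<zeta> w)) \<in> borel_measurable M" "(\<lambda>w. cr (\<zeta> w)) \<in> borel_measurable M"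
  using measurable_compose[OF \<zeta>_measurable L.T0_measurable] measurable_compose[OF \<zeta>_measurable L.tro_measurable] measurable_compose[OF \<zeta>_measurable crm(1)] by auto
 have m: "U \<in> borel_measurable M" "R \<in> borel_measurable M" "X \<in> borel_measurable M"
  unfolding U_def[abs_def] R_def[abs_def] X_def[abs_def] by measurable
 have h: "sqrt (dof1 N Sg/2) = L.T1/L.\<sigma>"
  using T1 unfolding dof1_eq L.\<sigma>_def by (simp add: real_sqrt_divide real_sqrt_mult)
 have shift: "observed_shift N mu Sg = sh/L.\<sigma>"
  unfolding observed_shift_def sh_def sq_norm_mean_difference trace_pooled_sq L.\<sigma>_def L.n_def ..
 have F: "0 \<le> R w \<and> F_stat p N (\<lambda>i j. y i j w) = (U w + R w * sqrt (dof1 N Sg/2) + 2*X w + sh/L.\<sigma>)/(R w * sqrt (dof1 N Sg/2))" if w: "w \<in> space M" for w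
 proof
  show "0 \<le> R w" unfolding R_def using tro_nonneg T1 by simp
  have Rh: "R w * sqrt (dof1 N Sg/2) = L.tro (\<zeta> w)/L.\<sigma>" unfolding R_def h using T1 by simp
  have "U w + L.tro (\<zeta> w)/L.\<sigma> + 2*X w + sh/L.\<sigma> = (L.T0 (\<zeta> w) + 2*cr (\<zeta> w) + sh)/L.\<sigma>"
   unfolding U_def X_def by (simp add: add_divide_distrib diff_divide_distrib)
  then show "F_stat p N (\<lambda>i j. y i j w) = (U w + R w * sqrt (dof1 N Sg/2) + 2*X w + sh/L.\<sigma>)/(R w * sqrt (dof1 N Sg/2))"
   unfolding Rh F_stat_eq[OF w] using \<sigma> by simp
 qed
 have \<nu>: "L.\<nu> = real (min (N 1) (N 2)) - 1" by (rule L.\<nu>_def)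
 have ch: "cmod (char (distr M borel U) \<theta> - (\<Prod>r<p. chi_factor (\<theta>*rel_eigenvalue (pooled N Sg) r))) \<le>
   (4*\<theta>\<^sup>2 + 16*(3 + \<bar>\<Delta>\<bar>)\<^sup>2*\<theta> ^ 4)/sqrt L.\<nu> + \<bar>\<theta>\<bar> * sqrt ((2 + \<bar>\<Delta>\<bar>)/(2*L.\<nu>))" for \<theta>
 proof -
  obtain Q where Q: "\<And>r s. r < p \<Longrightarrow> s < p \<Longrightarrow> (\<Sum>c<p. Q c r*Q c s) = (if r = s then 1 else 0)"
   "\<And>c d. c < p \<Longrightarrow> d < p \<Longrightarrow> L.Om c d = (\<Sum>r<p. lam r*Q c r*Q d r)"
   by (rule spectrum) blast
  have "char (distr M borel U) \<theta> = (\<integral>w. iexp (\<theta>*U w) \<partial>M)"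
   unfolding char_def using m(1) by (subst integral_distr) auto
  also have "\<dots> = (\<integral>w. (\<lambda>\<omega>. iexp (\<theta>*((L.T0 \<omega> - L.tro \<omega>)/L.\<sigma>))) (\<zeta> w) \<partial>M)" by (simp add: U_def)
  also have "\<dots> = (\<integral>\<omega>. iexp (\<theta>*((L.T0 \<omega> - L.tro \<omega>)/L.\<sigma>)) \<partial>?P)"
  proof (rule integral_\<zeta>)
   note [measurable] = L.T0_measurable L.tro_measurable
   show "(\<lambda>\<omega>. iexp (\<theta>*((L.T0 \<omega> - L.tro \<omega>)/L.\<sigma>))) \<in> borel_measurable ?P" by measurable
  qed
  finally have e: "char (distr M borel U) \<theta> = (\<integral>\<omega>. iexp (\<theta> * offdiag_quad m L.A (sample_index N) \<omega>) \<partial>?P)"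
   unfolding L.offdiag_quad_eq .
  have K: "3 + \<bar>\<Delta>\<bar> - 1 = 2 + \<bar>\<Delta>\<bar>" by simp
  show ?thesis unfolding e rel_eq
   by (rule L.char_limit_bound[OF T2 Q(2) Q(1) lam_nonneg lam_sums(1), unfolded K])
 qed
 have R: "integrable M R" "(\<integral>w. \<bar>R w - 1\<bar> \<partial>M) \<le> sqrt ((2 + \<bar>\<Delta>\<bar>)/L.\<nu>)"
 proof -
  have i: "integrable M (\<lambda>w. L.tro (\<zeta> w) - L.T1)" by (rule integrable_\<zeta>[OF L.tro_L1(1)])
  have "R = (\<lambda>w. (L.tro (\<zeta> w) - L.T1)/L.T1 + 1)" using T1 by (simp add: R_def fun_eq_iff diff_divide_distrib)
  then show "integrable M R" using i by simp
  have "(\<integral>w. \<bar>R w - 1\<bar> \<partial>M) = (\<integral>w. \<bar>L.tro (\<zeta> w) - L.T1\<bar>/L.T1 \<partial>M)"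
  proof (intro Bochner_Integration.integral_cong refl)
   fix w
   have "R w - 1 = (L.tro (\<zeta> w) - L.T1)/L.T1" using T1 by (simp add: R_def diff_divide_distrib)
   then show "\<bar>R w - 1\<bar> = \<bar>L.tro (\<zeta> w) - L.T1\<bar>/L.T1" using T1 by simp
  qed
  also have "\<dots> = (\<integral>w. \<bar>L.tro (\<zeta> w) - L.T1\<bar> \<partial>M)/L.T1" by simp
  also have "(\<integral>w. \<bar>L.tro (\<zeta> w) - L.T1\<bar> \<partial>M) = (\<integral>\<omega>. \<bar>L.tro \<omega> - L.T1\<bar> \<partial>?P)"
   by (rule integral_\<zeta>) (use L.tro_measurable in measurable)
  also have "\<dots>/L.T1 \<le> sqrt ((2 + \<bar>\<Delta>\<bar>)*L.T2/L.\<nu>)/L.T1"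
   using L.tro_L1(2) T1 by (intro divide_right_mono) auto
  also have "\<dots> = sqrt ((2 + \<bar>\<Delta>\<bar>)/L.\<nu>)*(sqrt L.T2/L.T1)"
   unfolding real_sqrt_mult[symmetric] times_divide_eq_right by (simp add: mult.commute)
  also have "\<dots> \<le> sqrt ((2 + \<bar>\<Delta>\<bar>)/L.\<nu>)*1"
   using sT T1 L.\<nu>_pos by (intro mult_left_mono) auto
  finally show "(\<integral>w. \<bar>R w - 1\<bar> \<partial>M) \<le> sqrt ((2 + \<bar>\<Delta>\<bar>)/L.\<nu>)" by simp
 qed
 have X: "integrable M X" "(\<integral>w. \<bar>X w\<bar> \<partial>M) \<le> sqrt (cross_bound N mu Sg)"
 proof -
  have sq: "integrable M (\<lambda>w. (X w)\<^sup>2)" unfolding X_def power_divide using integrable_\<zeta>[OF crm(2)] by simp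
  note e = expectation_abs_le_sqrt[OF m(3) sq]
  show "integrable M X" by (rule e)
  have v: "mu 1 - mu 2 \<in> carrier_vec p" using means by simp
  have qS: "(mu 1 - mu 2) \<bullet> (Sg i *\<^sub>v (mu 1 - mu 2)) = (\<Sum>c<p. \<Sum>d<p. \<delta> c*\<delta> d*L.S i c d)" if i: "i = 1 \<or> i = 2" for i
   unfolding quadratic_form[OF Sg_carrier[OF i] v]
   by (intro sum.cong refl) (use means in \<open>auto simp: \<delta>_def Sg_entry[OF i]\<close>)
  have "expectation (\<lambda>w. (X w)\<^sup>2) = (\<integral>w. (cr (\<zeta> w))\<^sup>2 \<partial>M)/L.\<sigma>\<^sup>2" unfolding X_def power_divide by simp
  also have "(\<integral>w. (cr (\<zeta> w))\<^sup>2 \<partial>M) = (\<integral>\<omega>. (cr \<omega>)\<^sup>2 \<partial>?P)" using crm(1) by (intro integral_\<zeta>) measurable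
  also have "\<dots> = real (N 1)*real (N 2)/L.n*(\<Sum>c<p. \<Sum>d<p. \<delta> c*\<delta> d*L.Om c d)" by (rule crm(3))
  also have "\<dots>/L.\<sigma>\<^sup>2 \<le> real (N 1)*real (N 2)/L.n*((mu 1 - mu 2) \<bullet> (Sg 1 *\<^sub>v (mu 1 - mu 2)) + (mu 1 - mu 2) \<bullet> (Sg 2 *\<^sub>v (mu 1 - mu 2)))/L.\<sigma>\<^sup>2"
  proof (intro divide_right_mono mult_left_mono)
   have "(\<Sum>c<p. \<Sum>d<p. \<delta> c*\<delta> d*L.Om c d) \<le> 1*(\<Sum>c<p. \<Sum>d<p. \<delta> c*\<delta> d*L.S 1 c d) + 1*(\<Sum>c<p. \<Sum>d<p. \<delta> c*\<delta> d*L.S 2 c d)"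
    unfolding L.quadratic_Om using L.wt_le_1 L.quadratic_S_nonneg by (intro add_mono mult_right_mono) auto
   then show "(\<Sum>c<p. \<Sum>d<p. \<delta> c*\<delta> d*L.Om c d) \<le> (mu 1 - mu 2) \<bullet> (Sg 1 *\<^sub>v (mu 1 - mu 2)) + (mu 1 - mu 2) \<bullet> (Sg 2 *\<^sub>v (mu 1 - mu 2))"
    unfolding qS[of 1, OF disjI1[OF refl]] qS[of 2, OF disjI2[OF refl]] by simp
  qed (use L.n_pos in auto)
  also have "L.\<sigma>\<^sup>2 = 2*trace (pooled N Sg*pooled N Sg)" using T2 unfolding trace_pooled_sq by (simp add: L.\<sigma>_def)
  finally have "expectation (\<lambda>w. (X w)\<^sup>2) \<le> cross_bound N mu Sg" unfolding cross_bound_def L.n_def .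
  then show "(\<integral>w. \<bar>X w\<bar> \<partial>M) \<le> sqrt (cross_bound N mu Sg)"
   using e(2) by (meson order_trans real_sqrt_le_mono)
 qed
 show ?thesis unfolding standardized_decomposition_def shift \<nu>[symmetric]
  by (rule exI[of _ U], rule exI[of _ R], rule exI[of _ X], intro conjI ballI allI m ch R X F[THEN conjunct1] F[THEN conjunct2])
qed

lemma trace_sq_pos: "dof1 N Sg \<noteq> 0 \<Longrightarrow> 0 < trace (pooled N Sg*pooled N Sg)"
 unfolding dof1_eq trace_pooled_sq using L.T2_nonneg by (cases "L.T2 = 0") auto

lemma dof1_ge_1: "dof1 N Sg \<noteq> 0 \<Longrightarrow> 1 \<le> dof1 N Sg"
 using trace_sq_pos T2_le_T1_sq unfolding dof1_eq trace_pooled_sq by (simp add: le_divide_eq)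

lemma dof1_rel: "dof1 N Sg = (\<Sum>r<p. rel_eigenvalue (pooled N Sg) r)\<^sup>2"
 unfolding dof1_eq rel_sum power_divide using L.T2_nonneg by simp

lemma rel_sq_sum_1: "dof1 N Sg \<noteq> 0 \<Longrightarrow> (\<Sum>r<p. (rel_eigenvalue (pooled N Sg) r)\<^sup>2) = 1"
 using rel_sq_sum trace_sq_pos unfolding trace_pooled_sq by blast

text \<open>
The denominator of \<open>dof2\<close> is at most \<open>T2\<close> divided by the smaller sample
size less one, while \<open>dof1\<close> has \<open>T2\<close> as its denominator.
\<close>
lemma dof2_bounds:
 assumes d: "dof1 N Sg \<noteq> 0" "dof2 N Sg \<noteq> 0"
 shows "0 < dof2 N Sg" "dof1 N Sg/dof2 N Sg \<le> 1/(real (min (N 1) (N 2)) - 1)"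
proof -
 define e where "e = dof2_denom N (trace (Sg 1*Sg 1)) (trace (Sg 2*Sg 2))"
 have d2: "dof2 N Sg = L.T1\<^sup>2/e" by (simp add: dof2_def e_def trace_pooled)
 have T2: "0 < L.T2" using trace_sq_pos[OF d(1)] unfolding trace_pooled_sq .
 have T1: "L.T1 \<noteq> 0" "e \<noteq> 0" using d(2) unfolding d2 by auto
 then have e: "0 < e" using dof2_denom_nonneg by (simp add: e_def less_le)
 show "0 < dof2 N Sg" unfolding d2 using T1 e by simp
 have "dof1 N Sg/dof2 N Sg = e/L.T2" unfolding dof1_eq d2 using T1 by simp
 also have "\<dots> \<le> (L.T2/L.\<nu>)/L.T2" using dof2_denom_le T2 unfolding e_def by (intro divide_right_mono) auto
 also have "\<dots> = 1/(real (min (N 1) (N 2)) - 1)" using T2 unfolding L.\<nu>_def[symmetric] by simp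
 finally show "dof1 N Sg/dof2 N Sg \<le> 1/(real (min (N 1) (N 2)) - 1)" .
qed

lemma trace_sum_sq_bounds:
 assumes "0 \<le> c" "c \<le> real (N 1)/real (N 1 + N 2)" "c \<le> real (N 2)/real (N 1 + N 2)"
 shows "0 \<le> trace ((Sg 1 + Sg 2)*(Sg 1 + Sg 2))"
  "c\<^sup>2*trace ((Sg 1 + Sg 2)*(Sg 1 + Sg 2)) \<le> trace (pooled N Sg*pooled N Sg)"
 unfolding trace_sum_sq trace_pooled_sq
 using L.tr2_nonneg assms by (auto intro!: L.trace_sum_sq_le simp: L.wt12 L.n_def simp del: One_nat_def)

lemma rel_le_of_fourth_trace:
 assumes "dof1 N Sg \<noteq> 0" "0 \<le> \<eta>" "r < p"
  "\<And>i. i = 1 \<or> i = 2 \<Longrightarrow> trace (Sg i*Sg i*Sg i*Sg i) \<le> \<eta> ^ 4*(trace (pooled N Sg*pooled N Sg))\<^sup>2"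
 shows "rel_eigenvalue (pooled N Sg) r \<le> 2*\<eta>"
 using rel_le[of \<eta> r] trace_sq_pos assms unfolding trace_pooled_sq by blast

text \<open>
Replacing the sample proportions by their limits changes the standardized shift by a factor that is
controlled by the proportions alone, because every term of the trace is nonnegative.
\<close>
lemma mean_shift_factor:
 fixes \<tau> :: real
 assumes d: "dof1 N Sg \<noteq> 0" and \<tau>: "0 < \<tau>" "\<tau> < 1"
  and ab: "a = real (N 1)/real (N 1 + N 2)" "b = real (N 2)/real (N 1 + N 2)"
 shows "\<exists>r. observed_shift N mu Sg = r*mean_shift \<tau> N mu Sg \<and>
  a*b/(\<tau>*(1 - \<tau>))*min (\<tau>/a) ((1 - \<tau>)/b) \<le> r \<and> r \<le> a*b/(\<tau>*(1 - \<tau>))*max (\<tau>/a) ((1 - \<tau>)/b)"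
  "0 \<le> mean_shift \<tau> N mu Sg"
proof -
 have T2: "0 < L.T2" using trace_sq_pos[OF d] unfolding trace_pooled_sq .
 have pos: "0 < a" "0 < b" using N_pos[of 1] N_pos[of 2] unfolding ab by auto
 define T where "T = (1 - \<tau>)\<^sup>2*L.tr2 1 1 + 2*(1 - \<tau>)*\<tau>*L.tr2 1 2 + \<tau>\<^sup>2*L.tr2 2 2"
 have T2': "L.T2 = b\<^sup>2*L.tr2 1 1 + 2*b*a*L.tr2 1 2 + a\<^sup>2*L.tr2 2 2"
  unfolding L.T2_eq L.wt12 L.n_def ab ..
 have form: "u\<^sup>2*L.tr2 1 1 + 2*u * v * L.tr2 1 2 + v\<^sup>2*L.tr2 2 2 \<le> u'\<^sup>2*L.tr2 1 1 + 2*u' * v'*L.tr2 1 2 + v'\<^sup>2*L.tr2 2 2"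
  if "0 \<le> u" "0 \<le> v" "u \<le> u'" "v \<le> v'" for u v u' v'
 proof -
  have "u * v \<le> u' * v'" using that by (intro mult_mono) auto
  then have "2*u * v \<le> 2*u' * v'" by simp
  then show ?thesis using that L.tr2_nonneg by (intro add_mono mult_right_mono power_mono) auto
 qed
 define q1 where "q1 = min (\<tau>/a) ((1 - \<tau>)/b)"
 define q2 where "q2 = max (\<tau>/a) ((1 - \<tau>)/b)"
 have q: "0 < q1" "0 < q2" using pos \<tau> by (auto simp: q1_def q2_def less_max_iff_disj)
 have h: "(q*u)\<^sup>2*A + 2*(q*u)*(q * v)*B + (q * v)\<^sup>2*C = q\<^sup>2*(u\<^sup>2*A + 2*u * v * B + v\<^sup>2*C)" for q u v A B C :: real
  by (simp add: power2_eq_square algebra_simps)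
 have l1: "q1*b \<le> 1 - \<tau>" "q1*a \<le> \<tau>"
  using pos min.cobounded2[of "\<tau>/a" "(1 - \<tau>)/b"] min.cobounded1[of "\<tau>/a" "(1 - \<tau>)/b"] unfolding q1_def[symmetric] by (simp_all add: le_divide_eq)
 have l2: "1 - \<tau> \<le> q2*b" "\<tau> \<le> q2*a"
  using pos max.cobounded2[of "(1 - \<tau>)/b" "\<tau>/a"] max.cobounded1[of "\<tau>/a" "(1 - \<tau>)/b"] unfolding q2_def[symmetric] by (simp_all add: divide_le_eq)
 have low: "q1\<^sup>2*L.T2 \<le> T" unfolding T2' T_def h[symmetric] using l1 q pos by (intro form) auto
 have up: "T \<le> q2\<^sup>2*L.T2" unfolding T2' T_def h[symmetric] using l2 \<tau> by (intro form) auto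
 have "0 < q1\<^sup>2*L.T2" using q T2 by simp
 then have T: "0 < T" using low by linarith
 have sq: "q1 \<le> sqrt T/sqrt L.T2" "sqrt T/sqrt L.T2 \<le> q2"
 proof -
  have "sqrt (q1\<^sup>2*L.T2) \<le> sqrt T" "sqrt T \<le> sqrt (q2\<^sup>2*L.T2)" using low up by (auto intro: real_sqrt_le_mono)
  then show "q1 \<le> sqrt T/sqrt L.T2" "sqrt T/sqrt L.T2 \<le> q2"
   using q T2 by (simp_all add: real_sqrt_mult le_divide_eq divide_le_eq)
 qed
 define \<kappa> where "\<kappa> = sq_norm_vec (mu 1 - mu 2)"
 have \<kappa>: "0 \<le> \<kappa>" unfolding \<kappa>_def sq_norm_mean_difference by (intro sum_nonneg) auto
 have ms: "mean_shift \<tau> N mu Sg = real (N 1 + N 2)*\<tau>*(1 - \<tau>)*\<kappa>/sqrt (2*T)"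
  unfolding mean_shift_def Let_def trace_combination_sq \<kappa>_def T_def ..
 show "0 \<le> mean_shift \<tau> N mu Sg" unfolding ms using \<kappa> \<tau> T by simp
 define r where "r = a*b/(\<tau>*(1 - \<tau>))*(sqrt T/sqrt L.T2)"
 have "real (N 1)*real (N 2)/real (N 1 + N 2) = a*b*real (N 1 + N 2)" using N_pos[of 1] unfolding ab by simp
 then have "real (N 1)*real (N 2)/real (N 1 + N 2)*\<kappa>/sqrt (2*L.T2) = a*b*real (N 1 + N 2)*\<kappa>/sqrt (2*L.T2)" by (simp only:)
 also have "\<dots> = r*mean_shift \<tau> N mu Sg"
 proof -
  have g: "x*k*y/(s2 * sq) = x/(u*t)*(sT/sq)*(k*u*t*y/(s2 * sT))"
   if "u \<noteq> 0" "t \<noteq> 0" "sT \<noteq> 0" "s2 \<noteq> 0" "sq \<noteq> 0" for x k y s2 sq u t sT :: real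
   using that by (simp add: field_simps)
  show ?thesis unfolding r_def ms real_sqrt_mult by (rule g) (use \<tau> T T2 in auto)
 qed
 finally have 1: "real (N 1)*real (N 2)/real (N 1 + N 2)*\<kappa>/sqrt (2*L.T2) = r*mean_shift \<tau> N mu Sg" .
 have "0 \<le> a*b/(\<tau>*(1 - \<tau>))" using pos \<tau> by simp
 then have "a*b/(\<tau>*(1 - \<tau>))*q1 \<le> r" "r \<le> a*b/(\<tau>*(1 - \<tau>))*q2"
  unfolding r_def using sq by (blast intro: mult_left_mono)+
 with 1 show "\<exists>r. observed_shift N mu Sg = r*mean_shift \<tau> N mu Sg \<and>
  a*b/(\<tau>*(1 - \<tau>))*min (\<tau>/a) ((1 - \<tau>)/b) \<le> r \<and> r \<le> a*b/(\<tau>*(1 - \<tau>))*max (\<tau>/a) ((1 - \<tau>)/b)"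
  unfolding observed_shift_def trace_pooled_sq \<kappa>_def[symmetric] q1_def[symmetric] q2_def[symmetric] by blast
qed

end

section \<open>Asymptotic power\<close>

lemma std_normal_tail: "measure std_normal_distribution {a..} = std_normal_cdf (- a)"
proof -
 interpret prob_space std_normal_distribution by (rule prob_space_normal_density) simp
 have "distributed std_normal_distribution lborel (\<lambda>x. x) (normal_density 0 1)"
  unfolding distributed_def by (auto simp: distr_id2)
 from normal_density_affine[OF this, of "-1" 0]
 have "distr std_normal_distribution lborel (\<lambda>x. - x) = std_normal_distribution"
  by (simp add: distributed_def)
 then have "measure std_normal_distribution {..- a} = measure (distr std_normal_distribution lborel (\<lambda>x. - x)) {..- a}" by simp
 also have "\<dots> = measure std_normal_distribution ((\<lambda>x. - x) -` {..- a} \<inter> space std_normal_distribution)"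
  by (rule measure_distr) auto
 also have "(\<lambda>x. - x) -` {..- a} \<inter> space std_normal_distribution = {a..}" by auto
 finally show ?thesis by (simp add: std_normal_cdf_def cdf_def)
qed

lemma std_normal_tail_pos: "0 < measure std_normal_distribution {a..}"
proof -
 interpret real_distribution std_normal_distribution by (rule real_dist_normal_dist)
 have "0 \<le> cdf std_normal_distribution (- a - 1)" by (rule cdf_nonneg)
 also have "\<dots> < cdf std_normal_distribution (- a)" by (rule cdf_normal_strict) simp
 finally show ?thesis by (simp add: std_normal_tail std_normal_cdf_def)
qed

lemma standardized_chi_square_law:
 assumes D: "0 < D"
 defines "\<mu> \<equiv> distr (chi_square D) borel (\<lambda>x. (x - D)*(1/sqrt (2*D)))"
 shows "real_distribution \<mu>" "isCont (cdf \<mu>) x" "x < y \<Longrightarrow> 0 < cdf \<mu> x \<Longrightarrow> cdf \<mu> x < cdf \<mu> y"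
proof -
 show "real_distribution \<mu>" unfolding \<mu>_def
  by (rule prob_space.real_distribution_distr[OF prob_space_chi_square[OF D]]) simp
 have c: "cdf \<mu> y = cdf (chi_square D) (D + y/(1/sqrt (2*D)))" for y
  unfolding \<mu>_def using D by (intro cdf_affine real_distribution_chi_square) auto
 have "isCont (\<lambda>y. cdf (chi_square D) (D + y/(1/sqrt (2*D)))) x"
  using D by (intro isCont_o2[OF _ isCont_cdf_chi_square[OF D]] continuous_intros) auto
 then show "isCont (cdf \<mu>) x" unfolding ext[of "cdf \<mu>", OF c] .
 show "cdf \<mu> x < cdf \<mu> y" if "x < y" "0 < cdf \<mu> x"
  using that D unfolding c by (intro cdf_chi_square_strict) (auto intro!: divide_strict_right_mono)
qed

lemma in_prob_D:
 assumes "\<And>k. prob_space (M k)" "\<And>k. integrable (M k) (X k)" "\<And>k. (\<integral>w. \<bar>X k w - c\<bar> \<partial>M k) \<le> b k" "b \<longlonglongrightarrow> 0"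
 shows "tendsto_in_prob M X c"
proof (rule in_prob_of_L1)
 show "(\<lambda>k. \<integral>w. \<bar>X k w - c\<bar> \<partial>M k) \<longlonglongrightarrow> 0"
  by (rule tendsto_sandwich[OF _ _ tendsto_const assms(4)]) (auto intro: always_eventually assms(3))
qed (use assms in auto)

text \<open>
A regime in which the degrees of freedom are nonzero and the samples have at least two elements for
every index. Every regime of the main theorem has this form from some index on.
\<close>
locale factor_regime =
 fixes M :: "nat \<Rightarrow> 'w measure" and p m :: "nat \<Rightarrow> nat" and N :: "nat \<Rightarrow> nat \<Rightarrow> nat"
  and mu :: "nat \<Rightarrow> nat \<Rightarrow> real vec" and Sg G :: "nat \<Rightarrow> nat \<Rightarrow> real mat"
  and y z :: "nat \<Rightarrow> nat \<Rightarrow> nat \<Rightarrow> 'w \<Rightarrow> real vec" and \<Delta> \<tau> \<alpha> :: real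
 assumes prob: "\<And>k. prob_space (M k)"
  and means: "\<And>k. mu k 1 \<in> carrier_vec (p k)" "\<And>k. mu k 2 \<in> carrier_vec (p k)"
  and \<alpha>: "0 < \<alpha>" "\<alpha> < 1"
  and p_lim: "filterlim p at_top sequentially"
  and n_lim: "filterlim (\<lambda>k. N k 1 + N k 2) at_top sequentially"
  and model: "\<And>k. factor_model (M k) (p k) (m k) (N k) (mu k) (Sg k) (y k) (G k) (z k)"
  and moments: "\<And>k i j. (i, j) \<in> sample_index (N k) \<Longrightarrow> moment_condition (M k) (m k) \<Delta> (z k i j)"
  and \<tau>: "0 < \<tau>" "\<tau> < 1" and proportion: "(\<lambda>k. real (N k 1)/real (N k 1 + N k 2)) \<longlonglongrightarrow> \<tau>"
  and LA: "local_alternative N mu Sg"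
  and ratio1: "tendsto_in_prob M (\<lambda>k w. dof1_hat (p k) (N k) (\<lambda>i j. y k i j w)/dof1 (N k) (Sg k)) 1"
  and ratio2: "tendsto_in_prob M (\<lambda>k w. dof2_hat (p k) (N k) (\<lambda>i j. y k i j w)/dof2 (N k) (Sg k)) 1"
  and sizes: "\<And>k. 2 \<le> N k 1" "\<And>k. 2 \<le> N k 2"
  and dof: "\<And>k. dof1 (N k) (Sg k) \<noteq> 0" "\<And>k. dof2 (N k) (Sg k) \<noteq> 0"
begin

lemma fs: "factor_sample (M k) (p k) (m k) (N k) (mu k) (Sg k) (y k) (G k) (z k) \<Delta>"
 by (intro factor_sample.intro prob model moments sizes means)

abbreviation d1 where "d1 k \<equiv> dof1 (N k) (Sg k)"
abbreviation d2 where "d2 k \<equiv> dof2 (N k) (Sg k)"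
abbreviation rel where "rel k r \<equiv> rel_eigenvalue (pooled (N k) (Sg k)) r"
abbreviation shift where "shift k \<equiv> mean_shift \<tau> (N k) (mu k) (Sg k)"
abbreviation power where "power k \<equiv> \<P>(w in M k. F_stat (p k) (N k) (\<lambda>i j. y k i j w)
 \<ge> F_upper (dof1_hat (p k) (N k) (\<lambda>i j. y k i j w)) (dof2_hat (p k) (N k) (\<lambda>i j. y k i j w)) \<alpha>)"

lemma proportion2: "(\<lambda>k. real (N k 2)/real (N k 1 + N k 2)) \<longlonglongrightarrow> 1 - \<tau>"
proof -
 have "real (N k 2)/real (N k 1 + N k 2) = 1 - real (N k 1)/real (N k 1 + N k 2)" for k
 proof -
  have nz: "real (N k 1 + N k 2) \<noteq> 0" using sizes(1)[of k] by simp
  have "1 - real (N k 1)/real (N k 1 + N k 2) = (real (N k 1 + N k 2) - real (N k 1))/real (N k 1 + N k 2)"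
   by (simp only: diff_divide_distrib divide_self[OF nz])
  then show ?thesis by simp
 qed
 then show ?thesis using tendsto_diff[OF tendsto_const[of 1] proportion] by simp
qed

abbreviation \<nu> where "\<nu> k \<equiv> real (min (N k 1) (N k 2)) - 1"

lemma \<nu>_lim: "filterlim \<nu> at_top sequentially"
proof -
 have n: "filterlim (\<lambda>k. real (N k 1 + N k 2)) at_top sequentially"
  by (rule filterlim_compose[OF filterlim_real_sequentially n_lim])
 have e: "real (N k i) = real (N k i)/real (N k 1 + N k 2)*real (N k 1 + N k 2)" for k i
  using sizes(1)[of k] by simp
 have 1: "filterlim (\<lambda>k. real (N k 1)) at_top sequentially"
  by (subst e) (rule filterlim_tendsto_pos_mult_at_top[OF proportion \<tau>(1) n])
 have 2: "filterlim (\<lambda>k. real (N k 2)) at_top sequentially"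
  by (subst e) (rule filterlim_tendsto_pos_mult_at_top[OF proportion2 _ n], use \<tau> in simp)
 show ?thesis unfolding filterlim_at_top
 proof
  fix Z :: real
  have "\<forall>\<^sub>F k in sequentially. Z + 1 \<le> real (N k 1)" "\<forall>\<^sub>F k in sequentially. Z + 1 \<le> real (N k 2)"
   using 1 2 unfolding filterlim_at_top by auto
  then show "\<forall>\<^sub>F k in sequentially. Z \<le> \<nu> k" by eventually_elim (simp add: min_def)
 qed
qed

lemma \<nu>_inverse_lim: "(\<lambda>k. c/\<nu> k) \<longlonglongrightarrow> 0"
 by (rule tendsto_divide_0[OF tendsto_const filterlim_at_top_imp_at_infinity[OF \<nu>_lim]])

lemma d1_ge_1: "1 \<le> d1 k" by (rule factor_sample.dof1_ge_1[OF fs dof(1)])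
lemma d2_pos: "0 < d2 k" by (rule factor_sample.dof2_bounds[OF fs dof(1) dof(2)])

lemma d1_d2: "(\<lambda>k. d1 k/d2 k) \<longlonglongrightarrow> 0"
 by (rule tendsto_sandwich[OF _ _ tendsto_const \<nu>_inverse_lim[of 1]])
  (use d1_ge_1 d2_pos factor_sample.dof2_bounds(2)[OF fs dof(1) dof(2)] in
   \<open>auto intro!: always_eventually divide_nonneg_nonneg intro: order_trans[of 0 1] less_imp_le\<close>)

definition c0 :: real where "c0 = min \<tau> (1 - \<tau>)/2"

lemma c0: "0 < c0" "\<forall>\<^sub>F k in sequentially. c0 \<le> real (N k 1)/real (N k 1 + N k 2) \<and> c0 \<le> real (N k 2)/real (N k 1 + N k 2)"
proof -
 have c: "0 < c0" "c0 < \<tau>" "c0 < 1 - \<tau>" using \<tau> by (auto simp: c0_def min_def)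
 show "0 < c0" by (rule c)
 show "\<forall>\<^sub>F k in sequentially. c0 \<le> real (N k 1)/real (N k 1 + N k 2) \<and> c0 \<le> real (N k 2)/real (N k 1 + N k 2)"
  using order_tendstoD(1)[OF proportion c(2)] order_tendstoD(1)[OF proportion2 c(3)] by eventually_elim simp
qed

text \<open>
The local alternative is formulated with the sum of the covariance matrices; the trace of its square
is comparable to that of the pooled matrix, as both proportions stay away from zero.
\<close>
lemma cross_bound_lim: "(\<lambda>k. sqrt (cross_bound (N k) (mu k) (Sg k))) \<longlonglongrightarrow> 0"
proof -
 let ?g = "\<lambda>k. real (N k 1)*real (N k 2)/real (N k 1 + N k 2)"
 let ?q = "\<lambda>k i. (mu k 1 - mu k 2) \<bullet> (Sg k i *\<^sub>v (mu k 1 - mu k 2))"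
 let ?T = "\<lambda>k. trace (pooled (N k) (Sg k)*pooled (N k) (Sg k))"
 let ?TS = "\<lambda>k. trace ((Sg k 1 + Sg k 2)*(Sg k 1 + Sg k 2))"
 have "(\<lambda>k. ?g k*(?q k 1 + ?q k 2)/(2*?T k)) \<longlonglongrightarrow> 0" unfolding tendsto_iff dist_real_def diff_0_right
 proof (intro allI impI)
  fix e :: real assume e: "0 < e"
  define e' where "e' = e/2*c0\<^sup>2"
  have e': "0 < e'" using e c0(1) by (simp add: e'_def)
  have o: "\<forall>\<^sub>F k in sequentially. norm (?q k i) \<le> e'*norm (?TS k/real (N k 1 + N k 2))" if "i = 1 \<or> i = 2" for i
   using LA e' that unfolding local_alternative_def by (intro landau_o.smallD) auto
  show "\<forall>\<^sub>F k in sequentially. \<bar>?g k*(?q k 1 + ?q k 2)/(2*?T k)\<bar> < e"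
   using o[of 1, OF disjI1[OF refl]] o[of 2, OF disjI2[OF refl]] c0(2)
  proof eventually_elim
   case (elim k)
   define n where "n = real (N k 1 + N k 2)"
   have n: "0 < n" using sizes(1)[of k] by (simp add: n_def)
   have T: "0 < ?T k" by (rule factor_sample.trace_sq_pos[OF fs dof(1)])
   have TS: "0 \<le> ?TS k" "c0\<^sup>2*?TS k \<le> ?T k"
    using factor_sample.trace_sum_sq_bounds[OF fs, of c0 k] elim(3) c0(1) by auto
   have g: "0 \<le> ?g k" "?g k \<le> n"
   proof -
    show "0 \<le> ?g k" by simp
    have "real (N k 1)*real (N k 2) \<le> n*n" unfolding n_def by (intro mult_mono) auto
    then show "?g k \<le> n" using n unfolding n_def[symmetric] by (simp add: divide_le_eq)
   qed
   have q: "\<bar>?q k 1\<bar> \<le> e'*(?TS k/n)" "\<bar>?q k 2\<bar> \<le> e'*(?TS k/n)" using elim(1,2) TS n unfolding n_def by auto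
   have "\<bar>?g k*(?q k 1 + ?q k 2)/(2*?T k)\<bar> = ?g k*\<bar>?q k 1 + ?q k 2\<bar>/(2*?T k)"
    unfolding abs_divide abs_mult using g T by simp
   also have "\<dots> \<le> n*(2*(e'*(?TS k/n)))/(2*?T k)"
    using g q T n e' TS by (intro divide_right_mono mult_mono) auto
   also have "\<dots> = e'*?TS k/?T k" using n by simp
   also have "\<dots> = e/2*(c0\<^sup>2*?TS k)/?T k" by (simp add: e'_def)
   also have "\<dots> \<le> e/2*?T k/?T k" using e T TS by (intro divide_right_mono mult_left_mono) auto
   also have "\<dots> < e" using T e by simp
   finally show ?case .
  qed
 qed
 from tendsto_real_sqrt[OF this] show ?thesis by (simp add: cross_bound_def)
qed

text \<open>
The limiting law \<open>L\<close> of the quadratic form and the limiting law \<open>\<mu>\<close> of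
the standardized chi-square variable with \<open>d1\<close> degrees of freedom may differ, so they
are kept apart.
\<close>
lemma power_asymptotics:
 assumes ch: "\<And>\<theta>. (\<lambda>k. \<Prod>r<p k. chi_factor (\<theta>*rel k r)) \<longlonglongrightarrow> char L \<theta>"
  and L: "real_distribution L" "\<And>x. isCont (cdf L) x" "\<And>x. 0 < measure L {x..}"
  and weak: "\<And>v. (\<And>k. 0 < v k) \<Longrightarrow> (\<lambda>k. v k/d1 k) \<longlonglongrightarrow> 1 \<Longrightarrow>
   weak_conv_m (\<lambda>k. distr (chi_square (v k)) borel (\<lambda>x. (x - v k)*(1/sqrt (2 * v k)))) \<mu>"
  and \<mu>: "real_distribution \<mu>" "\<And>x. isCont (cdf \<mu>) x" "\<And>x y. x < y \<Longrightarrow> 0 < cdf \<mu> x \<Longrightarrow> cdf \<mu> x < cdf \<mu> y"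
  and b: "b \<longlonglongrightarrow> upper_percentile \<mu> \<alpha>"
 shows "power \<sim>[sequentially] (\<lambda>k. measure L {b k - shift k..})"
proof -
 note D = factor_sample.standardized_decomposition_exists[OF fs factor_sample.trace_sq_pos[OF fs dof(1)]]
 obtain U R X where UR: "\<And>k. standardized_decomposition (M k) (p k) (N k) (mu k) (Sg k) (y k) \<Delta> (U k) (R k) (X k)"
  using D by metis
 note E = UR[unfolded standardized_decomposition_def]
 have meas: "U k \<in> borel_measurable (M k)" "R k \<in> borel_measurable (M k)" "X k \<in> borel_measurable (M k)" for k
  using E[of k] by auto
 have R0: "0 \<le> R k w" and F: "F_stat (p k) (N k) (\<lambda>i j. y k i j w) =
   (U k w + R k w * sqrt (d1 k/2) + 2*X k w + observed_shift (N k) (mu k) (Sg k))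
   / (R k w * sqrt (d1 k/2))" if "w \<in> space (M k)" for k w
  using E[of k] that by blast+
 have chU: "cmod (char (distr (M k) borel (U k)) \<theta> - (\<Prod>r<p k. chi_factor (\<theta>*rel k r))) \<le>
   (4*\<theta>\<^sup>2 + 16*(3 + \<bar>\<Delta>\<bar>)\<^sup>2*\<theta> ^ 4)/sqrt (\<nu> k) + \<bar>\<theta>\<bar> * sqrt ((2 + \<bar>\<Delta>\<bar>)/(2*\<nu> k))" for k \<theta>
  using E[of k] by blast
 have R1: "integrable (M k) (R k)" "(\<integral>w. \<bar>R k w - 1\<bar> \<partial>M k) \<le> sqrt ((2 + \<bar>\<Delta>\<bar>)/\<nu> k)" for k
  using E[of k] by blast+
 have X1: "integrable (M k) (X k)" "(\<integral>w. \<bar>X k w - 0\<bar> \<partial>M k) \<le> sqrt (cross_bound (N k) (mu k) (Sg k))" for k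
  unfolding diff_0_right using E[of k] by blast+
 let ?a = "\<lambda>k. real (N k 1)/real (N k 1 + N k 2)" and ?b = "\<lambda>k. real (N k 2)/real (N k 1 + N k 2)"
 let ?lo = "\<lambda>k. ?a k*?b k/(\<tau>*(1 - \<tau>))*min (\<tau>/?a k) ((1 - \<tau>)/?b k)"
 let ?up = "\<lambda>k. ?a k*?b k/(\<tau>*(1 - \<tau>))*max (\<tau>/?a k) ((1 - \<tau>)/?b k)"
 have "\<forall>k. \<exists>r. observed_shift (N k) (mu k) (Sg k)
   = r * shift k \<and>
  ?lo k \<le> r \<and>
  r \<le> ?up k"
  by (intro allI factor_sample.mean_shift_factor(1)[OF fs dof(1) \<tau>] refl)
 from choice[OF this] obtain r where r: "\<And>k. observed_shift (N k) (mu k) (Sg k)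
   = r k * shift k"
  "\<And>k. ?lo k \<le> r k"
  "\<And>k. r k \<le> ?up k"
  by blast
 have rlim: "r \<longlonglongrightarrow> 1"
 proof (rule tendsto_sandwich[OF always_eventually[OF allI, OF r(2)] always_eventually[OF allI, OF r(3)]])
  have "(\<lambda>k. ?lo k) \<longlonglongrightarrow> \<tau>*(1 - \<tau>)/(\<tau>*(1 - \<tau>))*min (\<tau>/\<tau>) ((1 - \<tau>)/(1 - \<tau>))"
   using \<tau> by (intro tendsto_intros tendsto_min proportion proportion2) auto
  then show "(\<lambda>k. ?lo k) \<longlonglongrightarrow> 1"
   using \<tau> by simp
  have "(\<lambda>k. ?up k) \<longlonglongrightarrow> \<tau>*(1 - \<tau>)/(\<tau>*(1 - \<tau>))*max (\<tau>/\<tau>) ((1 - \<tau>)/(1 - \<tau>))"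
   using \<tau> by (intro tendsto_intros tendsto_max proportion proportion2) auto
  then show "(\<lambda>k. ?up k) \<longlonglongrightarrow> 1"
   using \<tau> by simp
 qed
 have weakU: "weak_conv_m (\<lambda>k. distr (M k) borel (U k)) L"
 proof (rule levy_continuity[OF _ L(1)])
  show "real_distribution (distr (M k) borel (U k))" for k
   by (rule prob_space.real_distribution_distr[OF prob meas(1)])
  fix \<theta>
  have "(\<lambda>k. (4*\<theta>\<^sup>2 + 16*(3 + \<bar>\<Delta>\<bar>)\<^sup>2*\<theta> ^ 4)/sqrt (\<nu> k) + \<bar>\<theta>\<bar> * sqrt ((2 + \<bar>\<Delta>\<bar>)/2/\<nu> k)) \<longlonglongrightarrow> 0 + \<bar>\<theta>\<bar> * sqrt 0"
   by (intro tendsto_intros \<nu>_inverse_lim tendsto_divide_0[OF tendsto_const filterlim_at_top_imp_at_infinity[OF filterlim_compose[OF sqrt_at_top \<nu>_lim]]])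
  then have B: "(\<lambda>k. (4*\<theta>\<^sup>2 + 16*(3 + \<bar>\<Delta>\<bar>)\<^sup>2*\<theta> ^ 4)/sqrt (\<nu> k) + \<bar>\<theta>\<bar> * sqrt ((2 + \<bar>\<Delta>\<bar>)/(2*\<nu> k))) \<longlonglongrightarrow> 0"
   by simp
  have "(\<lambda>k. char (distr (M k) borel (U k)) \<theta> - (\<Prod>r<p k. chi_factor (\<theta>*rel k r))) \<longlonglongrightarrow> 0"
   by (rule Lim_null_comparison[OF _ B]) (intro always_eventually allI chU)
  from tendsto_add[OF this ch[of \<theta>]] show "(\<lambda>k. char (distr (M k) borel (U k)) \<theta>) \<longlonglongrightarrow> char L \<theta>" by simp
 qed
 have Rp: "tendsto_in_prob M R 1"
  using tendsto_real_sqrt[OF \<nu>_inverse_lim[of "2 + \<bar>\<Delta>\<bar>"]] by (intro in_prob_D[OF prob R1]) simp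
 have Xp: "tendsto_in_prob M X 0" by (rule in_prob_D[OF prob X1 cross_bound_lim])
 have f: "(\<lambda>w. dof1_hat (p k) (N k) (\<lambda>i j. y k i j w)) \<in> borel_measurable (M k)"
  "(\<lambda>w. dof2_hat (p k) (N k) (\<lambda>i j. y k i j w)) \<in> borel_measurable (M k)" for k
  by (rule dof_hat_measurable[OF factor_sample.y_entry_measurable[OF fs]]; assumption)+
 show ?thesis
  by (rule studentized_test_power[where U = U and R = R and X = X and r = r and s = shift, OF prob meas f _ R0 weakU L \<alpha> d1_ge_1 d2_pos d1_d2 weak \<mu> ratio1 ratio2 Rp Xp
    factor_sample.mean_shift_factor(2)[OF fs dof(1) \<tau> refl refl] rlim b])
   (simp_all only: F r(1))
qed

lemma rel_sum_ge_1: "1 \<le> (\<Sum>r<p k. rel k r)"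
proof -
 have "1 \<le> (\<Sum>r<p k. rel k r)\<^sup>2" using d1_ge_1[of k] factor_sample.dof1_rel[OF fs, of k] by simp
 moreover have "0 \<le> (\<Sum>r<p k. rel k r)" by (intro sum_nonneg factor_sample.rel_nonneg[OF fs]) simp
 ultimately show ?thesis by (metis one_power2 power2_le_imp_le)
qed

text \<open>
The squared sum of the limiting relative eigenvalues is the limit \<open>D\<close> of
\<open>d1\<close>. It is at least one, so the largest limiting eigenvalue is positive and the
mixture has no atoms.
\<close>
theorem power_under_spectral_limit:
 assumes sp: "spectral_limit p N Sg \<rho>"
 shows "power \<sim>[sequentially] (\<lambda>k. measure (chi_square_mixture \<rho>)
  {x. x \<ge> (F_upper (d1 k) (d2 k) \<alpha> - 1)/sqrt (2/d1 k) - shift k})"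
proof -
 have unif: "\<And>e. e > 0 \<Longrightarrow> \<forall>\<^sub>F k in sequentially. \<forall>r<p k. \<bar>rel k r - \<rho> r\<bar> < e" and sm: "summable \<rho>"
  and sumlim: "(\<lambda>k. \<Sum>r<p k. rel k r) \<longlonglongrightarrow> (\<Sum>r. \<rho> r)"
  using sp by (auto simp: spectral_limit_def)
 have ev: "\<forall>\<^sub>F k in sequentially. r < p k" for r
  using p_lim unfolding filterlim_at_top by (auto simp: Suc_le_eq dest: spec[of _ "Suc r"])
 have pt: "(\<lambda>k. rel k r) \<longlonglongrightarrow> \<rho> r" for r unfolding tendsto_iff dist_real_def
 proof (intro allI impI)
  fix e :: real assume "0 < e"
  from unif[OF this] ev[of r] show "\<forall>\<^sub>F k in sequentially. \<bar>rel k r - \<rho> r\<bar> < e" by eventually_elim simp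
 qed
 have nn: "r < p k \<Longrightarrow> 0 \<le> rel k r" for k r by (rule factor_sample.rel_nonneg[OF fs])
 have \<rho>0: "0 \<le> \<rho> r" for r
 proof (rule tendsto_lowerbound[OF pt[of r]])
  show "\<forall>\<^sub>F k in sequentially. 0 \<le> rel k r" using ev[of r] by eventually_elim (rule nn)
 qed simp
 have mono: "\<rho> r \<le> \<rho> 0" for r
 proof (rule tendsto_le[OF _ pt[of 0] pt[of r]])
  show "\<forall>\<^sub>F k in sequentially. rel k r \<le> rel k 0" using ev[of r]
   by eventually_elim (rule factor_sample.rel_antimono[OF fs], auto)
 qed simp
 define D where "D = (\<Sum>r. \<rho> r)\<^sup>2"
 have S1: "1 \<le> (\<Sum>r. \<rho> r)" by (rule tendsto_lowerbound[OF sumlim]) (auto intro: always_eventually rel_sum_ge_1)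
 then have D: "0 < D" by (simp add: D_def)
 have pos: "0 < \<rho> 0"
 proof (rule ccontr)
  assume "\<not> 0 < \<rho> 0"
  then have "\<rho> r = 0" for r using \<rho>0[of r] mono[of r] by linarith
  then have "(\<Sum>r. \<rho> r) = 0" by simp
  then show False using S1 by simp
 qed
 have d1lim: "d1 \<longlonglongrightarrow> D"
  using tendsto_power[OF sumlim, of 2] unfolding D_def by (simp add: factor_sample.dof1_rel[OF fs])
 define \<mu> where "\<mu> = distr (chi_square D) borel (\<lambda>x. (x - D)*(1/sqrt (2*D)))"
 note \<mu> = standardized_chi_square_law[OF D, folded \<mu>_def]
 have weak: "weak_conv_m (\<lambda>k. distr (chi_square (v k)) borel (\<lambda>x. (x - v k)*(1/sqrt (2 * v k)))) \<mu>"
  if v: "\<And>k. 0 < v k" "(\<lambda>k. v k/d1 k) \<longlonglongrightarrow> 1" for v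
 proof -
  have "(\<lambda>k. v k/d1 k*d1 k) \<longlonglongrightarrow> 1*D" by (intro tendsto_mult v d1lim)
  moreover have "v k/d1 k*d1 k = v k" for k using dof(1)[of k] by simp
  ultimately have "v \<longlonglongrightarrow> D" by simp
  then show ?thesis unfolding \<mu>_def by (rule standardized_chi_square_weak_conv[OF v(1) _ D])
 qed
 have b: "(\<lambda>k. (F_upper (d1 k) (d2 k) \<alpha> - 1)/sqrt (2/d1 k)) \<longlonglongrightarrow> upper_percentile \<mu> \<alpha>"
 proof -
  have "(\<lambda>k. (F_upper (1*d1 k) (1*d2 k) \<alpha> - 1) * sqrt (d1 k/2)) \<longlonglongrightarrow> upper_percentile \<mu> \<alpha>"
   by (rule critical_value_tendsto[OF \<alpha> d1_ge_1 d2_pos d1_d2 weak \<mu> tendsto_const tendsto_const])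
  moreover have "(F_upper (d1 k) (d2 k) \<alpha> - 1)/sqrt (2/d1 k) = (F_upper (1*d1 k) (1*d2 k) \<alpha> - 1) * sqrt (d1 k/2)" for k
   by (simp add: real_sqrt_divide)
  ultimately show ?thesis by simp
 qed
 have "power \<sim>[sequentially] (\<lambda>k. measure (chi_square_mixture \<rho>) {(F_upper (d1 k) (d2 k) \<alpha> - 1)/sqrt (2/d1 k) - shift k..})"
  by (rule power_asymptotics[OF chi_factor_prod_tendsto_mixture[OF nn \<rho>0 sm p_lim pt sumlim] real_distribution_chi_square_mixture
     chi_square_mixture_continuous_positive[OF \<rho>0 sm pos] weak \<mu> b])
 then show ?thesis by (simp only: atLeast_def)
qed

text \<open>
Since the relative eigenvalues have squares adding up to one, their sum diverges as soon as their
maximum vanishes; so \<open>d1\<close> diverges and both limits are normal.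
\<close>
theorem power_under_trace_condition:
 assumes tc: "trace_condition Sg"
 shows "power \<sim>[sequentially] (\<lambda>k. std_normal_cdf (- z_upper \<alpha> + shift k))"
proof -
 have nn: "r < p k \<Longrightarrow> 0 \<le> rel k r" for k r by (rule factor_sample.rel_nonneg[OF fs])
 have small: "\<forall>\<^sub>F k in sequentially. \<forall>r<p k. rel k r \<le> e" if e: "e > 0" for e
 proof -
  \<comment> \<open>The factor \<open>c0 ^ 4\<close> pays for passing from the sum of the covariance matrices to the pooled matrix.\<close>
  define \<epsilon> where "\<epsilon> = (e/2) ^ 4*c0 ^ 4"
  have \<epsilon>: "0 < \<epsilon>" using e c0(1) by (simp add: \<epsilon>_def)
  have o: "\<forall>\<^sub>F k in sequentially. norm (trace (Sg k i*Sg k i*Sg k i*Sg k i)) \<le> \<epsilon>*norm ((trace ((Sg k 1 + Sg k 2)*(Sg k 1 + Sg k 2)))\<^sup>2)"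
   if "i = 1 \<or> i = 2" for i
   using tc \<epsilon> that unfolding trace_condition_def by (intro landau_o.smallD) auto
  show ?thesis using o[of 1, OF disjI1[OF refl]] o[of 2, OF disjI2[OF refl]] c0(2)
  proof eventually_elim
   case (elim k)
   let ?TS = "trace ((Sg k 1 + Sg k 2)*(Sg k 1 + Sg k 2))"
   let ?T = "trace (pooled (N k) (Sg k)*pooled (N k) (Sg k))"
   have TS: "0 \<le> ?TS" "c0\<^sup>2*?TS \<le> ?T"
    using factor_sample.trace_sum_sq_bounds[OF fs, of c0 k] elim(3) c0(1) by auto
   have "(c0\<^sup>2*?TS)\<^sup>2 \<le> ?T\<^sup>2" using TS c0(1) by (intro power_mono) auto
   then have T4: "c0 ^ 4*?TS\<^sup>2 \<le> ?T\<^sup>2" by (simp add: power_mult_distrib flip: power_mult)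
   have b: "trace (Sg k i*Sg k i*Sg k i*Sg k i) \<le> (e/2) ^ 4*?T\<^sup>2" if i: "i = 1 \<or> i = 2" for i
   proof -
    have "trace (Sg k i*Sg k i*Sg k i*Sg k i) \<le> \<epsilon>*?TS\<^sup>2" using i elim(1,2) by auto
    also have "\<dots> = (e/2) ^ 4*(c0 ^ 4*?TS\<^sup>2)" by (simp add: \<epsilon>_def)
    also have "\<dots> \<le> (e/2) ^ 4*?T\<^sup>2" using T4 e by (intro mult_left_mono) auto
    finally show ?thesis .
   qed
   show ?case
   proof (intro allI impI)
    fix r assume r: "r < p k"
    have "rel k r \<le> 2*(e/2)"
     by (rule factor_sample.rel_le_of_fourth_trace[OF fs dof(1) _ r b]) (use e in auto)
    then show "rel k r \<le> e" by simp
   qed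
  qed
 qed
 have sq: "(\<Sum>r<p k. (rel k r)\<^sup>2) = 1" for k by (rule factor_sample.rel_sq_sum_1[OF fs dof(1)])
 have ch: "(\<lambda>k. \<Prod>r<p k. chi_factor (\<theta>*rel k r)) \<longlonglongrightarrow> char std_normal_distribution \<theta>" for \<theta>
 proof -
  have "(\<lambda>k. \<Prod>r<p k. char (chi_square 1) (\<theta>*rel k r/sqrt 2)*iexp (- (1*(\<theta>*rel k r/sqrt 2)))) \<longlonglongrightarrow> char std_normal_distribution \<theta>"
   by (rule chi_square_sum_clt[where v = "\<lambda>_. 1" and p = p and \<rho> = rel]) (use nn small sq in auto)
  then show ?thesis by (simp add: chi_factor_def)
 qed
 have d1lim: "filterlim d1 at_top sequentially" unfolding filterlim_at_top
 proof
  fix Z :: real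
  \<comment> \<open>The choice of \<open>e\<close> makes the sum of the relative eigenvalues at least \<open>1/e\<close>.\<close>
  define e where "e = 1/(1 + \<bar>Z\<bar>)"
  have e: "0 < e" by (simp add: e_def)
  from small[OF e] show "\<forall>\<^sub>F k in sequentially. Z \<le> d1 k"
  proof eventually_elim
   case (elim k)
   let ?s = "\<Sum>r<p k. rel k r"
   have "1 = (\<Sum>r<p k. (rel k r)\<^sup>2)" by (simp only: sq)
   also have "\<dots> \<le> (\<Sum>r<p k. e*rel k r)"
    using elim nn by (intro sum_mono) (auto simp: power2_eq_square intro!: mult_right_mono)
   also have "\<dots> = e*?s" by (simp only: sum_distrib_left)
   finally have "1 + \<bar>Z\<bar> \<le> ?s" by (simp add: e_def field_simps)
   moreover have "?s*1 \<le> ?s*?s" using rel_sum_ge_1[of k] by (intro mult_left_mono) auto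
   ultimately have "1 + \<bar>Z\<bar> \<le> ?s\<^sup>2" by (simp add: power2_eq_square)
   then show "Z \<le> d1 k" unfolding factor_sample.dof1_rel[OF fs] by linarith
  qed
 qed
 have weak: "weak_conv_m (\<lambda>k. distr (chi_square (v k)) borel (\<lambda>x. (x - v k)*(1/sqrt (2 * v k)))) std_normal_distribution"
  if v: "\<And>k. 0 < v k" "(\<lambda>k. v k/d1 k) \<longlonglongrightarrow> 1" for v
 proof (rule standardized_chi_square_weak_conv_normal[OF v(1)])
  have "filterlim (\<lambda>k. v k/d1 k*d1 k) at_top sequentially"
   by (rule filterlim_tendsto_pos_mult_at_top[OF v(2) _ d1lim]) simp
  moreover have "v k/d1 k*d1 k = v k" for k using dof(1)[of k] by simp
  ultimately show "filterlim v at_top sequentially" by simp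
 qed
 have b: "(\<lambda>k. z_upper \<alpha>) \<longlonglongrightarrow> upper_percentile std_normal_distribution \<alpha>" unfolding z_upper_def by (rule tendsto_const)
 have "power \<sim>[sequentially] (\<lambda>k. measure std_normal_distribution {z_upper \<alpha> - shift k..})"
  by (rule power_asymptotics[OF ch real_dist_normal_dist isCont_cdf_normal std_normal_tail_pos weak real_dist_normal_dist isCont_cdf_normal cdf_normal_strict b])
 moreover have "- (z_upper \<alpha> - shift k) = - z_upper \<alpha> + shift k" for k by simp
 ultimately show ?thesis by (simp only: std_normal_tail)
qed

end

lemma asymp_equiv_offset:
 fixes f g :: "nat \<Rightarrow> real"
 assumes "(\<lambda>k. f (k + K)) \<sim>[sequentially] (\<lambda>k. g (k + K))"
 shows "f \<sim>[sequentially] g"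
 using assms unfolding asymp_equiv_def by (rule LIMSEQ_offset)

text \<open>A quotient by zero is zero by convention and thus stays at distance one from the limit.\<close>
lemma in_prob_eventually_nonzero:
 fixes d :: "nat \<Rightarrow> real"
 assumes prob: "\<And>k. prob_space (M k)" and X: "tendsto_in_prob M (\<lambda>k w. f k w/d k) 1"
 shows "\<forall>\<^sub>F k in sequentially. d k \<noteq> 0"
proof -
 have "(\<lambda>k. \<P>(w in M k. \<bar>f k w/d k - 1\<bar> > 1/2)) \<longlonglongrightarrow> 0"
  by (rule X[unfolded tendsto_in_prob_def, rule_format]) simp
 then have "\<forall>\<^sub>F k in sequentially. \<P>(w in M k. \<bar>f k w/d k - 1\<bar> > 1/2) < 1" by (rule order_tendstoD) simp
 then show ?thesis
 proof eventually_elim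
  case (elim k)
  interpret prob_space "M k" by (rule prob)
  show ?case using elim by (auto simp: prob_space)
 qed
qed

lemma tendsto_in_prob_offset:
 "tendsto_in_prob M X c \<Longrightarrow> tendsto_in_prob (\<lambda>k. M (k + K)) (\<lambda>k. X (k + K)) c"
 unfolding tendsto_in_prob_def by (auto intro: LIMSEQ_ignore_initial_segment)

theorem theorem2:
 fixes M :: "nat \<Rightarrow> 'w measure"
  and p m :: "nat \<Rightarrow> nat"
  and N :: "nat \<Rightarrow> nat \<Rightarrow> nat"
  and mu :: "nat \<Rightarrow> nat \<Rightarrow> real vec"
  and Sg G :: "nat \<Rightarrow> nat \<Rightarrow> real mat"
  and y z :: "nat \<Rightarrow> nat \<Rightarrow> nat \<Rightarrow> 'w \<Rightarrow> real vec"
  and \<Delta> \<tau> \<alpha> :: real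
 assumes prob: "\<And>k. prob_space (M k)"
  and samples: "\<And>k. two_samples (M k) (p k) (N k) (mu k) (Sg k) (y k)"
  and alpha: "0 < \<alpha>" "\<alpha> < 1"
  and p_lim: "filterlim p at_top sequentially"
  and n_lim: "filterlim (\<lambda>k. N k 1 + N k 2) at_top sequentially"
  and C1: "\<And>k. factor_model (M k) (p k) (m k) (N k) (mu k) (Sg k) (y k) (G k) (z k)"
  and C2: "\<And>k i j. (i, j) \<in> sample_index (N k) \<Longrightarrow> moment_condition (M k) (m k) \<Delta> (z k i j)"
  and C3: "0 < \<tau>" "\<tau> < 1" "(\<lambda>k. real (N k 1)/real (N k 1 + N k 2)) \<longlonglongrightarrow> \<tau>"
  and LA: "local_alternative N mu Sg"
  and ratio1: "tendsto_in_prob M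
   (\<lambda>k w. dof1_hat (p k) (N k) (\<lambda>i j. y k i j w)/dof1 (N k) (Sg k)) 1"
  and ratio2: "tendsto_in_prob M
   (\<lambda>k w. dof2_hat (p k) (N k) (\<lambda>i j. y k i j w)/dof2 (N k) (Sg k)) 1"
 shows "(\<forall>\<rho>. spectral_limit p N Sg \<rho> \<longrightarrow>
   (\<lambda>k. \<P>(w in M k. F_stat (p k) (N k) (\<lambda>i j. y k i j w)
       \<ge> F_upper (dof1_hat (p k) (N k) (\<lambda>i j. y k i j w))
            (dof2_hat (p k) (N k) (\<lambda>i j. y k i j w)) \<alpha>))
   \<sim>[sequentially]
   (\<lambda>k. measure (chi_square_mixture \<rho>)
    {x. x \<ge> (F_upper (dof1 (N k) (Sg k)) (dof2 (N k) (Sg k)) \<alpha> - 1)/sqrt (2/dof1 (N k) (Sg k))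
        - mean_shift \<tau> (N k) (mu k) (Sg k)}))
  \<and> (trace_condition Sg \<longrightarrow>
   (\<lambda>k. \<P>(w in M k. F_stat (p k) (N k) (\<lambda>i j. y k i j w)
       \<ge> F_upper (dof1_hat (p k) (N k) (\<lambda>i j. y k i j w))
            (dof2_hat (p k) (N k) (\<lambda>i j. y k i j w)) \<alpha>))
   \<sim>[sequentially]
   (\<lambda>k. std_normal_cdf (- z_upper \<alpha> + mean_shift \<tau> (N k) (mu k) (Sg k))))"
proof -
 have n: "filterlim (\<lambda>k. real (N k 1 + N k 2)) at_top sequentially"
  by (rule filterlim_compose[OF filterlim_real_sequentially n_lim])
 define c where "c = min \<tau> (1 - \<tau>)/2"
 have c: "0 < c" "c < \<tau>" "\<tau> < 1 - c" using C3(1,2) by (auto simp: c_def min_def field_simps)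
 have "\<forall>\<^sub>F k in sequentially. 2/c \<le> real (N k 1 + N k 2)" using n unfolding filterlim_at_top by blast
 then have "\<forall>\<^sub>F k in sequentially. 2 \<le> N k 1 \<and> 2 \<le> N k 2"
  using order_tendstoD(1)[OF C3(3) c(2)] order_tendstoD(2)[OF C3(3) c(3)]
 proof eventually_elim
  case (elim k)
  define t where "t = real (N k 1 + N k 2)"
  have "0 < 2/c" using c by simp
  then have t: "0 < t" using elim(1) unfolding t_def by (rule less_le_trans)
  have t2: "2 \<le> c*t" using elim(1) c(1) unfolding t_def[symmetric] by (simp add: divide_le_eq mult.commute)
  have "c*t < real (N k 1)" "real (N k 1) < (1 - c)*t"
   using elim(2,3) t unfolding t_def[symmetric] by (simp_all add: less_divide_eq divide_less_eq)
  moreover have "real (N k 2) = t - real (N k 1)" by (simp add: t_def)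
  ultimately have "2 < real (N k 1)" "2 < real (N k 2)" using t2 by (auto simp: algebra_simps)
  then show ?case by auto
 qed
 then have "\<forall>\<^sub>F k in sequentially. (2 \<le> N k 1 \<and> 2 \<le> N k 2) \<and> dof1 (N k) (Sg k) \<noteq> 0 \<and> dof2 (N k) (Sg k) \<noteq> 0"
  using in_prob_eventually_nonzero[OF prob ratio1] in_prob_eventually_nonzero[OF prob ratio2]
  by eventually_elim simp
 then obtain K where K: "\<And>k. K \<le> k \<Longrightarrow> (2 \<le> N k 1 \<and> 2 \<le> N k 2) \<and> dof1 (N k) (Sg k) \<noteq> 0 \<and> dof2 (N k) (Sg k) \<noteq> 0"
  unfolding eventually_sequentially by blast
 have sh: "filterlim (\<lambda>k. k + K) sequentially sequentially" by (rule filterlim_add_const_nat_at_top)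
 have means: "mu k 1 \<in> carrier_vec (p k)" "mu k 2 \<in> carrier_vec (p k)" for k
  using samples[of k] by (auto simp: two_samples_def)
 have LA': "local_alternative (\<lambda>k. N (k + K)) (\<lambda>k. mu (k + K)) (\<lambda>k. Sg (k + K))"
  unfolding local_alternative_def
 proof
  fix i :: nat assume i: "i \<in> {1, 2}"
  show "(\<lambda>k. (mu (k + K) 1 - mu (k + K) 2) \<bullet> (Sg (k + K) i *\<^sub>v (mu (k + K) 1 - mu (k + K) 2)))
     \<in> o(\<lambda>k. trace ((Sg (k + K) 1 + Sg (k + K) 2)*(Sg (k + K) 1 + Sg (k + K) 2))/real (N (k + K) 1 + N (k + K) 2))"
   using LA i unfolding local_alternative_def by (intro landau_o.small.compose[OF _ sh]) auto
 qed
 \<comment> \<open>The hypotheses concern the limit only, so finitely many indices may be discarded.\<close>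
 interpret R: factor_regime "\<lambda>k. M (k + K)" "\<lambda>k. p (k + K)" "\<lambda>k. m (k + K)" "\<lambda>k. N (k + K)" "\<lambda>k. mu (k + K)"
  "\<lambda>k. Sg (k + K)" "\<lambda>k. G (k + K)" "\<lambda>k. y (k + K)" "\<lambda>k. z (k + K)" \<Delta> \<tau> \<alpha>
 proof (rule factor_regime.intro)
  show "filterlim (\<lambda>k. p (k + K)) at_top sequentially" by (rule filterlim_compose[OF p_lim sh])
  show "filterlim (\<lambda>k. N (k + K) 1 + N (k + K) 2) at_top sequentially" by (rule filterlim_compose[OF n_lim sh])
  show "(\<lambda>k. real (N (k + K) 1)/real (N (k + K) 1 + N (k + K) 2)) \<longlonglongrightarrow> \<tau>" by (rule filterlim_compose[OF C3(3) sh])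
  show "tendsto_in_prob (\<lambda>k. M (k + K)) (\<lambda>k w. dof1_hat (p (k + K)) (N (k + K)) (\<lambda>i j. y (k + K) i j w)/dof1 (N (k + K)) (Sg (k + K))) 1"
   by (rule tendsto_in_prob_offset[OF ratio1])
  show "tendsto_in_prob (\<lambda>k. M (k + K)) (\<lambda>k w. dof2_hat (p (k + K)) (N (k + K)) (\<lambda>i j. y (k + K) i j w)/dof2 (N (k + K)) (Sg (k + K))) 1"
   by (rule tendsto_in_prob_offset[OF ratio2])
  show "2 \<le> N (k + K) 1" "2 \<le> N (k + K) 2" "dof1 (N (k + K)) (Sg (k + K)) \<noteq> 0" "dof2 (N (k + K)) (Sg (k + K)) \<noteq> 0" for k
   using K[of "k + K"] by auto
 qed (fact prob means alpha C1 C2 C3(1,2) LA')+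
 show ?thesis
 proof (intro conjI allI impI, goal_cases)
  case (1 \<rho>)
  then have "spectral_limit (\<lambda>k. p (k + K)) (\<lambda>k. N (k + K)) (\<lambda>k. Sg (k + K)) \<rho>"
   unfolding spectral_limit_def
   by (auto intro: eventually_compose_filterlim[OF _ sh] LIMSEQ_ignore_initial_segment)
  from R.power_under_spectral_limit[OF this] show ?case by (rule asymp_equiv_offset)
 next
  case 2
  have "trace_condition (\<lambda>k. Sg (k + K))" unfolding trace_condition_def
  proof (intro ballI)
   fix i j l h :: nat assume "i \<in> {1, 2}" "j \<in> {1, 2}" "l \<in> {1, 2}" "h \<in> {1, 2}"
   then have "(\<lambda>k. trace (Sg k i*Sg k j*Sg k l*Sg k h)) \<in> o(\<lambda>k. (trace ((Sg k 1 + Sg k 2)*(Sg k 1 + Sg k 2)))\<^sup>2)"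
    using 2 unfolding trace_condition_def by blast
   from landau_o.small.compose[OF this sh]
   show "(\<lambda>k. trace (Sg (k + K) i*Sg (k + K) j*Sg (k + K) l*Sg (k + K) h)) \<in> o(\<lambda>k. (trace ((Sg (k + K) 1 + Sg (k + K) 2)*(Sg (k + K) 1 + Sg (k + K) 2)))\<^sup>2)" .
  qed
  from R.power_under_trace_condition[OF this] show ?case by (rule asymp_equiv_offset)
 qed
qed

end
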